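(* Consider a RAP-modulated fluid process $\{(R_t,\mathbf{A}_t)\}_{t\ge 0}$ with $n^0=0$ (state space $\mathfrak{Z}^+\cup\mathfrak{Z}^-$), let $\tau_-=\inf\{t>0:R_t\le 0\}$, and let $\Omega_n$, $n\ge 1$, be the sets of paths defined in the context. Then there are unique matrices $\{\Psi_n\}_{n\ge 1}$, $\Psi_n\in\mathbb{R}^{\eta^+\times\eta^-}$, such that for every $\boldsymbol{\alpha}\in\mathfrak{Z}^+$ and all $n\ge 1$, $$\mathbb{E}_{\boldsymbol{\alpha}}\left[\mathbf{A}_{\tau_-}\mathbb{1}\{\Omega_n\}\right]=\boldsymbol{\alpha}\Psi_n ,$$ and these satisfy, with $\Psi_0=0$, $$\Psi_n=\int_0^\infty e^{C^+y}\left(D^{+-}+\Psi_{n-1}D^{-+}\Psi_{n-1}\right)e^{C^-y}\,\mathrm{d}y,\qquad n\ge 1.$$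
   Context: Setting (RAP-modulated fluid process with $n^0=0$). Elements of state spaces are row vectors; $\mathbf{1}$ is a column vector of ones of appropriate dimension. For $k\in\{+,-\}$ let $n^k\ge 1$, $m^k_1,\dots,m^k_{n^k}\ge1$ be integers, $\eta^k=\sum_i m^k_i$, and split $\mathbb{R}^{\eta^k}$ into $n^k$ consecutive blocks of sizes $m_1^k,\dots,m^k_{n^k}$. For $1\le i\le n^k$ let $\mathfrak{Z}^k_i$ be a subset of $\{\boldsymbol{x}\in\mathbb{R}^{\eta^k}:\boldsymbol{x}$ vanishes outside block $i$ and $\boldsymbol{x}\mathbf{1}=1\}$ which is bounded and minimal, i.e. not contained in any affine subspace of dimension $m^k_i-2$ (the only affine subspace of dimension $-1$ is $\varnothing$). Put $\mathfrak{Z}^k=\bigcup_i\mathfrak{Z}^k_i$; $\mathfrak{Z}^+$ and $\mathfrak{Z}^-$ are regarded as lying in different spaces, hence disjoint. Given are real matrices $C^k_{ij}\in\mathbb{R}^{m^k_i\times m^k_j}$ and $D^{k\ell}_{ij}\in\mathbb{R}^{m^k_i\times m^\ell_j}$ ($\ell\ne k$); let $C^k=(C^k_{ij})_{i,j}\in\mathbb{R}^{\eta^k\times\eta^k}$ and $D^{k\ell}=(D^{k\ell}_{ij})_{i,j}\in\mathbb{R}^{\eta^k\times\eta^\ell}$ be the full block matrices, $\Gamma^k=\mathrm{diag}(C^k_{11},\dots,C^k_{n^kn^k})$, and let $\widehat C^k_{ij}$ ($i\neq j$), $\widehat D^{k\ell}_{ij}$ be the matrices of the sizes of $C^k$, $D^{k\ell}$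 whose $(i,j)$ block is $C^k_{ij}$, $D^{k\ell}_{ij}$ and which are zero elsewhere. Assume $C^k\mathbf{1}+D^{k\ell}\mathbf{1}=\mathbf{0}$ for $k\neq\ell$. The orbit process $\{\mathbf{A}_t\}_{t\ge0}$ is a càdlàg piecewise-deterministic Markov process on $\mathfrak{Z}^+\cup\mathfrak{Z}^-$: with no jumps after $t$ and $\mathbf{A}_t\in\mathfrak{Z}^k$, $\mathbf{A}_{t+r}=\mathbf{A}_te^{\Gamma^kr}/(\mathbf{A}_te^{\Gamma^kr}\mathbf{1})\in\mathfrak{Z}^k$; from a state $\boldsymbol{a}\in\mathfrak{Z}^k_i$ it jumps to $\boldsymbol{a}\widehat C^k_{ij}/(\boldsymbol{a}\widehat C^k_{ij}\mathbf{1})\in\mathfrak{Z}^k_j$ ($j\ne i$) with intensity $\boldsymbol{a}\widehat C^k_{ij}\mathbf{1}\ge0$, and to $\boldsymbol{a}\widehat D^{k\ell}_{ij}/(\boldsymbol{a}\widehat D^{k\ell}_{ij}\mathbf{1})\in\mathfrak{Z}^\ell_j$ ($\ell\neq k$) with intensity $\boldsymbol{a}\widehat D^{k\ell}_{ij}\mathbf{1}\ge0$. It is assumed that the data are such that all these intensities are nonnegative and all these points lie in the indicated sets. The level process is $R_t=\int_0^t(\mathbb{1}\{\mathbf{A}_s\in\mathfrak{Z}^+\}-\mathbb{1}\{\mathbf{A}_s\in\mathfrak{Z}^-\})\,\mathrm{d}s$. Nontriviality assumption: for $k\in\{+,-\}$ and all $\boldsymbol{\alpha}\in\mathfrak{Z}^k$,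 $\mathbb{P}(\mathbf{A}_s\in\mathfrak{Z}^k\ \forall s\in[0,t]\mid\mathbf{A}_0=\boldsymbol{\alpha})\to0$ as $t\to\infty$. $\mathbb{P}_{\boldsymbol{\alpha}},\mathbb{E}_{\boldsymbol{\alpha}}$ denote law and expectation given $\mathbf{A}_0=\boldsymbol{\alpha}$. Path sets. The process is defined on its canonical path space, restricted to the full-measure set $\Omega$ of paths $\{(r_t,\boldsymbol{a}_t)\}$ for which $\boldsymbol{a}$ has finitely many jumps in compact intervals, $\boldsymbol{a}$ does not eventually stay in $\mathfrak{Z}^+$ or eventually stay in $\mathfrak{Z}^-$, and no two jumps of $\boldsymbol{a}$ occur at the same level of $r$. The shift is $\theta_s\{(r_t,\boldsymbol{a}_t)\}_{t\ge0}=\{(r_{t+s}-r_s,\boldsymbol{a}_{t+s})\}_{t\ge0}$. Let $\Omega_-=\{\mathbf{A}_0\in\mathfrak{Z}^+,\tau_-<\infty\}$. Let $\Omega_1\subset\Omega_-$ be the set of paths in $\Omega_-$ having exactly one jump from $\mathfrak{Z}^+$ to $\mathfrak{Z}^-$ during $[0,\tau_-)$. For a path in $\Omega_-\setminus\Omega_1$ let $p=\inf\{y\ge0:\exists t\in[0,\tau_-)$ with $R_t=y,\ \mathbf{A}_{t^-}\in\mathfrak{Z}^-,\ \mathbf{A}_t\in\mathfrak{Z}^+\}$ (the lowest level of a down-up peak before $\tau_-$), $T_1=\inf\{t\ge0:R_t=p\}$ and $T_2=T_1+\tau_-\circ\theta_{T_1}$. Put $\Omega_1'=\Omega_1$ and,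 for $n\ge2$, let $\Omega_n'$ be the set of $\omega\in\Omega_-\setminus\Omega_1$ with $\theta_{T_1}\omega\in\Omega_{n-1}'\cup\Omega_1$ and $\theta_{T_2}\omega\in\Omega_{n-1}'\cup\Omega_1$. Finally $\Omega_n=\Omega_n'\cup\Omega_1$ for $n\ge1$. *)

theory Defs
  imports "HOL-Probability.Probability"
begin

definition mat_exp :: "real^'n^'n \<Rightarrow> real^'n^'n" where
  "mat_exp A = (\<Sum>k. (1 / fact k) *\<^sub>R (((**) A ^^ k) (mat 1)))"

text \<open>A block decomposition of the coordinates is a map from coordinates to block labels; the
  \<open>(i,j)\<close> block of a matrix consists of the entries whose row has label \<open>i\<close> and column label \<open>j\<close>.\<close>

definition block_part :: "('r \<Rightarrow> 'i) \<Rightarrow> ('c \<Rightarrow> 'j) \<Rightarrow> 'i \<Rightarrow> 'j \<Rightarrow> real^'c^'r \<Rightarrow> real^'c^'r" where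
  "block_part f g i j M = (\<chi> r c. if f r = i \<and> g c = j then M $ r $ c else 0)"

definition block_diag :: "('r \<Rightarrow> 'i) \<Rightarrow> real^'r^'r \<Rightarrow> real^'r^'r" where
  "block_diag f M = (\<chi> r c. if f r = f c then M $ r $ c else 0)"

text \<open>The index types \<open>'p\<close> and \<open>'m\<close> have \<open>\<eta>\<^sup>+\<close> and \<open>\<eta>\<^sup>-\<close> elements, the label types
  \<open>'i\<close> and \<open>'j\<close> have \<open>n\<^sup>+\<close> and \<open>n\<^sup>-\<close> elements.\<close>

record ('p, 'm, 'i, 'j) rap_data =
  blkp :: "'p \<Rightarrow> 'i"
  blkm :: "'m \<Rightarrow> 'j"
  Cp :: "real^'p^'p"
  Cm :: "real^'m^'m"
  Dpm :: "real^'m^'p"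
  Dmp :: "real^'p^'m"
  Zp :: "'i \<Rightarrow> (real^'p) set"
  Zm :: "'j \<Rightarrow> (real^'m) set"

text \<open>The orbit lives in the product of the two orbit spaces, \<open>Z\<^sup>+\<close> being embedded as
  \<open>(x, 0)\<close> and \<open>Z\<^sup>-\<close> as \<open>(0, y)\<close>. As all coordinate sums are 1, the two images are
  topologically separated, so this is the disjoint union.\<close>

type_synonym ('p, 'm) state = "(real^'p) \<times> (real^'m)"

type_synonym ('p, 'm) path = "real \<Rightarrow> (real^'p) \<times> (real^'m)"

fun cell :: "('p::finite, 'm::finite, 'i, 'j) rap_data \<Rightarrow> 'i + 'j \<Rightarrow> ('p, 'm) state set" where
  "cell X (Inl i) = {(x, 0) |x. x \<in> Zp X i}"
| "cell X (Inr j) = {(0, y) |y. y \<in> Zm X j}"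

definition Zplus :: "('p::finite, 'm::finite, 'i, 'j) rap_data \<Rightarrow> ('p, 'm) state set" where
  "Zplus X = (\<Union>i. cell X (Inl i))"

definition Zminus :: "('p::finite, 'm::finite, 'i, 'j) rap_data \<Rightarrow> ('p, 'm) state set" where
  "Zminus X = (\<Union>j. cell X (Inr j))"

definition states :: "('p::finite, 'm::finite, 'i, 'j) rap_data \<Rightarrow> ('p, 'm) state set" where
  "states X = Zplus X \<union> Zminus X"

definition mass :: "('p::finite, 'm::finite) state \<Rightarrow> real" where
  "mass a = (\<Sum>k\<in>UNIV. fst a $ k) + (\<Sum>k\<in>UNIV. snd a $ k)"

definition normalise :: "('p::finite, 'm::finite) state \<Rightarrow> ('p, 'm) state" where
  "normalise a = a /\<^sub>R mass a"

definition flow ::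
    "('p::finite, 'm::finite, 'i, 'j) rap_data \<Rightarrow> real \<Rightarrow> ('p, 'm) state \<Rightarrow> ('p, 'm) state" where
  "flow X r a = normalise (fst a v* mat_exp (r *\<^sub>R block_diag (blkp X) (Cp X)),
                           snd a v* mat_exp (r *\<^sub>R block_diag (blkm X) (Cm X)))"

text \<open>\<open>jump_vec X c d a\<close> is the row vector \<open>a\<close> times the full-size matrix carrying only the block
  \<open>(c,d)\<close> of the appropriate matrix \<open>C\<close> or \<open>D\<close>; it is used for \<open>c \<noteq> d\<close> only.\<close>

fun jump_vec :: "('p::finite, 'm::finite, 'i, 'j) rap_data \<Rightarrow> 'i + 'j \<Rightarrow> 'i + 'j \<Rightarrow>
    ('p, 'm) state \<Rightarrow> ('p, 'm) state" where
  "jump_vec X (Inl i) (Inl j) a = (fst a v* block_part (blkp X) (blkp X) i j (Cp X), 0)"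
| "jump_vec X (Inl i) (Inr j) a = (0, fst a v* block_part (blkp X) (blkm X) i j (Dpm X))"
| "jump_vec X (Inr i) (Inl j) a = (snd a v* block_part (blkm X) (blkp X) i j (Dmp X), 0)"
| "jump_vec X (Inr i) (Inr j) a = (0, snd a v* block_part (blkm X) (blkm X) i j (Cm X))"

definition intensity :: "('p::finite, 'm::finite, 'i, 'j) rap_data \<Rightarrow> 'i + 'j \<Rightarrow> 'i + 'j \<Rightarrow>
    ('p, 'm) state \<Rightarrow> real" where
  "intensity X c d a = mass (jump_vec X c d a)"

definition jump_target :: "('p::finite, 'm::finite, 'i, 'j) rap_data \<Rightarrow> 'i + 'j \<Rightarrow> 'i + 'j \<Rightarrow>
    ('p, 'm) state \<Rightarrow> ('p, 'm) state" where
  "jump_target X c d a = normalise (jump_vec X c d a)"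

text \<open>Bounded and minimal subsets of the hyperplane \<open>x 1 = 1\<close> of the block \<open>i\<close>. In the
  library \<open>aff_dim {} = -1\<close>, so for a block of size 1 minimality says that \<open>Z\<close> is nonempty.\<close>

definition orbit_set :: "('n::finite \<Rightarrow> 'i) \<Rightarrow> 'i \<Rightarrow> (real^'n) set \<Rightarrow> bool" where
  "orbit_set f i Z \<longleftrightarrow>
     (\<forall>x\<in>Z. (\<forall>k. f k \<noteq> i \<longrightarrow> x $ k = 0) \<and> (\<Sum>k\<in>UNIV. x $ k) = 1) \<and>
     bounded Z \<and>
     \<not> (\<exists>S. affine S \<and> aff_dim S = int (card {k. f k = i}) - 2 \<and> Z \<subseteq> S)"

text \<open>In the last condition, a jump of intensity zero has a target of the form \<open>v/0\<close>. Only \<open>v = 0\<close>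
  (no jump at all) is admitted: if \<open>v \<noteq> 0\<close> had coordinate sum 0, there would be no point \<open>v/(v 1)\<close>
  that could lie in the indicated set.\<close>

definition rap_data_valid ::
    "('p::finite, 'm::finite, 'i::finite, 'j::finite) rap_data \<Rightarrow> bool" where
  "rap_data_valid X \<longleftrightarrow>
     surj (blkp X) \<and> surj (blkm X) \<and>
     (\<forall>i. orbit_set (blkp X) i (Zp X i)) \<and> (\<forall>j. orbit_set (blkm X) j (Zm X j)) \<and>
     Cp X *v vec 1 + Dpm X *v vec 1 = 0 \<and> Cm X *v vec 1 + Dmp X *v vec 1 = 0 \<and>
     (\<forall>a\<in>Zplus X. \<forall>r\<ge>0. flow X r a \<in> Zplus X) \<and>
     (\<forall>a\<in>Zminus X. \<forall>r\<ge>0. flow X r a \<in> Zminus X) \<and>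
     (\<forall>c d. \<forall>a\<in>cell X c. d \<noteq> c \<longrightarrow>
        0 \<le> intensity X c d a \<and>
        (jump_vec X c d a \<noteq> 0 \<longrightarrow> 0 < intensity X c d a \<and> jump_target X c d a \<in> cell X d))"

text \<open>The level is a function of the orbit, so a path is given by its orbit component alone. The
  shift of a path below then automatically restarts the level at 0.\<close>

definition level :: "('p::finite, 'm::finite, 'i, 'j) rap_data \<Rightarrow> ('p, 'm) path \<Rightarrow> real \<Rightarrow> real" where
  "level X \<omega> t = (LBINT s:{0..t}. indicator (Zplus X) (\<omega> s) - indicator (Zminus X) (\<omega> s))"

definition shift :: "real \<Rightarrow> (real \<Rightarrow> 'a) \<Rightarrow> real \<Rightarrow> 'a" where
  "shift s \<omega> = (\<lambda>t\<in>{0..}. \<omega> (t + s))"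

text \<open>The value before \<open>t\<close>; by convention there is no jump at time 0.\<close>

definition left_lim :: "(real \<Rightarrow> 'a::t2_space) \<Rightarrow> real \<Rightarrow> 'a" where
  "left_lim \<omega> t = (if t \<le> 0 then \<omega> 0 else Lim (at_left t) \<omega>)"

definition cadlag :: "(real \<Rightarrow> 'a::t2_space) \<Rightarrow> bool" where
  "cadlag \<omega> \<longleftrightarrow> (\<forall>t\<ge>0. (\<omega> \<longlongrightarrow> \<omega> t) (at_right t)) \<and> (\<forall>t>0. \<exists>l. (\<omega> \<longlongrightarrow> l) (at_left t))"

definition jumps :: "(real \<Rightarrow> 'a::t2_space) \<Rightarrow> real set" where
  "jumps \<omega> = {t. 0 \<le> t \<and> left_lim \<omega> t \<noteq> \<omega> t}"

definition canonical_paths ::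
    "('p::finite, 'm::finite, 'i, 'j) rap_data \<Rightarrow> ('p, 'm) path set" where
  "canonical_paths X = {\<omega> \<in> {0..} \<rightarrow>\<^sub>E states X. cadlag \<omega> \<and>
     (\<forall>t\<ge>0. \<forall>r\<ge>0. jumps \<omega> \<inter> {t<..t + r} = {} \<longrightarrow> \<omega> (t + r) = flow X r (\<omega> t))}"

definition Omega :: "('p::finite, 'm::finite, 'i, 'j) rap_data \<Rightarrow> ('p, 'm) path set" where
  "Omega X = {\<omega> \<in> canonical_paths X.
     (\<forall>t. finite (jumps \<omega> \<inter> {0..t})) \<and>
     \<not> (\<exists>t\<ge>0. \<forall>s\<ge>t. \<omega> s \<in> Zplus X) \<and>
     \<not> (\<exists>t\<ge>0. \<forall>s\<ge>t. \<omega> s \<in> Zminus X) \<and>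
     inj_on (level X \<omega>) (jumps \<omega>)}"

definition path_algebra ::
    "('p::finite, 'm::finite, 'i, 'j) rap_data \<Rightarrow> ('p, 'm) path measure" where
  "path_algebra X = restrict_space (PiM {0..} (\<lambda>_. borel)) (Omega X)"

definition past ::
    "('p::finite, 'm::finite, 'i, 'j) rap_data \<Rightarrow> real \<Rightarrow> ('p, 'm) path measure" where
  "past X s = vimage_algebra (Omega X) (\<lambda>\<omega>. restrict \<omega> {0..s}) (PiM {0..s} (\<lambda>_. borel))"

definition first_jump :: "(real \<Rightarrow> 'a::t2_space) \<Rightarrow> real" where
  "first_jump \<omega> = Inf (jumps \<omega>)"

definition total_intensity ::
    "('p::finite, 'm::finite, 'i::finite, 'j::finite) rap_data \<Rightarrow> 'i + 'j \<Rightarrow> ('p, 'm) state \<Rightarrow> real"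
  where "total_intensity X c a = (\<Sum>d\<in>UNIV - {c}. intensity X c d a)"

text \<open>\<open>P a\<close> is the law on the path space of the process started in \<open>a\<close>. The last condition is the
  description of a piecewise-deterministic Markov process by its local characteristics: the time of
  the first jump has hazard rate \<open>total_intensity\<close> along the flow, the target is chosen with
  probabilities proportional to the intensities, and the process then starts afresh from the target.
  Every path in \<open>Omega X\<close> has a jump, so \<open>B = Omega X\<close> gives the distribution of the first jump
  time.\<close>

definition orbit_process :: "('p::finite, 'm::finite, 'i::finite, 'j::finite) rap_data \<Rightarrow>
    (('p, 'm) state \<Rightarrow> ('p, 'm) path measure) \<Rightarrow> bool" where
  "orbit_process X P \<longleftrightarrow>
     P \<in> measurable (restrict_space borel (states X)) (prob_algebra (path_algebra X)) \<and>
     (\<forall>a\<in>states X. AE \<omega> in P a. \<omega> 0 = a) \<and>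
     (\<forall>a\<in>states X. \<forall>s\<ge>0. \<forall>E\<in>sets (past X s). \<forall>B\<in>sets (path_algebra X).
        measure (P a) {\<omega>\<in>E. shift s \<omega> \<in> B}
          = (LINT \<omega>|P a. indicator E \<omega> * measure (P (\<omega> s)) B)) \<and>
     (\<forall>c. \<forall>a\<in>cell X c. \<forall>t\<ge>0. \<forall>B\<in>sets (path_algebra X).
        measure (P a) {\<omega>\<in>Omega X. first_jump \<omega> \<le> t \<and> shift (first_jump \<omega>) \<omega> \<in> B}
          = (LBINT s:{0..t}. exp (- (LBINT u:{0..s}. total_intensity X c (flow X u a))) *
               (\<Sum>d\<in>UNIV - {c}. intensity X c d (flow X s a) *
                  measure (P (jump_target X c d (flow X s a))) B)))"

definition rap_fluid_process :: "('p::finite, 'm::finite, 'i::finite, 'j::finite) rap_data \<Rightarrow>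
    (('p, 'm) state \<Rightarrow> ('p, 'm) path measure) \<Rightarrow> bool" where
  "rap_fluid_process X P \<longleftrightarrow>
     rap_data_valid X \<and> orbit_process X P \<and>
     (\<forall>a\<in>Zplus X.
        ((\<lambda>t. measure (P a) {\<omega>\<in>Omega X. \<forall>s\<in>{0..t}. \<omega> s \<in> Zplus X}) \<longlongrightarrow> 0) at_top) \<and>
     (\<forall>a\<in>Zminus X.
        ((\<lambda>t. measure (P a) {\<omega>\<in>Omega X. \<forall>s\<in>{0..t}. \<omega> s \<in> Zminus X}) \<longlongrightarrow> 0) at_top)"

text \<open>\<open>\<tau>\<^sub>- < \<infinity>\<close> is expressed as nonemptiness of the set whose infimum is \<open>\<tau>\<^sub>-\<close>.\<close>

definition return_times ::
    "('p::finite, 'm::finite, 'i, 'j) rap_data \<Rightarrow> ('p, 'm) path \<Rightarrow> real set" where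
  "return_times X \<omega> = {t. 0 < t \<and> level X \<omega> t \<le> 0}"

definition tau_minus :: "('p::finite, 'm::finite, 'i, 'j) rap_data \<Rightarrow> ('p, 'm) path \<Rightarrow> real" where
  "tau_minus X \<omega> = Inf (return_times X \<omega>)"

definition Omega_minus :: "('p::finite, 'm::finite, 'i, 'j) rap_data \<Rightarrow> ('p, 'm) path set" where
  "Omega_minus X = {\<omega>\<in>Omega X. \<omega> 0 \<in> Zplus X \<and> return_times X \<omega> \<noteq> {}}"

definition Omega_one :: "('p::finite, 'm::finite, 'i, 'j) rap_data \<Rightarrow> ('p, 'm) path set" where
  "Omega_one X = {\<omega>\<in>Omega_minus X.
     card {t\<in>{0..<tau_minus X \<omega>}. left_lim \<omega> t \<in> Zplus X \<and> \<omega> t \<in> Zminus X} = 1}"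

definition lowest_peak :: "('p::finite, 'm::finite, 'i, 'j) rap_data \<Rightarrow> ('p, 'm) path \<Rightarrow> real" where
  "lowest_peak X \<omega> = Inf {y. 0 \<le> y \<and> (\<exists>t\<in>{0..<tau_minus X \<omega>}.
     level X \<omega> t = y \<and> left_lim \<omega> t \<in> Zminus X \<and> \<omega> t \<in> Zplus X)}"

definition time_one :: "('p::finite, 'm::finite, 'i, 'j) rap_data \<Rightarrow> ('p, 'm) path \<Rightarrow> real" where
  "time_one X \<omega> = Inf {t. 0 \<le> t \<and> level X \<omega> t = lowest_peak X \<omega>}"

definition time_two :: "('p::finite, 'm::finite, 'i, 'j) rap_data \<Rightarrow> ('p, 'm) path \<Rightarrow> real" where
  "time_two X \<omega> = time_one X \<omega> + tau_minus X (shift (time_one X \<omega>) \<omega>)"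

text \<open>The value at index 0 is a dummy.\<close>

fun Omega_prime ::
    "('p::finite, 'm::finite, 'i, 'j) rap_data \<Rightarrow> nat \<Rightarrow> ('p, 'm) path set" where
  "Omega_prime X 0 = {}"
| "Omega_prime X (Suc 0) = Omega_one X"
| "Omega_prime X (Suc (Suc n)) = {\<omega>\<in>Omega_minus X - Omega_one X.
     shift (time_one X \<omega>) \<omega> \<in> Omega_prime X (Suc n) \<union> Omega_one X \<and>
     shift (time_two X \<omega>) \<omega> \<in> Omega_prime X (Suc n) \<union> Omega_one X}"

definition Omega_n :: "('p::finite, 'm::finite, 'i, 'j) rap_data \<Rightarrow> nat \<Rightarrow> ('p, 'm) path set" where
  "Omega_n X n = Omega_prime X n \<union> Omega_one X"

text \<open>Almost surely the orbit at \<open>\<tau>\<^sub>-\<close> is of the form \<open>(0, y)\<close>, hence the second component. The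
  library notion \<open>has_bochner_integral\<close> includes the existence of the expectation.\<close>

definition psi_matrix :: "('p::finite, 'm::finite, 'i, 'j) rap_data \<Rightarrow>
    (('p, 'm) state \<Rightarrow> ('p, 'm) path measure) \<Rightarrow> nat \<Rightarrow> real^'m^'p \<Rightarrow> bool" where
  "psi_matrix X P n M \<longleftrightarrow> (\<forall>i. \<forall>\<alpha>\<in>Zp X i. has_bochner_integral (P (\<alpha>, 0))
     (\<lambda>\<omega>. indicator (Omega_n X n) \<omega> *\<^sub>R snd (\<omega> (tau_minus X \<omega>))) (\<alpha> v* M))"

end

theory Submission
  imports Defs
begin

text \<open>
  An excursion of the level above its starting point has the structure of a tree. It rises in one run
  until the orbit first changes to the minus side, at some level \<open>x\<close>, and then has to come down by \<open>x\<close>.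
  On its way down it is interrupted at valleys, where the orbit jumps back to the plus side. Every
  valley starts an excursion of the same kind that ends at the level of the valley, and there the way
  down is resumed. The height of an excursion is read off on the way down from a counter: it starts
  with 1, and a valley whose excursion has height \<open>k\<close> changes it from \<open>K\<close> to \<open>Suc (max K k)\<close>. The last
  valley is the lowest peak at which the sets \<open>Omega_prime\<close> split a path. Hence \<open>Omega_n\<close> consists of the
  excursions of height at most \<open>n\<close>, see \<open>Omega_n_iff\<close>.

  The probabilistic input is \<open>switch_integral\<close>, the law of the first change of side. A path that starts
  from \<open>a\<close> on the plus side switches in \<open>dw\<close> with the unnormalised state \<open>a e\<^sup>C\<^sup>w D dw\<close>, with the full matrix
  \<open>C\<close>, although the orbit may have jumped between blocks before. Both sides of this formula satisfy a renewal
  equation at the first jump which has only one bounded solution; for the right-hand side this is Duhamel's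
  formula. As the expectations are linear in the state, those of successive pieces of a path multiply as
  matrices.

  The law of the first switch follows a path from its beginning, so the expectations over descents are
  computed by splitting at the first valley (\<open>descent_integral\<close>). The recursion for \<open>\<Psi>\<^sub>n\<close>, like the sets
  \<open>Omega_n\<close>, splits at the last valley. Let \<open>descent_matrix n K h\<close> be the matrix of the descents by \<open>h\<close> on
  which the counter runs from \<open>K\<close> to at most \<open>n\<close>. It is defined by splitting at the last valley; that it
  satisfies the first-valley recursion as well is a matter of associativity of convolutions (\<open>descent_matrix_first_valley\<close>).
  Integrating over the initial rise, \<open>\<Psi>\<^sub>n\<close> is the integral of \<open>e\<^sup>C\<^sup>s D descent_matrix n 1 s\<close> with the matrices of the plus side
  (\<open>Psi_descent_matrix\<close>). Splitting the rise at the level of the last valley turns this into the integral equation.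

  The integrals converge because the process leaves either side: the exponentials of \<open>C\<close> vanish
  at infinity on all orbit states, hence everywhere since the orbit sets span the space, and then they decay
  exponentially. Spanning also gives uniqueness.
\<close>

section \<open>The matrix exponential\<close>

lemma bounded_bilinear_matrix_mult:
  "bounded_bilinear ((**) :: real^'n::finite^'m::finite \<Rightarrow> real^'k::finite^'n \<Rightarrow> real^'k^'m)"
  by (auto simp: bilinear_conv_bounded_bilinear[symmetric] bilinear_def
      matrix_matrix_mult_def vec_eq_iff sum.distrib algebra_simps sum_distrib_left intro!: linearI)

lemma bounded_bilinear_vector_matrix_mult:
  "bounded_bilinear ((v*) :: real^'m::finite \<Rightarrow> real^'n::finite^'m \<Rightarrow> real^'n)"
  by (auto simp: bilinear_conv_bounded_bilinear[symmetric] bilinear_def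
      vector_matrix_mult_def vec_eq_iff sum.distrib algebra_simps sum_distrib_left intro!: linearI)

lemma bounded_bilinear_matrix_vector_mult:
  "bounded_bilinear ((*v) :: real^'n::finite^'m::finite \<Rightarrow> real^'n \<Rightarrow> real^'m)"
  by (auto simp: bilinear_conv_bounded_bilinear[symmetric] bilinear_def
      matrix_vector_mult_def vec_eq_iff sum.distrib algebra_simps sum_distrib_left intro!: linearI)

definition mat_pow :: "real^'n::finite^'n \<Rightarrow> nat \<Rightarrow> real^'n^'n" where
  "mat_pow A k = ((**) A ^^ k) (mat 1)"

lemma mat_pow_0 [simp]: "mat_pow A 0 = mat 1"
  and mat_pow_Suc: "mat_pow A (Suc k) = A ** mat_pow A k"
  by (auto simp: mat_pow_def)

lemma mat_pow_Suc': "mat_pow A (Suc k) = mat_pow A k ** A"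
proof (induction k)
  case (Suc k)
  then show ?case by (metis mat_pow_Suc matrix_mul_assoc)
qed (auto simp: mat_pow_Suc)

lemma mat_pow_scaleR: "mat_pow (t *\<^sub>R A) k = t ^ k *\<^sub>R mat_pow A k"
  by (induction k) (auto simp: mat_pow_Suc bounded_bilinear.scaleR_left[OF bounded_bilinear_matrix_mult]
     bounded_bilinear.scaleR_right[OF bounded_bilinear_matrix_mult])

lemma mat_pow_entry_bound:
  "\<bar>mat_pow A k $ i $ j\<bar> \<le> (\<Sum>i\<in>UNIV. \<Sum>j\<in>UNIV. \<bar>A $ i $ j\<bar>) ^ k"
proof (induction k arbitrary: i j)
  case 0
  then show ?case by (auto simp: mat_def)
next
  case (Suc k)
  let ?b = "\<Sum>i\<in>UNIV. \<Sum>j\<in>UNIV. \<bar>A $ i $ j\<bar>"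
  have "\<bar>mat_pow A (Suc k) $ i $ j\<bar> \<le> (\<Sum>l\<in>UNIV. \<bar>A $ i $ l * mat_pow A k $ l $ j\<bar>)"
    by (simp add: mat_pow_Suc matrix_matrix_mult_def)
  also have "\<dots> \<le> (\<Sum>l\<in>UNIV. \<bar>A $ i $ l\<bar> * ?b ^ k)"
    by (intro sum_mono) (auto simp: abs_mult intro!: mult_left_mono Suc)
  also have "\<dots> = (\<Sum>l\<in>UNIV. \<bar>A $ i $ l\<bar>) * ?b ^ k" by (simp add: sum_distrib_right)
  also have "\<dots> \<le> ?b * ?b ^ k"
    by (intro mult_right_mono member_le_sum[where f="\<lambda>i. \<Sum>j\<in>UNIV. \<bar>A $ i $ j\<bar>"])
       (auto intro!: sum_nonneg zero_le_power)
  finally show ?case by simp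
qed

text \<open>Every entry of \<open>mat_exp (t *\<^sub>R A)\<close> is a real power series in \<open>t\<close>; the calculus of the matrix
  exponential is reduced to term-wise differentiation of these series.\<close>

lemma mat_exp_entry_summable: "summable (\<lambda>k. mat_pow A k $ i $ j / fact k * t ^ k)"
proof (rule summable_comparison_test')
  let ?b = "\<Sum>i\<in>UNIV. \<Sum>j\<in>UNIV. \<bar>A $ i $ j\<bar>"
  show "summable (\<lambda>k. (?b * \<bar>t\<bar>) ^ k /\<^sub>R fact k)" by (rule summable_exp_generic)
  fix k :: nat assume "k \<ge> 0"
  show "norm (mat_pow A k $ i $ j / fact k * t ^ k) \<le> (?b * \<bar>t\<bar>) ^ k /\<^sub>R fact k"
    using mat_pow_entry_bound[of A k i j]
    by (simp add: abs_mult power_mult_distrib divide_simps power_abs mult.commute[of "\<bar>t\<bar> ^ k"] mult_right_mono)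
qed

lemma mat_exp_entry: "mat_exp (t *\<^sub>R A) $ i $ j = (\<Sum>k. mat_pow A k $ i $ j / fact k * t ^ k)"
proof -
  have "(\<lambda>k. (1 / fact k) *\<^sub>R mat_pow (t *\<^sub>R A) k) sums
          (\<chi> i j. \<Sum>k. mat_pow A k $ i $ j / fact k * t ^ k)"
    unfolding sums_def
  proof (intro vec_tendstoI)
    fix i j
    have "(\<lambda>k. mat_pow A k $ i $ j / fact k * t ^ k) sums (\<Sum>k. mat_pow A k $ i $ j / fact k * t ^ k)"
      by (rule summable_sums[OF mat_exp_entry_summable])
    then show "(\<lambda>n. (\<Sum>k<n. (1 / fact k) *\<^sub>R mat_pow (t *\<^sub>R A) k) $ i $ j)
        \<longlonglongrightarrow> (\<chi> i j. \<Sum>k. mat_pow A k $ i $ j / fact k * t ^ k) $ i $ j"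
      by (simp add: sums_def mat_pow_scaleR algebra_simps)
  qed
  then have "mat_exp (t *\<^sub>R A) = (\<chi> i j. \<Sum>k. mat_pow A k $ i $ j / fact k * t ^ k)"
    unfolding mat_exp_def mat_pow_def[symmetric] by (rule sums_unique[symmetric])
  then show ?thesis by simp
qed

lemma mat_exp_entry_deriv:
  "((\<lambda>t. mat_exp (t *\<^sub>R A) $ i $ j) has_field_derivative
     (\<Sum>k. mat_pow A (Suc k) $ i $ j / fact k * t ^ k)) (at t)"
proof -
  have "diffs (\<lambda>k. mat_pow A k $ i $ j / fact k) = (\<lambda>k. mat_pow A (Suc k) $ i $ j / fact k)"
    by (auto simp: diffs_def fun_eq_iff divide_simps simp del: mult_Suc)
  with termdiffs_strong_converges_everywhere[OF mat_exp_entry_summable, of A i j t]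
  show ?thesis by (simp add: mat_exp_entry)
qed

lemma mat_exp_has_vector_derivative_left:
  "((\<lambda>t. mat_exp (t *\<^sub>R A)) has_vector_derivative (A ** mat_exp (t *\<^sub>R A))) (at t within S)"
proof -
  have e: "(A ** mat_exp (t *\<^sub>R A)) $ i $ j = (\<Sum>k. mat_pow A (Suc k) $ i $ j / fact k * t ^ k)" for i j
  proof -
    have "(\<Sum>k. mat_pow A (Suc k) $ i $ j / fact k * t ^ k)
        = (\<Sum>k. \<Sum>l\<in>UNIV. A $ i $ l * (mat_pow A k $ l $ j / fact k * t ^ k))"
      unfolding mat_pow_Suc matrix_matrix_mult_def vec_lambda_beta sum_distrib_right sum_divide_distrib
      by (intro suminf_cong sum.cong refl) simp
    also have "\<dots> = (\<Sum>l\<in>UNIV. A $ i $ l * (\<Sum>k. mat_pow A k $ l $ j / fact k * t ^ k))"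
      by (simp only: suminf_sum[OF summable_mult[OF mat_exp_entry_summable]] suminf_mult[OF mat_exp_entry_summable])
    finally show ?thesis by (simp add: matrix_matrix_mult_def mat_exp_entry)
  qed
  show ?thesis
    unfolding has_vector_derivative_def
  proof (subst has_derivative_componentwise_within, rule ballI)
    fix b :: "real^'a^'a" assume "b \<in> Basis"
    then obtain i j where b: "b = axis i (axis j 1)" by (auto simp: Basis_vec_def)
    have "((\<lambda>t. mat_exp (t *\<^sub>R A) $ i $ j) has_derivative (*) ((A ** mat_exp (t *\<^sub>R A)) $ i $ j)) (at t within S)"
      using mat_exp_entry_deriv[of A i j t] unfolding e[symmetric] has_field_derivative_def
      by (rule has_derivative_at_withinI)
    moreover have "(\<lambda>x. x *\<^sub>R (A ** mat_exp (t *\<^sub>R A)) \<bullet> b) = (*) ((A ** mat_exp (t *\<^sub>R A)) $ i $ j)"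
      by (simp add: b inner_axis fun_eq_iff)
    ultimately show "((\<lambda>x. mat_exp (x *\<^sub>R A) \<bullet> b) has_derivative (\<lambda>x. x *\<^sub>R (A ** mat_exp (t *\<^sub>R A)) \<bullet> b)) (at t within S)"
      by (simp add: b inner_axis)
  qed
qed

lemma mat_exp_commute: "A ** mat_exp (t *\<^sub>R A) = mat_exp (t *\<^sub>R A) ** A"
proof -
  have "(A ** mat_exp (t *\<^sub>R A)) $ i $ j = (mat_exp (t *\<^sub>R A) ** A) $ i $ j" for i j
  proof -
    have "(A ** mat_exp (t *\<^sub>R A)) $ i $ j = (\<Sum>l\<in>UNIV. \<Sum>k. A $ i $ l * (mat_pow A k $ l $ j / fact k * t ^ k))"
      by (simp only: matrix_matrix_mult_def mat_exp_entry vec_lambda_beta suminf_mult[OF mat_exp_entry_summable])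
    also have "\<dots> = (\<Sum>k. \<Sum>l\<in>UNIV. A $ i $ l * (mat_pow A k $ l $ j / fact k * t ^ k))"
      by (rule suminf_sum[symmetric]) (rule summable_mult[OF mat_exp_entry_summable])
    also have "\<dots> = (\<Sum>k. mat_pow A (Suc k) $ i $ j / fact k * t ^ k)"
      unfolding mat_pow_Suc matrix_matrix_mult_def vec_lambda_beta sum_distrib_right sum_divide_distrib
      by (intro suminf_cong sum.cong refl) simp
    also have "\<dots> = (\<Sum>k. \<Sum>l\<in>UNIV. (mat_pow A k $ i $ l / fact k * t ^ k) * A $ l $ j)"
      unfolding mat_pow_Suc' matrix_matrix_mult_def vec_lambda_beta sum_distrib_right sum_divide_distrib
      by (intro suminf_cong sum.cong refl) simp
    also have "\<dots> = (\<Sum>l\<in>UNIV. \<Sum>k. (mat_pow A k $ i $ l / fact k * t ^ k) * A $ l $ j)"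
      by (rule suminf_sum) (rule summable_mult2[OF mat_exp_entry_summable])
    also have "\<dots> = (mat_exp (t *\<^sub>R A) ** A) $ i $ j"
      by (simp only: matrix_matrix_mult_def mat_exp_entry vec_lambda_beta suminf_mult2[OF mat_exp_entry_summable])
    finally show ?thesis .
  qed
  then show ?thesis by (simp add: vec_eq_iff)
qed

lemma mat_exp_has_vector_derivative_right:
  "((\<lambda>t. mat_exp (t *\<^sub>R A)) has_vector_derivative (mat_exp (t *\<^sub>R A) ** A)) (at t within S)"
  using mat_exp_has_vector_derivative_left[of A t S] unfolding mat_exp_commute[of A t] .

lemma mat_exp_zero [simp]: "mat_exp (0 :: real^'n::finite^'n) = mat 1"
proof -
  have "mat_exp (0 *\<^sub>R (mat 1 :: real^'n^'n)) $ i $ j = (mat 1 :: real^'n^'n) $ i $ j" for i j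
    unfolding mat_exp_entry by (subst suminf_finite[where N="{0}"]) auto
  then show ?thesis by (simp add: vec_eq_iff)
qed

lemma continuous_on_mat_exp: "continuous_on S (\<lambda>t. mat_exp (t *\<^sub>R A))"
  unfolding continuous_on_eq_continuous_within
  by (intro ballI has_vector_derivative_continuous[OF mat_exp_has_vector_derivative_left])

lemma mat_exp_add: "mat_exp ((s + t) *\<^sub>R A) = mat_exp (s *\<^sub>R A) ** mat_exp (t *\<^sub>R A)"
proof -
  \<comment> \<open>both \<open>e\<^sup>(\<^sup>s\<^sup>+\<^sup>t\<^sup>)\<^sup>A e\<^sup>-\<^sup>t\<^sup>A\<close> and \<open>e\<^sup>-\<^sup>t\<^sup>A e\<^sup>t\<^sup>A\<close> are constant in \<open>t\<close>\<close>
  have c: "mat_exp ((s + t) *\<^sub>R A) ** mat_exp (- t *\<^sub>R A) = mat_exp (s *\<^sub>R A)" for s t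
  proof -
    have "((\<lambda>t. mat_exp ((s + t) *\<^sub>R A) ** mat_exp (- t *\<^sub>R A)) has_vector_derivative
        mat_exp ((s + t) *\<^sub>R A) ** (-1 *\<^sub>R (A ** mat_exp (- t *\<^sub>R A)))
        + (1 *\<^sub>R (mat_exp ((s + t) *\<^sub>R A) ** A)) ** mat_exp (- t *\<^sub>R A)) (at t within UNIV)" for t
    proof (rule bounded_bilinear.has_vector_derivative[OF bounded_bilinear_matrix_mult])
      show "((\<lambda>x. mat_exp ((s + x) *\<^sub>R A)) has_vector_derivative (1 *\<^sub>R (mat_exp ((s + t) *\<^sub>R A) ** A))) (at t)"
        using vector_diff_chain_at[OF _ mat_exp_has_vector_derivative_right[where A=A], where f="\<lambda>x. s + x" and f'=1 and x=t, unfolded o_def]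
        by (rule meta_mp) (auto intro!: derivative_eq_intros)
      show "((\<lambda>x. mat_exp (- x *\<^sub>R A)) has_vector_derivative (-1 *\<^sub>R (A ** mat_exp (- t *\<^sub>R A)))) (at t)"
        using vector_diff_chain_at[OF _ mat_exp_has_vector_derivative_left[where A=A], where f="\<lambda>x. - x" and f'="-1" and x=t, unfolded o_def]
        by (rule meta_mp) (auto intro!: derivative_eq_intros)
    qed
    then have "((\<lambda>t. mat_exp ((s + t) *\<^sub>R A) ** mat_exp (- t *\<^sub>R A)) has_derivative (\<lambda>h. 0)) (at t within UNIV)" for t
      by (simp add: has_vector_derivative_def matrix_mul_assoc
          bounded_bilinear.minus_right[OF bounded_bilinear_matrix_mult])
    from has_derivative_zero_unique[OF convex_UNIV this, of 0 t] show ?thesis by simp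
  qed
  have inv: "mat_exp (- t *\<^sub>R A) ** mat_exp (t *\<^sub>R A) = mat 1" for t
    using c[of 0 "-t"] by simp
  have "mat_exp ((s + t) *\<^sub>R A) = (mat_exp ((s + t) *\<^sub>R A) ** mat_exp (- t *\<^sub>R A)) ** mat_exp (t *\<^sub>R A)"
    by (simp add: matrix_mul_assoc[symmetric] inv del: scaleR_minus_left)
  also have "\<dots> = mat_exp (s *\<^sub>R A) ** mat_exp (t *\<^sub>R A)" by (simp only: c)
  finally show ?thesis .
qed

lemma mat_exp_block_diag_entry:
  assumes "f r \<noteq> f c"
  shows "mat_exp (t *\<^sub>R block_diag f A) $ r $ c = 0"
proof -
  have "f r \<noteq> f c \<Longrightarrow> mat_pow (block_diag f A) k $ r $ c = 0" for k r
  proof (induction k arbitrary: r)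
    case (Suc k)
    have "block_diag f A $ r $ l * mat_pow (block_diag f A) k $ l $ c = 0" for l
      using Suc by (cases "f r = f l") (auto simp: block_diag_def)
    then show ?case unfolding mat_pow_Suc matrix_matrix_mult_def by (simp only: vec_lambda_beta sum.neutral_const)
  qed (auto simp: mat_def)
  then show ?thesis using assms by (simp add: mat_exp_entry)
qed

section \<open>Orbit sets and linear flows of states\<close>

text \<open>Minimality of an orbit set speaks of the affine subspaces of one single dimension. Adding points to an
  affine hull one by one shows that it excludes those of smaller dimension as well.\<close>

lemma affine_superset_of_dim:
  fixes S :: "'a::euclidean_space set"
  assumes "aff_dim S \<le> d" "d \<le> int DIM('a)"
  shows "\<exists>T. affine T \<and> aff_dim T = d \<and> S \<subseteq> T"
proof -
  have "\<exists>T. affine T \<and> aff_dim T = aff_dim S + int n \<and> S \<subseteq> T" if "aff_dim S + int n \<le> int DIM('a)" for n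
    using that
  proof (induction n)
    case 0
    show ?case by (intro exI[of _ "affine hull S"]) (auto simp: hull_subset)
  next
    case (Suc n)
    then obtain T where T: "affine T" "aff_dim T = aff_dim S + int n" "S \<subseteq> T" by auto
    with Suc.prems have "T \<noteq> UNIV" by auto
    then obtain x where "x \<notin> T" by blast
    with T have "aff_dim (insert x T) = aff_dim S + int (Suc n)"
      by (simp add: aff_dim_insert hull_same)
    then show ?case using T(3)
      by (intro exI[of _ "affine hull (insert x T)"]) (auto intro: hull_inc)
  qed
  from this[of "nat (d - aff_dim S)"] assms show ?thesis by auto
qed

text \<open>An orbit set lies in the hyperplane of coordinate sum 1, so 0 is not in its affine hull and its span
  has one dimension more than its affine hull. By minimality the span is then the whole block.
  Consequently a linear identity has to be checked on orbit states only.\<close>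

lemma span_orbit_sets:
  fixes f :: "'n::finite \<Rightarrow> 'i" and Z :: "'i \<Rightarrow> (real^'n) set"
  assumes "\<And>i. orbit_set f i (Z i)" and surj: "surj f"
  shows "span (\<Union>i. Z i) = UNIV"
proof -
  have block: "{x::real^'n. \<forall>k. k \<notin> {k. f k = i} \<longrightarrow> x $ k = 0} \<subseteq> span (Z i)" (is "?S \<subseteq> _") for i
  proof -
    note o = assms(1)[of i, unfolded orbit_set_def]
    have dimS: "dim ?S = card {k. f k = i}"
      using dim_substandard_cart[where 'a=real, of "{k. f k = i}"]
      by (simp add: dim_vec_eq)
    have subS: "subspace ?S" by (auto simp: subspace_def)
    have ZS: "Z i \<subseteq> ?S" using o by auto
    have card: "card {k. f k = i} \<ge> 1"
    proof -
      from surj obtain k where "f k = i" by (metis surjD)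
      then have "{k. f k = i} \<noteq> {}" by auto
      then show ?thesis by (simp add: Suc_leI card_gt_0_iff)
    qed
    have "card {k. f k = i} \<le> card (UNIV :: 'n set)" by (rule card_mono) auto
    then have a: "aff_dim (Z i) > int (card {k. f k = i}) - 2"
      using o affine_superset_of_dim[of "Z i" "int (card {k. f k = i}) - 2"] by force
    have "0 \<notin> affine hull (Z i)"
    proof -
      have "affine {x::real^'n. (\<Sum>k\<in>UNIV. x $ k) = 1}"
        by (auto simp: affine_def sum.distrib sum_distrib_left[symmetric])
      then have "affine hull (Z i) \<subseteq> {x. (\<Sum>k\<in>UNIV. x $ k) = 1}"
        using o by (intro hull_minimal) auto
      then show ?thesis by auto
    qed
    then have "int (dim (Z i)) = aff_dim (Z i) + 1"
      using aff_dim_zero[of "insert 0 (Z i)"] by (simp add: aff_dim_insert hull_inc dim_insert span_zero)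
    then have "dim (Z i) \<ge> dim ?S" using a dimS by linarith
    then have "span (Z i) = ?S"
      using subspace_dim_equal[of "span (Z i)" ?S] ZS subS by (simp add: span_minimal)
    then show ?thesis by simp
  qed
  have "axis k (1::real) \<in> span (\<Union>i. Z i)" for k :: 'n
  proof -
    have "axis k (1::real) \<in> span (Z (f k))" using block[of "f k"] by (auto simp: axis_def)
    then show ?thesis using span_mono[of "Z (f k)" "\<Union>i. Z i"] by auto
  qed
  then have "(Basis :: (real^'n) set) \<subseteq> span (\<Union>i. Z i)" by (auto simp: Basis_vec_def)
  then have "span (Basis :: (real^'n) set) \<subseteq> span (\<Union>i. Z i)" by (intro span_minimal subspace_span)
  then show ?thesis unfolding span_Basis by blast
qed

definition side :: "('p::finite, 'm::finite, 'i, 'j) rap_data \<Rightarrow> bool \<Rightarrow> ('p, 'm) state set" where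
  "side X b = (if b then Zplus X else Zminus X)"

text \<open>Dropping the normalisation makes all evolutions of states linear. \<open>block_flow\<close> is the motion until
  the next jump; \<open>side_flow\<close>, with the full matrices \<open>C\<close>, also accounts for the jumps between the
  blocks of one side, and \<open>off_block\<close> is the difference of the two generators.\<close>

definition block_flow ::
    "('p::finite, 'm::finite, 'i, 'j) rap_data \<Rightarrow> real \<Rightarrow> ('p, 'm) state \<Rightarrow> ('p, 'm) state" where
  "block_flow X r a = (fst a v* mat_exp (r *\<^sub>R block_diag (blkp X) (Cp X)),
                       snd a v* mat_exp (r *\<^sub>R block_diag (blkm X) (Cm X)))"

definition side_flow ::
    "('p::finite, 'm::finite, 'i, 'j) rap_data \<Rightarrow> real \<Rightarrow> ('p, 'm) state \<Rightarrow> ('p, 'm) state" where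
  "side_flow X r a = (fst a v* mat_exp (r *\<^sub>R Cp X), snd a v* mat_exp (r *\<^sub>R Cm X))"

definition off_block ::
    "('p::finite, 'm::finite, 'i, 'j) rap_data \<Rightarrow> ('p, 'm) state \<Rightarrow> ('p, 'm) state" where
  "off_block X a = (fst a v* (Cp X - block_diag (blkp X) (Cp X)),
                    snd a v* (Cm X - block_diag (blkm X) (Cm X)))"

definition block_gen ::
    "('p::finite, 'm::finite, 'i, 'j) rap_data \<Rightarrow> ('p, 'm) state \<Rightarrow> ('p, 'm) state" where
  "block_gen X a = (fst a v* block_diag (blkp X) (Cp X), snd a v* block_diag (blkm X) (Cm X))"

definition cross ::
    "('p::finite, 'm::finite, 'i, 'j) rap_data \<Rightarrow> ('p, 'm) state \<Rightarrow> ('p, 'm) state" where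
  "cross X a = (snd a v* Dmp X, fst a v* Dpm X)"

definition in_block :: "('p::finite, 'm::finite, 'i, 'j) rap_data \<Rightarrow> 'i + 'j \<Rightarrow> ('p, 'm) state \<Rightarrow> bool" where
  "in_block X c a \<longleftrightarrow> (case c of
      Inl i \<Rightarrow> snd a = 0 \<and> (\<forall>k. blkp X k \<noteq> i \<longrightarrow> fst a $ k = 0)
    | Inr j \<Rightarrow> fst a = 0 \<and> (\<forall>k. blkm X k \<noteq> j \<longrightarrow> snd a $ k = 0))"

lemmas vm_bilinear = bounded_bilinear_vector_matrix_mult

lemma bounded_linear_vm: "bounded_linear (\<lambda>x. x v* A)"
  for A :: "real^'n::finite^'m::finite"
  by (rule bounded_bilinear.bounded_linear_left[OF vm_bilinear])

lemma bounded_linear_block_flow: "bounded_linear (block_flow X r)"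
  unfolding block_flow_def
  by (intro bounded_linear_Pair bounded_linear_compose[OF bounded_linear_vm] bounded_linear_fst bounded_linear_snd)

lemma bounded_linear_side_flow: "bounded_linear (side_flow X r)"
  unfolding side_flow_def
  by (intro bounded_linear_Pair bounded_linear_compose[OF bounded_linear_vm] bounded_linear_fst bounded_linear_snd)

lemma bounded_linear_off_block: "bounded_linear (off_block X)"
  unfolding off_block_def
  by (intro bounded_linear_Pair bounded_linear_compose[OF bounded_linear_vm] bounded_linear_fst bounded_linear_snd)

lemma bounded_linear_cross: "bounded_linear (cross X)"
  unfolding cross_def
  by (intro bounded_linear_Pair bounded_linear_compose[OF bounded_linear_vm] bounded_linear_fst bounded_linear_snd)

lemma bounded_linear_mass: "bounded_linear mass"
proof -
  have "linear (mass :: ('p::finite, 'm::finite) state \<Rightarrow> real)"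
    by (auto simp: mass_def sum.distrib sum_distrib_left algebra_simps intro!: linearI)
  then show ?thesis by (simp add: linear_conv_bounded_linear)
qed

lemma bounded_linear_jump_vec: "bounded_linear (jump_vec X c d)"
proof -
  have 0: "bounded_linear (\<lambda>a. (fst a v* A, 0 :: real^'zz::finite))" "bounded_linear (\<lambda>a. (0 :: real^'zz::finite, fst a v* A))"
     "bounded_linear (\<lambda>a. (snd a v* B, 0 :: real^'zz::finite))" "bounded_linear (\<lambda>a. (0 :: real^'zz::finite, snd a v* B))"
    for A :: "real^'z1::finite^'z2::finite" and B :: "real^'z3::finite^'z4::finite"
    by (auto intro!: bounded_linear_Pair bounded_linear_compose[OF bounded_linear_vm] bounded_linear_fst bounded_linear_snd bounded_linear_zero)
  have "jump_vec X (Inl i) (Inl k) = (\<lambda>a. (fst a v* block_part (blkp X) (blkp X) i k (Cp X), 0))"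
    "jump_vec X (Inl i) (Inr l) = (\<lambda>a. (0, fst a v* block_part (blkp X) (blkm X) i l (Dpm X)))"
    "jump_vec X (Inr j) (Inl k) = (\<lambda>a. (snd a v* block_part (blkm X) (blkp X) j k (Dmp X), 0))"
    "jump_vec X (Inr j) (Inr l) = (\<lambda>a. (0, snd a v* block_part (blkm X) (blkm X) j l (Cm X)))" for i j k l
    by (simp_all add: fun_eq_iff)
  then show ?thesis
    by (cases c; cases d) (simp_all add: 0)
qed

lemma block_flow_0 [simp]: "block_flow X 0 a = a"
  and side_flow_0 [simp]: "side_flow X 0 a = a"
  by (auto simp: block_flow_def side_flow_def)

lemma row_flow_has_vector_derivative:
  "((\<lambda>s. x v* mat_exp (s *\<^sub>R A)) has_vector_derivative ((x v* mat_exp (s *\<^sub>R A)) v* A)) (at s within S)"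
  using bounded_linear.has_vector_derivative[OF bounded_bilinear.bounded_linear_right[OF vm_bilinear, of x]
     mat_exp_has_vector_derivative_right[of A s S]]
  by (simp add: vector_matrix_mul_assoc)

lemma block_flow_has_vector_derivative:
  "((\<lambda>s. block_flow X s a) has_vector_derivative block_gen X (block_flow X s a)) (at s within S)"
  unfolding block_flow_def block_gen_def fst_conv snd_conv
  by (intro has_vector_derivative_Pair row_flow_has_vector_derivative)

lemma continuous_on_block_flow: "continuous_on S (\<lambda>s. block_flow X s a)"
  unfolding continuous_on_eq_continuous_within
  by (intro ballI has_vector_derivative_continuous[OF block_flow_has_vector_derivative])

lemma continuous_on_side_flow: "continuous_on S (\<lambda>s. side_flow X s a)"
  unfolding side_flow_def
  by (intro continuous_intros bounded_linear.continuous_on[OF bounded_bilinear.bounded_linear_right[OF vm_bilinear]] continuous_on_mat_exp)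

lemma row_duhamel:
  "((\<lambda>s. (x v* mat_exp (s *\<^sub>R G)) v* mat_exp ((z - s) *\<^sub>R C)) has_vector_derivative
      - (((x v* mat_exp (s *\<^sub>R G)) v* (C - G)) v* mat_exp ((z - s) *\<^sub>R C))) (at s within S)"
proof -
  have 1: "((\<lambda>x. mat_exp ((z - x) *\<^sub>R C)) has_vector_derivative (-1 *\<^sub>R (C ** mat_exp ((z - s) *\<^sub>R C)))) (at s)"
    using vector_diff_chain_at[OF _ mat_exp_has_vector_derivative_left[where A=C], where f="\<lambda>x. z - x" and f'="-1" and x=s, unfolded o_def]
    by (rule meta_mp) (auto intro!: derivative_eq_intros)
  have "((\<lambda>s. (x v* mat_exp (s *\<^sub>R G)) v* mat_exp ((z - s) *\<^sub>R C)) has_vector_derivative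
     ((x v* mat_exp (s *\<^sub>R G)) v* (-1 *\<^sub>R (C ** mat_exp ((z - s) *\<^sub>R C))) + ((x v* mat_exp (s *\<^sub>R G)) v* G) v* mat_exp ((z - s) *\<^sub>R C))) (at s within S)"
    by (intro bounded_bilinear.has_vector_derivative[OF vm_bilinear] row_flow_has_vector_derivative has_vector_derivative_at_within[OF 1])
  moreover have "(x v* mat_exp (s *\<^sub>R G)) v* (-1 *\<^sub>R (C ** mat_exp ((z - s) *\<^sub>R C))) + ((x v* mat_exp (s *\<^sub>R G)) v* G) v* mat_exp ((z - s) *\<^sub>R C)
     = - (((x v* mat_exp (s *\<^sub>R G)) v* (C - G)) v* mat_exp ((z - s) *\<^sub>R C))"
    by (simp add: bounded_bilinear.minus_right[OF vm_bilinear] bounded_bilinear.diff_right[OF vm_bilinear]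
         bounded_bilinear.diff_left[OF vm_bilinear] vector_matrix_mul_assoc[symmetric])
  ultimately show ?thesis by simp
qed

text \<open>The expression interpolates between the two flows: block flow until \<open>s\<close>, side flow afterwards.
  Its derivative is the integrand of Duhamel's formula.\<close>

lemma duhamel_derivative:
  "((\<lambda>s. side_flow X (z - s) (block_flow X s a)) has_vector_derivative
      - side_flow X (z - s) (off_block X (block_flow X s a))) (at s within S)"
  unfolding block_flow_def off_block_def side_flow_def fst_conv snd_conv minus_prod_def uminus_Pair
  by (intro has_vector_derivative_Pair row_duhamel)

lemma row_block_exp:
  fixes f :: "'n::finite \<Rightarrow> 'l" and x :: "real^'n"
  assumes "\<forall>k. f k \<noteq> i \<longrightarrow> x $ k = 0" "f k \<noteq> i"
  shows "(x v* mat_exp (r *\<^sub>R block_diag f A)) $ k = 0"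
proof -
  have "x $ l = 0 \<or> mat_exp (r *\<^sub>R block_diag f A) $ l $ k = 0" for l
    using assms mat_exp_block_diag_entry[of f l k r A] by (cases "f l = i") auto
  then show ?thesis
    unfolding vector_matrix_mult_def vec_lambda_beta by (intro sum.neutral) auto
qed

lemma in_block_block_flow: assumes "in_block X c a" shows "in_block X c (block_flow X r a)"
  using assms
  by (auto simp: in_block_def block_flow_def row_block_exp split: sum.splits)

lemma row_block_sum:
  fixes f :: "'n::finite \<Rightarrow> 'i::finite" and g :: "'m::finite \<Rightarrow> 'j::finite" and x :: "real^'n"
  assumes "\<forall>k. f k \<noteq> i \<longrightarrow> x $ k = 0"
  shows "(\<Sum>j\<in>J. (x v* block_part f g i j M) $ k) = (if g k \<in> J then (x v* M) $ k else 0)"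
proof -
  have "(x v* block_part f g i j M) $ k = (if g k = j then (x v* M) $ k else 0)" for j
    using assms by (auto simp: vector_matrix_mult_def block_part_def intro!: sum.cong)
  then show ?thesis by (simp add: sum.delta)
qed

text \<open>Summed over all destinations, the jump vectors of the single blocks reassemble the matrices \<open>D\<close> (here)
  and the off-diagonal part of the matrices \<open>C\<close> (below).\<close>

lemma sum_jump_vec_cross:
  fixes X :: "('p::finite, 'm::finite, 'i::finite, 'j::finite) rap_data"
  assumes "in_block X c a"
  shows "(\<Sum>d\<in>{d. isl d \<noteq> isl c}. jump_vec X c d a) = cross X a"
proof (cases c)
  case (Inl i)
  have "{d :: 'i + 'j. isl d \<noteq> isl c} = Inr ` UNIV"
  proof (intro set_eqI)
    fix d :: "'i + 'j" show "d \<in> {d. isl d \<noteq> isl c} \<longleftrightarrow> d \<in> Inr ` UNIV" using Inl by (cases d) auto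
  qed
  then have "(\<Sum>d\<in>{d. isl d \<noteq> isl c}. jump_vec X c d a) = (\<Sum>j\<in>UNIV. (0, fst a v* block_part (blkp X) (blkm X) i j (Dpm X)))"
    by (simp add: sum.reindex Inl)
  also have "\<dots> = (0, \<Sum>j\<in>UNIV. fst a v* block_part (blkp X) (blkm X) i j (Dpm X))"
    by (simp add: sum_prod)
  also have "(\<Sum>j\<in>UNIV. fst a v* block_part (blkp X) (blkm X) i j (Dpm X)) = fst a v* Dpm X"
    using assms Inl by (subst vec_eq_iff) (auto simp: in_block_def row_block_sum)
  finally show ?thesis using assms Inl by (simp add: cross_def in_block_def)
next
  case (Inr i)
  have "{d :: 'i + 'j. isl d \<noteq> isl c} = Inl ` UNIV" using Inr by (auto simp: isl_def)
  then have "(\<Sum>d\<in>{d. isl d \<noteq> isl c}. jump_vec X c d a) = (\<Sum>j\<in>UNIV. (snd a v* block_part (blkm X) (blkp X) i j (Dmp X), 0))"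
    by (simp add: sum.reindex Inr)
  also have "\<dots> = (\<Sum>j\<in>UNIV. snd a v* block_part (blkm X) (blkp X) i j (Dmp X), 0)"
    by (simp add: sum_prod)
  also have "(\<Sum>j\<in>UNIV. snd a v* block_part (blkm X) (blkp X) i j (Dmp X)) = snd a v* Dmp X"
    using assms Inr by (subst vec_eq_iff) (auto simp: in_block_def row_block_sum)
  finally show ?thesis using assms Inr by (simp add: cross_def in_block_def)
qed

lemma row_off_diag:
  fixes f :: "'n::finite \<Rightarrow> 'i" and x :: "real^'n"
  assumes "\<forall>k. f k \<noteq> i \<longrightarrow> x $ k = 0"
  shows "(x v* (M - block_diag f M)) $ k = (if f k \<noteq> i then (x v* M) $ k else 0)"
proof (cases "f k = i")
  case True
  have "x $ l = 0 \<or> (M - block_diag f M) $ l $ k = 0" for l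
    using assms True by (cases "f l = i") (auto simp: block_diag_def)
  then show ?thesis unfolding vector_matrix_mult_def vec_lambda_beta using True by (simp, intro sum.neutral) auto
next
  case False
  have "x $ l = 0 \<or> (M - block_diag f M) $ l $ k = M $ l $ k" for l
    using assms False by (cases "f l = i") (auto simp: block_diag_def)
  then have "(\<Sum>l\<in>UNIV. (M - block_diag f M) $ l $ k * x $ l) = (\<Sum>l\<in>UNIV. M $ l $ k * x $ l)"
    by (intro sum.cong refl) (metis mult_zero_right)
  then show ?thesis using False by (simp add: vector_matrix_mult_def mult.commute)
qed

lemma sum_jump_vec_off_block:
  fixes X :: "('p::finite, 'm::finite, 'i::finite, 'j::finite) rap_data"
  assumes "in_block X c a"
  shows "(\<Sum>d\<in>{d. d \<noteq> c \<and> isl d = isl c}. jump_vec X c d a) = off_block X a"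
proof (cases c)
  case (Inl i)
  have "{d :: 'i + 'j. d \<noteq> c \<and> isl d = isl c} = Inl ` (-{i})" using Inl by (auto simp: image_iff isl_def)
  then have "(\<Sum>d\<in>{d. d \<noteq> c \<and> isl d = isl c}. jump_vec X c d a) = (\<Sum>j\<in>-{i}. (fst a v* block_part (blkp X) (blkp X) i j (Cp X), 0))"
    by (simp add: sum.reindex Inl)
  also have "\<dots> = (\<Sum>j\<in>-{i}. fst a v* block_part (blkp X) (blkp X) i j (Cp X), 0)"
    by (simp add: sum_prod)
  also have "(\<Sum>j\<in>-{i}. fst a v* block_part (blkp X) (blkp X) i j (Cp X)) = fst a v* (Cp X - block_diag (blkp X) (Cp X))"
    using assms Inl by (subst vec_eq_iff) (auto simp: in_block_def row_block_sum row_off_diag[where i=i])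
  finally show ?thesis using assms Inl by (simp add: off_block_def in_block_def)
next
  case (Inr i)
  have "{d :: 'i + 'j. d \<noteq> c \<and> isl d = isl c} = Inr ` (-{i})"
  proof (intro set_eqI)
    fix d :: "'i + 'j" show "d \<in> {d. d \<noteq> c \<and> isl d = isl c} \<longleftrightarrow> d \<in> Inr ` (-{i})" using Inr by (cases d) auto
  qed
  then have "(\<Sum>d\<in>{d. d \<noteq> c \<and> isl d = isl c}. jump_vec X c d a) = (\<Sum>j\<in>-{i}. (0, snd a v* block_part (blkm X) (blkm X) i j (Cm X)))"
    by (simp add: sum.reindex Inr)
  also have "\<dots> = (0, \<Sum>j\<in>-{i}. snd a v* block_part (blkm X) (blkm X) i j (Cm X))"
    by (simp add: sum_prod)
  also have "(\<Sum>j\<in>-{i}. snd a v* block_part (blkm X) (blkm X) i j (Cm X)) = snd a v* (Cm X - block_diag (blkm X) (Cm X))"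
    using assms Inr by (subst vec_eq_iff) (auto simp: in_block_def row_block_sum row_off_diag[where i=i])
  finally show ?thesis using assms Inr by (simp add: off_block_def in_block_def)
qed

lemma mass_inner: "mass a = fst a \<bullet> vec 1 + snd a \<bullet> vec 1"
  by (simp add: mass_def inner_vec_def)

locale rap =
  fixes X :: "('p::finite, 'm::finite, 'i::finite, 'j::finite) rap_data"
  assumes valid: "rap_data_valid X"
begin

lemma orbit_set_p: "orbit_set (blkp X) i (Zp X i)" and orbit_set_m: "orbit_set (blkm X) j (Zm X j)"
  using valid by (auto simp: rap_data_valid_def)

lemma cell_in_block: "a \<in> cell X c \<Longrightarrow> in_block X c a"
  using orbit_set_p orbit_set_m
  by (cases c) (fastforce simp: in_block_def orbit_set_def)+

lemma mass_cell: "a \<in> cell X c \<Longrightarrow> mass a = 1"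
  using orbit_set_p orbit_set_m
  by (cases c) (fastforce simp: mass_def orbit_set_def)+

lemma states_cell: "a \<in> states X \<longleftrightarrow> (\<exists>c. a \<in> cell X c)"
  by (simp add: states_def Zplus_def Zminus_def split_sum_ex del: cell.simps)

lemma side_cell: "a \<in> side X b \<longleftrightarrow> (\<exists>c. isl c = b \<and> a \<in> cell X c)"
  by (simp add: side_def Zplus_def Zminus_def split_sum_ex del: cell.simps)

lemma mass_states: "a \<in> states X \<Longrightarrow> mass a = 1"
  using states_cell mass_cell by blast

lemma side_states: "a \<in> side X b \<Longrightarrow> a \<in> states X"
  by (auto simp: side_def states_def split: if_splits)

lemma states_side: "a \<in> states X \<Longrightarrow> \<exists>b. a \<in> side X b"
  by (auto simp: side_cell states_cell)

lemma normalise_scaleR: "c \<noteq> 0 \<Longrightarrow> normalise (c *\<^sub>R a) = normalise a"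
  by (simp add: normalise_def linear_cmul[OF bounded_linear.linear[OF bounded_linear_mass]])

lemma mass_0 [simp]: "mass 0 = 0"
  by (simp add: mass_def)

text \<open>On states, membership in a side is a condition on a continuous linear functional. This is what makes
  the sets of paths considered below measurable.\<close>

definition sgn_side :: "('p, 'm) state \<Rightarrow> real" where
  "sgn_side a = (\<Sum>k\<in>UNIV. fst a $ k) - (\<Sum>k\<in>UNIV. snd a $ k)"

lemma sgn_side: "a \<in> side X b \<Longrightarrow> sgn_side a = (if b then 1 else -1)"
proof (cases b)
  case True
  moreover assume "a \<in> side X b"
  ultimately obtain i x where "a = (x, 0)" "x \<in> Zp X i" by (auto simp: side_def Zplus_def)
  with True orbit_set_p[of i] show ?thesis by (simp add: sgn_side_def orbit_set_def)
next
  case False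
  moreover assume "a \<in> side X b"
  ultimately obtain i x where "a = (0, x)" "x \<in> Zm X i" by (auto simp: side_def Zminus_def)
  with False orbit_set_m[of i] show ?thesis by (simp add: sgn_side_def orbit_set_def)
qed

lemma side_iff_sgn_side: "a \<in> states X \<Longrightarrow> a \<in> side X b \<longleftrightarrow> sgn_side a = (if b then 1 else -1)"
proof -
  assume "a \<in> states X"
  then obtain c where c: "a \<in> side X c" using states_side by blast
  show ?thesis using sgn_side[OF c] c sgn_side[of a b] by (cases b; cases c) auto
qed

lemma side_not_iff: "a \<in> states X \<Longrightarrow> a \<in> side X (\<not> b) \<longleftrightarrow> a \<notin> side X b"
  using states_side[of a] by (cases b) (auto simp: side_iff_sgn_side split: if_splits)

lemma in_block_cell: assumes "in_block X c a" "a \<in> states X" shows "a \<in> cell X c"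
proof -
  obtain d where d: "a \<in> cell X d" using assms states_cell by auto
  have "c = d"
  proof (rule ccontr)
    assume "c \<noteq> d"
    with cell_in_block[OF d] assms(1) have "a = 0"
      by (cases c; cases d) (auto simp: in_block_def prod_eq_iff vec_eq_iff, metis+)
    then show False using mass_cell[OF d] by simp
  qed
  with d show ?thesis by simp
qed

lemma flow_normalise: "flow X r a = normalise (block_flow X r a)"
  by (simp add: flow_def block_flow_def)

lemma flow_side: "a \<in> side X b \<Longrightarrow> 0 \<le> r \<Longrightarrow> flow X r a \<in> side X b"
  using valid by (auto simp: side_def rap_data_valid_def)

lemma flow_states: "a \<in> states X \<Longrightarrow> 0 \<le> r \<Longrightarrow> flow X r a \<in> states X"
  using states_side flow_side side_states by blast

lemma mass_block_flow_pos: assumes "a \<in> states X" "0 \<le> r" shows "0 < mass (block_flow X r a)"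
proof (rule ccontr)
  have nz: "mass (block_flow X s a) \<noteq> 0" if "0 \<le> s" for s
    using mass_states[OF flow_states[OF assms(1) that]] by (auto simp: flow_normalise normalise_def)
  have c: "continuous_on {0..r} (\<lambda>s. mass (block_flow X s a))"
    by (intro bounded_linear.continuous_on[OF bounded_linear_mass] continuous_on_block_flow)
  assume "\<not> 0 < mass (block_flow X r a)"
  then have "\<exists>s\<ge>0. s \<le> r \<and> mass (block_flow X s a) = 0"
    using assms mass_states[OF assms(1)] by (intro IVT2'[OF _ _ _ c]) auto
  with nz show False by auto
qed

lemma flow_cell: assumes "a \<in> cell X c" "0 \<le> r" shows "flow X r a \<in> cell X c"
proof (rule in_block_cell)
  show "in_block X c (flow X r a)"
    using in_block_block_flow[OF cell_in_block[OF assms(1)], of r]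
    by (auto simp: flow_normalise normalise_def in_block_def split: sum.splits)
  show "flow X r a \<in> states X" using assms states_cell flow_states by blast
qed

lemma block_flow_eq: assumes "a \<in> states X" "0 \<le> r"
  shows "block_flow X r a = mass (block_flow X r a) *\<^sub>R flow X r a"
  using mass_block_flow_pos[OF assms] by (simp add: flow_normalise normalise_def)

lemma continuous_on_flow: assumes "a \<in> states X" shows "continuous_on {0..} (\<lambda>r. flow X r a)"
  unfolding flow_normalise normalise_def
  using mass_block_flow_pos[OF assms]
  by (intro continuous_intros bounded_linear.continuous_on[OF bounded_linear_mass] continuous_on_block_flow)
    (force simp: less_le)

text \<open>The mass of this vector is the density of a jump from block \<open>c\<close> to block \<open>d\<close> at time \<open>s\<close>: the
  intensity of the jump times the mass that the block flow has retained until then.\<close>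

definition jump_flow :: "'i + 'j \<Rightarrow> 'i + 'j \<Rightarrow> ('p, 'm) state \<Rightarrow> real \<Rightarrow> ('p, 'm) state" where
  "jump_flow c d a s = jump_vec X c d (block_flow X s a)"

lemma jump_flow_eq: assumes "a \<in> cell X c" "0 \<le> s"
  shows "jump_flow c d a s = mass (block_flow X s a) *\<^sub>R jump_vec X c d (flow X s a)"
  unfolding jump_flow_def
  using block_flow_eq[of a s] assms states_cell
    linear_cmul[OF bounded_linear.linear[OF bounded_linear_jump_vec], of X c d "mass (block_flow X s a)" "flow X s a"]
  by metis

lemma mass_jump_flow: assumes "a \<in> cell X c" "0 \<le> s"
  shows "mass (jump_flow c d a s) = mass (block_flow X s a) * intensity X c d (flow X s a)"
  unfolding jump_flow_eq[OF assms] intensity_def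
  by (simp add: linear_cmul[OF bounded_linear.linear[OF bounded_linear_mass]])

lemma normalise_jump_flow: assumes "a \<in> cell X c" "0 \<le> s"
  shows "normalise (jump_flow c d a s) = jump_target X c d (flow X s a)"
  unfolding jump_flow_eq[OF assms] jump_target_def
  using mass_block_flow_pos[OF _ assms(2), of a] assms(1) states_cell
  by (intro normalise_scaleR) (metis less_irrefl)

lemma mass_jump_flow_nonneg: assumes "a \<in> cell X c" "0 \<le> s" "d \<noteq> c" shows "0 \<le> mass (jump_flow c d a s)"
proof -
  have "0 \<le> intensity X c d (flow X s a)"
    using valid flow_cell[OF assms(1,2)] assms(3) unfolding rap_data_valid_def by blast
  then show ?thesis using mass_block_flow_pos[of a s] assms states_cell unfolding mass_jump_flow[OF assms(1,2)]
    by (metis less_eq_real_def mult_nonneg_nonneg)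
qed

lemma jump_flow_cases: assumes "a \<in> cell X c" "0 \<le> s" "d \<noteq> c"
  shows "jump_flow c d a s = 0 \<or> (0 < mass (jump_flow c d a s) \<and> normalise (jump_flow c d a s) \<in> cell X d)"
proof (cases "jump_vec X c d (flow X s a) = 0")
  case True then show ?thesis using jump_flow_eq[OF assms(1,2)] by simp
next
  case False
  then have "0 < intensity X c d (flow X s a)" "jump_target X c d (flow X s a) \<in> cell X d"
    using valid flow_cell[OF assms(1,2)] assms(3) unfolding rap_data_valid_def by blast+
  then show ?thesis using mass_block_flow_pos[of a s] assms states_cell
    unfolding mass_jump_flow[OF assms(1,2)] normalise_jump_flow[OF assms(1,2)] by (metis mult_pos_pos)
qed

text \<open>This is the assumption that the rows of \<open>C\<close> and \<open>D\<close> together sum to zero: the mass lost by the block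
  flow is the mass that the jumps carry away.\<close>

lemma mass_block_gen: assumes "in_block X c a"
  shows "mass (block_gen X a) = - (\<Sum>d\<in>UNIV - {c}. mass (jump_vec X c d a))"
proof -
  note lin = bounded_linear.linear[OF bounded_linear_mass]
  have "UNIV - {c} = {d. d \<noteq> c \<and> isl d = isl c} \<union> {d. isl d \<noteq> isl c}" by auto
  then have "(\<Sum>d\<in>UNIV - {c}. jump_vec X c d a) = off_block X a + cross X a"
    unfolding sum_jump_vec_cross[OF assms, symmetric] sum_jump_vec_off_block[OF assms, symmetric]
    by (simp only:) (intro sum.union_disjoint, auto)
  then have "(\<Sum>d\<in>UNIV - {c}. mass (jump_vec X c d a)) = mass (off_block X a + cross X a)"
    by (simp add: linear_sum[OF lin, symmetric])
  moreover have "mass (block_gen X a) + mass (off_block X a + cross X a) = 0"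
  proof -
    have "mass (block_gen X a) + mass (off_block X a + cross X a) = mass (block_gen X a + off_block X a + cross X a)"
      by (simp add: linear_add[OF lin])
    also have "block_gen X a + off_block X a = (fst a v* Cp X, snd a v* Cm X)"
      by (simp add: block_gen_def off_block_def bounded_bilinear.diff_right[OF vm_bilinear])
    also have "mass ((fst a v* Cp X, snd a v* Cm X) + cross X a)
       = fst a \<bullet> (Cp X *v vec 1 + Dpm X *v vec 1) + snd a \<bullet> (Cm X *v vec 1 + Dmp X *v vec 1)"
      by (simp add: cross_def mass_inner inner_add_left inner_add_right dot_lmul_matrix)
    also have "\<dots> = 0" using valid by (simp add: rap_data_valid_def)
    finally show ?thesis .
  qed
  ultimately show ?thesis by simp
qed

lemma mass_block_flow_deriv: assumes "a \<in> cell X c"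
  shows "((\<lambda>s. mass (block_flow X s a)) has_real_derivative - (\<Sum>d\<in>UNIV - {c}. mass (jump_flow c d a s))) (at s within S)"
proof -
  have "((\<lambda>s. mass (block_flow X s a)) has_vector_derivative mass (block_gen X (block_flow X s a))) (at s within S)"
    by (intro bounded_linear.has_vector_derivative[OF bounded_linear_mass] block_flow_has_vector_derivative)
  then show ?thesis
    unfolding mass_block_gen[OF in_block_block_flow[OF cell_in_block[OF assms]]] jump_flow_def[symmetric]
    by (simp add: has_real_derivative_iff_has_vector_derivative)
qed

lemma continuous_on_jump_flow: "continuous_on S (jump_flow c d a)"
  unfolding jump_flow_def
  by (intro bounded_linear.continuous_on[OF bounded_linear_jump_vec] continuous_on_block_flow)

text \<open>The total intensity is the logarithmic derivative of the mass of the block flow. Hence the exponential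
  factor in the law of the first jump cancels against the normalisation of the orbit.\<close>

lemma exp_total_intensity: assumes a: "a \<in> cell X c" and s: "0 \<le> s"
  shows "exp (- (LBINT u:{0..s}. total_intensity X c (flow X u a))) = mass (block_flow X s a)"
proof -
  let ?m = "\<lambda>s. mass (block_flow X s a)"
  have st: "a \<in> states X" using a states_cell by auto
  have pos: "0 < ?m u" if "0 \<le> u" for u using mass_block_flow_pos[OF st that] .
  have tot: "total_intensity X c (flow X u a) = (\<Sum>d\<in>UNIV - {c}. mass (jump_flow c d a u)) / ?m u" if "0 \<le> u" for u
    using pos[OF that] by (simp add: total_intensity_def mass_jump_flow[OF a that] sum_divide_distrib)
  have cont: "continuous_on {0..s} (\<lambda>u. (\<Sum>d\<in>UNIV - {c}. mass (jump_flow c d a u)) / ?m u)"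
    using pos by (intro continuous_intros bounded_linear.continuous_on[OF bounded_linear_mass] continuous_on_jump_flow continuous_on_block_flow)
       (force simp: less_le)
  have "(LBINT u:{0..s}. total_intensity X c (flow X u a))
     = (\<integral>u. indicator {0..s} u *\<^sub>R ((\<Sum>d\<in>UNIV - {c}. mass (jump_flow c d a u)) / ?m u) \<partial>lborel)"
    unfolding set_lebesgue_integral_def by (intro Bochner_Integration.integral_cong) (auto simp: tot indicator_def)
  also have "\<dots> = - ln (?m s) - (- ln (?m 0))"
  proof (rule integral_FTC_atLeastAtMost[OF s _ cont])
    fix u assume "0 \<le> u" "u \<le> s"
    have "((\<lambda>u. - ln (?m u)) has_real_derivative - (inverse (?m u) * - (\<Sum>d\<in>UNIV - {c}. mass (jump_flow c d a u)))) (at u within {0..s})"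
      by (intro DERIV_minus DERIV_chain2[OF _ mass_block_flow_deriv[OF a]] DERIV_ln pos \<open>0 \<le> u\<close>)
    then show "((\<lambda>u. - ln (?m u)) has_vector_derivative (\<Sum>d\<in>UNIV - {c}. mass (jump_flow c d a u)) / ?m u) (at u within {0..s})"
      by (simp add: has_real_derivative_iff_has_vector_derivative divide_inverse mult.commute)
  qed
  finally show ?thesis using pos[OF s] mass_states[OF st] by simp
qed

lemma bounded_states: "bounded (states X)"
proof -
  have "bounded (cell X c)" for c
  proof (cases c)
    case (Inl i)
    have "cell X (Inl i) = Zp X i \<times> {0}" by auto
    then show ?thesis using orbit_set_p[of i] Inl by (simp add: orbit_set_def bounded_Times)
  next
    case (Inr i)
    have "cell X (Inr i) = {0} \<times> Zm X i" by auto
    then show ?thesis using orbit_set_m[of i] Inr by (simp add: orbit_set_def bounded_Times)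
  qed
  moreover have "states X = (\<Union>c. cell X c)" using states_cell by auto
  ultimately show ?thesis by (metis bounded_UN finite_class.finite_UNIV)
qed

lemma span_Zp: "span (\<Union>i. Zp X i) = UNIV" and span_Zm: "span (\<Union>j. Zm X j) = UNIV"
  using valid by (auto intro!: span_orbit_sets simp: rap_data_valid_def)

end

section \<open>Paths and their first change of side\<close>

definition switch_time :: "('p::finite, 'm::finite, 'i, 'j) rap_data \<Rightarrow> ('p, 'm) path \<Rightarrow> real" where
  "switch_time X \<omega> = Inf {t. 0 < t \<and> (\<omega> t \<in> Zplus X \<longleftrightarrow> \<omega> 0 \<notin> Zplus X)}"

lemma filtermap_at_left_add: "filtermap (\<lambda>x. x + d) (at_left a) = at_left (a + d)" for a d :: real
proof -
  have "filtermap (\<lambda>x. - x) (filtermap (\<lambda>x. x - d) (at_right (- a))) = filtermap (\<lambda>x. - x) (at_right (- a - d))"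
    by (simp add: filtermap_at_right_shift)
  moreover have "filtermap (\<lambda>x. x + d) (at_left a) = filtermap (\<lambda>x. - x) (filtermap (\<lambda>x. x - d) (at_right (- a)))"
    unfolding at_left_minus[of a] filtermap_filtermap by (simp add: ac_simps)
  ultimately show ?thesis by (simp add: at_left_minus[of "a + d"])
qed

lemma filtermap_at_right_add: "filtermap (\<lambda>x. x + d) (at_right a) = at_right (a + d)" for a d :: real
  using filtermap_at_right_shift[of "-d" a] by simp

lemma shift_apply [simp]: "0 \<le> t \<Longrightarrow> shift s \<omega> t = \<omega> (t + s)"
  by (simp add: shift_def)

lemma shift_shift: "0 \<le> r \<Longrightarrow> shift r (shift s \<omega>) = shift (s + r) \<omega>"
  by (auto simp: shift_def fun_eq_iff restrict_def ac_simps)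

context rap
begin

lemma path_states: "\<omega> \<in> Omega X \<Longrightarrow> 0 \<le> t \<Longrightarrow> \<omega> t \<in> states X"
  by (auto simp: Omega_def canonical_paths_def)

lemma path_flow:
  "\<omega> \<in> Omega X \<Longrightarrow> 0 \<le> t \<Longrightarrow> 0 \<le> r \<Longrightarrow> jumps \<omega> \<inter> {t<..t + r} = {} \<Longrightarrow> \<omega> (t + r) = flow X r (\<omega> t)"
  by (auto simp: Omega_def canonical_paths_def)

lemma path_cadlag: "\<omega> \<in> Omega X \<Longrightarrow> cadlag \<omega>"
  by (auto simp: Omega_def canonical_paths_def)

lemma path_finite_jumps: "\<omega> \<in> Omega X \<Longrightarrow> finite (jumps \<omega> \<inter> {0..t})"
  by (auto simp: Omega_def)

lemma path_leaves_side: assumes "\<omega> \<in> Omega X" "0 \<le> t" shows "\<exists>s\<ge>t. \<omega> s \<notin> side X b"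
  using assms by (cases b) (auto simp: Omega_def side_def)

lemma path_level_inj: "\<omega> \<in> Omega X \<Longrightarrow> s \<in> jumps \<omega> \<Longrightarrow> t \<in> jumps \<omega> \<Longrightarrow> level X \<omega> s = level X \<omega> t \<Longrightarrow> s = t"
  by (auto simp: Omega_def dest: inj_onD)

lemma side_compl: "\<omega> \<in> Omega X \<Longrightarrow> 0 \<le> t \<Longrightarrow> \<omega> t \<in> side X (\<not> b) \<longleftrightarrow> \<omega> t \<notin> side X b"
  by (rule side_not_iff[OF path_states])

lemma quiet_before: assumes "\<omega> \<in> Omega X" "0 < t"
  shows "\<exists>r. 0 \<le> r \<and> r < t \<and> jumps \<omega> \<inter> {r<..<t} = {}"
proof -
  let ?J = "insert 0 (jumps \<omega> \<inter> {0..<t})"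
  have "finite (jumps \<omega> \<inter> {0..<t})"
    by (rule finite_subset[OF _ path_finite_jumps[OF assms(1), of t]]) auto
  then have f: "finite ?J" by simp
  have "Max ?J \<in> ?J" using f by (intro Max_in) auto
  moreover have "jumps \<omega> \<inter> {Max ?J<..<t} = {}"
  proof (rule ccontr)
    assume "\<not> ?thesis"
    then obtain u where u: "u \<in> jumps \<omega>" "Max ?J < u" "u < t" by auto
    with calculation assms have "u \<in> ?J" by (auto simp: jumps_def)
    with Max_ge[OF f] u show False by force
  qed
  ultimately show ?thesis using assms by (intro exI[of _ "Max ?J"]) auto
qed

lemma quiet_after: assumes "\<omega> \<in> Omega X" "0 \<le> t"
  shows "\<exists>u>t. jumps \<omega> \<inter> {t<..u} = {}"
proof -
  let ?J = "insert (t + 1) (jumps \<omega> \<inter> {t<..t+1})"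
  have f: "finite ?J"
    using finite_subset[OF Int_mono[OF subset_refl, of "{t<..t+1}" "{0..t+1}" "jumps \<omega>"] path_finite_jumps[OF assms(1), of "t + 1"]] assms(2)
    by (simp add: subset_iff)
  have M: "Min ?J \<in> ?J" using f by (intro Min_in) auto
  then have Mt: "Min ?J > t" "Min ?J \<le> t + 1" by auto
  have "jumps \<omega> \<inter> {t<..(t + Min ?J) / 2} = {}"
  proof (rule ccontr)
    assume "\<not> ?thesis"
    then obtain u where u: "u \<in> jumps \<omega>" "t < u" "u \<le> (t + Min ?J) / 2" by auto
    then have "u < Min ?J" "u \<le> t + 1" using Mt by (auto simp: field_simps)
    with u have "u \<in> ?J" by auto
    with Min_le[OF f] \<open>u < Min ?J\<close> show False by force
  qed
  then show ?thesis using Mt by (intro exI[of _ "(t + Min ?J) / 2"]) auto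
qed

lemma tendsto_left_flow: assumes \<omega>: "\<omega> \<in> Omega X" and r: "0 \<le> r" "r < t" "jumps \<omega> \<inter> {r<..<t} = {}"
  shows "(\<omega> \<longlongrightarrow> flow X (t - r) (\<omega> r)) (at_left t)"
proof -
  have "continuous (at (t - r) within {0..}) (\<lambda>u. flow X u (\<omega> r))"
    using continuous_on_flow[OF path_states[OF \<omega> r(1)]] r by (auto simp: continuous_on_eq_continuous_within)
  then have "continuous (at (t - r)) (\<lambda>u. flow X u (\<omega> r))"
    using r at_within_interior[of "t - r" "{0..}"] by simp
  then have "((\<lambda>u. flow X u (\<omega> r)) \<longlongrightarrow> flow X (t - r) (\<omega> r)) (at (t - r))"
    by (simp add: continuous_within)
  then have "((\<lambda>u. flow X u (\<omega> r)) \<longlongrightarrow> flow X (t - r) (\<omega> r)) (at_left (t - r))"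
    by (rule filterlim_mono) (auto intro: at_le)
  then have "((\<lambda>u. flow X (u - r) (\<omega> r)) \<longlongrightarrow> flow X (t - r) (\<omega> r)) (at_left t)"
    using filtermap_at_left_add[of "-r" t] filtermap_filtermap[of "\<lambda>u. flow X u (\<omega> r)" "\<lambda>x. x - r" "at_left t"]
    by (simp add: filterlim_def)
  moreover have "eventually (\<lambda>u. flow X (u - r) (\<omega> r) = \<omega> u) (at_left t)"
    unfolding eventually_at_left[OF r(2)]
  proof (intro exI[of _ r] conjI r allI impI)
    fix y assume "r < y" "y < t"
    then show "flow X (y - r) (\<omega> r) = \<omega> y"
      using path_flow[OF \<omega> r(1), of "y - r"] r(3) by (force simp: disjoint_iff)
  qed
  ultimately show ?thesis by (rule Lim_transform_eventually)
qed

lemma left_lim_flow: assumes \<omega>: "\<omega> \<in> Omega X" and r: "0 \<le> r" "r < t" "jumps \<omega> \<inter> {r<..<t} = {}"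
  shows "left_lim \<omega> t = flow X (t - r) (\<omega> r)"
  using tendsto_Lim[OF _ tendsto_left_flow[OF assms]] r by (simp add: left_lim_def)

lemma tendsto_left_lim: assumes \<omega>: "\<omega> \<in> Omega X" and t: "0 < t"
  shows "(\<omega> \<longlongrightarrow> left_lim \<omega> t) (at_left t)"
  using quiet_before[OF assms] left_lim_flow[OF \<omega>] tendsto_left_flow[OF \<omega>] by metis

lemma side_quiet: assumes \<omega>: "\<omega> \<in> Omega X" and "0 \<le> r" "jumps \<omega> \<inter> {r<..u} = {}" "\<omega> r \<in> side X b" "r \<le> u"
  shows "\<omega> u \<in> side X b"
  using path_flow[OF \<omega>, of r "u - r"] flow_side[of "\<omega> r" b "u - r"] assms by auto

lemma left_lim_side: assumes \<omega>: "\<omega> \<in> Omega X" and s: "0 \<le> s" "s < t" "\<And>u. s \<le> u \<Longrightarrow> u < t \<Longrightarrow> \<omega> u \<in> side X b"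
  shows "left_lim \<omega> t \<in> side X b"
proof -
  obtain r where r: "0 \<le> r" "r < t" "jumps \<omega> \<inter> {r<..<t} = {}" using quiet_before[OF \<omega>, of t] s by auto
  define m where "m = max r s"
  have m: "0 \<le> m" "m < t" "jumps \<omega> \<inter> {m<..<t} = {}" "s \<le> m" using r s by (auto simp: m_def disjoint_iff)
  show ?thesis unfolding left_lim_flow[OF \<omega> m(1-3)] using m s by (intro flow_side) auto
qed

lemma switch_is_jump: assumes \<omega>: "\<omega> \<in> Omega X" and s: "0 \<le> s" "s < t" "\<And>u. s \<le> u \<Longrightarrow> u < t \<Longrightarrow> \<omega> u \<in> side X b"
   "\<omega> t \<notin> side X b"
  shows "t \<in> jumps \<omega>"
  using left_lim_side[OF \<omega> s(1-3)] s by (auto simp: jumps_def)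

lemma side_after: assumes \<omega>: "\<omega> \<in> Omega X" and t: "0 \<le> t" "\<omega> t \<in> side X b"
  shows "\<exists>r>t. \<forall>u\<in>{t..r}. \<omega> u \<in> side X b"
proof -
  obtain r where r: "r > t" "jumps \<omega> \<inter> {t<..r} = {}" using quiet_after[OF \<omega> t(1)] by auto
  then show ?thesis using t
    by (intro exI[of _ r]) (auto intro!: side_quiet[OF \<omega> t(1)] simp: disjoint_iff)
qed

lemma switch_time:
  assumes \<omega>: "\<omega> \<in> Omega X" and b: "\<omega> 0 \<in> side X b"
  shows "0 < switch_time X \<omega>" "\<omega> (switch_time X \<omega>) \<in> side X (\<not> b)"
    "\<And>u. 0 \<le> u \<Longrightarrow> u < switch_time X \<omega> \<Longrightarrow> \<omega> u \<in> side X b"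
proof -
  let ?S = "{t. 0 < t \<and> \<omega> t \<notin> side X b}"
  have "\<omega> 0 \<in> Zplus X \<longleftrightarrow> b" using b side_not_iff[of "\<omega> 0" "\<not> b"] side_states[OF b] by (cases b) (auto simp: side_def)
  moreover have "\<omega> t \<in> Zplus X \<longleftrightarrow> \<omega> t \<in> side X b = b" if "0 < t" for t
    using side_compl[OF \<omega>, of t b] that by (cases b) (auto simp: side_def)
  ultimately have eq: "switch_time X \<omega> = Inf ?S"
    unfolding switch_time_def by (intro arg_cong[of _ _ Inf]) auto
  obtain s where "s \<ge> 0" "\<omega> s \<notin> side X b" using path_leaves_side[OF \<omega>, of 0] by auto
  then have ne: "?S \<noteq> {}" using b by (auto intro!: exI[of _ s]) (metis less_eq_real_def)
  have bd: "bdd_below ?S" by (rule bdd_belowI[of _ 0]) auto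
  obtain r where r: "0 < r" "\<forall>u\<in>{0..r}. \<omega> u \<in> side X b" using side_after[OF \<omega> _ b] by auto
  then have "r \<le> Inf ?S" using ne by (intro cInf_greatest) force+
  then show pos: "0 < switch_time X \<omega>" using r eq by simp
  show before: "\<omega> u \<in> side X b" if "0 \<le> u" "u < switch_time X \<omega>" for u
    using cInf_lower[OF _ bd, of u] that b unfolding eq by (cases "u = 0") force+
  show "\<omega> (switch_time X \<omega>) \<in> side X (\<not> b)"
  proof (rule ccontr)
    assume "\<not> ?thesis"
    then have "\<omega> (switch_time X \<omega>) \<in> side X b" using side_compl[OF \<omega>] pos by simp
    then obtain r where r: "r > switch_time X \<omega>" "\<forall>u\<in>{switch_time X \<omega>..r}. \<omega> u \<in> side X b"
      using side_after[OF \<omega> less_imp_le[OF pos]] by blast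
    have "r \<le> Inf ?S" using ne
    proof (rule cInf_greatest)
      fix x assume x: "x \<in> ?S"
      then have "switch_time X \<omega> \<le> x" using cInf_lower[OF _ bd] eq by simp
      with x r show "r \<le> x" by (metis (mono_tags, lifting) atLeastAtMost_iff linorder_le_cases mem_Collect_eq)
    qed
    with r(1) show False unfolding eq by linarith
  qed
qed

lemma switch_time_eqI:
  assumes \<omega>: "\<omega> \<in> Omega X" and t: "0 < t" "\<And>u. 0 \<le> u \<Longrightarrow> u < t \<Longrightarrow> \<omega> u \<in> side X b" "\<omega> t \<in> side X (\<not> b)"
  shows "switch_time X \<omega> = t"
proof -
  have b: "\<omega> 0 \<in> side X b" using t by simp
  note s = switch_time[OF \<omega> b]
  have ne: "\<omega> u \<in> side X b \<Longrightarrow> \<omega> u \<in> side X (\<not> b) \<Longrightarrow> False" for u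
    using side_not_iff side_states by blast
  show ?thesis
    using ne[of t] ne[of "switch_time X \<omega>"] s t by (metis less_eq_real_def linorder_neqE_linordered_idom)
qed

lemma switch_time_jump: assumes \<omega>: "\<omega> \<in> Omega X" shows "switch_time X \<omega> \<in> jumps \<omega>"
proof -
  obtain b where b: "\<omega> 0 \<in> side X b" using states_side[OF path_states[OF \<omega>, of 0]] by auto
  note s = switch_time[OF \<omega> b]
  show ?thesis using s side_compl[OF \<omega>, of "switch_time X \<omega>" b] by (intro switch_is_jump[OF \<omega>, of 0]) auto
qed

subsection \<open>The level process\<close>

lemma continuous_sgn_side: "continuous_on S sgn_side"
  unfolding sgn_side_def by (intro continuous_intros)

lemma countable_jumps: assumes "\<omega> \<in> Omega X" shows "countable (jumps \<omega>)"
proof -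
  have "jumps \<omega> = (\<Union>n. jumps \<omega> \<inter> {0..real n})" by (auto simp: jumps_def real_arch_simple)
  moreover have "countable (\<Union>n. jumps \<omega> \<inter> {0..real n})"
    using path_finite_jumps[OF assms] by (intro countable_UN) (auto intro: countable_finite)
  ultimately show ?thesis by simp
qed

lemma path_continuous: assumes \<omega>: "\<omega> \<in> Omega X" and "0 < t" "t \<notin> jumps \<omega>" shows "isCont \<omega> t"
proof -
  have "(\<omega> \<longlongrightarrow> \<omega> t) (at_left t)" using tendsto_left_lim[OF \<omega> assms(2)] assms by (auto simp: jumps_def)
  moreover have "(\<omega> \<longlongrightarrow> \<omega> t) (at_right t)" using path_cadlag[OF \<omega>] assms(2) by (auto simp: cadlag_def)
  ultimately show ?thesis by (simp add: isCont_def filterlim_at_split)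
qed

lemma borel_measurable_path_side: assumes \<omega>: "\<omega> \<in> Omega X"
  shows "(\<lambda>t. if 0 \<le> t then sgn_side (\<omega> t) else 0) \<in> borel_measurable borel" (is "?f \<in> _")
proof (rule borel_measurable_continuous_countable_exceptions[where X="insert 0 (jumps \<omega>)"])
  show "countable (insert 0 (jumps \<omega>))" using countable_jumps[OF \<omega>] by simp
  show "continuous_on (- insert 0 (jumps \<omega>)) ?f"
  proof (rule continuous_at_imp_continuous_on, rule ballI)
    fix t assume t: "t \<in> - insert 0 (jumps \<omega>)"
    show "isCont ?f t"
    proof (cases "t > 0")
      case True
      have "isCont sgn_side (\<omega> t)"
        using continuous_sgn_side[of UNIV] continuous_on_eq_continuous_at[OF open_UNIV, of sgn_side] by blast
      with path_continuous[OF \<omega> True] t have "isCont (\<lambda>t. sgn_side (\<omega> t)) t"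
        by (metis ComplD insertCI isCont_o2)
      moreover have "eventually (\<lambda>u. ?f u = sgn_side (\<omega> u)) (nhds t)"
        using eventually_nhds_in_open[of "{0<..}" t] True by (auto elim!: eventually_mono)
      ultimately show ?thesis by (simp add: isCont_cong)
    next
      case False
      with t have "t < 0" by auto
      then have "eventually (\<lambda>u. ?f u = 0) (nhds t)"
        using eventually_nhds_in_open[of "{..<0}" t] by (auto elim!: eventually_mono)
      then show ?thesis using isCont_cong[of ?f "\<lambda>_. 0" t] by simp
    qed
  qed
qed

lemma sgn_side_indicator: assumes "a \<in> states X"
  shows "indicator (Zplus X) a - indicator (Zminus X) a = sgn_side a"
proof -
  obtain b where b: "a \<in> side X b" using states_side[OF assms] by auto
  show ?thesis
    using b sgn_side[OF b] side_not_iff[OF assms, of b] by (cases b) (auto simp: side_def indicator_def)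
qed

lemma abs_sgn_side: "a \<in> states X \<Longrightarrow> \<bar>sgn_side a\<bar> = 1"
  using states_side[of a] sgn_side[of a] by (auto split: if_splits)

lemma set_integrable_path_side: assumes \<omega>: "\<omega> \<in> Omega X" and "0 \<le> a"
  shows "set_integrable lborel {a..b} (\<lambda>t. sgn_side (\<omega> t))"
proof -
  note [measurable] = borel_measurable_path_side[OF \<omega>]
  have "integrable lborel (\<lambda>t. indicator {a..b} t *\<^sub>R (if 0 \<le> t then sgn_side (\<omega> t) else 0))"
    by (rule integrableI_bounded_set[where A="{a..b}" and B=1])
       (auto simp: indicator_def abs_sgn_side path_states[OF \<omega>] emeasure_lborel_Icc_eq)
  then show ?thesis
    unfolding set_integrable_def using assms(2)
    by (subst Bochner_Integration.integrable_cong[OF refl, of _ _ "\<lambda>t. indicator {a..b} t *\<^sub>R (if 0 \<le> t then sgn_side (\<omega> t) else 0)"])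
      (auto simp: indicator_def)
qed

lemma level_eq_integral: assumes \<omega>: "\<omega> \<in> Omega X" and t: "0 \<le> t"
  shows "level X \<omega> t = integral {0..t} (\<lambda>s. sgn_side (\<omega> s))" "(\<lambda>s. sgn_side (\<omega> s)) integrable_on {a..b} \<or> a < 0"
proof -
  have "level X \<omega> t = (LBINT s:{0..t}. sgn_side (\<omega> s))"
    unfolding level_def set_lebesgue_integral_def
    by (intro Bochner_Integration.integral_cong refl)
       (simp add: indicator_def[of "{0..t}"] sgn_side_indicator path_states[OF \<omega>])
  then show "level X \<omega> t = integral {0..t} (\<lambda>s. sgn_side (\<omega> s))"
    using set_borel_integral_eq_integral(2)[OF set_integrable_path_side[OF \<omega>, of 0 t]] by simp
  show "(\<lambda>s. sgn_side (\<omega> s)) integrable_on {a..b} \<or> a < 0"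
    using set_borel_integral_eq_integral(1)[OF set_integrable_path_side[OF \<omega>, of a b]] by linarith
qed

lemma level_side: assumes \<omega>: "\<omega> \<in> Omega X" and t: "0 \<le> t" "\<And>u. 0 \<le> u \<Longrightarrow> u < t \<Longrightarrow> \<omega> u \<in> side X b"
  shows "level X \<omega> t = (if b then t else - t)"
proof -
  have "integral {0..t} (\<lambda>s. sgn_side (\<omega> s)) = integral {0..t} (\<lambda>s. if b then 1 else -1)"
    using t(1) by (intro integral_spike[of "{t}"]) (auto simp: sgn_side[OF t(2)])
  then show ?thesis using level_eq_integral(1)[OF \<omega> t(1)] t by simp
qed

lemma level_0 [simp]: "\<omega> \<in> Omega X \<Longrightarrow> level X \<omega> 0 = 0"
  using level_side[of \<omega> 0 True] by simp

lemma left_lim_shift: assumes \<omega>: "\<omega> \<in> Omega X" and "0 \<le> s" "0 < t"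
  shows "(shift s \<omega> \<longlongrightarrow> left_lim \<omega> (t + s)) (at_left t)" "left_lim (shift s \<omega>) t = left_lim \<omega> (t + s)"
proof -
  have "((\<lambda>u. \<omega> (u + s)) \<longlongrightarrow> left_lim \<omega> (t + s)) (at_left t)"
    using tendsto_left_lim[OF \<omega>, of "t + s"] assms filtermap_at_left_add[of s t] filtermap_filtermap[of \<omega> "\<lambda>x. x + s" "at_left t"]
    by (simp add: filterlim_def)
  moreover have "eventually (\<lambda>u. \<omega> (u + s) = shift s \<omega> u) (at_left t)"
    using eventually_at_left_real[OF assms(3)] by eventually_elim auto
  ultimately show *: "(shift s \<omega> \<longlongrightarrow> left_lim \<omega> (t + s)) (at_left t)"
    by (rule Lim_transform_eventually)
  then show "left_lim (shift s \<omega>) t = left_lim \<omega> (t + s)"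
    using assms(3) unfolding left_lim_def[of "shift s \<omega>"] by (auto intro: tendsto_Lim)
qed

lemma jumps_shift: assumes \<omega>: "\<omega> \<in> Omega X" and "0 \<le> s"
  shows "jumps (shift s \<omega>) = {t. 0 < t \<and> t + s \<in> jumps \<omega>}"
proof -
  have "t \<in> jumps (shift s \<omega>) \<longleftrightarrow> 0 < t \<and> t + s \<in> jumps \<omega>" for t
  proof (cases "0 < t")
    case True then show ?thesis using left_lim_shift(2)[OF \<omega> assms(2) True] assms by (simp add: jumps_def)
  next
    case False then show ?thesis by (auto simp: jumps_def left_lim_def)
  qed
  then show ?thesis by auto
qed

lemma level_add_integral: assumes \<omega>: "\<omega> \<in> Omega X" and "0 \<le> s" "0 \<le> t"
  shows "level X (shift s \<omega>) t = level X \<omega> (t + s) - level X \<omega> s"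
proof -
  note [measurable] = borel_measurable_path_side[OF \<omega>]
  have "level X (shift s \<omega>) t = (LBINT u:{0..t}. sgn_side (\<omega> (u + s)))"
    unfolding level_def set_lebesgue_integral_def using assms(2)
    by (intro Bochner_Integration.integral_cong refl)
       (simp add: indicator_def[of "{0..t}"] sgn_side_indicator path_states[OF \<omega>])
  also have "\<dots> = integral {0..t} (\<lambda>u. sgn_side (\<omega> (u + s)))"
  proof (rule set_borel_integral_eq_integral(2))
    have "integrable lborel (\<lambda>u. indicator {0..t} u *\<^sub>R (if 0 \<le> u + s then sgn_side (\<omega> (u + s)) else 0))"
      by (rule integrableI_bounded_set[where A="{0..t}" and B=1])
       (auto simp: indicator_def abs_sgn_side path_states[OF \<omega>] emeasure_lborel_Icc_eq)
    then show "set_integrable lborel {0..t} (\<lambda>u. sgn_side (\<omega> (u + s)))"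
      unfolding set_integrable_def using assms(2)
      by (subst Bochner_Integration.integrable_cong[OF refl, of _ _ "\<lambda>u. indicator {0..t} u *\<^sub>R (if 0 \<le> u + s then sgn_side (\<omega> (u + s)) else 0)"])
        (auto simp: indicator_def)
  qed
  also have "\<dots> = integral {s..t + s} (\<lambda>u. sgn_side (\<omega> u))"
    using integral_shift_real_ivl[of s s "t + s" "\<lambda>u. sgn_side (\<omega> u)"] by simp
  also have "\<dots> = integral {0..t + s} (\<lambda>u. sgn_side (\<omega> u)) - integral {0..s} (\<lambda>u. sgn_side (\<omega> u))"
    using Henstock_Kurzweil_Integration.integral_combine[of 0 s "t + s" "\<lambda>u. sgn_side (\<omega> u)"]
     level_eq_integral(2)[OF \<omega>, of 0 0 "t + s"] assms by simp
  finally show ?thesis using assms by (simp add: level_eq_integral(1)[OF \<omega>])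
qed

text \<open>The levels of the shifted path differ from those of the path by a constant, so jumps at different
  levels remain at different levels.\<close>

lemma shift_Omega: assumes \<omega>: "\<omega> \<in> Omega X" and s: "0 \<le> s" shows "shift s \<omega> \<in> Omega X"
proof -
  note js = jumps_shift[OF \<omega> s]
  have cad: "cadlag (shift s \<omega>)"
    unfolding cadlag_def
  proof (intro conjI allI impI)
    fix t :: real assume t: "0 \<le> t"
    have "(\<omega> \<longlongrightarrow> \<omega> (t + s)) (at_right (t + s))" using path_cadlag[OF \<omega>] t s by (auto simp: cadlag_def)
    then have "((\<lambda>u. \<omega> (u + s)) \<longlongrightarrow> \<omega> (t + s)) (at_right t)"
      using filtermap_at_right_add[of s t] filtermap_filtermap[of \<omega> "\<lambda>x. x + s" "at_right t"]
      by (simp add: filterlim_def)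
    moreover have "eventually (\<lambda>u. \<omega> (u + s) = shift s \<omega> u) (at_right t)"
      using eventually_at_right_less[of t] by eventually_elim (use t in auto)
    ultimately show "(shift s \<omega> \<longlongrightarrow> shift s \<omega> t) (at_right t)"
      using Lim_transform_eventually t by fastforce
  next
    fix t :: real assume "0 < t"
    then show "\<exists>l. (shift s \<omega> \<longlongrightarrow> l) (at_left t)" using left_lim_shift(1)[OF \<omega> s] by blast
  qed
  have fl: "shift s \<omega> (t + r) = flow X r (shift s \<omega> t)" if "0 \<le> t" "0 \<le> r" "jumps (shift s \<omega>) \<inter> {t<..t + r} = {}" for t r
  proof -
    have "jumps \<omega> \<inter> {t + s<..t + s + r} = {}"
    proof (rule ccontr)
      assume "\<not> ?thesis"
      then obtain u where "u \<in> jumps \<omega>" "t + s < u" "u \<le> t + s + r" by auto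
      then have "u - s \<in> jumps (shift s \<omega>) \<inter> {t<..t + r}" using that(1) by (auto simp: js)
      with that(3) show False by blast
    qed
    from path_flow[OF \<omega> _ _ this] that s show ?thesis by (simp add: ac_simps)
  qed
  have fin: "finite (jumps (shift s \<omega>) \<inter> {0..t})" for t
  proof (rule finite_imageD[where f="\<lambda>u. u + s"])
    show "finite ((\<lambda>u. u + s) ` (jumps (shift s \<omega>) \<inter> {0..t}))"
      using s by (intro finite_subset[OF _ path_finite_jumps[OF \<omega>, of "t + s"]]) (auto simp: js)
  qed auto
  have stay: "\<not> (\<exists>t\<ge>0. \<forall>u\<ge>t. shift s \<omega> u \<in> side X b)" for b
  proof
    assume "\<exists>t\<ge>0. \<forall>u\<ge>t. shift s \<omega> u \<in> side X b"
    then obtain t where t: "t \<ge> 0" "\<forall>u\<ge>t. shift s \<omega> u \<in> side X b" by auto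
    obtain u where "u \<ge> t + s" "\<omega> u \<notin> side X b" using path_leaves_side[OF \<omega>, of "t + s"] t s by auto
    moreover from this have "shift s \<omega> (u - s) \<in> side X b" using t by (auto simp del: shift_apply)
    ultimately show False using t by simp
  qed
  have inj: "inj_on (level X (shift s \<omega>)) (jumps (shift s \<omega>))"
  proof (rule inj_onI)
    fix x y assume xy: "x \<in> jumps (shift s \<omega>)" "y \<in> jumps (shift s \<omega>)" "level X (shift s \<omega>) x = level X (shift s \<omega>) y"
    then have "level X \<omega> (x + s) = level X \<omega> (y + s)"
      using level_add_integral[OF \<omega> s] by (auto simp: js)
    then show "x = y" using xy path_level_inj[OF \<omega>, of "x + s" "y + s"] by (auto simp: js)
  qed
  have ext: "shift s \<omega> \<in> {0..} \<rightarrow>\<^sub>E states X" using path_states[OF \<omega>] s by (auto simp: shift_def)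
  show ?thesis
    unfolding Omega_def canonical_paths_def
    using cad fl fin stay[of True] stay[of False] inj ext by (auto simp: side_def)
qed

lemma level_shift: assumes \<omega>: "\<omega> \<in> Omega X" and "0 \<le> s" "0 \<le> t"
  shows "level X \<omega> (s + t) = level X \<omega> s + level X (shift s \<omega>) t"
  using level_add_integral[OF assms] by (simp add: ac_simps)

lemma switch_time_shift: assumes \<omega>: "\<omega> \<in> Omega X" and u: "0 \<le> u" "u < switch_time X \<omega>"
  shows "switch_time X (shift u \<omega>) = switch_time X \<omega> - u"
proof -
  obtain b where b: "\<omega> 0 \<in> side X b" using states_side[OF path_states[OF \<omega>, of 0]] by auto
  note s = switch_time[OF \<omega> b]
  show ?thesis using s u by (intro switch_time_eqI[OF shift_Omega[OF \<omega> u(1)], of _ b]) auto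
qed

end

section \<open>Excursions and their heights\<close>

context rap
begin

abbreviation "sw \<equiv> switch_time X"

text \<open>A path that starts on the minus side and comes down by \<open>h\<close> in time \<open>t\<close>. The numbers \<open>K\<close> and \<open>n\<close> are the values
  of a counter at the start and at the end: passing a valley whose excursion has height \<open>k\<close> raises the
  counter from \<open>K\<close> to \<open>Suc (max K k)\<close>. The excursion at a valley is a run on the plus side followed by a
  descent of the same extent, with the counter started at 1.\<close>

inductive descent :: "('p, 'm) path \<Rightarrow> real \<Rightarrow> nat \<Rightarrow> nat \<Rightarrow> real \<Rightarrow> bool" where
  straight: "\<omega> 0 \<in> side X False \<Longrightarrow> 0 < h \<Longrightarrow> h \<le> sw \<omega> \<Longrightarrow> descent \<omega> h K K h"
| valley: "\<omega> 0 \<in> side X False \<Longrightarrow> sw \<omega> < h \<Longrightarrow> s = sw \<omega> + sw (shift (sw \<omega>) \<omega>) \<Longrightarrow>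
    descent (shift s \<omega>) (sw (shift (sw \<omega>) \<omega>)) 1 k t' \<Longrightarrow>
    descent (shift (s + t') \<omega>) (h - sw \<omega>) (Suc (max K k)) n t \<Longrightarrow>
    descent \<omega> h K n (s + t' + t)"

definition excursion :: "('p, 'm) path \<Rightarrow> nat \<Rightarrow> real \<Rightarrow> bool" where
  "excursion \<omega> k t \<longleftrightarrow> \<omega> 0 \<in> side X True \<and> descent (shift (sw \<omega>) \<omega>) (sw \<omega>) 1 k (t - sw \<omega>)"

lemma side_excl: "a \<in> side X b \<Longrightarrow> a \<in> side X (\<not> b) \<Longrightarrow> False"
  using side_not_iff side_states by blast

lemma descent_mono: "descent \<omega> h K n t \<Longrightarrow> K \<le> n"
  by (induction rule: descent.induct) auto

lemma descent_start: "descent \<omega> h K n t \<Longrightarrow> \<omega> 0 \<in> side X False"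
  by (induction rule: descent.induct) auto

lemma descent_unique: "descent \<omega> h K n t \<Longrightarrow> descent \<omega> h K n' t' \<Longrightarrow> n' = n \<and> t' = t"
proof (induction arbitrary: n' t' rule: descent.induct)
  case (straight \<omega> h K)
  from straight.prems straight.hyps show ?case by (cases rule: descent.cases) auto
next
  case (valley \<omega> h s k t1 K n t)
  from valley.prems show ?case
  proof (cases rule: descent.cases)
    case straight
    with valley.hyps show ?thesis by auto
  next
    case (valley s' k' t1' t2')
    with \<open>s = _\<close> have [simp]: "s' = s" by simp
    have "k' = k" "t1' = t1" using valley.IH(1)[of k' t1'] valley by auto
    then show ?thesis using valley.IH(2)[of n' t2'] valley by auto
  qed
qed

lemma excursion_unique: "excursion \<omega> k t \<Longrightarrow> excursion \<omega> k' t' \<Longrightarrow> k' = k \<and> t' = t"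
  unfolding excursion_def using descent_unique by force

lemma switch_shift: assumes "\<omega> \<in> Omega X" "\<omega> 0 \<in> side X b"
  shows "0 < sw \<omega>" "shift (sw \<omega>) \<omega> \<in> Omega X" "shift (sw \<omega>) \<omega> 0 \<in> side X (\<not> b)"
  using switch_time[OF assms] shift_Omega[OF assms(1)] by auto

lemma level_run: assumes "\<omega> \<in> Omega X" "\<omega> 0 \<in> side X b" "0 \<le> u" "u \<le> sw \<omega>"
  shows "level X \<omega> u = (if b then u else - u)"
  using assms switch_time(3)[OF assms(1,2)] by (intro level_side) auto

text \<open>A descent is the first passage through level \<open>- h\<close>. The last clause, that this level is reached along
  a run on the minus side, is what later excludes a jump at the moment when an excursion returns to
  the level of its valley.\<close>

lemma descent_level:
  assumes "descent \<omega> h K n t" "\<omega> \<in> Omega X"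
  shows "0 < h \<and> 0 < t \<and> level X \<omega> t = - h \<and> (\<forall>u. 0 \<le> u \<and> u < t \<longrightarrow> - h < level X \<omega> u) \<and>
     (\<exists>r\<ge>0. r < t \<and> (\<forall>u. r \<le> u \<and> u < t \<longrightarrow> \<omega> u \<in> side X False))"
  using assms
proof (induction rule: descent.induct)
  case (straight \<omega> h K)
  then show ?case using level_run[of \<omega> False] switch_time(3)[of \<omega> False]
    by (auto intro!: exI[of _ 0])
next
  case (valley \<omega> h s k t1 K n t)
  define s1 where "s1 = sw \<omega>"
  define \<omega>1 where "\<omega>1 = shift s1 \<omega>"
  define s2 where "s2 = sw \<omega>1"
  have s: "s = s1 + s2" using valley by (simp add: s1_def s2_def \<omega>1_def)
  have 1: "0 < s1" "\<omega>1 \<in> Omega X" "\<omega>1 0 \<in> side X True"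
    using switch_shift[OF valley.prems valley.hyps(1)] by (auto simp: s1_def \<omega>1_def)
  have 2: "0 < s2" using switch_shift[OF 1(2,3)] by (simp add: s2_def)
  have O2: "shift s \<omega> \<in> Omega X" using 1 2 s by (intro shift_Omega valley.prems) auto
  note IH1 = valley.IH(1)[OF O2, folded s1_def, folded \<omega>1_def, folded s2_def]
  then have t1: "0 < t1" by simp
  have O3: "shift (s + t1) \<omega> \<in> Omega X" using 1 2 s t1 by (intro shift_Omega valley.prems) auto
  note IH2 = valley.IH(2)[OF O3, folded s1_def]
  have h: "s1 < h" using valley.hyps by (simp add: s1_def)
  have L1: "level X \<omega> u = - u" if "0 \<le> u" "u \<le> s1" for u
    using level_run[OF valley.prems valley.hyps(1), of u] that by (simp add: s1_def)
  have L2: "level X \<omega> (s1 + u) = u - s1" if "0 \<le> u" "u \<le> s2" for u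
    using level_shift[OF valley.prems, of s1 u] level_run[OF 1(2,3), of u] that 1 L1[of s1] by (simp add: s2_def \<omega>1_def)
  have L3: "level X \<omega> (s + u) = s2 - s1 + level X (shift s \<omega>) u" if "0 \<le> u" for u
    using level_shift[OF valley.prems, of s u] L2[of s2] that 1 2 s by simp
  have L4: "level X \<omega> (s + t1 + u) = - s1 + level X (shift (s + t1) \<omega>) u" if "0 \<le> u" for u
    using level_shift[OF valley.prems, of "s + t1" u] L3[of t1] that 1 2 s t1 IH1 by simp
  have A: "- h < level X \<omega> u" if u: "0 \<le> u" "u < s + t1 + t" for u
  proof -
    consider "u \<le> s1" | "s1 < u" "u \<le> s" | "s < u" "u < s + t1" | "s + t1 \<le> u" using u by linarith
    then show ?thesis
    proof cases
      case 1 then show ?thesis using L1[of u] u h by simp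
    next
      case 2 then show ?thesis using L2[of "u - s1"] s h by simp
    next
      case 3
      then have "- s2 < level X (shift s \<omega>) (u - s)" using IH1 by auto
      with 3 L3[of "u - s"] h show ?thesis by simp
    next
      case 4
      then have "- (h - s1) < level X (shift (s + t1) \<omega>) (u - s - t1)" using IH2 u by auto
      with 4 L4[of "u - s - t1"] h show ?thesis by simp
    qed
  qed
  from IH2 obtain r where r: "r \<ge> 0" "r < t" "\<forall>u. r \<le> u \<and> u < t \<longrightarrow> shift (s + t1) \<omega> u \<in> side X False" by auto
  have "\<omega> u \<in> side X False" if "s + t1 + r \<le> u" "u < s + t1 + t" for u
    using r(3)[rule_format, of "u - s - t1"] r that by simp
  then have B: "\<exists>r\<ge>0. r < s + t1 + t \<and> (\<forall>u. r \<le> u \<and> u < s + t1 + t \<longrightarrow> \<omega> u \<in> side X False)"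
    using r 1 2 s t1 by (intro exI[of _ "s + t1 + r"]) auto
  show ?case using A B L4[of t] IH2 h 1 2 s t1 by simp
qed

lemma excursion_level:
  assumes "excursion \<omega> k t" "\<omega> \<in> Omega X"
  shows "0 < sw \<omega> \<and> sw \<omega> < t \<and> level X \<omega> t = 0 \<and> (\<forall>u. 0 < u \<and> u < t \<longrightarrow> 0 < level X \<omega> u) \<and>
     (\<exists>r\<ge>0. r < t \<and> (\<forall>u. r \<le> u \<and> u < t \<longrightarrow> \<omega> u \<in> side X False))"
proof -
  define s where "s = sw \<omega>"
  have o: "\<omega> 0 \<in> side X True" and d: "descent (shift s \<omega>) s 1 k (t - s)" using assms by (auto simp: excursion_def s_def)
  have 1: "0 < s" "shift s \<omega> \<in> Omega X" using switch_shift[OF assms(2) o] by (auto simp: s_def)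
  note D = descent_level[OF d 1(2)]
  have L1: "level X \<omega> u = u" if "0 \<le> u" "u \<le> s" for u
    using level_run[OF assms(2) o, of u] that by (simp add: s_def)
  have L2: "level X \<omega> u = s + level X (shift s \<omega>) (u - s)" if "s \<le> u" for u
    using level_shift[OF assms(2), of s "u - s"] L1[of s] that 1 by simp
  have A: "0 < level X \<omega> u" if u: "0 < u" "u < t" for u
  proof (cases "u \<le> s")
    case True then show ?thesis using L1[of u] u by simp
  next
    case False then show ?thesis using L2[of u] u D by (auto dest!: spec[of _ "u - s"])
  qed
  from D obtain r where r: "r \<ge> 0" "r < t - s" "\<forall>u. r \<le> u \<and> u < t - s \<longrightarrow> shift s \<omega> u \<in> side X False" by auto
  have "\<omega> u \<in> side X False" if "s + r \<le> u" "u < t" for u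
    using r(3)[rule_format, of "u - s"] r that by simp
  then have B: "\<exists>r\<ge>0. r < t \<and> (\<forall>u. r \<le> u \<and> u < t \<longrightarrow> \<omega> u \<in> side X False)"
    using r 1 by (intro exI[of _ "s + r"]) auto
  show ?thesis using A B 1 D L2[of t] by (simp flip: s_def)
qed

lemma excursion_tau_minus: assumes "excursion \<omega> k t" "\<omega> \<in> Omega X"
  shows "tau_minus X \<omega> = t" "\<omega> \<in> Omega_minus X"
proof -
  note E = excursion_level[OF assms]
  have t: "t \<in> return_times X \<omega>" using E by (auto simp: return_times_def)
  moreover have "t \<le> u" if "u \<in> return_times X \<omega>" for u
    using E that by (force simp: return_times_def not_le)
  ultimately show "tau_minus X \<omega> = t" unfolding tau_minus_def by (intro cInf_eq_minimum)
  show "\<omega> \<in> Omega_minus X" using assms t by (auto simp: Omega_minus_def excursion_def side_def)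
qed

lemma card_jumps_shift:
  assumes \<omega>: "\<omega> \<in> Omega X" and j: "j \<in> jumps \<omega>" "0 < j" "j \<le> s" "s \<le> T"
  shows "card (jumps (shift s \<omega>) \<inter> {0..T - s}) < card (jumps \<omega> \<inter> {0..T})"
proof -
  have "card (jumps (shift s \<omega>) \<inter> {0..T - s}) = card ((\<lambda>u. u + s) ` (jumps (shift s \<omega>) \<inter> {0..T - s}))"
    by (rule card_image[symmetric]) auto
  also have "\<dots> \<le> card (jumps \<omega> \<inter> {0..T} - {j})"
  proof (intro card_mono finite_Diff path_finite_jumps[OF \<omega>])
    have "0 \<le> s" using j by simp
    note js = jumps_shift[OF \<omega> this]
    show "(\<lambda>u. u + s) ` (jumps (shift s \<omega>) \<inter> {0..T - s}) \<subseteq> jumps \<omega> \<inter> {0..T} - {j}"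
    proof (rule image_subsetI)
      fix u assume u: "u \<in> jumps (shift s \<omega>) \<inter> {0..T - s}"
      then have "0 < u" "u + s \<in> jumps \<omega>" "u \<le> T - s" unfolding js by simp_all
      with j show "u + s \<in> jumps \<omega> \<inter> {0..T} - {j}" by simp
    qed
  qed
  also have "\<dots> < card (jumps \<omega> \<inter> {0..T})"
    using j by (intro card_Diff1_less path_finite_jumps[OF \<omega>] IntI) simp_all
  finally show ?thesis .
qed

text \<open>Induction on the number of jumps until \<open>T\<close>: the excursion at the first valley and the remaining descent
  both start after the switch into that valley, and so have fewer jumps left.\<close>

lemma descent_exists:
  assumes "\<omega> \<in> Omega X" "\<omega> 0 \<in> side X False" "0 < h" "0 \<le> T" "level X \<omega> T \<le> - h"
  shows "\<exists>n t. descent \<omega> h K n t"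
  using assms
proof (induction "card (jumps \<omega> \<inter> {0..T})" arbitrary: \<omega> h T K rule: less_induct)
  case less
  note \<omega> = less.prems(1) and m = less.prems(2)
  define s1 where "s1 = sw \<omega>"
  show ?case
  proof (cases "h \<le> s1")
    case True then show ?thesis using less.prems straight[of \<omega> h K] by (auto simp: s1_def)
  next
    case False
    define \<omega>1 where "\<omega>1 = shift s1 \<omega>"
    define s2 where "s2 = sw \<omega>1"
    define s where "s = s1 + s2"
    have 1: "0 < s1" "\<omega>1 \<in> Omega X" "\<omega>1 0 \<in> side X True"
      using switch_shift[OF \<omega> m] by (auto simp: s1_def \<omega>1_def)
    have 2: "0 < s2" "shift s \<omega> \<in> Omega X" "shift s \<omega> 0 \<in> side X False"
    proof -
      show 0: "0 < s2" using switch_shift[OF 1(2,3)] by (simp add: s2_def)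
      have "shift s \<omega> = shift s2 \<omega>1" using 0 by (simp add: s_def \<omega>1_def shift_shift)
      then show "shift s \<omega> \<in> Omega X" "shift s \<omega> 0 \<in> side X False"
        using switch_shift[OF 1(2,3)] by (simp_all add: s2_def)
    qed
    have jmp: "s1 \<in> jumps \<omega>" using switch_time_jump[OF \<omega>] by (simp add: s1_def)
    have L1: "level X \<omega> u = - u" if "0 \<le> u" "u \<le> s1" for u
      using level_run[OF \<omega> m, of u] that by (simp add: s1_def)
    have L2: "level X \<omega> (s1 + u) = u - s1" if "0 \<le> u" "u \<le> s2" for u
      using level_shift[OF \<omega>, of s1 u] level_run[OF 1(2,3), of u] that 1 L1[of s1] by (simp add: s2_def \<omega>1_def)
    have "s1 < T" using L1[of T] False less.prems by (cases "T \<le> s1") auto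
    then have sT: "s < T" using L2[of "T - s1"] False less.prems by (cases "T \<le> s") (auto simp: s_def)
    have L3: "level X \<omega> (s + u) = s2 - s1 + level X (shift s \<omega>) u" if "0 \<le> u" for u
      using level_shift[OF \<omega>, of s u] L2[of s2] that 1 2 by (simp add: s_def)
    have "\<exists>k t1. descent (shift s \<omega>) s2 1 k t1"
    proof (rule less.hyps[of "shift s \<omega>" "T - s"])
      show "card (jumps (shift s \<omega>) \<inter> {0..T - s}) < card (jumps \<omega> \<inter> {0..T})"
        using card_jumps_shift[OF \<omega> jmp, of s T] 1 2 sT by (auto simp: s_def)
      show "level X (shift s \<omega>) (T - s) \<le> - s2" using L3[of "T - s"] less.prems sT False by simp
    qed (use 2 sT in auto)
    then obtain k t1 where d1: "descent (shift s \<omega>) s2 1 k t1" by auto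
    note D1 = descent_level[OF d1 2(2)]
    have t1: "s + t1 \<le> T"
    proof (rule ccontr)
      assume "\<not> ?thesis"
      then have "- s2 < level X (shift s \<omega>) (T - s)" using D1 sT by auto
      then show False using L3[of "T - s"] less.prems sT False by simp
    qed
    define \<omega>3 where "\<omega>3 = shift (s + t1) \<omega>"
    have 3: "\<omega>3 \<in> Omega X" using 1 2 D1 by (auto simp: \<omega>3_def s_def intro!: shift_Omega \<omega>)
    have L4: "level X \<omega> (s + t1 + u) = - s1 + level X \<omega>3 u" if "0 \<le> u" for u
      using level_shift[OF \<omega>, of "s + t1" u] L3[of t1] that 1 2 D1 by (simp add: s_def \<omega>3_def)
    have "\<omega>3 0 \<in> side X False"
    proof (rule ccontr)
      \<comment> \<open>otherwise there are two jumps at the level \<open>- s1\<close>\<close>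
      assume *: "\<not> ?thesis"
      from D1 obtain r where r: "r \<ge> 0" "r < t1" "\<forall>u. r \<le> u \<and> u < t1 \<longrightarrow> shift s \<omega> u \<in> side X False" by auto
      have "t1 \<in> jumps (shift s \<omega>)"
        using r * by (intro switch_is_jump[OF 2(2) r(1,2), of False]) (auto simp: \<omega>3_def ac_simps)
      then have "s + t1 \<in> jumps \<omega>" using jumps_shift[OF \<omega>, of s] 1 2 by (simp add: s_def ac_simps)
      moreover have "level X \<omega> (s + t1) = level X \<omega> s1" using L4[of 0] L1[of s1] 1 3 by simp
      ultimately have "s + t1 = s1" using path_level_inj[OF \<omega> _ jmp] by simp
      then show False using 1 2 D1 by (simp add: s_def)
    qed
    moreover have "\<exists>n t. descent \<omega>3 (h - s1) (Suc (max K k)) n t" if "\<omega>3 0 \<in> side X False"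
    proof (rule less.hyps[of \<omega>3 "T - (s + t1)"])
      show "card (jumps \<omega>3 \<inter> {0..T - (s + t1)}) < card (jumps \<omega> \<inter> {0..T})"
        using card_jumps_shift[OF \<omega> jmp, of "s + t1" T] 1 2 D1 t1 unfolding \<omega>3_def by (auto simp: s_def)
      show "level X \<omega>3 (T - (s + t1)) \<le> - (h - s1)" using L4[of "T - (s + t1)"] less.prems t1 by simp
    qed (use 3 that t1 False in auto)
    ultimately obtain n t where "descent \<omega>3 (h - s1) (Suc (max K k)) n t" by auto
    then have "descent \<omega> h K n (s + t1 + t)"
      using False d1 by (intro valley[where \<omega>=\<omega>] m) (auto simp: s1_def s2_def s_def \<omega>1_def \<omega>3_def)
    then show ?thesis by auto
  qed
qed

lemma excursion_exists: assumes "\<omega> \<in> Omega_minus X" shows "\<exists>k t. excursion \<omega> k t"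
proof -
  have \<omega>: "\<omega> \<in> Omega X" and m: "\<omega> 0 \<in> side X True" using assms by (auto simp: Omega_minus_def side_def)
  obtain T where T: "0 < T" "level X \<omega> T \<le> 0" using assms by (auto simp: Omega_minus_def return_times_def)
  define s where "s = sw \<omega>"
  have 1: "0 < s" "shift s \<omega> \<in> Omega X" "shift s \<omega> 0 \<in> side X False" using switch_shift[OF \<omega> m] by (auto simp: s_def)
  have L1: "level X \<omega> u = u" if "0 \<le> u" "u \<le> s" for u
    using level_run[OF \<omega> m, of u] that by (simp add: s_def)
  have sT: "s < T" using L1[of T] T by (cases "T \<le> s") auto
  then have "level X (shift s \<omega>) (T - s) \<le> - s" using level_shift[OF \<omega>, of s "T - s"] L1[of s] 1 T by simp
  then obtain k t where "descent (shift s \<omega>) s 1 k t"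
    using descent_exists[OF 1(2,3,1), of "T - s" 1] sT by auto
  then have "excursion \<omega> k (s + t)" using m by (simp add: excursion_def s_def)
  then show ?thesis by auto
qed

text \<open>The rules of \<open>descent\<close> peel off the first valley. The sets \<open>Omega_prime\<close> split a path at its lowest
  peak, which is the last valley on the way down; so that one has to be isolated.\<close>

lemma descent_last_valley:
  assumes "descent \<omega> h K n t" "\<omega> \<in> Omega X"
  shows "(n = K \<and> h \<le> sw \<omega> \<and> t = h) \<or>
    (\<exists>u K1 t1 k t2. 0 < u \<and> u < h \<and> descent \<omega> u K K1 t1 \<and> excursion (shift t1 \<omega>) k t2 \<and>
       shift (t1 + t2) \<omega> 0 \<in> side X False \<and> h - u \<le> sw (shift (t1 + t2) \<omega>) \<and>
       t = t1 + t2 + (h - u) \<and> n = Suc (max K1 k))"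
  using assms
proof (induction rule: descent.induct)
  case (straight \<omega> h K)
  then show ?case by simp
next
  case (valley \<omega> h s k t1 K n t)
  define s1 where "s1 = sw \<omega>"
  define \<omega>1 where "\<omega>1 = shift s1 \<omega>"
  define s2 where "s2 = sw \<omega>1"
  have s: "s = s1 + s2" using valley by (simp add: s1_def s2_def \<omega>1_def)
  have 1: "0 < s1" "\<omega>1 \<in> Omega X" "\<omega>1 0 \<in> side X True"
    using switch_shift[OF valley.prems valley.hyps(1)] by (auto simp: s1_def \<omega>1_def)
  have 2: "0 < s2" using switch_shift[OF 1(2,3)] by (simp add: s2_def)
  have O2: "shift s \<omega> \<in> Omega X" using 1 2 s by (intro shift_Omega valley.prems) auto
  have t1: "0 < t1" using descent_level[OF valley.hyps(4) O2] by simp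
  define T where "T = s + t1"
  have T: "0 < T" using 1 2 s t1 by (simp add: T_def)
  have O3: "shift T \<omega> \<in> Omega X" using T by (intro shift_Omega valley.prems) auto
  have h: "s1 < h" using valley.hyps by (simp add: s1_def)
  have ex: "excursion \<omega>1 k (s2 + t1)"
    using valley.hyps(4) 1 2 by (simp add: excursion_def \<omega>1_def s1_def s2_def valley.hyps(3) shift_shift)
  from valley.IH(2)[folded T_def, OF O3] show ?case
  proof (elim disjE exE conjE)
    assume a: "n = Suc (max K k)" "h - sw \<omega> \<le> sw (shift T \<omega>)" "t = h - sw \<omega>"
    have d: "descent \<omega> s1 K K s1" using valley.hyps(1) 1 by (intro straight) (auto simp: s1_def)
    have m: "shift T \<omega> 0 \<in> side X False" using descent_start[OF valley.hyps(5)] by (simp add: T_def)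
    show ?thesis
      apply (rule disjI2)
      apply (rule exI[of _ s1], rule exI[of _ K], rule exI[of _ s1], rule exI[of _ k], rule exI[of _ "s2 + t1"])
      using a d m ex 1 h by (simp add: T_def s s1_def[symmetric] \<omega>1_def[symmetric] add.assoc)
  next
    fix u K1 t1' k' t2
    assume a: "0 < u" "u < h - sw \<omega>" "descent (shift T \<omega>) u (Suc (max K k)) K1 t1'"
      "excursion (shift t1' (shift T \<omega>)) k' t2" "shift (t1' + t2) (shift T \<omega>) 0 \<in> side X False"
      "h - sw \<omega> - u \<le> sw (shift (t1' + t2) (shift T \<omega>))" "t = t1' + t2 + (h - sw \<omega> - u)" "n = Suc (max K1 k')"
    have p: "0 < t1'" using descent_level[OF a(3) O3] by simp
    then have "shift t1' (shift T \<omega>) \<in> Omega X" using shift_Omega[OF O3] by simp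
    from excursion_level[OF a(4) this] have p2: "0 < t2" by simp
    have d: "descent \<omega> (s1 + u) K K1 (T + t1')"
      unfolding T_def
    proof (rule descent.valley[where \<omega>=\<omega>, OF valley.hyps(1) _ valley.hyps(3,4)])
      show "sw \<omega> < s1 + u" using a(1) by (simp add: s1_def)
      show "descent (shift (s + t1) \<omega>) (s1 + u - sw \<omega>) (Suc (max K k)) K1 t1'" using a(3) by (simp add: s1_def T_def)
    qed
    show ?thesis
      apply (rule disjI2)
      apply (rule exI[of _ "s1 + u"], rule exI[of _ K1], rule exI[of _ "T + t1'"], rule exI[of _ k'], rule exI[of _ t2])
      using a d 1 h p p2 by (simp add: s1_def[symmetric] T_def[symmetric] shift_shift add.assoc)
  qed
qed

lemma left_lim_switch: assumes "\<omega> \<in> Omega X" "\<omega> 0 \<in> side X b"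
  shows "left_lim \<omega> (sw \<omega>) \<in> side X b" "\<omega> (sw \<omega>) \<in> side X (\<not> b)"
  using switch_time[OF assms] by (auto intro!: left_lim_side[OF assms(1), of 0])

text \<open>Height 1 means that no valley is met on the way down, so that the path switches to the minus side only
  once before its return.\<close>

lemma Omega_one_iff: assumes \<omega>: "\<omega> \<in> Omega X"
  shows "\<omega> \<in> Omega_one X \<longleftrightarrow> (\<exists>t. excursion \<omega> 1 t)"
proof -
  let ?P = "{t\<in>{0..<tau_minus X \<omega>}. left_lim \<omega> t \<in> side X True \<and> \<omega> t \<in> side X False}"
  define s where "s = sw \<omega>"
  define \<omega>1 where "\<omega>1 = shift s \<omega>"
  have main: "card ?P = 1 \<longleftrightarrow> k = 1" if ex: "excursion \<omega> k t" for k t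
  proof -
    have m: "\<omega> 0 \<in> side X True" and d: "descent \<omega>1 s 1 k (t - s)" using ex by (auto simp: excursion_def s_def \<omega>1_def)
    have 1: "0 < s" "\<omega>1 \<in> Omega X" "\<omega>1 0 \<in> side X False" using switch_shift[OF \<omega> m] by (auto simp: s_def \<omega>1_def)
    note E = excursion_level[OF ex \<omega>, folded s_def]
    note tau = excursion_tau_minus(1)[OF ex \<omega>]
    have sP: "s \<in> ?P" using left_lim_switch[OF \<omega> m] E tau by (simp add: s_def)
    from descent_last_valley[OF d 1(2)] show ?thesis
    proof (elim disjE exE conjE)
      assume a: "k = 1" "s \<le> sw \<omega>1" "t - s = s"
      have "u = s" if u: "u \<in> ?P" for u
      proof (rule ccontr)
        assume "u \<noteq> s"
        then consider "u < s" | "s < u" by linarith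
        then show False
        proof cases
          case 1
          then have "\<omega> u \<in> side X True" using switch_time(3)[OF \<omega> m] u by (simp add: s_def)
          with u side_excl[of "\<omega> u" True] show False by simp
        next
          case 2
          have "left_lim \<omega> u \<in> side X False"
          proof (rule left_lim_side[OF \<omega> _ 2])
            fix v assume v: "s \<le> v" "v < u"
            then have "\<omega>1 (v - s) \<in> side X False" using switch_time(3)[OF 1(2,3), of "v - s"] a u tau by simp
            then show "\<omega> v \<in> side X False" using v by (simp add: \<omega>1_def)
          qed (use 1 E in simp)
          with u side_excl[of "left_lim \<omega> u" True] show False by simp
        qed
      qed
      then have "?P = {s}" using sP by blast
      with a show ?thesis by simp
    next
      fix u K1 t1 k' t2
      assume a: "0 < u" "u < s" "descent \<omega>1 u 1 K1 t1" "excursion (shift t1 \<omega>1) k' t2"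
        "t - s = t1 + t2 + (s - u)" "k = Suc (max K1 k')"
      have k: "k \<noteq> 1" using a descent_mono[OF a(3)] by simp
      have t1: "0 < t1" using descent_level[OF a(3) 1(2)] by simp
      define \<omega>2 where "\<omega>2 = shift (s + t1) \<omega>"
      have w2: "\<omega>2 \<in> Omega X" "shift t1 \<omega>1 = \<omega>2" using t1 1 \<omega> by (auto simp: \<omega>2_def \<omega>1_def shift_shift intro!: shift_Omega)
      have m2: "\<omega>2 0 \<in> side X True" using a w2 by (simp add: excursion_def)
      note E2 = excursion_level[OF a(4)[unfolded w2] w2(1)]
      have "s + t1 + sw \<omega>2 \<in> ?P"
        using left_lim_switch[OF w2(1) m2] E2 a tau 1 t1 left_lim_shift(2)[OF \<omega>, of "s + t1" "sw \<omega>2"]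
        by (simp add: \<omega>2_def ac_simps)
      moreover have "s + t1 + sw \<omega>2 \<noteq> s" using t1 E2 by simp
      ultimately have "card ?P \<noteq> 1"
      proof (intro notI)
        assume in_P: "s + t1 + sw \<omega>2 \<in> ?P" and ne: "s + t1 + sw \<omega>2 \<noteq> s" and "card ?P = 1"
        then obtain x where x: "?P = {x}" by (rule_tac card_1_singletonE)
        have "s = x" using sP unfolding x by simp
        moreover have "s + t1 + sw \<omega>2 = x" using in_P unfolding x by simp
        ultimately show False using ne by simp
      qed
      with k show ?thesis by simp
    qed
  qed
  show ?thesis
    using main excursion_exists[of \<omega>] excursion_tau_minus(2)[OF _ \<omega>] excursion_unique unfolding Omega_one_def side_def by auto
qed

text \<open>The lowest down-up peak is the last valley on the way down. Seen from the first passage through its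
  level, the path makes an excursion whose height is the counter just before this valley, and then
  the excursion that starts at the valley.\<close>

lemma excursion_split:
  assumes ex: "excursion \<omega> n t" and \<omega>: "\<omega> \<in> Omega X" and n: "n \<noteq> 1"
  shows "\<exists>k1 k2 u1 u2. excursion (shift (time_one X \<omega>) \<omega>) k1 u1 \<and> excursion (shift (time_two X \<omega>) \<omega>) k2 u2 \<and>
     shift (time_one X \<omega>) \<omega> \<in> Omega X \<and> shift (time_two X \<omega>) \<omega> \<in> Omega X \<and> n = Suc (max k1 k2)"
proof -
  define x where "x = sw \<omega>"
  define \<omega>1 where "\<omega>1 = shift x \<omega>"
  have m: "\<omega> 0 \<in> side X True" and d: "descent \<omega>1 x 1 n (t - x)" using ex by (auto simp: excursion_def x_def \<omega>1_def)
  have 1: "0 < x" "\<omega>1 \<in> Omega X" "\<omega>1 0 \<in> side X False" using switch_shift[OF \<omega> m] by (auto simp: x_def \<omega>1_def)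
  note tau = excursion_tau_minus(1)[OF ex \<omega>]
  from descent_last_valley[OF d 1(2)] n obtain u K1 t1 k t2 where
    a: "0 < u" "u < x" "descent \<omega>1 u 1 K1 t1" "excursion (shift t1 \<omega>1) k t2"
       "shift (t1 + t2) \<omega>1 0 \<in> side X False" "x - u \<le> sw (shift (t1 + t2) \<omega>1)"
        "t - x = t1 + t2 + (x - u)" "n = Suc (max K1 k)" by blast
  note D1 = descent_level[OF a(3) 1(2)]
  have t1: "0 < t1" using D1 by simp
  define \<omega>2 where "\<omega>2 = shift (x + t1) \<omega>"
  have w2: "\<omega>2 \<in> Omega X" "shift t1 \<omega>1 = \<omega>2" using t1 1 \<omega> by (auto simp: \<omega>2_def \<omega>1_def shift_shift intro!: shift_Omega)
  have m2: "\<omega>2 0 \<in> side X True" using a w2 by (simp add: excursion_def)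
  note ex2 = a(4)[unfolded w2]
  note E2 = excursion_level[OF ex2 w2(1)]
  define \<omega>3 where "\<omega>3 = shift (x + t1 + t2) \<omega>"
  have w3: "\<omega>3 \<in> Omega X" "shift (t1 + t2) \<omega>1 = \<omega>3" using t1 E2 1 \<omega> by (auto simp: \<omega>3_def \<omega>1_def shift_shift add.assoc intro!: shift_Omega)
  define p where "p = x - u"
  have p: "0 < p" "p < x" using a by (auto simp: p_def)
  have L1: "level X \<omega> v = v" if "0 \<le> v" "v \<le> x" for v
    using level_run[OF \<omega> m, of v] that by (simp add: x_def)
  have L2: "level X \<omega> (x + v) = x + level X \<omega>1 v" if "0 \<le> v" for v
    using level_shift[OF \<omega>, of x v] L1[of x] that 1 by (simp add: \<omega>1_def)
  have L3: "level X \<omega> (x + t1 + v) = p + level X \<omega>2 v" if "0 \<le> v" for v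
    using level_shift[OF \<omega>, of "x + t1" v] L2[of t1] that 1 D1 by (simp add: \<omega>2_def p_def)
  have lp: "lowest_peak X \<omega> = p"
    unfolding lowest_peak_def
  proof (rule cInf_eq_minimum)
    have "left_lim \<omega>1 t1 \<in> side X False"
    proof -
      from D1 obtain r where r: "r \<ge> 0" "r < t1" "\<forall>u. r \<le> u \<and> u < t1 \<longrightarrow> \<omega>1 u \<in> side X False" by auto
      then show ?thesis by (intro left_lim_side[OF 1(2)]) auto
    qed
    then have "left_lim \<omega> (x + t1) \<in> side X False" using left_lim_shift(2)[OF \<omega>, of x t1] 1 t1 by (simp add: \<omega>1_def ac_simps)
    moreover have "x + t1 < tau_minus X \<omega>" using tau a E2 by simp
    moreover have "level X \<omega> (x + t1) = p" using L3[of 0] w2 by simp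
    ultimately show "p \<in> {y. 0 \<le> y \<and> (\<exists>t\<in>{0..<tau_minus X \<omega>}. level X \<omega> t = y \<and> left_lim \<omega> t \<in> Zminus X \<and> \<omega> t \<in> Zplus X)}"
      using m2 p 1 t1 by (auto simp: side_def \<omega>2_def intro!: bexI[of _ "x + t1"])
  next
    fix y assume "y \<in> {y. 0 \<le> y \<and> (\<exists>t\<in>{0..<tau_minus X \<omega>}. level X \<omega> t = y \<and> left_lim \<omega> t \<in> Zminus X \<and> \<omega> t \<in> Zplus X)}"
    then obtain v where v: "0 \<le> v" "v < t" "level X \<omega> v = y" "left_lim \<omega> v \<in> side X False" "\<omega> v \<in> side X True"
      by (auto simp: tau side_def)
    consider "v = 0" | "0 < v" "v < x" | "v = x" | "x < v" "v < x + t1" | "x + t1 \<le> v" "v < x + t1 + t2" | "x + t1 + t2 \<le> v" using v(1) by linarith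
    then show "p \<le> y"
    proof cases
      case 1
      then have "left_lim \<omega> v = \<omega> 0" by (simp add: left_lim_def)
      then show ?thesis using v(4) m side_excl[of "\<omega> 0" True] by simp
    next
      case 2
      then have "left_lim \<omega> v \<in> side X True"
        using switch_time(3)[OF \<omega> m] by (intro left_lim_side[OF \<omega>, of 0]) (auto simp: x_def)
      then show ?thesis using v(4) side_excl[of "left_lim \<omega> v" True] by simp
    next
      case 3
      then have "\<omega> v \<in> side X False" using left_lim_switch[OF \<omega> m] by (simp add: x_def)
      then show ?thesis using v(5) side_excl[of "\<omega> v" True] by simp
    next
      case 4
      then have "- u < level X \<omega>1 (v - x)" using D1 by auto
      then show ?thesis using L2[of "v - x"] 4 v by (simp add: p_def)
    next
      case 5
      then have "0 \<le> level X \<omega>2 (v - x - t1)" using E2 level_0[OF w2(1)] by (cases "v = x + t1") (auto simp: less_imp_le)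
      then show ?thesis using L3[of "v - x - t1"] 5 v by simp
    next
      case 6
      have m3: "\<omega>3 0 \<in> side X False" using a(5) w3 by simp
      have "\<omega>3 (v - (x + t1 + t2)) \<in> side X False"
        using switch_time(3)[OF w3(1) m3, of "v - (x + t1 + t2)"] a(6,7) v 6 unfolding w3(2) by simp
      then have "\<omega> v \<in> side X False" using 6 by (simp add: \<omega>3_def)
      then show ?thesis using v(5) side_excl[of "\<omega> v" True] by simp
    qed
  qed
  have T1: "time_one X \<omega> = p"
    unfolding time_one_def lp
  proof (rule cInf_eq_minimum)
    fix v assume "v \<in> {t. 0 \<le> t \<and> level X \<omega> t = p}"
    then show "p \<le> v" using L1[of v] p by (cases "v < p") auto
  qed (use L1[of p] p in simp)
  have wp: "shift p \<omega> \<in> Omega X" using p \<omega> by (intro shift_Omega) auto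
  have swp: "sw (shift p \<omega>) = u" using switch_time_shift[OF \<omega>, of p] p by (simp add: x_def p_def)
  have exp: "excursion (shift p \<omega>) K1 (u + t1)"
    unfolding excursion_def swp
    using a(1,3) switch_time(3)[OF \<omega> m, of p] p by (simp add: shift_shift x_def[symmetric] \<omega>1_def[symmetric]) (simp add: p_def \<omega>1_def)
  have T2: "time_two X \<omega> = x + t1"
    unfolding time_two_def T1 using excursion_tau_minus(1)[OF exp wp] by (simp add: p_def)
  show ?thesis
    unfolding T1 T2 using exp ex2 wp w2(1) a(8) unfolding \<omega>2_def by blast
qed

text \<open>By \<open>excursion_split\<close> the height of an excursion obeys the recursion that defines \<open>Omega_prime\<close>.\<close>

lemma Omega_n_iff: assumes "\<omega> \<in> Omega X" "n \<ge> 1"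
  shows "\<omega> \<in> Omega_n X n \<longleftrightarrow> (\<exists>k t. k \<le> n \<and> excursion \<omega> k t)"
  using assms(2,1) unfolding Omega_n_def
proof (induction n arbitrary: \<omega> rule: dec_induct)
  case base
  have "1 \<le> k" if "excursion \<omega> k t" for k t using that descent_mono by (auto simp: excursion_def)
  then show ?case using Omega_one_iff[OF base] by (auto simp: le_Suc_eq)
next
  case (step n)
  then obtain n' where n': "n = Suc n'" by (cases n) auto
  show ?case
  proof
    assume *: "\<omega> \<in> Omega_prime X (Suc n) \<union> Omega_one X"
    show "\<exists>k t. k \<le> Suc n \<and> excursion \<omega> k t"
    proof (cases "\<omega> \<in> Omega_one X")
      case True
      then obtain t where "excursion \<omega> 1 t" using Omega_one_iff[OF step.prems] by blast
      moreover have "1 \<le> Suc n" by simp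
      ultimately show ?thesis by blast
    next
      case False
      with * have m: "\<omega> \<in> Omega_minus X" and
        s: "shift (time_one X \<omega>) \<omega> \<in> Omega_prime X n \<union> Omega_one X" "shift (time_two X \<omega>) \<omega> \<in> Omega_prime X n \<union> Omega_one X"
        by (auto simp: n')
      obtain k t where e: "excursion \<omega> k t" using excursion_exists[OF m] by auto
      have "k \<noteq> 1" using False Omega_one_iff[OF step.prems] e by auto
      from excursion_split[OF e step.prems this] obtain k1 k2 u1 u2 where
        k: "excursion (shift (time_one X \<omega>) \<omega>) k1 u1" "excursion (shift (time_two X \<omega>) \<omega>) k2 u2"
        "shift (time_one X \<omega>) \<omega> \<in> Omega X" "shift (time_two X \<omega>) \<omega> \<in> Omega X" "k = Suc (max k1 k2)" by blast
      have "k1 \<le> n" using step.IH[OF k(3)] s(1) excursion_unique[OF k(1)] by auto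
      moreover have "k2 \<le> n" using step.IH[OF k(4)] s(2) excursion_unique[OF k(2)] by auto
      ultimately have "k \<le> Suc n" using k(5) by simp
      then show ?thesis using e by blast
    qed
  next
    assume "\<exists>k t. k \<le> Suc n \<and> excursion \<omega> k t"
    then obtain k t where e: "k \<le> Suc n" "excursion \<omega> k t" by auto
    show "\<omega> \<in> Omega_prime X (Suc n) \<union> Omega_one X"
    proof (cases "k = 1")
      case True then show ?thesis using Omega_one_iff[OF step.prems] e by auto
    next
      case False
      from excursion_split[OF e(2) step.prems this] obtain k1 k2 u1 u2 where
        k: "excursion (shift (time_one X \<omega>) \<omega>) k1 u1" "excursion (shift (time_two X \<omega>) \<omega>) k2 u2"
        "shift (time_one X \<omega>) \<omega> \<in> Omega X" "shift (time_two X \<omega>) \<omega> \<in> Omega X" "k = Suc (max k1 k2)" by blast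
      have "\<omega> \<notin> Omega_one X" using Omega_one_iff[OF step.prems] False excursion_unique[OF e(2)] by auto
      moreover have "\<omega> \<in> Omega_minus X" using excursion_tau_minus(2)[OF e(2) step.prems] .
      moreover have "shift (time_one X \<omega>) \<omega> \<in> Omega_prime X n \<union> Omega_one X" using step.IH[OF k(3)] k(1,5) e(1) by auto
      moreover have "shift (time_two X \<omega>) \<omega> \<in> Omega_prime X n \<union> Omega_one X" using step.IH[OF k(4)] k(2,5) e(1) by auto
      ultimately show ?thesis by (simp add: n')
    qed
  qed
qed

end

section \<open>Measurability of path functionals\<close>

lemma sets_Collect_Ball_countable:
  assumes "\<And>i. i \<in> I \<Longrightarrow> {x \<in> space M. P i x} \<in> sets M" "countable I"
  shows "{x \<in> space M. \<forall>i\<in>I. P i x} \<in> sets M"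
proof (cases "I = {}")
  case False
  have "{x \<in> space M. \<forall>i\<in>I. P i x} = (\<Inter>i\<in>I. {x \<in> space M. P i x})" using False by auto
  also have "\<dots> \<in> sets M" using assms False by (intro sets.countable_INT') auto
  finally show ?thesis .
qed simp

context rap
begin

abbreviation "PA \<equiv> path_algebra X"

lemma space_PA [simp]: "space PA = Omega X"
  by (auto simp: path_algebra_def space_restrict_space space_PiM Omega_def canonical_paths_def PiE_def)

lemma measurable_eval: assumes "0 \<le> t" shows "(\<lambda>\<omega>. \<omega> t) \<in> borel_measurable PA"
  unfolding path_algebra_def
  using assms by (intro measurable_restrict_space1 measurable_component_singleton) simp

text \<open>By right-continuity the value of a path at time \<open>s\<close> is the limit of its values at the points of the
  grid of width \<open>1 / (n + 1)\<close> that come next after \<open>s\<close>, and of these there are only countably many.\<close>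

lemma measurable_eval_joint: assumes t: "0 \<le> t"
  shows "(\<lambda>(s, \<omega>). \<omega> (t + max 0 s)) \<in> borel_measurable (borel \<Otimes>\<^sub>M PA)"
proof (rule borel_measurable_LIMSEQ_metric[where f="\<lambda>n (s, \<omega>). \<omega> (t + (real (nat \<lfloor>(real n + 1) * max 0 s\<rfloor>) + 1) / (real n + 1))"])
  let ?q = "\<lambda>n i. t + (real i + 1) / (real n + 1)"
  let ?i = "\<lambda>n s. nat \<lfloor>(real n + 1) * max 0 s\<rfloor>"
  fix n :: nat
  have "(\<lambda>x. (\<lambda>i x. snd x (?q n i)) (?i n (fst x)) x) \<in> borel_measurable (borel \<Otimes>\<^sub>M PA)"
  proof (rule measurable_compose_countable[where f="\<lambda>i x. snd x (?q n i)" and g="\<lambda>x. ?i n (fst x)"])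
    fix i :: nat
    show "(\<lambda>x. snd x (?q n i)) \<in> borel_measurable (borel \<Otimes>\<^sub>M PA)"
      using measurable_compose[OF measurable_snd measurable_eval[of "?q n i"]] t by simp
  qed measurable
  then show "(\<lambda>(s, \<omega>). \<omega> (?q n (?i n s))) \<in> borel_measurable (borel \<Otimes>\<^sub>M PA)"
    by (simp add: case_prod_beta')
next
  let ?q = "\<lambda>n i. t + (real i + 1) / (real n + 1)"
  let ?i = "\<lambda>n s. nat \<lfloor>(real n + 1) * max 0 s\<rfloor>"
  fix x :: "real \<times> ('p, 'm) path" assume "x \<in> space (borel \<Otimes>\<^sub>M PA)"
  then obtain s \<omega> where x: "x = (s, \<omega>)" and \<omega>: "\<omega> \<in> Omega X" by (auto simp: space_pair_measure)
  define m where "m = max 0 s"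
  have m: "0 \<le> m" by (simp add: m_def)
  have b: "m < (real (?i n s) + 1) / (real n + 1)" "(real (?i n s) + 1) / (real n + 1) \<le> m + 1 / (real n + 1)" for n
  proof -
    have i: "real (?i n s) = of_int \<lfloor>(real n + 1) * m\<rfloor>" using m by (simp add: m_def)
    have "(real n + 1) * m < of_int \<lfloor>(real n + 1) * m\<rfloor> + 1" "of_int \<lfloor>(real n + 1) * m\<rfloor> \<le> (real n + 1) * m" by linarith+
    then have "m < (of_int \<lfloor>(real n + 1) * m\<rfloor> + 1) / (real n + 1)" "of_int \<lfloor>(real n + 1) * m\<rfloor> / (real n + 1) \<le> m"
      by (simp_all add: pos_less_divide_eq pos_divide_le_eq mult.commute)
    then show "m < (real (?i n s) + 1) / (real n + 1)" "(real (?i n s) + 1) / (real n + 1) \<le> m + 1 / (real n + 1)"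
      unfolding i by (simp_all add: add_divide_distrib)
  qed
  have "(\<lambda>n. 1 / (real n + 1)) \<longlonglongrightarrow> 0" using LIMSEQ_inverse_real_of_nat by (simp add: inverse_eq_divide ac_simps)
  then have u: "(\<lambda>n. m + 1 / (real n + 1)) \<longlonglongrightarrow> m" using tendsto_add[OF tendsto_const[of m]] by fastforce
  have "(\<lambda>n. (real (?i n s) + 1) / (real n + 1)) \<longlonglongrightarrow> m"
    by (rule tendsto_sandwich[OF _ _ tendsto_const u]) (use b in \<open>auto intro!: always_eventually less_imp_le\<close>)
  then have "(\<lambda>n. ?q n (?i n s)) \<longlonglongrightarrow> t + m" by (intro tendsto_intros)
  then have "filterlim (\<lambda>n. ?q n (?i n s)) (at_right (t + m)) sequentially"
    unfolding filterlim_at using b by (auto intro!: always_eventually)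
  moreover have "(\<omega> \<longlongrightarrow> \<omega> (t + m)) (at_right (t + m))" using path_cadlag[OF \<omega>] t m by (auto simp: cadlag_def)
  ultimately have "(\<lambda>n. \<omega> (?q n (?i n s))) \<longlonglongrightarrow> \<omega> (t + m)" by (rule filterlim_compose[rotated])
  then show "(\<lambda>n. case x of (s, \<omega>) \<Rightarrow> \<omega> (?q n (?i n s))) \<longlonglongrightarrow> (case x of (s, \<omega>) \<Rightarrow> \<omega> (t + max 0 s))"
    by (simp add: x m_def)
qed

lemma measurable_shift_joint: "(\<lambda>(s, \<omega>). shift (max 0 s) \<omega>) \<in> measurable (borel \<Otimes>\<^sub>M PA) PA"
proof -
  have 1: "(\<lambda>x. shift (max 0 (fst x)) (snd x)) \<in> measurable (borel \<Otimes>\<^sub>M PA) (PiM {0..} (\<lambda>_. borel))"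
  proof (rule measurable_PiM_single')
    fix t :: real assume t: "t \<in> {0..}"
    then show "(\<lambda>x. shift (max 0 (fst x)) (snd x) t) \<in> borel_measurable (borel \<Otimes>\<^sub>M PA)"
      using measurable_eval_joint[of t] by (simp add: case_prod_beta')
  next
    show "(\<lambda>x. shift (max 0 (fst x)) (snd x)) \<in> space (borel \<Otimes>\<^sub>M PA) \<rightarrow> (\<Pi>\<^sub>E i\<in>{0..}. space borel)"
      by (rule Pi_I) (simp add: shift_def)
  qed
  show ?thesis
    unfolding path_algebra_def[of X] case_prod_beta'
  proof (rule measurable_restrict_space2)
    show "(\<lambda>x. shift (max 0 (fst x)) (snd x)) \<in> space (borel \<Otimes>\<^sub>M restrict_space (PiM {0..} (\<lambda>_. borel)) (Omega X)) \<rightarrow> Omega X"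
      unfolding path_algebra_def[symmetric] space_pair_measure using shift_Omega by auto
  qed (use 1 in \<open>simp add: path_algebra_def[symmetric]\<close>)
qed

lemma measurable_shift:
  assumes [measurable]: "s \<in> borel_measurable M" "w \<in> measurable M PA" and "\<And>x. x \<in> space M \<Longrightarrow> 0 \<le> s x"
  shows "(\<lambda>x. shift (s x) (w x)) \<in> measurable M PA"
proof -
  have "(\<lambda>x. (s x, w x)) \<in> measurable M (borel \<Otimes>\<^sub>M PA)" by measurable
  from measurable_compose[OF this measurable_shift_joint]
  have "(\<lambda>x. shift (max 0 (s x)) (w x)) \<in> measurable M PA" by simp
  then show ?thesis using assms(3) by (subst measurable_cong[where g="\<lambda>x. shift (max 0 (s x)) (w x)"]) (auto simp: max_def)
qed

lemma measurable_sgn_side: "sgn_side \<in> borel_measurable borel"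
  using continuous_sgn_side by (rule borel_measurable_continuous_onI)

lemma path_side_iff: "\<omega> \<in> Omega X \<Longrightarrow> 0 \<le> t \<Longrightarrow> \<omega> t \<in> side X b \<longleftrightarrow> sgn_side (\<omega> t) = (if b then 1 else -1)"
  by (rule side_iff_sgn_side[OF path_states])

lemma measurable_in_side: assumes "w \<in> measurable M PA" "0 \<le> t"
  shows "Measurable.pred M (\<lambda>x. w x t \<in> side X b)"
proof -
  have [measurable]: "(\<lambda>x. sgn_side (w x t)) \<in> borel_measurable M"
    by (rule measurable_compose[OF measurable_compose[OF assms(1) measurable_eval[OF assms(2)]] measurable_sgn_side])
  have "w x \<in> Omega X" if "x \<in> space M" for x using measurable_space[OF assms(1) that] by simp
  then have "Measurable.pred M (\<lambda>x. w x t \<in> side X b) \<longleftrightarrow> Measurable.pred M (\<lambda>x. sgn_side (w x t) = (if b then 1 else -1))"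
    using assms(2) by (intro measurable_cong) (simp add: path_side_iff)
  then show ?thesis by simp
qed

text \<open>By right-continuity a violation of a closed condition before time \<open>t\<close> persists until some rational time.
  The time \<open>t\<close> itself has to be tested separately, as a violation may begin there.\<close>

definition test_times :: "real \<Rightarrow> real set" where
  "test_times t = insert t (\<rat> \<inter> {0..t})"

lemma countable_test_times: "countable (test_times t)"
  by (auto simp: test_times_def countable_rat intro: countable_Int1)

lemma switch_time_gr_iff: assumes \<omega>: "\<omega> \<in> Omega X" and t: "0 \<le> t"
  shows "t < sw \<omega> \<longleftrightarrow> (\<forall>u\<in>test_times t. sgn_side (\<omega> u) = sgn_side (\<omega> 0))"
    (is "_ \<longleftrightarrow> ?R")
proof
  obtain b where b: "\<omega> 0 \<in> side X b" using states_side[OF path_states[OF \<omega>, of 0]] by auto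
  assume a: "t < sw \<omega>"
  show ?R
  proof
    fix u assume "u \<in> test_times t"
    then have "\<omega> u \<in> side X b" using a t by (intro switch_time(3)[OF \<omega> b]) (auto simp: test_times_def)
    then show "sgn_side (\<omega> u) = sgn_side (\<omega> 0)" using sgn_side b by metis
  qed
next
  obtain b where b: "\<omega> 0 \<in> side X b" using states_side[OF path_states[OF \<omega>, of 0]] by auto
  note S = switch_time[OF \<omega> b]
  have eq: "\<omega> u \<in> side X (\<not> b) \<Longrightarrow> sgn_side (\<omega> u) \<noteq> sgn_side (\<omega> 0)" for u
    using sgn_side[OF b] sgn_side[of "\<omega> u" "\<not> b"] by (auto split: if_splits)
  assume R: ?R
  show "t < sw \<omega>"
  proof (rule ccontr)
    assume "\<not> ?thesis"
    moreover have "sw \<omega> \<noteq> t" using bspec[OF R, of t] eq[OF S(2)] by (metis insertI1 test_times_def)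
    ultimately have "sw \<omega> < t" by simp
    obtain r where r: "r > sw \<omega>" "\<forall>u\<in>{sw \<omega>..r}. \<omega> u \<in> side X (\<not> b)"
      using side_after[OF \<omega> less_imp_le[OF S(1)] S(2)] by blast
    obtain q where q: "q \<in> \<rat>" "sw \<omega> < q" "q < min r t"
      using Rats_dense_in_real[of "sw \<omega>" "min r t"] r(1) \<open>sw \<omega> < t\<close> by auto
    have "\<omega> q \<in> side X (\<not> b)" using q by (intro bspec[OF r(2)]) simp
    moreover have "q \<in> test_times t" using q S(1) by (simp add: test_times_def)
    ultimately show False using eq bspec[OF R] by blast
  qed
qed

lemma measurable_switch_time: "sw \<in> borel_measurable PA"
proof (rule borel_measurableI_greater)
  fix t :: real
  show "{\<omega> \<in> space PA. t < sw \<omega>} \<in> sets PA"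
  proof (cases "0 \<le> t")
    case True
    have ev: "(\<lambda>\<omega>. sgn_side (\<omega> u)) \<in> borel_measurable PA" if "0 \<le> u" for u
      by (rule measurable_compose[OF measurable_eval[OF that] measurable_sgn_side])
    have "{\<omega> \<in> space PA. \<forall>u\<in>test_times t. sgn_side (\<omega> u) = sgn_side (\<omega> 0)} \<in> sets PA"
    proof (rule sets_Collect_Ball_countable[OF _ countable_test_times])
      fix u assume "u \<in> test_times t"
      then have "0 \<le> u" using True by (auto simp: test_times_def)
      then show "{\<omega> \<in> space PA. sgn_side (\<omega> u) = sgn_side (\<omega> 0)} \<in> sets PA"
        by (rule borel_measurable_eq[OF ev ev[OF order_refl]])
    qed
    moreover have "{\<omega> \<in> space PA. t < sw \<omega>} = {\<omega> \<in> space PA. \<forall>u\<in>test_times t. sgn_side (\<omega> u) = sgn_side (\<omega> 0)}"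
      using switch_time_gr_iff[OF _ True] by auto
    ultimately show ?thesis by simp
  next
    case False
    have "t < sw \<omega>" if w: "\<omega> \<in> Omega X" for \<omega>
    proof -
      obtain b where b: "\<omega> 0 \<in> side X b" using states_side[OF path_states[OF w, of 0]] by auto
      show ?thesis using switch_time(1)[OF w b] False by linarith
    qed
    then have "{\<omega> \<in> space PA. t < sw \<omega>} = space PA" by auto
    then show ?thesis by (metis sets.top)
  qed
qed

lemma switch_time_pos: assumes "\<omega> \<in> Omega X" shows "0 < sw \<omega>"
proof -
  obtain b where "\<omega> 0 \<in> side X b" using states_side[OF path_states[OF assms, of 0]] by auto
  from switch_time(1)[OF assms this] show ?thesis .
qed

subsection \<open>The first jump\<close>

lemma first_jump: assumes \<omega>: "\<omega> \<in> Omega X"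
  shows "first_jump \<omega> \<in> jumps \<omega>" "0 < first_jump \<omega>" "\<And>u. u < first_jump \<omega> \<Longrightarrow> u \<notin> jumps \<omega>" "first_jump \<omega> \<le> sw \<omega>"
proof -
  define J where "J = jumps \<omega> \<inter> {0..sw \<omega>}"
  have J: "sw \<omega> \<in> J" using switch_time_jump[OF \<omega>] switch_time_pos[OF \<omega>] by (simp add: J_def)
  have fin: "finite J" unfolding J_def by (rule path_finite_jumps[OF \<omega>])
  have M: "Min J \<in> J" using fin J by (intro Min_in) auto
  have low: "Min J \<le> u" if "u \<in> jumps \<omega>" for u
  proof (cases "u \<le> sw \<omega>")
    case True then show ?thesis using that fin by (intro Min_le) (auto simp: J_def jumps_def)
  next
    case False then show ?thesis using Min_le[OF fin J] by simp
  qed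
  have eq: "first_jump \<omega> = Min J"
    unfolding first_jump_def using M low by (intro cInf_eq_minimum) (auto simp: J_def)
  show "first_jump \<omega> \<in> jumps \<omega>" using M eq by (simp add: J_def)
  then show "0 < first_jump \<omega>" by (auto simp: jumps_def left_lim_def split: if_splits)
  show "u \<notin> jumps \<omega>" if "u < first_jump \<omega>" for u using low that eq by force
  show "first_jump \<omega> \<le> sw \<omega>" using Min_le[OF fin J] eq by simp
qed

lemma before_first_jump: assumes \<omega>: "\<omega> \<in> Omega X" and u: "0 \<le> u" "u < first_jump \<omega>"
  shows "\<omega> u = flow X u (\<omega> 0)"
proof -
  have "jumps \<omega> \<inter> {0<..0 + u} = {}"
    unfolding disjoint_iff using u first_jump(3)[OF \<omega>] by (metis add_0 greaterThanAtMost_iff le_less_trans)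
  from path_flow[OF \<omega> order_refl u(1) this] show ?thesis by simp
qed

lemma first_jump_gr_iff: assumes \<omega>: "\<omega> \<in> Omega X" and t: "0 \<le> t"
  shows "t < first_jump \<omega> \<longleftrightarrow> (\<forall>u\<in>test_times t. \<omega> u = flow X u (\<omega> 0))"
    (is "_ \<longleftrightarrow> ?R")
proof
  assume a: "t < first_jump \<omega>"
  show ?R
  proof
    fix u assume "u \<in> test_times t"
    then show "\<omega> u = flow X u (\<omega> 0)" using a t by (intro before_first_jump[OF \<omega>]) (auto simp: test_times_def)
  qed
next
  assume R: ?R
  define j where "j = first_jump \<omega>"
  note F = first_jump[OF \<omega>, folded j_def]
  have "jumps \<omega> \<inter> {0<..<j} = {}" using F(3) unfolding disjoint_iff by (metis greaterThanLessThan_iff)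
  then have "left_lim \<omega> j = flow X j (\<omega> 0)"
    using left_lim_flow[OF \<omega> order_refl F(2)] by simp
  then have ne: "\<omega> j \<noteq> flow X j (\<omega> 0)" using F(1) unfolding jumps_def by auto
  show "t < first_jump \<omega>"
  proof (rule ccontr)
    assume "\<not> ?thesis"
    moreover have "j \<noteq> t" using bspec[OF R, of t] ne by (metis insertI1 test_times_def)
    ultimately have "j < t" by (simp add: j_def)
    have "continuous (at j within {0..}) (\<lambda>r. flow X r (\<omega> 0))"
      using continuous_on_flow[OF path_states[OF \<omega>, of 0]] F(2) by (auto simp: continuous_on_eq_continuous_within)
    then have "((\<lambda>r. flow X r (\<omega> 0)) \<longlongrightarrow> flow X j (\<omega> 0)) (at j within {0..})"
      by (simp add: continuous_within)
    then have "((\<lambda>r. flow X r (\<omega> 0)) \<longlongrightarrow> flow X j (\<omega> 0)) (at_right j)"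
      by (rule filterlim_mono) (use F(2) in \<open>auto intro!: at_le\<close>)
    moreover have "(\<omega> \<longlongrightarrow> \<omega> j) (at_right j)" using path_cadlag[OF \<omega>] F(2) by (auto simp: cadlag_def)
    ultimately have "((\<lambda>r. dist (\<omega> r) (flow X r (\<omega> 0))) \<longlongrightarrow> dist (\<omega> j) (flow X j (\<omega> 0))) (at_right j)"
      by (intro tendsto_dist)
    moreover have "0 < dist (\<omega> j) (flow X j (\<omega> 0))" using ne by (rule zero_less_dist_iff[THEN iffD2])
    ultimately have "eventually (\<lambda>r. 0 < dist (\<omega> r) (flow X r (\<omega> 0))) (at_right j)"
      by (rule order_tendstoD(1))
    then obtain r where r: "j < r" "\<And>u. j < u \<Longrightarrow> u < r \<Longrightarrow> 0 < dist (\<omega> u) (flow X u (\<omega> 0))"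
      unfolding eventually_at_right_field by blast
    obtain q where q: "q \<in> \<rat>" "j < q" "q < min r t"
      using Rats_dense_in_real[of j "min r t"] r(1) \<open>j < t\<close> by auto
    have "q \<in> test_times t" using q F(2) by (simp add: test_times_def)
    then have "\<omega> q = flow X q (\<omega> 0)" by (rule bspec[OF R])
    with r(2)[of q] q show False by (metis dist_self less_irrefl min_less_iff_conj)
  qed
qed

lemma measurable_flow: "flow X r \<in> borel_measurable borel"
proof -
  have [measurable]: "mass \<in> borel_measurable (borel :: ('p, 'm) state measure)"
    by (intro borel_measurable_continuous_onI linear_continuous_on bounded_linear_mass)
  have [measurable]: "block_flow X r \<in> borel_measurable borel"
    by (intro borel_measurable_continuous_onI linear_continuous_on bounded_linear_block_flow)
  have "flow X r = (\<lambda>a. block_flow X r a /\<^sub>R mass (block_flow X r a))"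
    by (auto simp: flow_normalise normalise_def)
  then show ?thesis by simp
qed

text \<open>Only the path up to \<open>t\<close> is inspected. The \<open>\<sigma>\<close>-algebra is left open so that the lemma applies to the
  algebra of all paths as well as to the past at \<open>t\<close>.\<close>

lemma first_jump_gr_sets:
  assumes sp: "space M = Omega X" and ev: "\<And>u. 0 \<le> u \<Longrightarrow> u \<le> t \<Longrightarrow> (\<lambda>\<omega>. \<omega> u) \<in> borel_measurable M" and t: "0 \<le> t"
  shows "{\<omega> \<in> Omega X. t < first_jump \<omega>} \<in> sets M"
proof -
  have "{\<omega> \<in> space M. \<forall>u\<in>test_times t. \<omega> u = flow X u (\<omega> 0)} \<in> sets M"
  proof (rule sets_Collect_Ball_countable[OF _ countable_test_times])
    fix u assume "u \<in> test_times t"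
    then have u: "0 \<le> u" "u \<le> t" using t by (auto simp: test_times_def)
    show "{\<omega> \<in> space M. \<omega> u = flow X u (\<omega> 0)} \<in> sets M"
    proof -
      have "(\<lambda>\<omega>. \<omega> u - flow X u (\<omega> 0)) \<in> borel_measurable M"
        by (rule borel_measurable_diff[OF ev[OF u] measurable_compose[OF ev[OF order_refl t] measurable_flow]])
      from measurable_sets[OF this, of "{0}"] have "(\<lambda>\<omega>. \<omega> u - flow X u (\<omega> 0)) -` {0} \<inter> space M \<in> sets M" by simp
      also have "(\<lambda>\<omega>. \<omega> u - flow X u (\<omega> 0)) -` {0} \<inter> space M = {\<omega> \<in> space M. \<omega> u = flow X u (\<omega> 0)}" by auto
      finally show ?thesis .
    qed
  qed
  moreover have "{\<omega> \<in> Omega X. t < first_jump \<omega>} = {\<omega> \<in> space M. \<forall>u\<in>test_times t. \<omega> u = flow X u (\<omega> 0)}"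
    unfolding sp using first_jump_gr_iff[OF _ t] by blast
  ultimately show ?thesis by simp
qed

lemma measurable_first_jump: "first_jump \<in> borel_measurable PA"
proof (rule borel_measurableI_greater)
  fix t :: real
  show "{\<omega> \<in> space PA. t < first_jump \<omega>} \<in> sets PA"
  proof (cases "0 \<le> t")
    case True then show ?thesis using first_jump_gr_sets[of PA t] measurable_eval by simp
  next
    case False
    have "t < first_jump \<omega>" if "\<omega> \<in> Omega X" for \<omega> using first_jump(2)[OF that] False by linarith
    then have "{\<omega> \<in> space PA. t < first_jump \<omega>} = space PA" by auto
    then show ?thesis by (metis sets.top)
  qed
qed

lemma first_jump_gr_past: assumes t: "0 \<le> t" shows "{\<omega> \<in> Omega X. t < first_jump \<omega>} \<in> sets (past X t)"
proof (rule first_jump_gr_sets[OF _ _ t])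
  show "space (past X t) = Omega X" by (simp add: past_def)
  fix u assume u: "0 \<le> u" "u \<le> t"
  have "(\<lambda>\<omega>. restrict \<omega> {0..t}) \<in> measurable (past X t) (PiM {0..t} (\<lambda>_. borel))"
    unfolding past_def by (rule measurable_vimage_algebra1) (auto simp: space_PiM)
  from measurable_compose[OF this measurable_component_singleton, of u] u
  show "(\<lambda>\<omega>. \<omega> u) \<in> borel_measurable (past X t)" by simp
qed

lemma switch_time_first_jump:
  assumes \<omega>: "\<omega> \<in> Omega X" and b: "\<omega> 0 \<in> side X b"
  shows "\<omega> (first_jump \<omega>) \<in> side X (\<not> b) \<Longrightarrow> sw \<omega> = first_jump \<omega>"
    "\<omega> (first_jump \<omega>) \<in> side X b \<Longrightarrow> sw \<omega> = first_jump \<omega> + sw (shift (first_jump \<omega>) \<omega>)"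
proof -
  define j where "j = first_jump \<omega>"
  note F = first_jump[OF \<omega>, folded j_def]
  have before: "\<omega> u \<in> side X b" if "0 \<le> u" "u < j" for u
    using before_first_jump[OF \<omega>, of u] that flow_side[OF b, of u] by (simp add: j_def)
  show "sw \<omega> = first_jump \<omega>" if "\<omega> (first_jump \<omega>) \<in> side X (\<not> b)"
    using switch_time_eqI[OF \<omega> F(2) before] that by (simp add: j_def)
  show "sw \<omega> = first_jump \<omega> + sw (shift (first_jump \<omega>) \<omega>)" if "\<omega> (first_jump \<omega>) \<in> side X b"
  proof -
    have O: "shift j \<omega> \<in> Omega X" using F by (intro shift_Omega[OF \<omega>]) simp
    have b': "shift j \<omega> 0 \<in> side X b" using that by (simp add: j_def)
    note S = switch_time[OF O b']
    have "sw \<omega> = j + sw (shift j \<omega>)"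
    proof (rule switch_time_eqI[OF \<omega>, of _ b])
      show "0 < j + sw (shift j \<omega>)" using S F by simp
      show "\<omega> (j + sw (shift j \<omega>)) \<in> side X (\<not> b)" using S by (simp add: add.commute)
      fix u assume u: "0 \<le> u" "u < j + sw (shift j \<omega>)"
      show "\<omega> u \<in> side X b"
      proof (cases "u < j")
        case False
        then have "shift j \<omega> (u - j) \<in> side X b" using u by (intro S(3)) auto
        with False show ?thesis by simp
      qed (use before u in auto)
    qed
    then show ?thesis by (simp add: j_def)
  qed
qed

subsection \<open>Functionals of the path after a descent\<close>

lemma descent_unique_height: "descent \<omega> h K n t \<Longrightarrow> descent \<omega> h K n' t' \<Longrightarrow> n' = n"
  using descent_unique by blast

text \<open>Descents take positive time, so 0 can stand for the absence of a descent.\<close>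

definition descent_time :: "nat \<Rightarrow> nat \<Rightarrow> real \<Rightarrow> ('p, 'm) path \<Rightarrow> real" where
  "descent_time K n h \<omega> = (if \<exists>t. descent \<omega> h K n t then THE t. descent \<omega> h K n t else 0)"

lemma descent_time_eq: "descent \<omega> h K n t \<Longrightarrow> descent_time K n h \<omega> = t"
  unfolding descent_time_def using descent_unique by (auto intro!: the_equality)

lemma descent_time_pos: assumes "\<omega> \<in> Omega X"
  shows "0 < descent_time K n h \<omega> \<longleftrightarrow> (\<exists>t. descent \<omega> h K n t)" "0 \<le> descent_time K n h \<omega>"
proof -
  have *: "0 < descent_time K n h \<omega>" if "descent \<omega> h K n t" for t
    using descent_level[OF that assms] descent_time_eq[OF that] by simp
  show "0 < descent_time K n h \<omega> \<longleftrightarrow> (\<exists>t. descent \<omega> h K n t)"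
  proof
    assume a: "0 < descent_time K n h \<omega>"
    show "\<exists>t. descent \<omega> h K n t"
      by (rule ccontr) (use a in \<open>simp add: descent_time_def\<close>)
  qed (use * in blast)
  show "0 \<le> descent_time K n h \<omega>"
  proof (cases "\<exists>t. descent \<omega> h K n t")
    case True then show ?thesis using * less_imp_le by blast
  qed (simp add: descent_time_def)
qed

text \<open>A function \<open>V\<close> of the time of the descent, and 0 if there is none. In this form the rules of \<open>descent\<close>
  become the equation \<open>visit_rec\<close>, whose right-hand side is built from measurable operations only.\<close>

definition visit :: "nat \<Rightarrow> nat \<Rightarrow> (real \<Rightarrow> real) \<Rightarrow> real \<Rightarrow> ('p, 'm) path \<Rightarrow> real" where
  "visit K n V h \<omega> = (if 0 < descent_time K n h \<omega> then V (descent_time K n h \<omega>) else 0)"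

lemma visit_cong: "(\<And>t. 0 < t \<Longrightarrow> V t = V' t) \<Longrightarrow> visit K n V h \<omega> = visit K n V' h \<omega>"
  by (simp add: visit_def)

lemma visit_eq: "\<omega> \<in> Omega X \<Longrightarrow> descent \<omega> h K n t \<Longrightarrow> visit K n V h \<omega> = V t"
  unfolding visit_def using descent_time_eq[of \<omega> h K n t] descent_time_pos(1)[of \<omega> K n h] by auto

lemma visit_none: "\<omega> \<in> Omega X \<Longrightarrow> (\<And>t. \<not> descent \<omega> h K n t) \<Longrightarrow> visit K n V h \<omega> = 0"
  unfolding visit_def using descent_time_pos(1) by auto

text \<open>The sum is over the possible heights of the excursion at the first valley, of which at most one
  contributes. A height \<open>k \<ge> n\<close> would lift the counter beyond \<open>n\<close>.\<close>

lemma visit_rec: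
  assumes \<omega>: "\<omega> \<in> Omega X" and m: "\<omega> 0 \<in> side X False" and h: "0 < h"
    and s_eq: "s = sw \<omega> + sw (shift (sw \<omega>) \<omega>)"
  shows "visit K n V h \<omega> = (if h \<le> sw \<omega> then (if n = K then V h else 0)
    else (\<Sum>k\<in>{1..<n}. visit 1 k (\<lambda>t1. visit (Suc (max K k)) n (\<lambda>t2. V (s + t1 + t2)) (h - sw \<omega>) (shift (s + t1) \<omega>))
      (sw (shift (sw \<omega>) \<omega>)) (shift s \<omega>)))"
proof (cases "h \<le> sw \<omega>")
  case True
  have d: "descent \<omega> h K K h" by (rule straight[OF m h True])
  have "n = K" if "descent \<omega> h K n t" for t
    using that True by (cases rule: descent.cases) auto
  then show ?thesis using True visit_eq[OF \<omega> d] visit_none[OF \<omega>, of h K n V] by auto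
next
  case False
  define s1 where "s1 = sw \<omega>"
  define \<omega>1 where "\<omega>1 = shift s1 \<omega>"
  define s2 where "s2 = sw \<omega>1"
  have s: "s = s1 + s2" by (simp add: s_eq s1_def \<omega>1_def s2_def)
  have 1: "0 < s1" "\<omega>1 \<in> Omega X" "\<omega>1 0 \<in> side X True"
    using switch_shift[OF \<omega> m] by (auto simp: s1_def \<omega>1_def)
  have 2: "0 < s2" "shift s2 \<omega>1 = shift s \<omega>"
    using switch_shift[OF 1(2,3)] by (auto simp: s2_def s \<omega>1_def shift_shift)
  have O2: "shift s \<omega> \<in> Omega X" using switch_shift[OF 1(2,3)] 2 by (simp add: s2_def)
  let ?F = "\<lambda>k. visit 1 k (\<lambda>t1. visit (Suc (max K k)) n (\<lambda>t2. V (s + t1 + t2)) (h - s1) (shift (s + t1) \<omega>)) s2 (shift s \<omega>)"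
  have F: "?F k = (if \<exists>t1 t. descent (shift s \<omega>) s2 1 k t1 \<and> descent (shift (s + t1) \<omega>) (h - s1) (Suc (max K k)) n t
     then visit K n V h \<omega> else 0)" for k
  proof (cases "\<exists>t1. descent (shift s \<omega>) s2 1 k t1")
    case True
    then obtain t1 where t1: "descent (shift s \<omega>) s2 1 k t1" by auto
    have p: "0 < t1" using descent_level[OF t1 O2] by simp
    have O3: "shift (s + t1) \<omega> \<in> Omega X" using p 1 2 by (intro shift_Omega \<omega>) (simp add: s)
    have u: "t1' = t1" if "descent (shift s \<omega>) s2 1 k t1'" for t1' using descent_unique[OF t1 that] by simp
    have Fk: "?F k = visit (Suc (max K k)) n (\<lambda>t2. V (s + t1 + t2)) (h - s1) (shift (s + t1) \<omega>)"
      by (rule visit_eq[OF O2 t1])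
    show ?thesis
    proof (cases "\<exists>t. descent (shift (s + t1) \<omega>) (h - s1) (Suc (max K k)) n t")
      case True
      then obtain t where t: "descent (shift (s + t1) \<omega>) (h - s1) (Suc (max K k)) n t" by auto
      have "descent \<omega> h K n (s + t1 + t)"
      proof (rule valley[where \<omega>=\<omega>, OF m])
        show "sw \<omega> < h" using False by simp
        show "s = sw \<omega> + sw (shift (sw \<omega>) \<omega>)" by (rule s_eq)
        show "descent (shift s \<omega>) (sw (shift (sw \<omega>) \<omega>)) 1 k t1" using t1 by (simp add: s1_def s2_def \<omega>1_def)
        show "descent (shift (s + t1) \<omega>) (h - sw \<omega>) (Suc (max K k)) n t" using t by (simp add: s1_def)
      qed
      then have "visit K n V h \<omega> = V (s + t1 + t)" by (rule visit_eq[OF \<omega>])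
      moreover have "?F k = V (s + t1 + t)" unfolding Fk by (rule visit_eq[OF O3 t])
      ultimately show ?thesis using t1 t by auto
    next
      case False
      then have "?F k = 0" unfolding Fk by (intro visit_none[OF O3]) auto
      then show ?thesis using False u by auto
    qed
  next
    case none: False
    then have "?F k = 0" by (intro visit_none[OF O2]) auto
    then show ?thesis using none by auto
  qed
  have sum: "(\<Sum>k\<in>{1..<n}. ?F k) = visit K n V h \<omega>"
  proof (cases "\<exists>t. descent \<omega> h K n t")
    case True
    then obtain t where "descent \<omega> h K n t" by auto
    then obtain k t1 t2 where k: "descent (shift s \<omega>) s2 1 k t1" "descent (shift (s + t1) \<omega>) (h - s1) (Suc (max K k)) n t2"
      using False by (cases rule: descent.cases) (auto simp: s1_def s2_def s_eq \<omega>1_def)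
    have kn: "k \<in> {1..<n}" using descent_mono[OF k(1)] descent_mono[OF k(2)] by auto
    have "?F k' = 0" if "k' \<noteq> k" for k' unfolding F using that descent_unique_height[OF k(1)] by auto
    then have "(\<Sum>k\<in>{1..<n}. ?F k) = ?F k"
      using kn sum.remove[of "{1..<n}" k ?F] by (simp add: sum.neutral)
    then show ?thesis using F[of k] k by auto
  next
    case none: False
    have z: "visit K n V h \<omega> = 0" using none by (intro visit_none[OF \<omega>]) auto
    show ?thesis unfolding F z by simp
  qed
  show ?thesis using False sum by (simp add: s1_def \<omega>1_def s2_def)
qed

lemma descent_time_visit: "\<omega> \<in> Omega X \<Longrightarrow> descent_time K n h \<omega> = visit K n (\<lambda>t. t) h \<omega>"
  using descent_time_pos(2)[of \<omega> K n h] by (simp add: visit_def)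

text \<open>In \<open>visit_rec\<close> the excursion at the first valley has a smaller final counter, and the rest of the descent
  has the same final counter but starts from a larger one.\<close>

lemma measurable_descent_time_joint:
  "(\<lambda>(h, \<omega>). descent_time K n h \<omega>) \<in> borel_measurable (borel \<Otimes>\<^sub>M PA)"
proof (induction n arbitrary: K rule: less_induct)
  case (less n)
  note outer = less
  show ?case
  proof (induction "n - K" arbitrary: K rule: less_induct)
  case (less K)
  have IH: "(\<lambda>(h, \<omega>). descent_time K' n' h \<omega>) \<in> borel_measurable (borel \<Otimes>\<^sub>M PA)"
    if "n' < n \<or> n' = n \<and> n - K' < n - K" for K' n'
    using that
  proof (elim disjE conjE)
    assume "n' < n" then show ?thesis by (rule outer)
  next
    assume "n' = n" "n - K' < n - K" then show ?thesis using less[of K'] by simp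
  qed
  let ?B = "borel \<Otimes>\<^sub>M PA :: (real \<times> ('p, 'm) path) measure"
  have [measurable]: "sw \<in> borel_measurable PA" by (rule measurable_switch_time)
  have pos: "0 < sw \<omega>" if "\<omega> \<in> Omega X" for \<omega> by (rule switch_time_pos[OF that])
  define w1 where "w1 = (\<lambda>x :: real \<times> ('p, 'm) path. shift (sw (snd x)) (snd x))"
  have w1[measurable]: "w1 \<in> measurable ?B PA"
    unfolding w1_def by (rule measurable_shift) (auto simp: space_pair_measure less_imp_le[OF pos])
  define s where "s = (\<lambda>x :: real \<times> ('p, 'm) path. sw (snd x) + sw (w1 x))"
  have s[measurable]: "s \<in> borel_measurable ?B" unfolding s_def by measurable
  have w1O: "w1 x \<in> Omega X" if "x \<in> space ?B" for x using measurable_space[OF w1 that] by simp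
  have s0: "0 < s x" if "x \<in> space ?B" for x
    using that pos[OF w1O[OF that]] pos[of "snd x"] by (auto simp: s_def space_pair_measure)
  define w2 where "w2 = (\<lambda>x. shift (s x) (snd x))"
  have w2[measurable]: "w2 \<in> measurable ?B PA"
    unfolding w2_def by (rule measurable_shift) (auto simp: less_imp_le[OF s0])
  have w2O: "w2 x \<in> Omega X" if "x \<in> space ?B" for x using measurable_space[OF w2 that] by simp
  have T: "(\<lambda>x. visit 1 k (\<lambda>t1. visit (Suc (max K k)) n (\<lambda>t2. s x + t1 + t2) (fst x - sw (snd x)) (shift (s x + t1) (snd x)))
      (sw (w1 x)) (w2 x)) \<in> borel_measurable ?B" if k: "k \<in> {1..<n}" for k
  proof (cases "Suc (max K k) \<le> n")
    case True
    define t1 where "t1 = (\<lambda>x. descent_time 1 k (sw (w1 x)) (w2 x))"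
    have "(\<lambda>x. (sw (w1 x), w2 x)) \<in> measurable ?B ?B" by measurable
    from measurable_compose[OF this IH[of k 1]] k have t1[measurable]: "t1 \<in> borel_measurable ?B" by (simp add: t1_def)
    have t1_0: "0 \<le> t1 x" if "x \<in> space ?B" for x
      unfolding t1_def by (rule descent_time_pos(2)[OF w2O[OF that]])
    define w3 where "w3 = (\<lambda>x. shift (s x + t1 x) (snd x))"
    have w3[measurable]: "w3 \<in> measurable ?B PA"
      unfolding w3_def
    proof (rule measurable_shift)
      show "0 \<le> s x + t1 x" if "x \<in> space ?B" for x using s0[OF that] t1_0[OF that] by linarith
    qed measurable
    define t2 where "t2 = (\<lambda>x. descent_time (Suc (max K k)) n (fst x - sw (snd x)) (w3 x))"
    have "(\<lambda>x. (fst x - sw (snd x), w3 x)) \<in> measurable ?B ?B" by measurable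
    from measurable_compose[OF this IH[of n "Suc (max K k)"]] True have t2[measurable]: "t2 \<in> borel_measurable ?B" by (simp add: t2_def)
    have "(\<lambda>x. if 0 < t1 x then if 0 < t2 x then s x + t1 x + t2 x else 0 else 0) \<in> borel_measurable ?B" by measurable
    moreover have "descent_time 1 k (sw (w1 x)) (w2 x) = t1 x" "shift (s x + t1 x) (snd x) = w3 x"
      "descent_time (Suc (max K k)) n (fst x - sw (snd x)) (w3 x) = t2 x" for x
      by (simp_all add: t1_def w3_def t2_def)
    ultimately show ?thesis unfolding visit_def by (simp only:)
  next
    case False
    have "visit (Suc (max K k)) n V h \<omega> = 0" if "\<omega> \<in> Omega X" for V h \<omega>
      by (rule visit_none[OF that]) (use descent_mono False in blast)
    note z = this
    have "visit 1 k (\<lambda>t1. visit (Suc (max K k)) n (\<lambda>t2. s x + t1 + t2) (fst x - sw (snd x)) (shift (s x + t1) (snd x)))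
      (sw (w1 x)) (w2 x) = visit 1 k (\<lambda>_. 0) (sw (w1 x)) (w2 x)" if "x \<in> space ?B" for x
    proof (rule visit_cong, rule z, rule shift_Omega)
      show "snd x \<in> Omega X" using that by (auto simp: space_pair_measure)
    qed (use s0[OF that] in linarith)
    moreover have "visit 1 k (\<lambda>_. 0) h \<omega> = 0" for h \<omega> by (simp add: visit_def)
    ultimately show ?thesis by (subst measurable_cong[where g="\<lambda>_. 0"]) simp_all
  qed
  have "(\<lambda>x. if snd x 0 \<in> side X False \<and> 0 < fst x then (if fst x \<le> sw (snd x) then (if n = K then fst x else 0)
    else (\<Sum>k\<in>{1..<n}. visit 1 k (\<lambda>t1. visit (Suc (max K k)) n (\<lambda>t2. s x + t1 + t2) (fst x - sw (snd x)) (shift (s x + t1) (snd x)))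
      (sw (w1 x)) (w2 x))) else 0) \<in> borel_measurable ?B" (is "?f \<in> _")
  proof (intro measurable_If borel_measurable_sum T)
    show "{x \<in> space ?B. snd x 0 \<in> side X False \<and> 0 < fst x} \<in> sets ?B"
      using measurable_in_side[of snd ?B 0 False] by measurable
  qed auto
  also have "?f \<in> borel_measurable ?B \<longleftrightarrow> (\<lambda>(h, \<omega>). descent_time K n h \<omega>) \<in> borel_measurable ?B"
  proof (rule measurable_cong)
    fix x assume x: "x \<in> space ?B"
    then obtain h \<omega> where xx: "x = (h, \<omega>)" and \<omega>: "\<omega> \<in> Omega X" by (auto simp: space_pair_measure)
    show "?f x = (case x of (h, \<omega>) \<Rightarrow> descent_time K n h \<omega>)"
    proof (cases "\<omega> 0 \<in> side X False \<and> 0 < h")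
      case True
      have e: "w1 (h, \<omega>) = shift (sw \<omega>) \<omega>" "w2 (h, \<omega>) = shift (s (h, \<omega>)) \<omega>" "s (h, \<omega>) = sw \<omega> + sw (shift (sw \<omega>) \<omega>)"
        by (simp_all add: w1_def w2_def s_def)
      show ?thesis
        unfolding xx fst_conv snd_conv prod.case descent_time_visit[OF \<omega>, of K] e(1,2)
          visit_rec[OF \<omega> conjunct1[OF True] conjunct2[OF True] e(3), of K n "\<lambda>t. t"]
        by (simp only: True simp_thms if_True)
    next
      case False
      then have "\<not> descent \<omega> h K n t" for t using descent_start[of \<omega> h K n t] descent_level[OF _ \<omega>] by blast
      then have d: "descent_time K n h \<omega> = 0" by (simp add: descent_time_def)
      show ?thesis unfolding xx fst_conv snd_conv prod.case d by (simp only: False if_False)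
    qed
  qed
  finally show ?case .
  qed
qed

lemma measurable_descent_time:
  assumes [measurable]: "h \<in> borel_measurable M" "w \<in> measurable M PA"
  shows "(\<lambda>x. descent_time K n (h x) (w x)) \<in> borel_measurable M"
proof -
  have "(\<lambda>x. (h x, w x)) \<in> measurable M (borel \<Otimes>\<^sub>M PA)" by measurable
  from measurable_compose[OF this measurable_descent_time_joint] show ?thesis by simp
qed

definition after_descent :: "nat \<Rightarrow> nat \<Rightarrow> (('p, 'm) path \<Rightarrow> real) \<Rightarrow> real \<Rightarrow> ('p, 'm) path \<Rightarrow> real" where
  "after_descent K n H h \<omega> = visit K n (\<lambda>t. H (shift t \<omega>)) h \<omega>"

definition after_excursion :: "nat \<Rightarrow> (('p, 'm) path \<Rightarrow> real) \<Rightarrow> ('p, 'm) path \<Rightarrow> real" where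
  "after_excursion k H \<omega> = after_descent 1 k H (sw \<omega>) (shift (sw \<omega>) \<omega>)"

lemma measurable_after_descent:
  assumes h: "h \<in> borel_measurable M" and w: "w \<in> measurable M PA"
    and H: "(\<lambda>(x, \<omega>). H x \<omega>) \<in> borel_measurable (M \<Otimes>\<^sub>M PA)"
  shows "(\<lambda>x. after_descent K n (H x) (h x) (w x)) \<in> borel_measurable M"
proof -
  define t where "t = (\<lambda>x. descent_time K n (h x) (w x))"
  have [measurable]: "t \<in> borel_measurable M" unfolding t_def by (rule measurable_descent_time[OF h w])
  have O: "w x \<in> Omega X" if "x \<in> space M" for x using measurable_space[OF w that] by simp
  have [measurable]: "(\<lambda>x. shift (t x) (w x)) \<in> measurable M PA"
    by (rule measurable_shift[OF \<open>t \<in> borel_measurable M\<close> w]) (simp add: t_def descent_time_pos(2)[OF O])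
  have "(\<lambda>x. (x, shift (t x) (w x))) \<in> measurable M (M \<Otimes>\<^sub>M PA)" by measurable
  from measurable_compose[OF this H] have [measurable]: "(\<lambda>x. H x (shift (t x) (w x))) \<in> borel_measurable M" by simp
  have "(\<lambda>x. if 0 < t x then H x (shift (t x) (w x)) else 0) \<in> borel_measurable M" by measurable
  moreover have "descent_time K n (h x) (w x) = t x" for x by (simp add: t_def)
  ultimately show ?thesis unfolding after_descent_def visit_def by (simp only:)
qed

lemma measurable_after_excursion:
  assumes w: "w \<in> measurable M PA"
    and H: "(\<lambda>(x, \<omega>). H x \<omega>) \<in> borel_measurable (M \<Otimes>\<^sub>M PA)"
  shows "(\<lambda>x. after_excursion k (H x) (w x)) \<in> borel_measurable M"
proof -
  have O: "w x \<in> Omega X" if "x \<in> space M" for x using measurable_space[OF w that] by simp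
  have s: "(\<lambda>x. sw (w x)) \<in> borel_measurable M" by (rule measurable_compose[OF w measurable_switch_time])
  show ?thesis
    unfolding after_excursion_def
    by (rule measurable_after_descent[OF s measurable_shift[OF s w] H]) (rule less_imp_le[OF switch_time_pos[OF O]])
qed

text \<open>The functional is evaluated at the end of the descent; its recursion therefore nests the functionals
  of the two pieces instead of adding their times.\<close>

lemma after_descent_rec:
  assumes \<omega>: "\<omega> \<in> Omega X" and m: "\<omega> 0 \<in> side X False" and h: "0 < h"
  shows "after_descent K n H h \<omega> = (if h \<le> sw \<omega> then (if n = K then H (shift h \<omega>) else 0)
    else (\<Sum>k\<in>{1..<n}. after_excursion k (after_descent (Suc (max K k)) n H (h - sw \<omega>)) (shift (sw \<omega>) \<omega>)))"
proof -
  define s1 where "s1 = sw \<omega>"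
  define \<omega>1 where "\<omega>1 = shift s1 \<omega>"
  define s2 where "s2 = sw \<omega>1"
  have 1: "0 < s1" "\<omega>1 \<in> Omega X" "\<omega>1 0 \<in> side X True"
    using switch_shift[OF \<omega> m] by (auto simp: s1_def \<omega>1_def)
  have 2: "0 < s2" "shift s2 \<omega>1 = shift (s1 + s2) \<omega>"
    using switch_shift[OF 1(2,3)] by (auto simp: s2_def \<omega>1_def shift_shift)
  have "after_excursion k (after_descent (Suc (max K k)) n H (h - s1)) \<omega>1 =
     visit 1 k (\<lambda>t1. visit (Suc (max K k)) n (\<lambda>t2. H (shift (s1 + s2 + t1 + t2) \<omega>)) (h - s1) (shift (s1 + s2 + t1) \<omega>)) s2 (shift (s1 + s2) \<omega>)" for k
    unfolding after_excursion_def after_descent_def s2_def[symmetric] 2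
    by (intro visit_cong) (auto simp: shift_shift intro!: visit_cong)
  then show ?thesis
    using visit_rec[OF \<omega> m h refl, of K n "\<lambda>t. H (shift t \<omega>)"]
    by (simp add: after_descent_def s1_def \<omega>1_def s2_def)
qed

lemma after_excursion_eq: assumes "\<omega> \<in> Omega X" "\<omega> 0 \<in> side X True"
  shows "excursion \<omega> k t \<Longrightarrow> after_excursion k H \<omega> = H (shift t \<omega>)"
    "(\<And>t. \<not> excursion \<omega> k t) \<Longrightarrow> after_excursion k H \<omega> = 0"
proof -
  note S = switch_shift[OF assms]
  show "after_excursion k H \<omega> = H (shift t \<omega>)" if e: "excursion \<omega> k t"
  proof -
    have d: "descent (shift (sw \<omega>) \<omega>) (sw \<omega>) 1 k (t - sw \<omega>)" using e by (simp add: excursion_def)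
    have "0 < t - sw \<omega>" using descent_level[OF d S(2)] by simp
    then show ?thesis
      unfolding after_excursion_def after_descent_def visit_eq[OF S(2) d] by (simp add: shift_shift)
  qed
  show "after_excursion k H \<omega> = 0" if n: "\<And>t. \<not> excursion \<omega> k t"
    unfolding after_excursion_def after_descent_def
  proof (rule visit_none[OF S(2)])
    fix t show "\<not> descent (shift (sw \<omega>) \<omega>) (sw \<omega>) 1 k t"
      using n[of "t + sw \<omega>"] assms by (simp add: excursion_def)
  qed
qed

lemma after_descent_bounded: assumes "\<omega> \<in> Omega X" "\<And>\<omega>. \<omega> \<in> Omega X \<Longrightarrow> \<bar>H \<omega>\<bar> \<le> B"
  shows "\<bar>after_descent K n H h \<omega>\<bar> \<le> B"
proof -
  have "0 \<le> B" using assms(2)[OF assms(1)] by (meson abs_ge_zero order_trans)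
  then show ?thesis
    using assms(2)[OF shift_Omega[OF assms(1), of "descent_time K n h \<omega>"]] descent_time_pos(2)[OF assms(1)]
    by (simp add: after_descent_def visit_def)
qed

lemma after_excursion_bounded: assumes "\<omega> \<in> Omega X" "\<And>\<omega>. \<omega> \<in> Omega X \<Longrightarrow> \<bar>H \<omega>\<bar> \<le> B"
  shows "\<bar>after_excursion k H \<omega>\<bar> \<le> B"
  unfolding after_excursion_def
  using switch_time_pos[OF assms(1)] by (intro after_descent_bounded assms shift_Omega) auto

end

section \<open>The law of the first jump\<close>

text \<open>For a fixed \<open>B\<close> both measures restrict to measures on the real line with the same distribution
  function. Hence they agree on all rectangles.\<close>

lemma measure_eqI_atMost_Times:
  fixes M N :: "(real \<times> 'a) measure"
  assumes sM: "sets M = sets (borel \<Otimes>\<^sub>M L)" and sN: "sets N = sets (borel \<Otimes>\<^sub>M L)"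
    and fin: "finite_measure M"
    and eq: "\<And>u B. B \<in> sets L \<Longrightarrow> emeasure M ({..u} \<times> B) = emeasure N ({..u} \<times> B)"
  shows "M = N"
proof -
  interpret finite_measure M by (rule fin)
  note [measurable_cong] = sM sN
  have rect: "emeasure M (A \<times> B) = emeasure N (A \<times> B)" if A: "A \<in> sets borel" and B[measurable]: "B \<in> sets L" for A B
  proof -
    have [measurable]: "UNIV \<times> B \<in> sets (borel \<Otimes>\<^sub>M L)" by measurable
    define M' where "M' = distr (density M (indicator (UNIV \<times> B))) borel fst"
    define N' where "N' = distr (density N (indicator (UNIV \<times> B))) borel fst"
    have iM: "emeasure M' A = emeasure M (A \<times> B)" if [measurable]: "A \<in> sets borel" for A
    proof -
      have "fst -` A \<inter> space (density M (indicator (UNIV \<times> B))) \<in> sets M"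
        unfolding space_density by (rule measurable_sets[of fst M borel]) (measurable)
      then have "emeasure M' A = (\<integral>\<^sup>+x. indicator (UNIV \<times> B) x * indicator (fst -` A \<inter> space M) x \<partial>M)"
        unfolding M'_def by (subst emeasure_distr) (auto simp: emeasure_density)
      also have "\<dots> = (\<integral>\<^sup>+x. indicator (A \<times> B) x \<partial>M)"
        by (intro nn_integral_cong) (auto simp: indicator_def)
      finally show ?thesis by simp
    qed
    have iN: "emeasure N' A = emeasure N (A \<times> B)" if [measurable]: "A \<in> sets borel" for A
    proof -
      have "fst -` A \<inter> space (density N (indicator (UNIV \<times> B))) \<in> sets N"
        unfolding space_density by (rule measurable_sets[of fst N borel]) (measurable)
      then have "emeasure N' A = (\<integral>\<^sup>+x. indicator (UNIV \<times> B) x * indicator (fst -` A \<inter> space N) x \<partial>N)"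
        unfolding N'_def by (subst emeasure_distr) (auto simp: emeasure_density)
      also have "\<dots> = (\<integral>\<^sup>+x. indicator (A \<times> B) x \<partial>N)"
        by (intro nn_integral_cong) (auto simp: indicator_def)
      finally show ?thesis by simp
    qed
    have "M' = N'"
    proof (rule measure_eqI_generator_eq[where E="range atMost" and \<Omega>=UNIV and A="\<lambda>i. {..real i}"])
      show "Int_stable (range (atMost :: real \<Rightarrow> real set))"
        by (auto simp: Int_stable_def intro!: image_eqI[where x="min _ _"])
      show "sets M' = sigma_sets UNIV (range atMost)" "sets N' = sigma_sets UNIV (range atMost)"
        unfolding M'_def N'_def sets_distr by (simp_all add: borel_eq_atMost)
      show "(\<Union>i. {..real i}) = UNIV" using real_arch_simple by auto
      show "emeasure M' X = emeasure N' X" if "X \<in> range atMost" for X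
        using that eq[OF B] iM[of X] iN[of X] by auto
      show "emeasure M' {..real i} \<noteq> \<infinity>" for i using iM[of "{..real i}"] by simp
    qed auto
    then show ?thesis using iM[OF A] iN[OF A] by simp
  qed
  show ?thesis
  proof (rule measure_eqI_generator_eq[where E="{a \<times> b | a b. a \<in> sets borel \<and> b \<in> sets L}" and \<Omega>="UNIV \<times> space L"
        and A="\<lambda>_. UNIV \<times> space L"])
    show "Int_stable {a \<times> b |a b. a \<in> sets borel \<and> b \<in> sets L}" by (rule Int_stable_pair_measure_generator)
    show "{a \<times> b |a b. a \<in> sets borel \<and> b \<in> sets L} \<subseteq> Pow (UNIV \<times> space L)"
      using sets.sets_into_space[of _ L] by auto
    show "sets M = sigma_sets (UNIV \<times> space L) {a \<times> b |a b. a \<in> sets borel \<and> b \<in> sets L}"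
      "sets N = sigma_sets (UNIV \<times> space L) {a \<times> b |a b. a \<in> sets borel \<and> b \<in> sets L}"
      using sets_pair_measure[of borel L] by (simp_all add: sM sN)
    show "range (\<lambda>_. UNIV \<times> space L) \<subseteq> {a \<times> b |a b. a \<in> sets borel \<and> b \<in> sets L}"
      by (auto intro!: exI[of _ UNIV] exI[of _ "space L"])
    show "emeasure M (UNIV \<times> space L) \<noteq> \<infinity>" by simp
    show "emeasure M Z = emeasure N Z" if "Z \<in> {a \<times> b |a b. a \<in> sets borel \<and> b \<in> sets L}" for Z
      using that rect by blast
  qed simp
qed

locale rap_process = rap X for X :: "('p::finite, 'm::finite, 'i::finite, 'j::finite) rap_data" +
  fixes P :: "('p, 'm) state \<Rightarrow> ('p, 'm) path measure"
  assumes orbit_process: "orbit_process X P"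
begin

lemma P_kernel: "P \<in> measurable (restrict_space borel (states X)) (prob_algebra PA)"
  using orbit_process by (simp add: orbit_process_def)

lemma P_states: assumes "a \<in> states X"
  shows prob_space_P: "prob_space (P a)" and sets_P: "sets (P a) = sets PA" and space_P: "space (P a) = Omega X"
proof -
  have "P a \<in> space (prob_algebra PA)"
    using measurable_space[OF P_kernel, of a] assms by (simp add: space_restrict_space)
  then show "prob_space (P a)" and 1: "sets (P a) = sets PA" by (auto simp: space_prob_algebra)
  show "space (P a) = Omega X" using sets_eq_imp_space_eq[OF 1] by simp
qed

lemma measurable_P: "a \<in> states X \<Longrightarrow> measurable (P a) N = measurable PA N"
  using sets_P by (intro measurable_cong_sets) auto

lemma integrable_P:
  fixes f :: "_ \<Rightarrow> real"
  assumes "a \<in> states X" "f \<in> borel_measurable PA" "\<And>\<omega>. \<omega> \<in> Omega X \<Longrightarrow> \<bar>f \<omega>\<bar> \<le> B"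
  shows "integrable (P a) f"
proof -
  interpret prob_space "P a" by (rule prob_space_P[OF assms(1)])
  show ?thesis using assms by (intro integrable_const_bound[where B=B]) (auto simp: measurable_P space_P intro!: AE_I2)
qed

lemma integral_P_bound:
  fixes f :: "_ \<Rightarrow> real"
  assumes "a \<in> states X" "\<And>\<omega>. \<omega> \<in> Omega X \<Longrightarrow> \<bar>f \<omega>\<bar> \<le> B"
  shows "\<bar>LINT \<omega>|P a. f \<omega>\<bar> \<le> B"
proof (cases "integrable (P a) f")
  case True
  interpret prob_space "P a" by (rule prob_space_P[OF assms(1)])
  have "\<bar>LINT \<omega>|P a. f \<omega>\<bar> \<le> (LINT \<omega>|P a. \<bar>f \<omega>\<bar>)" by (rule integral_abs_bound)
  also have "\<dots> \<le> (LINT \<omega>|P a. B)" using True assms by (intro integral_mono) (auto simp: space_P)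
  also have "\<dots> = B" by (simp add: prob_space)
  finally show ?thesis .
next
  case False
  obtain \<omega> where "\<omega> \<in> Omega X" using prob_space.not_empty[OF prob_space_P[OF assms(1)]] space_P[OF assms(1)] by auto
  then have "0 \<le> B" using assms(2)[of \<omega>] by linarith
  then show ?thesis using False by (simp add: not_integrable_integral_eq)
qed

lemma AE_start: "a \<in> states X \<Longrightarrow> AE \<omega> in P a. \<omega> 0 = a"
  using orbit_process by (simp add: orbit_process_def)

lemma integral_P_start:
  fixes f g :: "_ \<Rightarrow> real"
  assumes "a \<in> states X" "f \<in> borel_measurable PA" "g \<in> borel_measurable PA"
    "\<And>\<omega>. \<omega> \<in> Omega X \<Longrightarrow> \<omega> 0 = a \<Longrightarrow> f \<omega> = g \<omega>"
  shows "(LINT \<omega>|P a. f \<omega>) = (LINT \<omega>|P a. g \<omega>)"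
proof (rule integral_cong_AE)
  show "AE \<omega> in P a. f \<omega> = g \<omega>"
    using AE_start[OF assms(1)] AE_space by eventually_elim (use assms in \<open>auto simp: space_P\<close>)
qed (use assms in \<open>auto simp: measurable_P\<close>)

lemma measurable_integral_P:
  fixes H :: "'x \<Rightarrow> ('p, 'm) path \<Rightarrow> real"
  assumes [measurable]: "(\<lambda>(x, \<omega>). H x \<omega>) \<in> borel_measurable (M \<Otimes>\<^sub>M PA)"
    and g: "g \<in> measurable M (restrict_space borel (states X))"
  shows "(\<lambda>x. LINT \<omega>|P (g x). H x \<omega>) \<in> borel_measurable M"
proof -
  have L[measurable]: "(\<lambda>x. P (g x)) \<in> measurable M (subprob_algebra PA)"
    by (rule measurable_prob_algebraD[OF measurable_compose[OF g P_kernel]])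
  have "(\<lambda>x. distr (P (g x)) (M \<Otimes>\<^sub>M PA) (\<lambda>\<omega>. (x, \<omega>))) \<in> measurable M (subprob_algebra (M \<Otimes>\<^sub>M PA))"
    by (rule measurable_distr2[OF _ L]) measurable
  from measurable_compose[OF this integral_measurable_subprob_algebra[OF assms(1)]]
  have "(\<lambda>x. LINT y|distr (P (g x)) (M \<Otimes>\<^sub>M PA) (\<lambda>\<omega>. (x, \<omega>)). (case y of (x, \<omega>) \<Rightarrow> H x \<omega>)) \<in> borel_measurable M" .
  moreover have "(LINT y|distr (P (g x)) (M \<Otimes>\<^sub>M PA) (\<lambda>\<omega>. (x, \<omega>)). (case y of (x, \<omega>) \<Rightarrow> H x \<omega>)) = (LINT \<omega>|P (g x). H x \<omega>)"
    if x: "x \<in> space M" for x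
  proof -
    have gx: "g x \<in> states X" using measurable_space[OF g x] by (simp add: space_restrict_space)
    show ?thesis using x by (subst integral_distr) (auto simp: measurable_P[OF gx] intro!: assms(1))
  qed
  ultimately show ?thesis by (subst measurable_cong[symmetric]) auto
qed

text \<open>The state \<open>a\<close> is a default that keeps the value among the states when the jump has density 0.\<close>

definition target :: "'i + 'j \<Rightarrow> 'i + 'j \<Rightarrow> ('p, 'm) state \<Rightarrow> real \<Rightarrow> ('p, 'm) state" where
  "target c d a s = (if 0 \<le> s \<and> 0 < mass (jump_flow c d a s) then normalise (jump_flow c d a s) else a)"

lemma measurable_jump_flow [measurable]: "jump_flow c d a \<in> borel_measurable borel"
  using continuous_on_jump_flow by (rule borel_measurable_continuous_onI)

lemma measurable_mass [measurable]: "(mass :: ('p, 'm) state \<Rightarrow> real) \<in> borel_measurable borel"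
  by (intro borel_measurable_continuous_onI linear_continuous_on bounded_linear_mass)

lemma target_cell: assumes "a \<in> cell X c" "d \<noteq> c" "0 \<le> s" "0 < mass (jump_flow c d a s)"
  shows "target c d a s \<in> cell X d" "jump_flow c d a s = mass (jump_flow c d a s) *\<^sub>R target c d a s"
  using jump_flow_cases[OF assms(1,3,2)] assms by (auto simp: target_def normalise_def)

lemma target_states: assumes "a \<in> cell X c" "d \<noteq> c" shows "target c d a s \<in> states X"
proof (cases "0 \<le> s \<and> 0 < mass (jump_flow c d a s)")
  case True then show ?thesis using target_cell[OF assms] states_cell by blast
next
  case False then show ?thesis using assms states_cell by (auto simp: target_def)
qed

lemma measurable_target: assumes "a \<in> cell X c" "d \<noteq> c"
  shows "target c d a \<in> measurable borel (restrict_space borel (states X))"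
proof (rule measurable_restrict_space2)
  show "target c d a \<in> space borel \<rightarrow> states X" using target_states[OF assms] by auto
  show "target c d a \<in> borel_measurable borel" unfolding target_def normalise_def by measurable
qed

text \<open>The process is given by a distribution function of the first jump time together with an event after it.
  Here the joint law is exhibited as a density followed by a kernel, so that functionals of the
  pair can be integrated.\<close>

lemma first_jump_law:
  assumes a: "a \<in> cell X c"
  defines "N \<equiv> density (count_space (UNIV - {c}) \<Otimes>\<^sub>M lborel) (\<lambda>(d, s). ennreal (indicator {0..} s * mass (jump_flow c d a s)))
     \<bind> (\<lambda>(d, s). distr (P (target c d a s)) (borel \<Otimes>\<^sub>M PA) (\<lambda>\<omega>. (s, \<omega>)))"
  shows "UNIV - {c} \<noteq> {} \<Longrightarrow> distr (P a) (borel \<Otimes>\<^sub>M PA) (\<lambda>\<omega>. (first_jump \<omega>, shift (first_jump \<omega>) \<omega>)) = N"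
    "UNIV - {c} \<noteq> {} \<Longrightarrow> g \<in> borel_measurable (borel \<Otimes>\<^sub>M PA) \<Longrightarrow> (\<integral>\<^sup>+y. g y \<partial>N) =
      (\<Sum>d\<in>UNIV - {c}. \<integral>\<^sup>+s. ennreal (indicator {0..} s * mass (jump_flow c d a s)) * (\<integral>\<^sup>+\<omega>. g (s, \<omega>) \<partial>P (target c d a s)) \<partial>lborel)"
proof -
  let ?D = "UNIV - {c}"
  let ?M = "count_space ?D \<Otimes>\<^sub>M (lborel :: real measure)"
  let ?F = "\<lambda>(d, s). ennreal (indicator {0..} s * mass (jump_flow c d a s))"
  let ?K = "\<lambda>(d, s). distr (P (target c d a s)) (borel \<Otimes>\<^sub>M PA) (\<lambda>\<omega>. (s, \<omega>))"
  assume ne: "?D \<noteq> {}"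
  have st: "a \<in> states X" using a states_cell by auto
  have F[measurable]: "?F \<in> borel_measurable ?M"
    by (rule measurable_pair_measure_countable1) auto
  have K: "?K \<in> measurable ?M (subprob_algebra (borel \<Otimes>\<^sub>M PA))"
  proof (rule measurable_pair_measure_countable1)
    fix d assume "d \<in> ?D"
    then have d: "d \<noteq> c" by simp
    have "(\<lambda>s. P (target c d a s)) \<in> measurable lborel (subprob_algebra PA)"
      using measurable_prob_algebraD[OF measurable_compose[OF measurable_target[OF a d] P_kernel]] by simp
    then have "(\<lambda>s. distr (P (target c d a s)) (borel \<Otimes>\<^sub>M PA) (\<lambda>\<omega>. (s, \<omega>))) \<in> measurable lborel (subprob_algebra (borel \<Otimes>\<^sub>M PA))"
      by (rule measurable_distr2[rotated]) measurable
    then show "(\<lambda>s. case (d, s) of (d, s) \<Rightarrow> distr (P (target c d a s)) (borel \<Otimes>\<^sub>M PA) (\<lambda>\<omega>. (s, \<omega>))) \<in> measurable lborel (subprob_algebra (borel \<Otimes>\<^sub>M PA))"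
      by simp
  qed auto
  have K': "?K \<in> measurable (density ?M ?F) (subprob_algebra (borel \<Otimes>\<^sub>M PA))" using K by simp
  have nn: "(\<integral>\<^sup>+y. g y \<partial>N) =
      (\<Sum>d\<in>?D. \<integral>\<^sup>+s. ennreal (indicator {0..} s * mass (jump_flow c d a s)) * (\<integral>\<^sup>+\<omega>. g (s, \<omega>) \<partial>P (target c d a s)) \<partial>lborel)"
    if g[measurable]: "g \<in> borel_measurable (borel \<Otimes>\<^sub>M PA)" for g
  proof -
    have gK: "(\<lambda>x. \<integral>\<^sup>+y. g y \<partial>?K x) \<in> borel_measurable ?M"
      by (rule measurable_compose[OF K nn_integral_measurable_subprob_algebra[OF g]])
    have "(\<integral>\<^sup>+y. g y \<partial>N) = (\<integral>\<^sup>+x. \<integral>\<^sup>+y. g y \<partial>?K x \<partial>density ?M ?F)"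
      unfolding N_def by (rule nn_integral_bind[OF g K'])
    also have "\<dots> = (\<integral>\<^sup>+x. ?F x * (\<integral>\<^sup>+y. g y \<partial>?K x) \<partial>?M)"
      by (rule nn_integral_density[OF F gK])
    also have "\<dots> = (\<integral>\<^sup>+d. \<integral>\<^sup>+s. ?F (d, s) * (\<integral>\<^sup>+y. g y \<partial>?K (d, s)) \<partial>lborel \<partial>count_space ?D)"
      by (rule lborel.nn_integral_fst[symmetric]) (use gK in measurable)
    also have "\<dots> = (\<Sum>d\<in>?D. \<integral>\<^sup>+s. ?F (d, s) * (\<integral>\<^sup>+y. g y \<partial>?K (d, s)) \<partial>lborel)"
      by (rule nn_integral_count_space_finite) simp
    also have "\<dots> = (\<Sum>d\<in>?D. \<integral>\<^sup>+s. ennreal (indicator {0..} s * mass (jump_flow c d a s)) * (\<integral>\<^sup>+\<omega>. g (s, \<omega>) \<partial>P (target c d a s)) \<partial>lborel)"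
    proof (intro sum.cong refl nn_integral_cong)
      fix d s assume "d \<in> ?D"
      then have t: "target c d a s \<in> states X" by (intro target_states[OF a]) auto
      have "(\<integral>\<^sup>+y. g y \<partial>?K (d, s)) = (\<integral>\<^sup>+\<omega>. g (s, \<omega>) \<partial>P (target c d a s))"
        by (simp, subst nn_integral_distr) (auto simp: measurable_P[OF t])
      then show "?F (d, s) * (\<integral>\<^sup>+y. g y \<partial>?K (d, s)) = ennreal (indicator {0..} s * mass (jump_flow c d a s)) * (\<integral>\<^sup>+\<omega>. g (s, \<omega>) \<partial>P (target c d a s))"
        by simp
    qed
    finally show ?thesis .
  qed
  then show "g \<in> borel_measurable (borel \<Otimes>\<^sub>M PA) \<Longrightarrow> (\<integral>\<^sup>+y. g y \<partial>N) =
      (\<Sum>d\<in>?D. \<integral>\<^sup>+s. ennreal (indicator {0..} s * mass (jump_flow c d a s)) * (\<integral>\<^sup>+\<omega>. g (s, \<omega>) \<partial>P (target c d a s)) \<partial>lborel)" .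
  have fj[measurable]: "(\<lambda>\<omega>. (first_jump \<omega>, shift (first_jump \<omega>) \<omega>)) \<in> measurable PA (borel \<Otimes>\<^sub>M PA)"
  proof -
    have "(\<lambda>\<omega>. shift (first_jump \<omega>) \<omega>) \<in> measurable PA PA"
      by (rule measurable_shift) (auto simp: measurable_first_jump less_imp_le[OF first_jump(2)])
    then show ?thesis using measurable_first_jump by measurable
  qed
  interpret pa: prob_space "P a" by (rule prob_space_P[OF st])
  show "distr (P a) (borel \<Otimes>\<^sub>M PA) (\<lambda>\<omega>. (first_jump \<omega>, shift (first_jump \<omega>) \<omega>)) = N"
  proof (rule measure_eqI_atMost_Times)
    show "sets N = sets (borel \<Otimes>\<^sub>M PA)"
      unfolding N_def by (rule sets_bind[OF sets_kernel[OF K']]) (use ne in \<open>auto simp: space_pair_measure\<close>)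
    show "finite_measure (distr (P a) (borel \<Otimes>\<^sub>M PA) (\<lambda>\<omega>. (first_jump \<omega>, shift (first_jump \<omega>) \<omega>)))"
      by (intro prob_space.finite_measure pa.prob_space_distr) (simp add: measurable_P[OF st] fj)
    fix u :: real and B assume B[measurable]: "B \<in> sets PA"
    let ?S = "{\<omega> \<in> Omega X. first_jump \<omega> \<le> u \<and> shift (first_jump \<omega>) \<omega> \<in> B}"
    have L: "emeasure (distr (P a) (borel \<Otimes>\<^sub>M PA) (\<lambda>\<omega>. (first_jump \<omega>, shift (first_jump \<omega>) \<omega>))) ({..u} \<times> B)
       = ennreal (measure (P a) ?S)"
      by (subst emeasure_distr) (auto simp: measurable_P[OF st] fj pa.emeasure_eq_measure space_P[OF st] intro!: arg_cong[where f="measure (P a)"])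
    let ?g = "\<lambda>d s. indicator {0..u} s * (mass (jump_flow c d a s) * measure (P (target c d a s)) B)"
    have meas: "(\<lambda>s. measure (P (target c d a s)) B) \<in> borel_measurable borel" if "d \<in> ?D" for d
      using measurable_compose[OF measurable_prob_algebraD[OF measurable_compose[OF measurable_target[OF a, of d] P_kernel]] measurable_measure_subprob_algebra[OF B]] that
      by simp
    have nonneg: "0 \<le> ?g d s" if "d \<in> ?D" for d s
      using mass_jump_flow_nonneg[OF a, of s d] that by (auto simp: indicator_def)
    have "emeasure N ({..u} \<times> B) = (\<integral>\<^sup>+y. indicator ({..u} \<times> B) y \<partial>N)"
      using \<open>sets N = sets (borel \<Otimes>\<^sub>M PA)\<close> by (subst nn_integral_indicator) auto
    also have "\<dots> = (\<Sum>d\<in>?D. \<integral>\<^sup>+s. ennreal (indicator {0..} s * mass (jump_flow c d a s)) * (\<integral>\<^sup>+\<omega>. indicator ({..u} \<times> B) (s, \<omega>) \<partial>P (target c d a s)) \<partial>lborel)"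
      by (rule nn) measurable
    also have "\<dots> = (\<Sum>d\<in>?D. \<integral>\<^sup>+s. ennreal (?g d s) \<partial>lborel)"
    proof (intro sum.cong refl nn_integral_cong)
      fix d s assume d: "d \<in> ?D"
      then have t: "target c d a s \<in> states X" by (intro target_states[OF a]) auto
      interpret pt: prob_space "P (target c d a s)" by (rule prob_space_P[OF t])
      have "(\<integral>\<^sup>+\<omega>. indicator ({..u} \<times> B) (s, \<omega>) \<partial>P (target c d a s)) = (\<integral>\<^sup>+\<omega>. indicator {..u} s * indicator B \<omega> \<partial>P (target c d a s))"
        by (intro nn_integral_cong) (auto simp: indicator_def)
      also have "\<dots> = ennreal (indicator {..u} s * measure (P (target c d a s)) B)"
        using B by (subst nn_integral_cmult) (auto simp: measurable_P[OF t] sets_P[OF t] pt.emeasure_eq_measure indicator_def)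
      finally show "ennreal (indicator {0..} s * mass (jump_flow c d a s)) * (\<integral>\<^sup>+\<omega>. indicator ({..u} \<times> B) (s, \<omega>) \<partial>P (target c d a s)) = ennreal (?g d s)"
        using mass_jump_flow_nonneg[OF a, of s d] d by (auto simp: indicator_def ennreal_mult)
    qed
    also have "\<dots> = (\<integral>\<^sup>+s. (\<Sum>d\<in>?D. ennreal (?g d s)) \<partial>lborel)"
      by (rule nn_integral_sum[symmetric]) (use meas in measurable)
    also have "\<dots> = (\<integral>\<^sup>+s. ennreal (\<Sum>d\<in>?D. ?g d s) \<partial>lborel)"
      by (intro nn_integral_cong sum_ennreal nonneg)
    also have "\<dots> = ennreal (LINT s|lborel. (\<Sum>d\<in>?D. ?g d s))"
    proof (rule nn_integral_eq_integral)
      show "AE s in lborel. 0 \<le> (\<Sum>d\<in>?D. ?g d s)" by (intro AE_I2 sum_nonneg nonneg)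
      show "integrable lborel (\<lambda>s. \<Sum>d\<in>?D. ?g d s)"
      proof (rule Bochner_Integration.integrable_sum)
        fix d assume d: "d \<in> ?D"
        have "compact ((\<lambda>s. mass (jump_flow c d a s)) ` {0..u})"
          by (intro compact_continuous_image bounded_linear.continuous_on[OF bounded_linear_mass] continuous_on_jump_flow) simp
        then obtain Q where Q: "\<And>s. s \<in> {0..u} \<Longrightarrow> \<bar>mass (jump_flow c d a s)\<bar> \<le> Q"
          using compact_imp_bounded by (fastforce simp: bounded_iff)
        show "integrable lborel (?g d)"
        proof (rule integrableI_bounded_set[where A="{0..u}" and B=Q])
          show "AE s\<in>{0..u} in lborel. norm (?g d s) \<le> Q"
          proof (rule AE_I2, rule impI)
            fix s assume s: "s \<in> {0..u}"
            then have t: "target c d a s \<in> states X" using d by (intro target_states[OF a]) auto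
            have "\<bar>mass (jump_flow c d a s)\<bar> * measure (P (target c d a s)) B \<le> Q * 1"
              using Q[OF s] prob_space.prob_le_1[OF prob_space_P[OF t]] by (intro mult_mono) auto
            then show "norm (?g d s) \<le> Q" using s by (simp add: abs_mult)
          qed
        qed (use meas[OF d] in \<open>auto simp: emeasure_lborel_Icc_eq indicator_def\<close>)
      qed
    qed
    also have "(LINT s|lborel. (\<Sum>d\<in>?D. ?g d s)) = measure (P a) ?S"
    proof (cases "0 \<le> u")
      case True
      have "measure (P a) ?S = (LBINT s:{0..u}. exp (- (LBINT u:{0..s}. total_intensity X c (flow X u a))) *
               (\<Sum>d\<in>UNIV - {c}. intensity X c d (flow X s a) * measure (P (jump_target X c d (flow X s a))) B))"
        using orbit_process a True B unfolding orbit_process_def by blast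
      also have "\<dots> = (LINT s|lborel. (\<Sum>d\<in>?D. ?g d s))"
        unfolding set_lebesgue_integral_def[of lborel "{0..u}"]
      proof (rule Bochner_Integration.integral_cong[OF refl])
        fix s
        show "indicator {0..u} s *\<^sub>R (exp (- (LBINT u:{0..s}. total_intensity X c (flow X u a))) *
               (\<Sum>d\<in>UNIV - {c}. intensity X c d (flow X s a) * measure (P (jump_target X c d (flow X s a))) B)) = (\<Sum>d\<in>?D. ?g d s)"
        proof (cases "s \<in> {0..u}")
          case True
          then have s: "0 \<le> s" by simp
          have "mass (block_flow X s a) * (intensity X c d (flow X s a) * measure (P (jump_target X c d (flow X s a))) B)
             = mass (jump_flow c d a s) * measure (P (target c d a s)) B" if "d \<in> ?D" for d
            using mass_jump_flow_nonneg[OF a s, of d] that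
            unfolding mult.assoc[symmetric] mass_jump_flow[OF a s, symmetric] normalise_jump_flow[OF a s, symmetric]
            by (cases "mass (jump_flow c d a s) = 0") (auto simp: target_def s)
          then show ?thesis using True by (simp add: exp_total_intensity[OF a s] sum_distrib_left)
        qed simp
      qed
      finally show ?thesis by simp
    next
      case False
      then have "?S = {}" using first_jump(2) by fastforce
      then have "measure (P a) ?S = 0" by (simp only: measure_empty)
      moreover have "(LINT s|lborel. (\<Sum>d\<in>?D. ?g d s)) = 0" using False by simp
      ultimately show ?thesis by simp
    qed
    finally show "emeasure (distr (P a) (borel \<Otimes>\<^sub>M PA) (\<lambda>\<omega>. (first_jump \<omega>, shift (first_jump \<omega>) \<omega>))) ({..u} \<times> B) = emeasure N ({..u} \<times> B)"
      unfolding L by simp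
  qed simp
qed

lemma another_cell: "UNIV - {c :: 'i + 'j} \<noteq> {}"
proof (cases c)
  case (Inl i) then have "Inr undefined \<in> UNIV - {c}" by simp
  then show ?thesis by blast
next
  case (Inr j) then have "Inl undefined \<in> UNIV - {c}" by simp
  then show ?thesis by blast
qed

lemma measurable_target_integral:
  assumes "a \<in> cell X c" "d \<noteq> c" "(\<lambda>(s, \<omega>). G s \<omega>) \<in> borel_measurable (borel \<Otimes>\<^sub>M PA)"
  shows "(\<lambda>s. LINT \<omega>|P (target c d a s). G s \<omega> :: real) \<in> borel_measurable borel"
  by (rule measurable_integral_P[OF assms(3) measurable_target[OF assms(1,2)]])

lemma jump_flow_bounded: "\<exists>Q\<ge>0. \<forall>s\<in>{0..t}. \<bar>mass (jump_flow c d a s)\<bar> \<le> Q"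
proof -
  have "compact ((\<lambda>s. mass (jump_flow c d a s)) ` {0..t})"
    by (intro compact_continuous_image bounded_linear.continuous_on[OF bounded_linear_mass] continuous_on_jump_flow) simp
  then obtain Q where Q: "\<And>x. x \<in> (\<lambda>s. mass (jump_flow c d a s)) ` {0..t} \<Longrightarrow> norm x \<le> Q"
    using compact_imp_bounded bounded_iff by metis
  then show ?thesis by (intro exI[of _ "max 0 Q"]) (force simp: max_def)
qed

lemma integrable_jump_term:
  assumes a: "a \<in> cell X c" and d: "d \<noteq> c" and T[measurable]: "T \<in> borel_measurable borel"
    and B: "\<And>s. 0 \<le> s \<Longrightarrow> s \<le> t \<Longrightarrow> \<bar>T s\<bar> \<le> B"
  shows "integrable lborel (\<lambda>s. indicator {0..t} s * (mass (jump_flow c d a s) * T s :: real))"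
proof -
  obtain Q where Q: "0 \<le> Q" "\<forall>s\<in>{0..t}. \<bar>mass (jump_flow c d a s)\<bar> \<le> Q" using jump_flow_bounded by blast
  show ?thesis
  proof (rule integrableI_bounded_set[where A="{0..t}" and B="Q * B"])
    show "AE s\<in>{0..t} in lborel. norm (indicator {0..t} s * (mass (jump_flow c d a s) * T s)) \<le> Q * B"
    proof (rule AE_I2, rule impI)
      fix s assume s: "s \<in> {0..t}"
      have "\<bar>mass (jump_flow c d a s)\<bar> * \<bar>T s\<bar> \<le> Q * B" using Q s B[of s] by (intro mult_mono) auto
      then show "norm (indicator {0..t} s * (mass (jump_flow c d a s) * T s)) \<le> Q * B" using s by (simp add: abs_mult)
    qed
  qed (auto simp: emeasure_lborel_Icc_eq indicator_def)
qed

lemma measurable_first_jump_pair: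
  "(\<lambda>\<omega>. (first_jump \<omega>, shift (first_jump \<omega>) \<omega>)) \<in> measurable PA (borel \<Otimes>\<^sub>M PA)"
proof -
  have "(\<lambda>\<omega>. shift (first_jump \<omega>) \<omega>) \<in> measurable PA PA"
    by (rule measurable_shift) (auto simp: measurable_first_jump less_imp_le[OF first_jump(2)])
  then show ?thesis using measurable_first_jump by measurable
qed

lemma measurable_at_first_jump:
  assumes G: "(\<lambda>(s, \<omega>). G s \<omega> :: real) \<in> borel_measurable (borel \<Otimes>\<^sub>M PA)"
  shows "(\<lambda>\<omega>. if first_jump \<omega> \<le> t then G (first_jump \<omega>) (shift (first_jump \<omega>) \<omega>) else 0) \<in> borel_measurable PA"
proof -
  note [measurable] = measurable_first_jump
  have [measurable]: "(\<lambda>\<omega>. G (first_jump \<omega>) (shift (first_jump \<omega>) \<omega>)) \<in> borel_measurable PA"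
    using measurable_compose[OF measurable_first_jump_pair G] by simp
  show ?thesis by measurable
qed

lemma first_jump_integral_nonneg:
  assumes a: "a \<in> cell X c" and t: "0 \<le> t" and G: "(\<lambda>(s, \<omega>). G s \<omega> :: real) \<in> borel_measurable (borel \<Otimes>\<^sub>M PA)"
    and B: "\<And>s \<omega>. \<omega> \<in> Omega X \<Longrightarrow> 0 \<le> G s \<omega>" "\<And>s \<omega>. \<omega> \<in> Omega X \<Longrightarrow> G s \<omega> \<le> B"
  shows "(LINT \<omega>|P a. (if first_jump \<omega> \<le> t then G (first_jump \<omega>) (shift (first_jump \<omega>) \<omega>) else 0)) =
    (\<Sum>d\<in>UNIV - {c}. LINT s|lborel. indicator {0..t} s * (mass (jump_flow c d a s) * (LINT \<omega>|P (target c d a s). G s \<omega>)))"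
proof -
  let ?D = "UNIV - {c}"
  have st: "a \<in> states X" using a states_cell by auto
  define f where "f = (\<lambda>\<omega>. if first_jump \<omega> \<le> t then G (first_jump \<omega>) (shift (first_jump \<omega>) \<omega>) else 0)"
  have f: "f \<in> borel_measurable PA" unfolding f_def by (rule measurable_at_first_jump[OF G])
  have O: "shift (first_jump \<omega>) \<omega> \<in> Omega X" if "\<omega> \<in> Omega X" for \<omega>
    using first_jump(2)[OF that] by (intro shift_Omega that) simp
  have "0 \<le> B" using B[of "SOME \<omega>. \<omega> \<in> Omega X" 0] someI_ex[of "\<lambda>\<omega>. \<omega> \<in> Omega X"]
     prob_space.not_empty[OF prob_space_P[OF st]] space_P[OF st] by (metis (no_types, lifting) ex_in_conv order_trans)
  have f0: "0 \<le> f \<omega>" "\<bar>f \<omega>\<bar> \<le> B" if "\<omega> \<in> Omega X" for \<omega>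
    using B[OF O[OF that]] \<open>0 \<le> B\<close> by (auto simp: f_def)
  define T where "T = (\<lambda>d s. LINT \<omega>|P (target c d a s). G s \<omega>)"
  have cut: "(\<lambda>(s, \<omega>). ennreal (if s \<le> t then G s \<omega> else 0)) \<in> borel_measurable (borel \<Otimes>\<^sub>M PA)"
  proof -
    have [measurable]: "(\<lambda>y. G (fst y) (snd y)) \<in> borel_measurable (borel \<Otimes>\<^sub>M PA)" using G by (simp add: case_prod_beta')
    have "(\<lambda>y. ennreal (if fst y \<le> t then G (fst y) (snd y) else 0)) \<in> borel_measurable (borel \<Otimes>\<^sub>M PA)" by measurable
    then show ?thesis by (simp add: case_prod_beta')
  qed
  have Gs: "(\<lambda>\<omega>. G s \<omega>) \<in> borel_measurable PA" for s
    using measurable_compose[OF measurable_Pair1'[of s borel PA] G] by simp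
  have tg: "target c d a s \<in> states X" if "d \<in> ?D" for d s using that by (intro target_states[OF a]) auto
  have Tm: "T d \<in> borel_measurable borel" if "d \<in> ?D" for d
    using that unfolding T_def by (intro measurable_target_integral[OF a _ G]) auto
  have T0: "0 \<le> T d s" "\<bar>T d s\<bar> \<le> B" if "d \<in> ?D" for d s
  proof -
    show "\<bar>T d s\<bar> \<le> B" unfolding T_def using B by (intro integral_P_bound[OF tg[OF that]]) auto
    show "0 \<le> T d s" unfolding T_def using B(1) space_P[OF tg[OF that]] by (intro Bochner_Integration.integral_nonneg_AE AE_I2) auto
  qed
  let ?g = "\<lambda>d s. indicator {0..t} s * (mass (jump_flow c d a s) * T d s)"
  have gi: "integrable lborel (?g d)" if "d \<in> ?D" for d
    using that T0[OF that] by (intro integrable_jump_term[OF a _ Tm[OF that]]) auto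
  have g0: "0 \<le> ?g d s" if "d \<in> ?D" for d s
    using mass_jump_flow_nonneg[OF a, of s d] T0[OF that, of s] that by (auto simp: indicator_def)
  have "ennreal (LINT \<omega>|P a. f \<omega>) = (\<integral>\<^sup>+\<omega>. ennreal (f \<omega>) \<partial>P a)"
    using f0 by (intro nn_integral_eq_integral[symmetric] integrable_P[OF st f]) (auto simp: space_P[OF st])
  also have "\<dots> = (\<integral>\<^sup>+x. (\<lambda>(s, \<omega>). ennreal (if s \<le> t then G s \<omega> else 0)) (first_jump x, shift (first_jump x) x) \<partial>P a)"
    by (simp add: f_def)
  also have "\<dots> = (\<integral>\<^sup>+y. (\<lambda>(s, \<omega>). ennreal (if s \<le> t then G s \<omega> else 0)) y \<partial>distr (P a) (borel \<Otimes>\<^sub>M PA) (\<lambda>\<omega>. (first_jump \<omega>, shift (first_jump \<omega>) \<omega>)))"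
    by (rule nn_integral_distr[symmetric]) (simp_all add: measurable_P[OF st] measurable_first_jump_pair cut)
  also have "\<dots> = (\<Sum>d\<in>?D. \<integral>\<^sup>+s. ennreal (indicator {0..} s * mass (jump_flow c d a s)) *
       (\<integral>\<^sup>+\<omega>. (case (s, \<omega>) of (s, \<omega>) \<Rightarrow> ennreal (if s \<le> t then G s \<omega> else 0)) \<partial>P (target c d a s)) \<partial>lborel)"
    unfolding first_jump_law(1)[OF a another_cell]
  proof (rule first_jump_law(2)[OF a another_cell])
    show "(\<lambda>(s, \<omega>). ennreal (if s \<le> t then G s \<omega> else 0)) \<in> borel_measurable (borel \<Otimes>\<^sub>M PA)"
      by (rule cut)
  qed
  also have "\<dots> = (\<Sum>d\<in>?D. \<integral>\<^sup>+s. ennreal (?g d s) \<partial>lborel)"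
  proof (intro sum.cong refl nn_integral_cong)
    fix d s assume d: "d \<in> ?D"
    have "(\<integral>\<^sup>+\<omega>. ennreal (G s \<omega>) \<partial>P (target c d a s)) = ennreal (T d s)"
      unfolding T_def using B space_P[OF tg[OF d]]
      by (intro nn_integral_eq_integral integrable_P[OF tg[OF d] Gs, where B=B]) auto
    then show "ennreal (indicator {0..} s * mass (jump_flow c d a s)) *
       (\<integral>\<^sup>+\<omega>. (case (s, \<omega>) of (s, \<omega>) \<Rightarrow> ennreal (if s \<le> t then G s \<omega> else 0)) \<partial>P (target c d a s)) = ennreal (?g d s)"
      using mass_jump_flow_nonneg[OF a, of s d] d T0[OF d, of s] by (auto simp: indicator_def ennreal_mult)
  qed
  also have "\<dots> = (\<Sum>d\<in>?D. ennreal (LINT s|lborel. ?g d s))"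
    using g0 gi by (intro sum.cong refl nn_integral_eq_integral) auto
  also have "\<dots> = ennreal (\<Sum>d\<in>?D. LINT s|lborel. ?g d s)"
    using g0 by (intro sum_ennreal Bochner_Integration.integral_nonneg_AE) auto
  finally have "ennreal (LINT \<omega>|P a. f \<omega>) = ennreal (\<Sum>d\<in>?D. LINT s|lborel. ?g d s)" .
  moreover have "0 \<le> (LINT \<omega>|P a. f \<omega>)" using f0 space_P[OF st] by (intro Bochner_Integration.integral_nonneg_AE AE_I2) auto
  moreover have "0 \<le> (\<Sum>d\<in>?D. LINT s|lborel. ?g d s)" using g0 by (intro sum_nonneg Bochner_Integration.integral_nonneg_AE) auto
  ultimately show ?thesis by (simp add: f_def T_def)
qed

lemma first_jump_integral:
  assumes a: "a \<in> cell X c" and t: "0 \<le> t" and G: "(\<lambda>(s, \<omega>). G s \<omega> :: real) \<in> borel_measurable (borel \<Otimes>\<^sub>M PA)"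
    and B: "\<And>s \<omega>. \<omega> \<in> Omega X \<Longrightarrow> \<bar>G s \<omega>\<bar> \<le> B"
  shows "(LINT \<omega>|P a. (if first_jump \<omega> \<le> t then G (first_jump \<omega>) (shift (first_jump \<omega>) \<omega>) else 0)) =
    (\<Sum>d\<in>UNIV - {c}. LINT s|lborel. indicator {0..t} s * (mass (jump_flow c d a s) * (LINT \<omega>|P (target c d a s). G s \<omega>)))"
proof -
  let ?D = "UNIV - {c}"
  have st: "a \<in> states X" using a states_cell by auto
  have GB: "(\<lambda>(s, \<omega>). G s \<omega> + B) \<in> borel_measurable (borel \<Otimes>\<^sub>M PA)"
    using borel_measurable_add[OF G borel_measurable_const[of B]] by (simp add: case_prod_beta')
  have CB: "(\<lambda>(s, \<omega>). B) \<in> borel_measurable ((borel :: real measure) \<Otimes>\<^sub>M PA)" by simp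
  obtain \<omega>0 where w0: "\<omega>0 \<in> Omega X" using prob_space.not_empty[OF prob_space_P[OF st]] space_P[OF st] by auto
  have B0: "0 \<le> B" using B[OF w0, of 0] by linarith
  note 1 = first_jump_integral_nonneg[OF a t GB, where B="2 * B"]
  note 2 = first_jump_integral_nonneg[OF a t CB, where B=B]
  have Gs: "(\<lambda>\<omega>. G s \<omega>) \<in> borel_measurable PA" for s
    using measurable_compose[OF measurable_Pair1'[of s borel PA] G] by simp
  have O: "shift (first_jump \<omega>) \<omega> \<in> Omega X" if "\<omega> \<in> Omega X" for \<omega>
    using first_jump(2)[OF that] by (intro shift_Omega that) simp
  have b1: "\<bar>G s \<omega> + B\<bar> \<le> 2 * B" "0 \<le> G s \<omega> + B" "G s \<omega> + B \<le> 2 * B" if "\<omega> \<in> Omega X" for s \<omega> using B[OF that, of s] by linarith+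
  have tg: "target c d a s \<in> states X" if "d \<in> ?D" for d s using that by (intro target_states[OF a]) auto
  have "(LINT \<omega>|P a. (if first_jump \<omega> \<le> t then G (first_jump \<omega>) (shift (first_jump \<omega>) \<omega>) else 0)) =
      (LINT \<omega>|P a. (if first_jump \<omega> \<le> t then G (first_jump \<omega>) (shift (first_jump \<omega>) \<omega>) + B else 0) - (if first_jump \<omega> \<le> t then B else 0))"
    by (intro Bochner_Integration.integral_cong) auto
  also have "\<dots> = (LINT \<omega>|P a. (if first_jump \<omega> \<le> t then G (first_jump \<omega>) (shift (first_jump \<omega>) \<omega>) + B else 0)) - (LINT \<omega>|P a. (if first_jump \<omega> \<le> t then B else 0))"
  proof (rule Bochner_Integration.integral_diff)
    show "integrable (P a) (\<lambda>\<omega>. if first_jump \<omega> \<le> t then G (first_jump \<omega>) (shift (first_jump \<omega>) \<omega>) + B else 0)"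
      using b1[OF O] B0 by (intro integrable_P[OF st measurable_at_first_jump[OF GB], where B="2*B"]) auto
    show "integrable (P a) (\<lambda>\<omega>. if first_jump \<omega> \<le> t then B else 0)"
      using B0 by (intro integrable_P[OF st measurable_at_first_jump[OF CB], where B=B]) auto
  qed
  also have "\<dots> = (\<Sum>d\<in>?D. (LINT s|lborel. indicator {0..t} s * (mass (jump_flow c d a s) * (LINT \<omega>|P (target c d a s). G s \<omega> + B)))
       - (LINT s|lborel. indicator {0..t} s * (mass (jump_flow c d a s) * (LINT \<omega>|P (target c d a s). B))))"
    using 1 2 b1 B0 by (simp add: sum_subtractf)
  also have "\<dots> = (\<Sum>d\<in>?D. LINT s|lborel. indicator {0..t} s * (mass (jump_flow c d a s) * (LINT \<omega>|P (target c d a s). G s \<omega>)))"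
  proof (rule sum.cong[OF refl])
    fix d assume d: "d \<in> ?D"
    then have dc: "d \<noteq> c" by simp
    have "(LINT s|lborel. indicator {0..t} s * (mass (jump_flow c d a s) * (LINT \<omega>|P (target c d a s). G s \<omega> + B)))
       - (LINT s|lborel. indicator {0..t} s * (mass (jump_flow c d a s) * (LINT \<omega>|P (target c d a s). B)))
     = (LINT s|lborel. indicator {0..t} s * (mass (jump_flow c d a s) * (LINT \<omega>|P (target c d a s). G s \<omega> + B))
       - indicator {0..t} s * (mass (jump_flow c d a s) * (LINT \<omega>|P (target c d a s). B)))"
    proof (rule Bochner_Integration.integral_diff[symmetric])
      show "integrable lborel (\<lambda>s. indicator {0..t} s * (mass (jump_flow c d a s) * (LINT \<omega>|P (target c d a s). G s \<omega> + B)))"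
        by (rule integrable_jump_term[OF a dc measurable_target_integral[OF a dc GB], where B="2 * B"])
          (rule integral_P_bound[OF tg[OF d] b1(1)])
      show "integrable lborel (\<lambda>s. indicator {0..t} s * (mass (jump_flow c d a s) * (LINT \<omega>|P (target c d a s). B)))"
        by (rule integrable_jump_term[OF a dc measurable_target_integral[OF a dc CB], where B=B])
          (rule integral_P_bound[OF tg[OF d]], use B0 in simp)
    qed
    also have "\<dots> = (LINT s|lborel. indicator {0..t} s * (mass (jump_flow c d a s) * (LINT \<omega>|P (target c d a s). G s \<omega>)))"
    proof (rule Bochner_Integration.integral_cong[OF refl])
      fix s
      interpret pt: prob_space "P (target c d a s)" by (rule prob_space_P[OF tg[OF d]])
      have "(LINT \<omega>|P (target c d a s). G s \<omega> + B) = (LINT \<omega>|P (target c d a s). G s \<omega>) + B"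
        using integrable_P[OF tg[OF d] Gs B] by (subst Bochner_Integration.integral_add) (auto simp: pt.prob_space)
      then show "indicator {0..t} s * (mass (jump_flow c d a s) * (LINT \<omega>|P (target c d a s). G s \<omega> + B))
       - indicator {0..t} s * (mass (jump_flow c d a s) * (LINT \<omega>|P (target c d a s). B))
       = indicator {0..t} s * (mass (jump_flow c d a s) * (LINT \<omega>|P (target c d a s). G s \<omega>))"
        by (simp add: pt.prob_space algebra_simps)
    qed
    finally show "(LINT s|lborel. indicator {0..t} s * (mass (jump_flow c d a s) * (LINT \<omega>|P (target c d a s). G s \<omega> + B)))
       - (LINT s|lborel. indicator {0..t} s * (mass (jump_flow c d a s) * (LINT \<omega>|P (target c d a s). B)))
       = (LINT s|lborel. indicator {0..t} s * (mass (jump_flow c d a s) * (LINT \<omega>|P (target c d a s). G s \<omega>)))" .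
  qed
  finally show ?thesis .
qed

lemma prob_no_jump: assumes a: "a \<in> cell X c" and t: "0 \<le> t"
  shows "measure (P a) {\<omega> \<in> Omega X. t < first_jump \<omega>} = mass (block_flow X t a)"
proof -
  have st: "a \<in> states X" using a states_cell by auto
  interpret pa: prob_space "P a" by (rule prob_space_P[OF st])
  have E: "{\<omega> \<in> Omega X. t < first_jump \<omega>} \<in> sets (P a)"
    using first_jump_gr_sets[of PA t] measurable_eval t by (simp add: sets_P[OF st])
  have "(LINT \<omega>|P a. (if first_jump \<omega> \<le> t then 1 else 0 :: real)) = (\<Sum>d\<in>UNIV - {c}. LINT s|lborel. indicator {0..t} s * (mass (jump_flow c d a s) * (LINT \<omega>|P (target c d a s). 1)))"
    by (rule first_jump_integral[OF a t, where G="\<lambda>_ _. 1" and B=1]) auto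
  also have "\<dots> = (\<Sum>d\<in>UNIV - {c}. LINT s|lborel. indicator {0..t} s * (mass (jump_flow c d a s) * 1))"
    by (intro sum.cong refl Bochner_Integration.integral_cong)
      (auto simp: prob_space.prob_space[OF prob_space_P[OF target_states[OF a]]])
  also have "\<dots> = (LINT s|lborel. (\<Sum>d\<in>UNIV - {c}. indicator {0..t} s * (mass (jump_flow c d a s) * 1)))"
    by (rule Bochner_Integration.integral_sum[symmetric]) (rule integrable_jump_term[OF a, where B=1], auto)
  also have "\<dots> = (LINT s|lborel. indicator {0..t} s *\<^sub>R (\<Sum>d\<in>UNIV - {c}. mass (jump_flow c d a s)))"
    by (simp add: sum_distrib_left)
  also have "\<dots> = - mass (block_flow X t a) - (- mass (block_flow X 0 a))"
  proof (rule integral_FTC_atLeastAtMost[OF t])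
    show "continuous_on {0..t} (\<lambda>s. \<Sum>d\<in>UNIV - {c}. mass (jump_flow c d a s))"
      by (intro continuous_on_sum bounded_linear.continuous_on[OF bounded_linear_mass] continuous_on_jump_flow)
    fix s
    have "((\<lambda>s. - mass (block_flow X s a)) has_real_derivative - (- (\<Sum>d\<in>UNIV - {c}. mass (jump_flow c d a s)))) (at s within {0..t})"
      by (intro DERIV_minus mass_block_flow_deriv[OF a])
    then show "((\<lambda>s. - mass (block_flow X s a)) has_vector_derivative (\<Sum>d\<in>UNIV - {c}. mass (jump_flow c d a s))) (at s within {0..t})"
      by (simp add: has_real_derivative_iff_has_vector_derivative)
  qed
  finally have 1: "(LINT \<omega>|P a. (if first_jump \<omega> \<le> t then 1 else 0 :: real)) = 1 - mass (block_flow X t a)"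
    using mass_states[OF st] by simp
  have "measure (P a) {\<omega> \<in> Omega X. t < first_jump \<omega>} = (LINT \<omega>|P a. indicator {\<omega> \<in> Omega X. t < first_jump \<omega>} \<omega>)"
    using E by simp
  also have "\<dots> = (LINT \<omega>|P a. 1 - (if first_jump \<omega> \<le> t then 1 else 0 :: real))"
    by (intro Bochner_Integration.integral_cong) (auto simp: space_P[OF st] indicator_def)
  also have "\<dots> = 1 - (LINT \<omega>|P a. (if first_jump \<omega> \<le> t then 1 else 0 :: real))"
    using integrable_P[OF st measurable_at_first_jump[where G="\<lambda>_ _. 1" and t=t], of 1]
    by (subst Bochner_Integration.integral_diff) (auto simp: pa.prob_space)
  finally show ?thesis using 1 by simp
qed

text \<open>The absence of jumps until \<open>t\<close> is an event of the past at \<open>t\<close>, and on this event the state at \<open>t\<close> is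
  deterministic; so the Markov property applies with a fixed state.\<close>

lemma no_jump_integral:
  assumes a: "a \<in> cell X c" and t: "0 \<le> t" and H: "H \<in> borel_measurable PA"
  shows "(LINT \<omega>|P a. (if t < first_jump \<omega> then H (shift t \<omega>) else 0 :: real)) =
     mass (block_flow X t a) * (LINT \<omega>|P (flow X t a). H \<omega>)"
proof -
  have st: "a \<in> states X" using a states_cell by auto
  have fs: "flow X t a \<in> states X" by (rule flow_states[OF st t])
  interpret pa: prob_space "P a" by (rule prob_space_P[OF st])
  interpret pf: prob_space "P (flow X t a)" by (rule prob_space_P[OF fs])
  define E where "E = {\<omega> \<in> Omega X. t < first_jump \<omega>}"
  have E[measurable]: "E \<in> sets PA"
    using first_jump_gr_sets[of PA t] measurable_eval t by (simp add: E_def)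
  have [measurable]: "shift t \<in> measurable PA PA"
    using measurable_shift[of "\<lambda>_. t" PA "\<lambda>\<omega>. \<omega>"] t by simp
  note [measurable_cong] = sets_P[OF st] sets_P[OF fs]
  let ?m = "measure (P a) E"
  have pE: "?m = mass (block_flow X t a)" unfolding E_def by (rule prob_no_jump[OF a t])
  have eq: "distr (density (P a) (\<lambda>\<omega>. ennreal (indicator E \<omega>))) PA (shift t) = density (P (flow X t a)) (\<lambda>_. ennreal ?m)"
  proof (rule measure_eqI)
    fix B assume "B \<in> sets (distr (density (P a) (\<lambda>\<omega>. ennreal (indicator E \<omega>))) PA (shift t))"
    then have B[measurable]: "B \<in> sets PA" by simp
    have "measure (P a) {\<omega> \<in> E. shift t \<omega> \<in> B} = (LINT \<omega>|P a. indicator E \<omega> * measure (P (\<omega> t)) B)"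
      using orbit_process st t B first_jump_gr_past[OF t] unfolding orbit_process_def E_def by blast
    also have "\<dots> = (LINT \<omega>|P a. indicator E \<omega> * measure (P (flow X t a)) B)"
    proof (rule integral_cong_AE)
      have "(\<lambda>\<omega>. \<omega> t) \<in> measurable PA (restrict_space borel (states X))"
        using measurable_eval[OF t] path_states t by (intro measurable_restrict_space2) auto
      from measurable_compose[OF measurable_prob_algebraD[OF measurable_compose[OF this P_kernel]] measurable_measure_subprob_algebra[OF B]]
      have [measurable]: "(\<lambda>\<omega>. measure (P (\<omega> t)) B) \<in> borel_measurable PA" .
      show "(\<lambda>\<omega>. indicator E \<omega> * measure (P (\<omega> t)) B) \<in> borel_measurable (P a)"
        "(\<lambda>\<omega>. indicator E \<omega> * measure (P (flow X t a)) B) \<in> borel_measurable (P a)" by measurable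
      show "AE \<omega> in P a. indicator E \<omega> * measure (P (\<omega> t)) B = indicator E \<omega> * measure (P (flow X t a)) B"
        using AE_start[OF st]
      proof eventually_elim
        fix \<omega> :: "('p, 'm) path" assume "\<omega> 0 = a"
        then show "indicator E \<omega> * measure (P (\<omega> t)) B = indicator E \<omega> * measure (P (flow X t a)) B"
          using before_first_jump[of \<omega> t] t by (auto simp: E_def indicator_def)
      qed
    qed
    also have "\<dots> = ?m * measure (P (flow X t a)) B" using E by (simp add: sets_P[OF st])
    finally have m: "measure (P a) {\<omega> \<in> E. shift t \<omega> \<in> B} = ?m * measure (P (flow X t a)) B" .
    have "emeasure (distr (density (P a) (\<lambda>\<omega>. ennreal (indicator E \<omega>))) PA (shift t)) B
      = (\<integral>\<^sup>+\<omega>. ennreal (indicator E \<omega>) * indicator (shift t -` B \<inter> Omega X) \<omega> \<partial>P a)"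
    proof -
      have "shift t -` B \<inter> Omega X \<in> sets PA" using measurable_sets[of "shift t" PA PA B] by simp
      then show ?thesis by (subst emeasure_distr) (auto simp: emeasure_density space_P[OF st] sets_P[OF st])
    qed
    also have "\<dots> = (\<integral>\<^sup>+\<omega>. indicator {\<omega> \<in> E. shift t \<omega> \<in> B} \<omega> \<partial>P a)"
      by (intro nn_integral_cong) (auto simp: indicator_def E_def)
    also have "\<dots> = emeasure (P a) {\<omega> \<in> E. shift t \<omega> \<in> B}"
    proof (rule nn_integral_indicator)
      have "{\<omega> \<in> E. shift t \<omega> \<in> B} = E \<inter> (shift t -` B \<inter> space PA)" by (auto simp: E_def)
      also have "\<dots> \<in> sets PA" by measurable
      finally show "{\<omega> \<in> E. shift t \<omega> \<in> B} \<in> sets (P a)" by (simp add: sets_P[OF st])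
    qed
    also have "\<dots> = ennreal (?m * measure (P (flow X t a)) B)" by (simp add: pa.emeasure_eq_measure m)
    also have "\<dots> = emeasure (density (P (flow X t a)) (\<lambda>_. ennreal ?m)) B"
      using B by (subst emeasure_density) (auto simp: sets_P[OF fs] nn_integral_cmult pf.emeasure_eq_measure ennreal_mult)
    finally show "emeasure (distr (density (P a) (\<lambda>\<omega>. ennreal (indicator E \<omega>))) PA (shift t)) B = emeasure (density (P (flow X t a)) (\<lambda>_. ennreal ?m)) B" .
  qed (simp add: sets_P[OF fs])
  have "(LINT \<omega>|P a. (if t < first_jump \<omega> then H (shift t \<omega>) else 0 :: real)) = (LINT \<omega>|P a. indicator E \<omega> *\<^sub>R H (shift t \<omega>))"
    by (intro Bochner_Integration.integral_cong) (auto simp: space_P[OF st] E_def indicator_def)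
  also have "\<dots> = (LINT \<omega>|density (P a) (\<lambda>\<omega>. ennreal (indicator E \<omega>)). H (shift t \<omega>))"
    by (subst integral_density) (auto intro!: measurable_compose[OF _ H] simp: measurable_P[OF st])
  also have "\<dots> = (LINT \<omega>|distr (density (P a) (\<lambda>\<omega>. ennreal (indicator E \<omega>))) PA (shift t). H \<omega>)"
    by (subst integral_distr) (auto simp: H measurable_P[OF st])
  also have "\<dots> = (LINT \<omega>|P (flow X t a). ?m *\<^sub>R H \<omega>)"
    unfolding eq by (subst integral_density) (auto simp: H measurable_P[OF fs])
  finally show ?thesis by (simp add: pE)
qed

end

section \<open>The law of the first change of side\<close>

lemma compact_image_bound:
  fixes f :: "'a::topological_space \<Rightarrow> 'b::real_normed_vector"
  assumes "compact S" "continuous_on S f"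
  shows "\<exists>Q\<ge>0. \<forall>x\<in>S. norm (f x) \<le> Q"
proof -
  have "bounded (f ` S)" by (intro compact_imp_bounded compact_continuous_image assms)
  then obtain Q where "\<forall>y\<in>f ` S. norm y \<le> Q" unfolding bounded_iff by blast
  then show ?thesis by (intro exI[of _ "max 0 Q"]) (simp add: le_max_iff_disj)
qed

lemma continuous_on_row_exp:
  assumes "continuous_on S f" "continuous_on S g"
  shows "continuous_on S (\<lambda>x. f x v* mat_exp (g x *\<^sub>R A))"
proof (rule bounded_bilinear.continuous_on[OF vm_bilinear assms(1)])
  show "continuous_on S (\<lambda>x. mat_exp (g x *\<^sub>R A))"
    using continuous_on_compose2[OF continuous_on_mat_exp[of UNIV A] assms(2)] by simp
qed

lemma continuous_on_side_flow2:
  assumes "continuous_on S f" "continuous_on S g"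
  shows "continuous_on S (\<lambda>x. side_flow X (g x) (f x))"
  unfolding side_flow_def
  by (intro continuous_on_Pair continuous_on_row_exp continuous_on_fst continuous_on_snd assms)

lemma continuous_on_block_flow2:
  assumes "continuous_on S f" "continuous_on S g"
  shows "continuous_on S (\<lambda>x. block_flow X (g x) (f x))"
  unfolding block_flow_def
  by (intro continuous_on_Pair continuous_on_row_exp continuous_on_fst continuous_on_snd assms)

lemma measurable_side_flow:
  assumes [measurable]: "f \<in> borel_measurable M" "g \<in> borel_measurable M"
  shows "(\<lambda>x. side_flow X (g x) (f x)) \<in> borel_measurable M"
proof -
  have 1: "(\<lambda>p. side_flow X (fst p) (snd p)) \<in> borel_measurable borel"
    by (intro borel_measurable_continuous_onI continuous_on_side_flow2 continuous_intros)
  have "(\<lambda>x. (g x, f x)) \<in> borel_measurable M" by measurable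
  from measurable_compose[OF this 1] show ?thesis by simp
qed

lemma row_exp_bound:
  fixes A :: "real^'n::finite^'n"
  shows "\<exists>L\<ge>0. \<forall>r\<in>{0..t}. \<forall>x. norm (x v* mat_exp (r *\<^sub>R A)) \<le> L * norm x"
proof -
  obtain K where K: "K > 0" "\<And>(x :: real^'n) (A :: real^'n^'n). norm (x v* A) \<le> norm x * norm A * K"
    using bounded_bilinear.pos_bounded[OF vm_bilinear] by blast
  obtain Q where Q: "0 \<le> Q" "\<forall>r\<in>{0..t}. norm (mat_exp (r *\<^sub>R A)) \<le> Q"
    using compact_image_bound[OF compact_Icc continuous_on_mat_exp] by blast
  show ?thesis
  proof (intro exI[of _ "max 0 Q * K"] conjI ballI allI)
    fix r and x :: "real^'n" assume "r \<in> {0..t}"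
    then have "norm (mat_exp (r *\<^sub>R A)) \<le> max 0 Q" using Q by auto
    then have "norm x * norm (mat_exp (r *\<^sub>R A)) * K \<le> norm x * max 0 Q * K"
      using K(1) by (intro mult_right_mono mult_left_mono) auto
    then show "norm (x v* mat_exp (r *\<^sub>R A)) \<le> max 0 Q * K * norm x" using K(2)[of x "mat_exp (r *\<^sub>R A)"] by (simp add: ac_simps)
  qed (use K in simp)
qed

lemma side_flow_bound:
  fixes X :: "('p::finite, 'm::finite, 'i, 'j) rap_data"
  shows "\<exists>L\<ge>0. \<forall>r\<in>{0..t}. \<forall>a. norm (side_flow X r a) \<le> L * norm a"
proof -
  obtain L1 L2 where L: "L1 \<ge> 0" "\<forall>r\<in>{0..t}. \<forall>x. norm (x v* mat_exp (r *\<^sub>R Cp X)) \<le> L1 * norm x"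
     "L2 \<ge> 0" "\<forall>r\<in>{0..t}. \<forall>x. norm (x v* mat_exp (r *\<^sub>R Cm X)) \<le> L2 * norm x"
    using row_exp_bound[of t "Cp X"] row_exp_bound[of t "Cm X"] by blast
  show ?thesis
  proof (intro exI[of _ "L1 + L2"] conjI ballI allI)
    fix r and a :: "('p, 'm) state" assume r: "r \<in> {0..t}"
    have "norm (side_flow X r a) \<le> norm (fst a v* mat_exp (r *\<^sub>R Cp X)) + norm (snd a v* mat_exp (r *\<^sub>R Cm X))"
      unfolding side_flow_def norm_Pair by (rule sqrt_sum_squares_le_sum) auto
    also have "\<dots> \<le> L1 * norm (fst a) + L2 * norm (snd a)" using L r by (intro add_mono) auto
    also have "\<dots> \<le> L1 * norm a + L2 * norm a"
      using L norm_fst_le[of "fst a" "snd a"] norm_snd_le[of "snd a" "fst a"] by (intro add_mono mult_left_mono) auto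
    finally show "norm (side_flow X r a) \<le> (L1 + L2) * norm a" by (simp add: algebra_simps)
  qed (use L in simp)
qed

lemma integral_power_diff: assumes "0 \<le> r"
  shows "(LINT s|lborel. indicator {0..r} s *\<^sub>R (r - s) ^ m) = (r ^ Suc m / real (Suc m) :: real)"
proof -
  have "(LINT s|lborel. indicator {0..r} s *\<^sub>R (r - s) ^ m) = - ((r - r) ^ Suc m / real (Suc m)) - (- ((r - 0) ^ Suc m / real (Suc m)))"
  proof (rule integral_FTC_atLeastAtMost[OF assms])
    fix s
    have "((\<lambda>s. - ((r - s) ^ Suc m / real (Suc m))) has_real_derivative (r - s) ^ m) (at s within {0..r})"
      by (rule derivative_eq_intros refl | simp)+
    then show "((\<lambda>s. - ((r - s) ^ Suc m / real (Suc m))) has_vector_derivative (r - s) ^ m) (at s within {0..r})"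
      by (simp add: has_real_derivative_iff_has_vector_derivative)
  qed (intro continuous_intros)
  then show ?thesis by simp
qed

lemma duhamel_integral: assumes "0 \<le> z"
  shows "(LINT s|lborel. indicator {0..z} s *\<^sub>R side_flow X (z - s) (off_block X (block_flow X s a))) = side_flow X z a - block_flow X z a"
proof -
  have "(LINT s|lborel. indicator {0..z} s *\<^sub>R side_flow X (z - s) (off_block X (block_flow X s a)))
     = - side_flow X (z - z) (block_flow X z a) - (- side_flow X (z - 0) (block_flow X 0 a))"
  proof (rule integral_FTC_atLeastAtMost[OF assms])
    fix s show "((\<lambda>s. - side_flow X (z - s) (block_flow X s a)) has_vector_derivative side_flow X (z - s) (off_block X (block_flow X s a))) (at s within {0..z})"
      using has_vector_derivative_minus[OF duhamel_derivative[of X z a s "{0..z}"]] by simp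
  qed (intro continuous_on_side_flow2 continuous_intros bounded_linear.continuous_on[OF bounded_linear_off_block] continuous_on_block_flow)
  then show ?thesis by simp
qed

lemma duhamel_integrable:
  "integrable lborel (\<lambda>s. indicator {0..z} s *\<^sub>R side_flow X (z - s) (off_block X (block_flow X s a)))"
proof -
  have "continuous_on {0..z} (\<lambda>s. side_flow X (z - s) (off_block X (block_flow X s a)))"
    by (intro continuous_on_side_flow2 continuous_intros bounded_linear.continuous_on[OF bounded_linear_off_block] continuous_on_block_flow)
  then show ?thesis using borel_integrable_compact[of "{0..z}" "\<lambda>s. side_flow X (z - s) (off_block X (block_flow X s a))"] by simp
qed

text \<open>Duhamel's formula tested against \<open>M\<close>: integrating first over the time \<open>s\<close> at which the block flow is
  left, and then over the time \<open>z\<close> of the reward, replaces the block flow by the side flow.\<close>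

lemma duhamel_weighted:
  fixes M :: "real \<Rightarrow> (real^'p::finite) \<times> (real^'m::finite)" and X :: "('p, 'm, 'i, 'j) rap_data"
    and a :: "('p, 'm) state"
  assumes M[measurable]: "M \<in> borel_measurable borel" and B: "\<And>z. 0 \<le> z \<Longrightarrow> z \<le> r \<Longrightarrow> norm (M z) \<le> B" and r: "0 \<le> r"
  defines "f \<equiv> \<lambda>s z. indicator {0..r} s * (indicator {s..r} z * (cross X (side_flow X (z - s) (off_block X (block_flow X s a))) \<bullet> M z))"
  shows "(LINT s|lborel. LINT z|lborel. f s z) = (LINT z|lborel. indicator {0..r} z * ((cross X (side_flow X z a) - cross X (block_flow X z a)) \<bullet> M z))"
    "integrable lborel (\<lambda>s. LINT z|lborel. f s z)"
proof -
  let ?F = "\<lambda>s z. cross X (side_flow X (z - s) (off_block X (block_flow X s a)))"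
  have cont: "continuous_on UNIV (\<lambda>x. ?F (fst x) (snd x))"
    by (intro bounded_linear.continuous_on[OF bounded_linear_cross] continuous_on_side_flow2 continuous_on_block_flow2
       bounded_linear.continuous_on[OF bounded_linear_off_block] continuous_intros)
  have Fm[measurable]: "(\<lambda>x. ?F (fst x) (snd x)) \<in> borel_measurable (borel \<Otimes>\<^sub>M borel)"
    using borel_measurable_continuous_onI[OF cont] by (simp add: borel_prod)
  obtain Q where Q0: "0 \<le> Q" and Q1: "\<forall>x\<in>{0..r} \<times> {0..r}. norm (?F (fst x) (snd x)) \<le> Q"
    using compact_image_bound[OF compact_Times[OF compact_Icc compact_Icc] continuous_on_subset[OF cont subset_UNIV]] by blast
  have Q: "norm (?F s z) \<le> Q" if "s \<in> {0..r}" "z \<in> {0..r}" for s z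
    using bspec[OF Q1, of "(s, z)"] that by simp
  have B0: "0 \<le> B" using B[of 0] r by (meson norm_ge_zero order_trans order_refl)
  have fm: "(\<lambda>x. f (fst x) (snd x)) \<in> borel_measurable (lborel \<Otimes>\<^sub>M lborel)"
  proof -
    have "(\<lambda>x. indicator {0..r} (fst x) * ((if fst x \<le> snd x \<and> snd x \<le> r then 1 else 0) * (?F (fst x) (snd x) \<bullet> M (snd x)))) \<in> borel_measurable (borel \<Otimes>\<^sub>M borel)"
      by measurable
    moreover have "(\<lambda>x. indicator {0..r} (fst x) * ((if fst x \<le> snd x \<and> snd x \<le> r then 1 else 0) * (?F (fst x) (snd x) \<bullet> M (snd x)))) = (\<lambda>x. f (fst x) (snd x))"
      by (auto simp: f_def fun_eq_iff indicator_def)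
    ultimately have "(\<lambda>x. f (fst x) (snd x)) \<in> borel_measurable (borel \<Otimes>\<^sub>M borel)" by simp
    then show ?thesis by (simp cong: measurable_cong_sets)
  qed
  have int: "integrable (lborel \<Otimes>\<^sub>M lborel) (\<lambda>x. f (fst x) (snd x))"
  proof (rule integrableI_bounded_set[where A="{0..r} \<times> {0..r}" and B="Q * B", OF _ fm])
    show "{0..r} \<times> {0..r} \<in> sets (lborel \<Otimes>\<^sub>M lborel)" by simp
    show "emeasure (lborel \<Otimes>\<^sub>M lborel) ({0..r} \<times> {0..r}) < \<infinity>"
      by (subst lborel.emeasure_pair_measure_Times) (auto simp: emeasure_lborel_Icc_eq ennreal_mult_less_top)
    show "AE x\<in>{0..r} \<times> {0..r} in lborel \<Otimes>\<^sub>M lborel. norm (f (fst x) (snd x)) \<le> Q * B"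
    proof (rule AE_I2, rule impI)
      fix x assume "x \<in> {0..r} \<times> {0..r}"
      then have x: "fst x \<in> {0..r}" "snd x \<in> {0..r}" by auto
      have "\<bar>?F (fst x) (snd x) \<bullet> M (snd x)\<bar> \<le> norm (?F (fst x) (snd x)) * norm (M (snd x))" by (rule Cauchy_Schwarz_ineq2)
      also have "\<dots> \<le> Q * B" using Q[OF x] B[of "snd x"] x Q0 by (intro mult_mono) auto
      finally show "norm (f (fst x) (snd x)) \<le> Q * B" using Q0 B0 by (auto simp: f_def indicator_def)
    qed
  qed (auto simp: f_def indicator_def)
  have int': "integrable (lborel \<Otimes>\<^sub>M lborel) (case_prod f)" using int by (simp add: case_prod_beta')
  show "integrable lborel (\<lambda>s. LINT z|lborel. f s z)" using lborel_pair.integrable_fst'[OF int'] by simp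
  have "(LINT s|lborel. LINT z|lborel. f s z) = (LINT z|lborel. LINT s|lborel. f s z)"
    by (rule lborel_pair.Fubini_integral[OF int', symmetric])
  also have "\<dots> = (LINT z|lborel. indicator {0..r} z * ((cross X (side_flow X z a) - cross X (block_flow X z a)) \<bullet> M z))"
  proof (rule Bochner_Integration.integral_cong[OF refl])
    fix z :: real
    show "(LINT s|lborel. f s z) = indicator {0..r} z * ((cross X (side_flow X z a) - cross X (block_flow X z a)) \<bullet> M z)"
    proof (cases "z \<in> {0..r}")
      case True
      let ?L = "\<lambda>x. cross X x \<bullet> M z"
      have bl: "bounded_linear ?L" by (rule bounded_linear_compose[OF bounded_linear_inner_left bounded_linear_cross])
      have "(LINT s|lborel. f s z) = (LINT s|lborel. ?L (indicator {0..z} s *\<^sub>R side_flow X (z - s) (off_block X (block_flow X s a))))"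
      proof (rule Bochner_Integration.integral_cong[OF refl])
        fix s show "f s z = ?L (indicator {0..z} s *\<^sub>R side_flow X (z - s) (off_block X (block_flow X s a)))"
          using True by (auto simp: f_def indicator_def linear_0[OF bounded_linear.linear[OF bounded_linear_cross]])
      qed
      also have "\<dots> = ?L (LINT s|lborel. indicator {0..z} s *\<^sub>R side_flow X (z - s) (off_block X (block_flow X s a)))"
        by (rule integral_bounded_linear[OF bl duhamel_integrable])
      also have "\<dots> = (cross X (side_flow X z a) - cross X (block_flow X z a)) \<bullet> M z"
        using True duhamel_integral[of z X a] by (simp add: linear_diff[OF bounded_linear.linear[OF bounded_linear_cross]])
      finally show ?thesis using True by simp
    next
      case False
      then have "f s z = 0" for s by (auto simp: f_def indicator_def)
      then show ?thesis using False by simp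
    qed
  qed
  finally show "(LINT s|lborel. LINT z|lborel. f s z) = (LINT z|lborel. indicator {0..r} z * ((cross X (side_flow X z a) - cross X (block_flow X z a)) \<bullet> M z))" .
qed

context rap_process
begin

lemma mass_block_flow_le_1: assumes "a \<in> cell X c" "0 \<le> s" shows "mass (block_flow X s a) \<le> 1"
proof -
  have "a \<in> states X" using assms(1) states_cell by blast
  from prob_space.prob_le_1[OF prob_space_P[OF this]] show ?thesis unfolding prob_no_jump[OF assms, symmetric] .
qed

lemma jump_rate_bound: "\<exists>L\<ge>0. \<forall>c d a s. a \<in> cell X c \<longrightarrow> d \<noteq> c \<longrightarrow> 0 \<le> s \<longrightarrow> \<bar>mass (jump_flow c d a s)\<bar> \<le> L"
proof -
  obtain S where S: "\<And>a. a \<in> states X \<Longrightarrow> norm a \<le> S" using bounded_states by (auto simp: bounded_iff)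
  have "\<forall>c d. \<exists>K\<ge>0. \<forall>a. norm (mass (jump_vec X c d a)) \<le> norm a * K"
    using bounded_linear.nonneg_bounded[OF bounded_linear_compose[OF bounded_linear_mass bounded_linear_jump_vec]] by blast
  then obtain K where K: "\<And>c d. 0 \<le> K c d" "\<And>c d a. norm (mass (jump_vec X c d a)) \<le> norm a * K c d" by metis
  show ?thesis
  proof (intro exI[of _ "\<Sum>c\<in>UNIV. \<Sum>d\<in>UNIV. max 0 S * K c d"] conjI allI impI)
    show "0 \<le> (\<Sum>c\<in>UNIV. \<Sum>d\<in>UNIV. max 0 S * K c d)" using K by (intro sum_nonneg) auto
    fix c d :: "'i + 'j" and a :: "('p, 'm) state" and s :: real assume a: "a \<in> cell X c" and "d \<noteq> c" and s: "0 \<le> s"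
    have f: "flow X s a \<in> states X" using flow_cell[OF a s] states_cell by auto
    have "\<bar>mass (jump_flow c d a s)\<bar> = mass (block_flow X s a) * \<bar>mass (jump_vec X c d (flow X s a))\<bar>"
    proof -
      have "a \<in> states X" using a states_cell by blast
      from mass_block_flow_pos[OF this s] show ?thesis by (subst mass_jump_flow[OF a s]) (simp add: abs_mult intensity_def)
    qed
    also have "\<dots> \<le> 1 * \<bar>mass (jump_vec X c d (flow X s a))\<bar>"
      using mass_block_flow_le_1[OF a s] by (intro mult_right_mono) auto
    also have "\<dots> \<le> norm (flow X s a) * K c d" using K(2)[of c d "flow X s a"] by simp
    also have "\<dots> \<le> max 0 S * K c d" using S[OF f] K by (intro mult_right_mono) auto
    also have "\<dots> \<le> (\<Sum>d\<in>UNIV. max 0 S * K c d)" using K by (intro member_le_sum) auto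
    also have "\<dots> \<le> (\<Sum>c\<in>UNIV. \<Sum>d\<in>UNIV. max 0 S * K c d)"
      using K by (intro member_le_sum[where f="\<lambda>c. \<Sum>d\<in>UNIV. max 0 S * K c d"]) (auto intro!: sum_nonneg)
    finally show "\<bar>mass (jump_flow c d a s)\<bar> \<le> (\<Sum>c\<in>UNIV. \<Sum>d\<in>UNIV. max 0 S * K c d)" .
  qed
qed

text \<open>Iterating the equation \<open>m\<close> times bounds its solution by a constant multiple of \<open>(N * L * r) ^ m / fact m\<close>.\<close>

lemma renewal_unique:
  fixes \<delta> :: "real \<Rightarrow> ('p, 'm) state \<Rightarrow> real"
  assumes bound: "\<And>r a. 0 \<le> r \<Longrightarrow> r \<le> t \<Longrightarrow> a \<in> side X b \<Longrightarrow> \<bar>\<delta> r a\<bar> \<le> B"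
    and meas: "\<And>r c d a. 0 \<le> r \<Longrightarrow> r \<le> t \<Longrightarrow> a \<in> cell X c \<Longrightarrow> isl c = b \<Longrightarrow> d \<noteq> c \<Longrightarrow> isl d = b \<Longrightarrow>
       integrable lborel (\<lambda>s. indicator {0..r} s * (mass (jump_flow c d a s) * \<delta> (r - s) (target c d a s)))"
    and eq: "\<And>r c a. 0 \<le> r \<Longrightarrow> r \<le> t \<Longrightarrow> a \<in> cell X c \<Longrightarrow> isl c = b \<Longrightarrow>
       \<delta> r a = (\<Sum>d\<in>{d. d \<noteq> c \<and> isl d = isl c}. LINT s|lborel. indicator {0..r} s * (mass (jump_flow c d a s) * \<delta> (r - s) (target c d a s)))"
    and r: "0 \<le> r" "r \<le> t" and a: "a \<in> side X b"
  shows "\<delta> r a = 0"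
proof -
  obtain L where L: "0 \<le> L" "\<And>c d a s. a \<in> cell X c \<Longrightarrow> d \<noteq> c \<Longrightarrow> 0 \<le> s \<Longrightarrow> \<bar>mass (jump_flow c d a s)\<bar> \<le> L"
    using jump_rate_bound by blast
  define N where "N = real (card (UNIV :: ('i + 'j) set))"
  have B0: "0 \<le> B" using bound[OF r a] by linarith
  have "\<bar>\<delta> r a\<bar> \<le> B * (N * L) ^ m * (r ^ m / fact m)" if "0 \<le> r" "r \<le> t" "a \<in> side X b" for m r a
    using that
  proof (induction m arbitrary: r a)
    case 0 then show ?case using bound by simp
  next
    case (Suc m)
    note r = Suc.prems(1,2)
    obtain c where c: "isl c = b" "a \<in> cell X c" using Suc.prems side_cell by auto
    let ?D = "{d. d \<noteq> c \<and> isl d = isl c}"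
    let ?q = "B * (N * L) ^ m / fact m"
    have q0: "0 \<le> ?q" using B0 L(1) by (simp add: N_def)
    have int: "integrable lborel (\<lambda>s. indicator {0..r} s *\<^sub>R (r - s) ^ m)"
      using borel_integrable_compact[of "{0..r}" "\<lambda>s. (r - s) ^ m"] by (simp add: continuous_intros)
    have each: "\<bar>LINT s|lborel. indicator {0..r} s * (mass (jump_flow c d a s) * \<delta> (r - s) (target c d a s))\<bar> \<le> L * ?q * (r ^ Suc m / real (Suc m))"
      if d: "d \<in> ?D" for d
    proof -
      have dd: "d \<noteq> c" "isl d = b" using d c by auto
      have i: "integrable lborel (\<lambda>s. indicator {0..r} s * (mass (jump_flow c d a s) * \<delta> (r - s) (target c d a s)))"
        by (rule meas[OF r c(2,1) dd])
      have "\<bar>LINT s|lborel. indicator {0..r} s * (mass (jump_flow c d a s) * \<delta> (r - s) (target c d a s))\<bar>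
          \<le> (LINT s|lborel. \<bar>indicator {0..r} s * (mass (jump_flow c d a s) * \<delta> (r - s) (target c d a s))\<bar>)"
        by (rule integral_abs_bound)
      also have "\<dots> \<le> (LINT s|lborel. (L * ?q) * (indicator {0..r} s *\<^sub>R (r - s) ^ m))"
      proof (rule integral_mono)
        show "integrable lborel (\<lambda>s. \<bar>indicator {0..r} s * (mass (jump_flow c d a s) * \<delta> (r - s) (target c d a s))\<bar>)"
          using i by (rule integrable_abs)
        show "integrable lborel (\<lambda>s. (L * ?q) * (indicator {0..r} s *\<^sub>R (r - s) ^ m))"
          using int by (rule integrable_mult_right)
        fix s :: real
        show "\<bar>indicator {0..r} s * (mass (jump_flow c d a s) * \<delta> (r - s) (target c d a s))\<bar> \<le> (L * ?q) * (indicator {0..r} s *\<^sub>R (r - s) ^ m)"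
        proof (cases "s \<in> {0..r} \<and> mass (jump_flow c d a s) \<noteq> 0")
          case True
          then have s: "0 \<le> s" "s \<le> r" by auto
          have "0 < mass (jump_flow c d a s)" using mass_jump_flow_nonneg[OF c(2) s(1) dd(1)] True by simp
          then have "target c d a s \<in> side X b" using target_cell(1)[OF c(2) dd(1) s(1)] dd(2) side_cell by auto
          then have "\<bar>\<delta> (r - s) (target c d a s)\<bar> \<le> B * (N * L) ^ m * ((r - s) ^ m / fact m)"
            using s r by (intro Suc.IH) auto
          then have "\<bar>mass (jump_flow c d a s)\<bar> * \<bar>\<delta> (r - s) (target c d a s)\<bar> \<le> L * (B * (N * L) ^ m * ((r - s) ^ m / fact m))"
            using L(2)[OF c(2) dd(1) s(1)] L(1) by (intro mult_mono) auto
          then show ?thesis using True by (simp add: abs_mult)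
        next
          case False
          then have "indicator {0..r} s * (mass (jump_flow c d a s) * \<delta> (r - s) (target c d a s)) = 0" by auto
          moreover have "0 \<le> indicator {0..r} s *\<^sub>R (r - s) ^ m" by (cases "s \<in> {0..r}") simp_all
          then have "0 \<le> (L * ?q) * (indicator {0..r} s *\<^sub>R (r - s) ^ m)"
            by (rule mult_nonneg_nonneg[OF mult_nonneg_nonneg[OF L(1) q0]])
          ultimately show ?thesis by (simp only: abs_zero)
        qed
      qed
      also have "\<dots> = L * ?q * (r ^ Suc m / real (Suc m))"
        by (simp only: integral_mult_right_zero integral_power_diff[OF r(1)])
      finally show ?thesis .
    qed
    have "\<bar>\<delta> r a\<bar> \<le> (\<Sum>d\<in>?D. \<bar>LINT s|lborel. indicator {0..r} s * (mass (jump_flow c d a s) * \<delta> (r - s) (target c d a s))\<bar>)"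
      unfolding eq[OF r c(2,1)] by (rule sum_abs)
    also have "\<dots> \<le> (\<Sum>d\<in>?D. L * ?q * (r ^ Suc m / real (Suc m)))" by (rule sum_mono[OF each])
    also have "\<dots> = real (card ?D) * (L * ?q * (r ^ Suc m / real (Suc m)))" by simp
    also have "\<dots> \<le> N * (L * ?q * (r ^ Suc m / real (Suc m)))"
    proof (rule mult_right_mono)
      show "real (card ?D) \<le> N" unfolding N_def by (intro of_nat_mono card_mono) auto
      have "0 \<le> r ^ Suc m / real (Suc m)" using r by simp
      then show "0 \<le> L * ?q * (r ^ Suc m / real (Suc m))" by (rule mult_nonneg_nonneg[OF mult_nonneg_nonneg[OF L(1) q0]])
    qed
    also have "\<dots> = B * (N * L) ^ Suc m * (r ^ Suc m / fact (Suc m))" by (simp add: field_simps)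
    finally show ?case .
  qed
  from this[OF r a] have le: "\<bar>\<delta> r a\<bar> \<le> B * ((N * L * r) ^ m / fact m)" for m
    by (simp add: power_mult_distrib ac_simps)
  have "(\<lambda>m. (N * L * r) ^ m / fact m) \<longlonglongrightarrow> 0"
    using summable_LIMSEQ_zero[OF summable_exp_generic[of "N * L * r"]] by (simp add: divide_inverse mult.commute)
  then have "(\<lambda>m. B * ((N * L * r) ^ m / fact m)) \<longlonglongrightarrow> B * 0" by (intro tendsto_intros)
  then have "\<bar>\<delta> r a\<bar> \<le> B * 0" by (rule LIMSEQ_le_const) (use le in auto)
  then show ?thesis by simp
qed

lemma integral_Icc_bound:
  fixes q :: "real \<Rightarrow> real"
  assumes "0 \<le> r" "\<And>s. 0 \<le> s \<Longrightarrow> s \<le> r \<Longrightarrow> \<bar>q s\<bar> \<le> Q"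
  shows "\<bar>LINT s|lborel. indicator {0..r} s * q s\<bar> \<le> Q * r"
proof (cases "integrable lborel (\<lambda>s. indicator {0..r} s * q s)")
  case True
  have "\<bar>LINT s|lborel. indicator {0..r} s * q s\<bar> \<le> (LINT s|lborel. \<bar>indicator {0..r} s * q s\<bar>)" by (rule integral_abs_bound)
  also have "\<dots> \<le> (LINT s|lborel. indicator {0..r} s * Q)"
  proof (rule integral_mono)
    show "integrable lborel (\<lambda>s. indicator {0..r} s * Q)"
      by (intro integrable_mult_left integrable_real_indicator) (auto simp: emeasure_lborel_Icc_eq)
  qed (use True assms in \<open>auto simp: indicator_def\<close>)
  also have "\<dots> = Q * r" using assms(1) by simp
  finally show ?thesis .
next
  case False
  have "0 \<le> Q" using assms(2)[of 0] assms(1) by linarith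
  then show ?thesis using False assms(1) by (simp add: not_integrable_integral_eq)
qed

lemma integrable_weight:
  fixes M g :: "real \<Rightarrow> 'v::euclidean_space"
  assumes [measurable]: "M \<in> borel_measurable borel" and B: "\<And>z. 0 \<le> z \<Longrightarrow> z \<le> r \<Longrightarrow> norm (M z) \<le> B"
    and g: "continuous_on UNIV g"
  shows "integrable lborel (\<lambda>s. indicator {0..r} s * (g s \<bullet> M s))"
proof -
  have [measurable]: "g \<in> borel_measurable borel" by (rule borel_measurable_continuous_onI[OF g])
  obtain Q where Q: "0 \<le> Q" "\<forall>s\<in>{0..r}. norm (g s) \<le> Q"
    using compact_image_bound[OF compact_Icc continuous_on_subset[OF g subset_UNIV]] by blast
  show ?thesis
  proof (rule integrableI_bounded_set[where A="{0..r}" and B="max 0 Q * B"])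
    show "AE s\<in>{0..r} in lborel. norm (indicator {0..r} s * (g s \<bullet> M s)) \<le> max 0 Q * B"
    proof (rule AE_I2, rule impI)
      fix s assume s: "s \<in> {0..r}"
      have "\<bar>g s \<bullet> M s\<bar> \<le> norm (g s) * norm (M s)" by (rule Cauchy_Schwarz_ineq2)
      also have "\<dots> \<le> max 0 Q * B" using Q B[of s] s by (intro mult_mono) auto
      finally show "norm (indicator {0..r} s * (g s \<bullet> M s)) \<le> max 0 Q * B" using s by simp
    qed
  qed (auto simp: emeasure_lborel_Icc_eq indicator_def)
qed

lemmas cross_linear = bounded_linear.linear[OF bounded_linear_cross]
lemmas side_flow_linear = bounded_linear.linear[OF bounded_linear_side_flow]

lemma continuous_cross_side_flow: "continuous_on UNIV (\<lambda>s. cross X (side_flow X s a))"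
  by (intro bounded_linear.continuous_on[OF bounded_linear_cross] continuous_on_side_flow)

text \<open>The value, as a formula, of the following game: a path is followed for the time \<open>r\<close>; if it switches sides
  it earns the linear reward \<open>M\<close>, taken at the clock time of the switch, and otherwise the
  linear reward \<open>\<mu>\<close> at the end. The clock starts at \<open>t - r\<close> and so shows \<open>t\<close> at the end.\<close>

definition reward :: "('p, 'm) state \<Rightarrow> (real \<Rightarrow> ('p, 'm) state) \<Rightarrow> real \<Rightarrow> real \<Rightarrow> ('p, 'm) state \<Rightarrow> real" where
  "reward \<mu> M t r a = side_flow X r a \<bullet> \<mu> + (LINT w|lborel. indicator {0..r} w * (cross X (side_flow X w a) \<bullet> M (t - r + w)))"

context
  fixes M :: "real \<Rightarrow> ('p, 'm) state" and B t :: real and \<mu> :: "('p, 'm) state"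
  assumes Mm[measurable]: "M \<in> borel_measurable borel" and MB: "\<And>s. 0 \<le> s \<Longrightarrow> s \<le> t \<Longrightarrow> norm (M s) \<le> B"
begin

lemma integrable_reward: assumes "0 \<le> r" "r \<le> t"
  shows "integrable lborel (\<lambda>w. indicator {0..r} w * (cross X (side_flow X w a) \<bullet> M (t - r + w)))"
  using assms MB by (intro integrable_weight[where B=B and M="\<lambda>w. M (t - r + w)"] continuous_cross_side_flow) auto

lemma linear_reward: assumes r: "0 \<le> r" "r \<le> t" shows "linear (reward \<mu> M t r)"
proof (rule linearI)
  fix a a' :: "('p, 'm) state" and k :: real
  show "reward \<mu> M t r (a + a') = reward \<mu> M t r a + reward \<mu> M t r a'"
    unfolding reward_def using integrable_reward[OF r, of a] integrable_reward[OF r, of a']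
    by (simp add: linear_add[OF side_flow_linear] linear_add[OF cross_linear] inner_add_left distrib_left)
  have "(LINT w|lborel. indicator {0..r} w * (k * (cross X (side_flow X w a) \<bullet> M (t - r + w))))
     = k * (LINT w|lborel. indicator {0..r} w * (cross X (side_flow X w a) \<bullet> M (t - r + w)))"
    by (subst integral_mult_right_zero[symmetric]) (simp add: ac_simps)
  then show "reward \<mu> M t r (k *\<^sub>R a) = k *\<^sub>R reward \<mu> M t r a"
    unfolding reward_def by (simp add: linear_cmul[OF side_flow_linear] linear_cmul[OF cross_linear] distrib_left)
qed

lemma reward_bound: "\<exists>K\<ge>0. \<forall>r a. 0 \<le> r \<longrightarrow> r \<le> t \<longrightarrow> \<bar>reward \<mu> M t r a\<bar> \<le> K * norm a"
proof (cases "0 \<le> t")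
  case True
  obtain L where L: "0 \<le> L" "\<And>r a. r \<in> {0..t} \<Longrightarrow> norm (side_flow X r a) \<le> L * norm a" using side_flow_bound[of t X] by blast
  obtain Kc where Kc: "0 \<le> Kc" "\<And>a. norm (cross X a) \<le> norm a * Kc"
    using bounded_linear.nonneg_bounded[OF bounded_linear_cross] by blast
  have B0: "0 \<le> B" using MB[of 0] True by (meson norm_ge_zero order_trans order_refl)
  show ?thesis
  proof (intro exI[of _ "L * norm \<mu> + L * Kc * B * t"] conjI allI impI)
    show "0 \<le> L * norm \<mu> + L * Kc * B * t" using L Kc B0 True by simp
    fix r and a :: "('p, 'm) state" assume r: "0 \<le> r" "r \<le> t"
    have 1: "\<bar>side_flow X r a \<bullet> \<mu>\<bar> \<le> L * norm a * norm \<mu>"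
      using L(2)[of r a] r by (intro order_trans[OF Cauchy_Schwarz_ineq2] mult_right_mono) auto
    have "\<bar>LINT w|lborel. indicator {0..r} w * (cross X (side_flow X w a) \<bullet> M (t - r + w))\<bar> \<le> (L * norm a * Kc * B) * r"
    proof (rule integral_Icc_bound[OF r(1)])
      fix w assume w: "0 \<le> w" "w \<le> r"
      have "\<bar>cross X (side_flow X w a) \<bullet> M (t - r + w)\<bar> \<le> norm (cross X (side_flow X w a)) * norm (M (t - r + w))"
        by (rule Cauchy_Schwarz_ineq2)
      also have "\<dots> \<le> (L * norm a * Kc) * B"
      proof (rule mult_mono)
        have "norm (cross X (side_flow X w a)) \<le> norm (side_flow X w a) * Kc" by (rule Kc(2))
        also have "\<dots> \<le> L * norm a * Kc" using L(2)[of w a] w r Kc(1) by (intro mult_right_mono) auto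
        finally show "norm (cross X (side_flow X w a)) \<le> L * norm a * Kc" .
        show "norm (M (t - r + w)) \<le> B" using w r by (intro MB) auto
      qed (use L Kc in auto)
      finally show "\<bar>cross X (side_flow X w a) \<bullet> M (t - r + w)\<bar> \<le> L * norm a * Kc * B" .
    qed
    also have "\<dots> \<le> (L * norm a * Kc * B) * t" using r L Kc B0 by (intro mult_left_mono mult_nonneg_nonneg) auto
    finally show "\<bar>reward \<mu> M t r a\<bar> \<le> (L * norm \<mu> + L * Kc * B * t) * norm a"
      using 1 unfolding reward_def by (simp add: algebra_simps)
  qed
next
  case False then show ?thesis by (intro exI[of _ 0]) auto
qed

lemma measurable_reward:
  assumes [measurable]: "a \<in> borel_measurable borel"
  shows "(\<lambda>s. reward \<mu> M t (r - s) (a s)) \<in> borel_measurable borel"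
proof -
  have [measurable]: "(\<lambda>s. side_flow X (r - s) (a s)) \<in> borel_measurable borel"
    by (rule measurable_side_flow) measurable
  have c: "cross X \<in> borel_measurable borel"
    by (intro borel_measurable_continuous_onI linear_continuous_on bounded_linear_cross)
  have "(\<lambda>x. side_flow X (snd x) (a (fst x))) \<in> borel_measurable (borel \<Otimes>\<^sub>M (borel :: real measure))"
    by (rule measurable_side_flow) measurable
  from measurable_compose[OF this c]
  have [measurable]: "(\<lambda>x. cross X (side_flow X (snd x) (a (fst x)))) \<in> borel_measurable (borel \<Otimes>\<^sub>M (borel :: real measure))" .
  have "(\<lambda>x. (if 0 \<le> snd x \<and> snd x \<le> r - fst x then 1 else 0) * (cross X (side_flow X (snd x) (a (fst x))) \<bullet> M (t - (r - fst x) + snd x))) \<in> borel_measurable (borel \<Otimes>\<^sub>M (borel :: real measure))"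
    by measurable
  also have "(\<lambda>x. (if 0 \<le> snd x \<and> snd x \<le> r - fst x then 1 else 0) * (cross X (side_flow X (snd x) (a (fst x))) \<bullet> M (t - (r - fst x) + snd x)))
    = (\<lambda>(s, w). indicator {0..r - s} w * (cross X (side_flow X w (a s)) \<bullet> M (t - (r - s) + w)))"
    by (auto simp: fun_eq_iff indicator_def)
  finally have "(\<lambda>(s, w). indicator {0..r - s} w * (cross X (side_flow X w (a s)) \<bullet> M (t - (r - s) + w))) \<in> borel_measurable (borel \<Otimes>\<^sub>M lborel)"
    by (simp cong: measurable_cong_sets)
  from lborel.borel_measurable_lebesgue_integral[OF this]
  have [measurable]: "(\<lambda>s. LINT w|lborel. indicator {0..r - s} w * (cross X (side_flow X w (a s)) \<bullet> M (t - (r - s) + w))) \<in> borel_measurable borel" .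
  show ?thesis unfolding reward_def by measurable
qed

lemma integrable_jump_reward:
  assumes r: "0 \<le> r" "r \<le> t" and a: "a \<in> cell X c" and d: "d \<noteq> c"
  shows "integrable lborel (\<lambda>s. indicator {0..r} s * (mass (jump_flow c d a s) * reward \<mu> M t (r - s) (target c d a s)))"
proof -
  obtain K where K: "0 \<le> K" "\<And>r a. 0 \<le> r \<Longrightarrow> r \<le> t \<Longrightarrow> \<bar>reward \<mu> M t r a\<bar> \<le> K * norm a" using reward_bound by blast
  obtain S where S: "\<And>a. a \<in> states X \<Longrightarrow> norm a \<le> S" using bounded_states by (auto simp: bounded_iff)
  have tm: "target c d a \<in> borel_measurable borel"
    using measurable_target[OF a d] by (simp add: measurable_restrict_space2_iff)
  show ?thesis
  proof (rule integrable_jump_term[OF a d measurable_reward[OF tm], where B="K * S"])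
    fix s assume s: "0 \<le> s" "s \<le> r"
    have "\<bar>reward \<mu> M t (r - s) (target c d a s)\<bar> \<le> K * norm (target c d a s)" using s r by (intro K(2)) auto
    also have "\<dots> \<le> K * S" using S[OF target_states[OF a d]] K(1) by (intro mult_left_mono)
    finally show "\<bar>reward \<mu> M t (r - s) (target c d a s)\<bar> \<le> K * S" .
  qed
qed

lemma mass_target: assumes "a \<in> cell X c" "d \<noteq> c" "0 \<le> s"
  shows "mass (jump_flow c d a s) *\<^sub>R target c d a s = jump_flow c d a s"
  using jump_flow_cases[OF assms(1,3,2)] target_cell(2)[OF assms] by auto

text \<open>The formula solves the renewal equation at the first jump. The jumps to the other side make up the last
  sum. The jumps within the side make up the middle one, where linearity allows adding up the
  destinations before Duhamel's formula is applied.\<close>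

lemma reward_first_jump:
  assumes r: "0 \<le> r" "r \<le> t" and a: "a \<in> cell X c"
  shows "reward \<mu> M t r a = block_flow X r a \<bullet> \<mu> +
    (\<Sum>d\<in>{d. d \<noteq> c \<and> isl d = isl c}. LINT s|lborel. indicator {0..r} s * (mass (jump_flow c d a s) * reward \<mu> M t (r - s) (target c d a s))) +
    (\<Sum>d\<in>{d. isl d \<noteq> isl c}. LINT s|lborel. indicator {0..r} s * (mass (jump_flow c d a s) * (target c d a s \<bullet> M (t - r + s))))"
proof -
  let ?S = "{d :: 'i + 'j. d \<noteq> c \<and> isl d = isl c}" and ?O = "{d :: 'i + 'j. isl d \<noteq> isl c}"
  let ?bf = "\<lambda>s. block_flow X s a"
  define Mr where "Mr = (\<lambda>z. M (t - r + z))"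
  have Mr[measurable]: "Mr \<in> borel_measurable borel" by (simp add: Mr_def)
  have MrB: "norm (Mr z) \<le> B" if "0 \<le> z" "z \<le> r" for z using that r by (auto simp: Mr_def intro!: MB)
  have ib: "in_block X c (?bf s)" for s by (rule in_block_block_flow[OF cell_in_block[OF a]])
  have opp: "(\<Sum>d\<in>?O. LINT s|lborel. indicator {0..r} s * (mass (jump_flow c d a s) * (target c d a s \<bullet> M (t - r + s))))
    = (LINT s|lborel. indicator {0..r} s * (cross X (?bf s) \<bullet> Mr s))"
  proof -
    have "(\<Sum>d\<in>?O. LINT s|lborel. indicator {0..r} s * (mass (jump_flow c d a s) * (target c d a s \<bullet> M (t - r + s))))
      = (\<Sum>d\<in>?O. LINT s|lborel. indicator {0..r} s * (jump_flow c d a s \<bullet> Mr s))"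
    proof (intro sum.cong refl Bochner_Integration.integral_cong)
      fix d s assume d: "d \<in> ?O"
      then have "d \<noteq> c" by auto
      from mass_target[OF a this, of s]
      show "indicator {0..r} s * (mass (jump_flow c d a s) * (target c d a s \<bullet> M (t - r + s))) = indicator {0..r} s * (jump_flow c d a s \<bullet> Mr s)"
        by (cases "s \<in> {0..r}") (simp_all add: Mr_def flip: inner_scaleR_left)
    qed
    also have "\<dots> = (LINT s|lborel. (\<Sum>d\<in>?O. indicator {0..r} s * (jump_flow c d a s \<bullet> Mr s)))"
      by (rule Bochner_Integration.integral_sum[symmetric]) (rule integrable_weight[OF Mr MrB continuous_on_jump_flow])
    also have "\<dots> = (LINT s|lborel. indicator {0..r} s * (cross X (?bf s) \<bullet> Mr s))"
      by (intro Bochner_Integration.integral_cong refl)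
        (simp add: sum_jump_vec_cross[OF ib, symmetric] jump_flow_def inner_sum_left sum_distrib_left)
    finally show ?thesis .
  qed
  let ?R = "\<lambda>s. reward \<mu> M t (r - s) (off_block X (?bf s))"
  have same: "(\<Sum>d\<in>?S. LINT s|lborel. indicator {0..r} s * (mass (jump_flow c d a s) * reward \<mu> M t (r - s) (target c d a s)))
     = (LINT s|lborel. indicator {0..r} s * ?R s)"
  proof -
    have "(\<Sum>d\<in>?S. LINT s|lborel. indicator {0..r} s * (mass (jump_flow c d a s) * reward \<mu> M t (r - s) (target c d a s)))
      = (LINT s|lborel. (\<Sum>d\<in>?S. indicator {0..r} s * (mass (jump_flow c d a s) * reward \<mu> M t (r - s) (target c d a s))))"
      by (rule Bochner_Integration.integral_sum[symmetric]) (use integrable_jump_reward[OF r a] in auto)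
    also have "\<dots> = (LINT s|lborel. indicator {0..r} s * ?R s)"
    proof (rule Bochner_Integration.integral_cong[OF refl])
      fix s :: real
      show "(\<Sum>d\<in>?S. indicator {0..r} s * (mass (jump_flow c d a s) * reward \<mu> M t (r - s) (target c d a s))) = indicator {0..r} s * ?R s"
      proof (cases "s \<in> {0..r}")
        case True
        then have lin: "linear (reward \<mu> M t (r - s))" using r by (intro linear_reward) auto
        have "mass (jump_flow c d a s) * reward \<mu> M t (r - s) (target c d a s) = reward \<mu> M t (r - s) (jump_flow c d a s)" if "d \<in> ?S" for d
          using mass_target[OF a, of d s] that True linear_cmul[OF lin, of "mass (jump_flow c d a s)" "target c d a s"] by simp
        then have "(\<Sum>d\<in>?S. mass (jump_flow c d a s) * reward \<mu> M t (r - s) (target c d a s)) = reward \<mu> M t (r - s) (\<Sum>d\<in>?S. jump_flow c d a s)"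
          by (simp add: linear_sum[OF lin])
        then show ?thesis using True by (simp add: sum_jump_vec_off_block[OF ib, symmetric] jump_flow_def sum_distrib_left[symmetric])
      qed simp
    qed
    finally show ?thesis .
  qed
  define f :: "real \<Rightarrow> real \<Rightarrow> real" where
    "f s z = indicator {0..r} s * (indicator {s..r} z * (cross X (side_flow X (z - s) (off_block X (?bf s))) \<bullet> Mr z))" for s z
  note D = duhamel_weighted[OF Mr MrB r(1), where a=a and X=X, folded f_def]
  let ?L = "\<lambda>x. x \<bullet> \<mu>"
  have R: "indicator {0..r} s * ?R s = ?L (indicator {0..r} s *\<^sub>R side_flow X (r - s) (off_block X (?bf s))) + (LINT z|lborel. f s z)" for s
  proof (cases "s \<in> {0..r}")
    case True
    have "(LINT w|lborel. indicator {0..r - s} w * (cross X (side_flow X w (off_block X (?bf s))) \<bullet> M (t - (r - s) + w)))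
       = (LINT z|lborel. f s z)"
    proof (subst lborel_integral_real_affine[where c=1 and t="-s"])
      show "\<bar>1\<bar> *\<^sub>R (LINT x|lborel. indicator {0..r - s} (- s + 1 * x) * (cross X (side_flow X (- s + 1 * x) (off_block X (?bf s))) \<bullet> M (t - (r - s) + (- s + 1 * x))))
        = (LINT z|lborel. f s z)"
        unfolding abs_one scaleR_one
      proof (rule Bochner_Integration.integral_cong[OF refl])
        fix z show "indicator {0..r - s} (- s + 1 * z) * (cross X (side_flow X (- s + 1 * z) (off_block X (?bf s))) \<bullet> M (t - (r - s) + (- s + 1 * z))) = f s z"
          using True by (auto simp: f_def Mr_def indicator_def algebra_simps)
      qed
    qed simp
    then show ?thesis using True by (simp add: reward_def)
  next
    case False then show ?thesis by (simp add: f_def)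
  qed
  have i1: "integrable lborel (\<lambda>s. ?L (indicator {0..r} s *\<^sub>R side_flow X (r - s) (off_block X (?bf s))))"
    by (rule integrable_bounded_linear[OF bounded_linear_inner_left duhamel_integrable])
  have "(LINT s|lborel. indicator {0..r} s * ?R s) = (LINT s|lborel. ?L (indicator {0..r} s *\<^sub>R side_flow X (r - s) (off_block X (?bf s))) + (LINT z|lborel. f s z))"
    by (rule Bochner_Integration.integral_cong[OF refl R])
  also have "\<dots> = (LINT s|lborel. ?L (indicator {0..r} s *\<^sub>R side_flow X (r - s) (off_block X (?bf s)))) + (LINT s|lborel. LINT z|lborel. f s z)"
    by (rule Bochner_Integration.integral_add[OF i1 D(2)])
  also have "(LINT s|lborel. ?L (indicator {0..r} s *\<^sub>R side_flow X (r - s) (off_block X (?bf s)))) = ?L (side_flow X r a - ?bf r)"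
    using integral_bounded_linear[OF bounded_linear_inner_left[of \<mu>] duhamel_integrable[of r X a]] duhamel_integral[OF r(1), of X a] by simp
  also note D(1)
  finally have same': "(LINT s|lborel. indicator {0..r} s * ?R s) = ?L (side_flow X r a - ?bf r) +
     (LINT z|lborel. indicator {0..r} z * ((cross X (side_flow X z a) - cross X (?bf z)) \<bullet> Mr z))" .
  have i2: "integrable lborel (\<lambda>z. indicator {0..r} z * (cross X (side_flow X z a) \<bullet> Mr z))"
    by (rule integrable_weight[OF Mr MrB continuous_cross_side_flow])
  have i3: "integrable lborel (\<lambda>z. indicator {0..r} z * (cross X (?bf z) \<bullet> Mr z))"
    by (rule integrable_weight[OF Mr MrB bounded_linear.continuous_on[OF bounded_linear_cross continuous_on_block_flow]])
  have "(LINT z|lborel. indicator {0..r} z * ((cross X (side_flow X z a) - cross X (?bf z)) \<bullet> Mr z))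
     = (LINT z|lborel. indicator {0..r} z * (cross X (side_flow X z a) \<bullet> Mr z)) - (LINT z|lborel. indicator {0..r} z * (cross X (?bf z) \<bullet> Mr z))"
    using Bochner_Integration.integral_diff[OF i2 i3] by (simp add: inner_diff_left right_diff_distrib)
  then show ?thesis
    unfolding opp same same' unfolding reward_def Mr_def by (simp add: inner_diff_left)
qed

text \<open>The first switch may be preceded by any number of jumps within the side, but its law is that of a single
  jump out of the side flow. Indeed both sides of the equation solve the renewal equation at the
  first jump, and this has only one bounded solution. It is essential that the expectations \<open>HL\<close> and
  \<open>GL\<close> are linear in the state: only then does the normalisation of the orbit cancel.\<close>

lemma switch_integral:
  assumes a: "a \<in> side X b" and t: "0 \<le> t"
    and G: "(\<lambda>(s, \<omega>). G s \<omega> :: real) \<in> borel_measurable (borel \<Otimes>\<^sub>M PA)" and GB: "\<And>s \<omega>. \<omega> \<in> Omega X \<Longrightarrow> \<bar>G s \<omega>\<bar> \<le> B'"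
    and H: "H \<in> borel_measurable PA" and HB: "\<And>\<omega>. \<omega> \<in> Omega X \<Longrightarrow> \<bar>H \<omega>\<bar> \<le> B'"
    and HL: "\<And>a. a \<in> side X b \<Longrightarrow> (LINT \<omega>|P a. H \<omega>) = a \<bullet> \<mu>"
    and GL: "\<And>s a. 0 \<le> s \<Longrightarrow> s \<le> t \<Longrightarrow> a \<in> side X (\<not> b) \<Longrightarrow> (LINT \<omega>|P a. G s \<omega>) = a \<bullet> M s"
  shows "(LINT \<omega>|P a. (if sw \<omega> \<le> t then G (sw \<omega>) (shift (sw \<omega>) \<omega>) else H (shift t \<omega>))) = reward \<mu> M t t a"
proof -
  define V where "V = (\<lambda>r \<omega>. if sw \<omega> \<le> r then G (t - r + sw \<omega>) (shift (sw \<omega>) \<omega>) else H (shift (max 0 r) \<omega>))"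
  let ?B2 = "(borel :: real measure) \<Otimes>\<^sub>M PA"
  have swm[measurable]: "(\<lambda>x. sw (snd x)) \<in> borel_measurable ?B2" by (rule measurable_compose[OF measurable_snd measurable_switch_time])
  have sp: "0 \<le> sw (snd x)" if "x \<in> space ?B2" for x :: "real \<times> ('p, 'm) path"
    using that switch_time_pos[of "snd x"] by (auto simp: space_pair_measure)
  have V: "(\<lambda>(r, \<omega>). V r \<omega>) \<in> borel_measurable ?B2"
  proof -
    have s1: "(\<lambda>x. shift (sw (snd x)) (snd x)) \<in> measurable ?B2 PA" by (rule measurable_shift[OF swm measurable_snd sp])
    have s2: "(\<lambda>x. shift (max 0 (fst x)) (snd x)) \<in> measurable ?B2 PA"
      using measurable_shift_joint by (simp add: case_prod_beta')
    have [measurable]: "(\<lambda>x. H (shift (max 0 (fst x)) (snd x))) \<in> borel_measurable ?B2" by (rule measurable_compose[OF s2 H])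
    have "(\<lambda>x. (t - fst x + sw (snd x), shift (sw (snd x)) (snd x))) \<in> measurable ?B2 ?B2" using s1 by measurable
    from measurable_compose[OF this G] have [measurable]: "(\<lambda>x. G (t - fst x + sw (snd x)) (shift (sw (snd x)) (snd x))) \<in> borel_measurable ?B2" by simp
    have "(\<lambda>x. if sw (snd x) \<le> fst x then G (t - fst x + sw (snd x)) (shift (sw (snd x)) (snd x)) else H (shift (max 0 (fst x)) (snd x))) \<in> borel_measurable ?B2"
      by measurable
    then show ?thesis by (simp add: V_def case_prod_beta')
  qed
  have Vr: "V r \<in> borel_measurable PA" for r using measurable_compose[OF measurable_Pair1'[of r borel PA] V] by simp
  have VB: "\<bar>V r \<omega>\<bar> \<le> B'" if "\<omega> \<in> Omega X" for r \<omega>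
    using GB[OF shift_Omega[OF that less_imp_le[OF switch_time_pos[OF that]]]] HB[OF shift_Omega[OF that, of "max 0 r"]] by (simp add: V_def)
  define U where "U = (\<lambda>r a. LINT \<omega>|P a. V r \<omega>)"
  have U_eq: "U r a = block_flow X r a \<bullet> \<mu> +
    (\<Sum>d\<in>{d. d \<noteq> c \<and> isl d = isl c}. LINT s|lborel. indicator {0..r} s * (mass (jump_flow c d a s) * U (r - s) (target c d a s))) +
    (\<Sum>d\<in>{d. isl d \<noteq> isl c}. LINT s|lborel. indicator {0..r} s * (mass (jump_flow c d a s) * (target c d a s \<bullet> M (t - r + s))))"
    if r: "0 \<le> r" "r \<le> t" and a: "a \<in> cell X c" and c: "isl c = b" for r a c
  proof -
    have st: "a \<in> states X" and ab: "a \<in> side X b" using a c states_cell side_cell by auto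
    define G1 where "G1 = (\<lambda>s \<omega>. if \<omega> 0 \<in> side X b then V (r - s) \<omega> else G (t - r + s) \<omega>)"
    have G1: "(\<lambda>(s, \<omega>). G1 s \<omega>) \<in> borel_measurable ?B2"
    proof -
      have "(\<lambda>x. (r - fst x, snd x)) \<in> measurable ?B2 ?B2" by measurable
      from measurable_compose[OF this V] have [measurable]: "(\<lambda>x. V (r - fst x) (snd x)) \<in> borel_measurable ?B2" by simp
      have "(\<lambda>x. (t - r + fst x, snd x)) \<in> measurable ?B2 ?B2" by measurable
      from measurable_compose[OF this G] have [measurable]: "(\<lambda>x. G (t - r + fst x) (snd x)) \<in> borel_measurable ?B2" by simp
      have [measurable]: "Measurable.pred ?B2 (\<lambda>x. snd x 0 \<in> side X b)" by (rule measurable_in_side[OF measurable_snd]) simp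
      have "(\<lambda>x. if snd x 0 \<in> side X b then V (r - fst x) (snd x) else G (t - r + fst x) (snd x)) \<in> borel_measurable ?B2" by measurable
      then show ?thesis by (simp add: G1_def case_prod_beta')
    qed
    have G1B: "\<bar>G1 s \<omega>\<bar> \<le> B'" if "\<omega> \<in> Omega X" for s \<omega> using VB[OF that] GB[OF that] by (simp add: G1_def)
    have G1s: "G1 s \<in> borel_measurable PA" for s using measurable_compose[OF measurable_Pair1'[of s borel PA] G1] by simp
    let ?A = "\<lambda>\<omega>. if r < first_jump \<omega> then H (shift r \<omega>) else 0"
    let ?C = "\<lambda>\<omega>. if first_jump \<omega> \<le> r then G1 (first_jump \<omega>) (shift (first_jump \<omega>) \<omega>) else 0"
    have Am: "?A \<in> borel_measurable PA"
    proof -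
      note [measurable] = measurable_first_jump
      have "shift r \<in> measurable PA PA" using measurable_shift[of "\<lambda>_. r" PA "\<lambda>\<omega>. \<omega>"] r by simp
      from measurable_compose[OF this H] have [measurable]: "(\<lambda>\<omega>. H (shift r \<omega>)) \<in> borel_measurable PA" .
      show ?thesis by measurable
    qed
    have Cm: "?C \<in> borel_measurable PA" by (rule measurable_at_first_jump[OF G1])
    have B'0: "0 \<le> B'" if "\<omega> \<in> Omega X" for \<omega> using HB[OF that] by linarith
    have split: "V r \<omega> = ?A \<omega> + ?C \<omega>" if \<omega>: "\<omega> \<in> Omega X" and start: "\<omega> 0 = a" for \<omega>
    proof -
      define j where "j = first_jump \<omega>"
      note F = first_jump[OF \<omega>, folded j_def]
      have \<omega>b: "\<omega> 0 \<in> side X b" using start ab by simp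
      show ?thesis
      proof (cases "r < j")
        case True
        then show ?thesis using F(4) r by (simp add: V_def j_def[symmetric])
      next
        case False
        show ?thesis
        proof (cases "\<omega> j \<in> side X b")
          case True
          have s: "sw \<omega> = j + sw (shift j \<omega>)" using switch_time_first_jump(2)[OF \<omega> \<omega>b] True by (simp add: j_def)
          have p: "0 < sw (shift j \<omega>)" using F(2) by (intro switch_time_pos shift_Omega \<omega>) simp
          have "V r \<omega> = V (r - j) (shift j \<omega>)"
            using False p F(2) r by (auto simp: V_def s shift_shift algebra_simps)
          then show ?thesis using False True by (simp add: G1_def j_def[symmetric])
        next
          case opp: False
          then have "sw \<omega> = j" using switch_time_first_jump(1)[OF \<omega> \<omega>b] side_compl[OF \<omega>, of j b] F(2) by (simp add: j_def)
          then show ?thesis using False opp by (simp add: V_def G1_def j_def[symmetric])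
        qed
      qed
    qed
    have "U r a = (LINT \<omega>|P a. ?A \<omega> + ?C \<omega>)"
      unfolding U_def by (rule integral_P_start[OF st Vr borel_measurable_add[OF Am Cm] split])
    also have "\<dots> = (LINT \<omega>|P a. ?A \<omega>) + (LINT \<omega>|P a. ?C \<omega>)"
    proof (rule Bochner_Integration.integral_add)
      show "integrable (P a) ?A"
        using HB[OF shift_Omega[OF _ r(1)]] B'0 by (intro integrable_P[OF st Am, where B=B']) auto
      have "\<bar>G1 (first_jump \<omega>) (shift (first_jump \<omega>) \<omega>)\<bar> \<le> B'" if "\<omega> \<in> Omega X" for \<omega>
        using first_jump(2)[OF that] by (intro G1B shift_Omega that) simp
      then show "integrable (P a) ?C"
        using B'0 by (intro integrable_P[OF st Cm, where B=B']) auto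
    qed
    also have "(LINT \<omega>|P a. ?A \<omega>) = block_flow X r a \<bullet> \<mu>"
    proof -
      have "(LINT \<omega>|P a. ?A \<omega>) = mass (block_flow X r a) * (flow X r a \<bullet> \<mu>)"
        using no_jump_integral[OF a r(1) H] HL[OF flow_side[OF ab r(1)]] by simp
      also have "\<dots> = block_flow X r a \<bullet> \<mu>" by (subst (2) block_flow_eq[OF st r(1)]) simp
      finally show ?thesis .
    qed
    also have "(LINT \<omega>|P a. ?C \<omega>) = (\<Sum>d\<in>UNIV - {c}. LINT s|lborel. indicator {0..r} s * (mass (jump_flow c d a s) * (LINT \<omega>|P (target c d a s). G1 s \<omega>)))"
      by (rule first_jump_integral[OF a r(1) G1 G1B])
    also have "\<dots> = (\<Sum>d\<in>UNIV - {c}. LINT s|lborel. indicator {0..r} s * (mass (jump_flow c d a s) *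
        (if isl d = b then U (r - s) (target c d a s) else target c d a s \<bullet> M (t - r + s))))"
    proof (intro sum.cong refl Bochner_Integration.integral_cong)
      fix d s assume "d \<in> UNIV - {c}"
      then have d: "d \<noteq> c" by simp
      show "indicator {0..r} s * (mass (jump_flow c d a s) * (LINT \<omega>|P (target c d a s). G1 s \<omega>)) =
        indicator {0..r} s * (mass (jump_flow c d a s) * (if isl d = b then U (r - s) (target c d a s) else target c d a s \<bullet> M (t - r + s)))"
      proof (cases "s \<in> {0..r} \<and> mass (jump_flow c d a s) \<noteq> 0")
        case True
        then have s: "0 \<le> s" "s \<le> r" by auto
        have "0 < mass (jump_flow c d a s)" using mass_jump_flow_nonneg[OF a s(1) d] True by simp
        note tc = target_cell(1)[OF a d s(1) this]
        have ts: "target c d a s \<in> states X" by (rule target_states[OF a d])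
        have "(LINT \<omega>|P (target c d a s). G1 s \<omega>) = (if isl d = b then U (r - s) (target c d a s) else target c d a s \<bullet> M (t - r + s))"
        proof (cases "isl d = b")
          case True
          then have "target c d a s \<in> side X b" using tc side_cell by auto
          then have "(LINT \<omega>|P (target c d a s). G1 s \<omega>) = (LINT \<omega>|P (target c d a s). V (r - s) \<omega>)"
            by (intro integral_P_start[OF ts G1s Vr]) (simp add: G1_def)
          then show ?thesis using True by (simp add: U_def)
        next
          case False
          then have sd: "target c d a s \<in> side X (\<not> b)" using tc side_cell by auto
          then have "(LINT \<omega>|P (target c d a s). G1 s \<omega>) = (LINT \<omega>|P (target c d a s). G (t - r + s) \<omega>)"
            using measurable_compose[OF measurable_Pair1'[of "t - r + s" borel PA] G] side_excl[of "target c d a s" b]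
            by (intro integral_P_start[OF ts G1s]) (auto simp: G1_def)
          also have "\<dots> = target c d a s \<bullet> M (t - r + s)" using s r sd by (intro GL) auto
          finally show ?thesis using False by simp
        qed
        then show ?thesis by simp
      qed auto
    qed
    also have "\<dots> = (\<Sum>d\<in>{d. d \<noteq> c \<and> isl d = isl c}. LINT s|lborel. indicator {0..r} s * (mass (jump_flow c d a s) *
        (if isl d = b then U (r - s) (target c d a s) else target c d a s \<bullet> M (t - r + s))))
      + (\<Sum>d\<in>{d. isl d \<noteq> isl c}. LINT s|lborel. indicator {0..r} s * (mass (jump_flow c d a s) *
        (if isl d = b then U (r - s) (target c d a s) else target c d a s \<bullet> M (t - r + s))))"
      by (subst sum.union_disjoint[symmetric]) (auto intro!: sum.cong)
    finally show ?thesis using c by (simp add: add.assoc)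
  qed
  have st: "a \<in> states X" using side_states[OF a] .
  obtain K where K: "0 \<le> K" "\<And>r a. 0 \<le> r \<Longrightarrow> r \<le> t \<Longrightarrow> \<bar>reward \<mu> M t r a\<bar> \<le> K * norm a" using reward_bound by blast
  obtain S where S: "\<And>a. a \<in> states X \<Longrightarrow> norm a \<le> S" using bounded_states by (auto simp: bounded_iff)
  have Ui: "integrable lborel (\<lambda>s. indicator {0..r} s * (mass (jump_flow c d a s) * U (r - s) (target c d a s)))"
    if a: "a \<in> cell X c" and d: "d \<noteq> c" for r a c d
  proof (rule integrable_jump_term[OF a d, where B=B'])
    have "(\<lambda>x. (r - fst x, snd x)) \<in> measurable ?B2 ?B2" by measurable
    from measurable_compose[OF this V] have "(\<lambda>(s, \<omega>). V (r - s) \<omega>) \<in> borel_measurable ?B2" by (simp add: case_prod_beta')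
    from measurable_target_integral[OF a d this] show "(\<lambda>s. U (r - s) (target c d a s)) \<in> borel_measurable borel" by (simp add: U_def)
    show "\<bar>U (r - s) (target c d a s)\<bar> \<le> B'" for s unfolding U_def by (rule integral_P_bound[OF target_states[OF a d] VB])
  qed
  have "U t a - reward \<mu> M t t a = 0"
  proof (rule renewal_unique[where \<delta>="\<lambda>r a. U r a - reward \<mu> M t r a" and b=b and t=t and B="B' + K * S"])
    fix r a' assume r: "0 \<le> r" "r \<le> t" and a': "a' \<in> side X b"
    have "\<bar>U r a'\<bar> \<le> B'" unfolding U_def by (rule integral_P_bound[OF side_states[OF a'] VB])
    moreover have "\<bar>reward \<mu> M t r a'\<bar> \<le> K * S"
      using K(2)[OF r, of a'] mult_left_mono[OF S[OF side_states[OF a']] K(1)] by linarith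
    ultimately show "\<bar>U r a' - reward \<mu> M t r a'\<bar> \<le> B' + K * S" by linarith
  next
    fix r c d a' assume *: "0 \<le> r" "r \<le> t" "a' \<in> cell X c" "isl c = b" "d \<noteq> c" "isl d = b"
    show "integrable lborel (\<lambda>s. indicator {0..r} s * (mass (jump_flow c d a' s) * (U (r - s) (target c d a' s) - reward \<mu> M t (r - s) (target c d a' s))))"
      using Bochner_Integration.integrable_diff[OF Ui[OF *(3,5), of r] integrable_jump_reward[OF *(1,2,3,5)]]
      by (simp add: right_diff_distrib)
  next
    fix r c a' assume *: "0 \<le> r" "r \<le> t" "a' \<in> cell X c" "isl c = b"
    have "(\<Sum>d\<in>{d. d \<noteq> c \<and> isl d = isl c}. LINT s|lborel. indicator {0..r} s * (mass (jump_flow c d a' s) * (U (r - s) (target c d a' s) - reward \<mu> M t (r - s) (target c d a' s))))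
      = (\<Sum>d\<in>{d. d \<noteq> c \<and> isl d = isl c}. (LINT s|lborel. indicator {0..r} s * (mass (jump_flow c d a' s) * U (r - s) (target c d a' s)))
         - (LINT s|lborel. indicator {0..r} s * (mass (jump_flow c d a' s) * reward \<mu> M t (r - s) (target c d a' s))))"
    proof (rule sum.cong[OF refl])
      fix d assume "d \<in> {d. d \<noteq> c \<and> isl d = isl c}"
      then have d: "d \<noteq> c" by simp
      show "(LINT s|lborel. indicator {0..r} s * (mass (jump_flow c d a' s) * (U (r - s) (target c d a' s) - reward \<mu> M t (r - s) (target c d a' s))))
       = (LINT s|lborel. indicator {0..r} s * (mass (jump_flow c d a' s) * U (r - s) (target c d a' s)))
         - (LINT s|lborel. indicator {0..r} s * (mass (jump_flow c d a' s) * reward \<mu> M t (r - s) (target c d a' s)))"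
        using Bochner_Integration.integral_diff[OF Ui[OF *(3) d, of r] integrable_jump_reward[OF *(1,2,3) d]]
        by (simp add: right_diff_distrib)
    qed
    then show "U r a' - reward \<mu> M t r a' = (\<Sum>d\<in>{d. d \<noteq> c \<and> isl d = isl c}. LINT s|lborel. indicator {0..r} s *
        (mass (jump_flow c d a' s) * (U (r - s) (target c d a' s) - reward \<mu> M t (r - s) (target c d a' s))))"
      unfolding U_eq[OF *] reward_first_jump[OF *(1,2,3)] by (simp add: sum_subtractf)
  qed (use t a in auto)
  moreover have "U t a = (LINT \<omega>|P a. (if sw \<omega> \<le> t then G (sw \<omega>) (shift (sw \<omega>) \<omega>) else H (shift t \<omega>)))"
    using t by (simp add: U_def V_def cong: if_cong)
  ultimately show ?thesis by simp
qed

end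

end

section \<open>Convolutions of matrix exponentials\<close>

text \<open>If \<open>mat_exp (T *\<^sub>R A)\<close> is small enough, the semigroup property halves the bound on the norm with every
  further period \<open>T\<close>.\<close>

lemma mat_exp_decay:
  fixes A :: "real^'n::finite^'n"
  assumes "((\<lambda>t. mat_exp (t *\<^sub>R A)) \<longlongrightarrow> 0) at_top"
  shows "\<exists>K c. 0 \<le> K \<and> 0 < c \<and> (\<forall>t\<ge>0. norm (mat_exp (t *\<^sub>R A)) \<le> K * exp (- c * t))"
proof -
  obtain k where k: "0 < k" "\<And>(x :: real^'n^'n) (y :: real^'n^'n). norm (x ** y) \<le> norm x * norm y * k"
    using bounded_bilinear.pos_bounded[OF bounded_bilinear_matrix_mult] by blast
  have "eventually (\<lambda>t. norm (mat_exp (t *\<^sub>R A)) < 1 / (2 * k)) at_top"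
    using assms k(1) tendstoD[OF assms, of "1 / (2 * k)"] by simp
  then have "eventually (\<lambda>t. 0 < t \<and> norm (mat_exp (t *\<^sub>R A)) < 1 / (2 * k)) at_top"
    by (intro eventually_conj eventually_gt_at_top)
  from eventually_happens'[OF trivial_limit_at_top_linorder this]
  obtain T where T: "0 < T" "norm (mat_exp (T *\<^sub>R A)) < 1 / (2 * k)" by blast
  have "bounded ((\<lambda>t. mat_exp (t *\<^sub>R A)) ` {0..T})"
    by (intro compact_imp_bounded compact_continuous_image continuous_on_mat_exp) simp
  then obtain Q where Q: "\<forall>y\<in>(\<lambda>t. mat_exp (t *\<^sub>R A)) ` {0..T}. norm y \<le> Q" unfolding bounded_iff by blast
  have "norm (mat_exp (0 *\<^sub>R A)) \<le> Q" by (rule bspec[OF Q imageI]) (use T(1) in simp)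
  then have Q0: "0 \<le> Q" using norm_ge_zero order_trans by blast
  have step: "norm (mat_exp ((real n * T + r) *\<^sub>R A)) \<le> (1 / 2) ^ n * Q" if r: "r \<in> {0..T}" for n r
  proof (induction n)
    case 0 then show ?case using Q r by simp
  next
    case (Suc n)
    have "(real (Suc n) * T + r) *\<^sub>R A = (T + (real n * T + r)) *\<^sub>R A" by (simp add: algebra_simps)
    then have "norm (mat_exp ((real (Suc n) * T + r) *\<^sub>R A)) \<le> norm (mat_exp (T *\<^sub>R A)) * norm (mat_exp ((real n * T + r) *\<^sub>R A)) * k"
      using k(2)[of "mat_exp (T *\<^sub>R A)" "mat_exp ((real n * T + r) *\<^sub>R A)"] by (simp only: mat_exp_add)
    also have "\<dots> \<le> (1 / (2 * k)) * ((1 / 2) ^ n * Q) * k"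
      using T(2) Suc k(1) by (intro mult_right_mono mult_mono) auto
    also have "\<dots> = (1 / 2) ^ Suc n * Q" using k(1) by simp
    finally show ?case .
  qed
  show ?thesis
  proof (rule exI[of _ "2 * Q"], rule exI[of _ "ln 2 / T"], intro conjI allI impI)
    fix t :: real assume t: "0 \<le> t"
    define n where "n = nat \<lfloor>t / T\<rfloor>"
    have n: "real n \<le> t / T" "t / T < real n + 1" using t T by (auto simp: n_def)
    then have r: "t - real n * T \<in> {0..T}" using T(1) by (auto simp: field_simps)
    have "norm (mat_exp (t *\<^sub>R A)) \<le> (1 / 2) ^ n * Q" using step[OF r, of n] by simp
    also have "(1 / 2) ^ n = exp (- real n * ln 2)"
      by (simp add: exp_minus exp_of_nat_mult power_one_over inverse_eq_divide)
    \<comment> \<open>the last, incomplete period costs a factor 2\<close>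
    also have "exp (- real n * ln 2) \<le> exp (- (t / T - 1) * ln 2)"
    proof -
      have "(t / T - 1) * ln 2 \<le> real n * ln 2" using n by (intro mult_right_mono) auto
      then show ?thesis by (simp only: exp_le_cancel_iff mult_minus_left neg_le_iff_le)
    qed
    also have "- (t / T - 1) * ln 2 = ln 2 + - (ln 2 / T) * t" by (simp add: algebra_simps)
    also have "exp (ln 2 + - (ln 2 / T) * t) = 2 * exp (- (ln 2 / T) * t)" by (subst exp_add) simp
    finally show "norm (mat_exp (t *\<^sub>R A)) \<le> 2 * Q * exp (- (ln 2 / T) * t)"
      using Q0 by (simp add: mult_right_mono ac_simps)
  qed (use Q0 T in auto)
qed

lemma integrable_exp_decay: assumes "0 < c"
  shows "integrable lborel (\<lambda>t. indicator {0..} t * exp (- c * t) :: real)"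
proof -
  have "(\<integral>\<^sup>+t. ennreal (exp (- c * t)) * indicator {0..} t \<partial>lborel) = ennreal (0 - (- (exp (- c * 0) / c)))"
  proof (rule nn_integral_FTC_atLeast)
    fix t show "((\<lambda>t. - (exp (- c * t) / c)) has_real_derivative exp (- c * t)) (at t)"
      using assms by (auto intro!: derivative_eq_intros)
    have "filterlim (\<lambda>t. - c * t) at_bot at_top"
      using assms by (intro filterlim_tendsto_neg_mult_at_bot[OF tendsto_const] filterlim_ident) auto
    then have "((\<lambda>t. exp (- c * t)) \<longlongrightarrow> 0) at_top" by (rule filterlim_compose[OF exp_at_bot])
    from tendsto_minus[OF tendsto_divide[OF this tendsto_const[of c]]]
    show "((\<lambda>t. - (exp (- c * t) / c)) \<longlongrightarrow> 0) at_top" using assms by simp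
  qed auto
  then have "(\<integral>\<^sup>+t. ennreal (exp (- c * t)) * indicator {0..} t \<partial>lborel) < \<infinity>" by simp
  moreover have "ennreal (exp (- c * t)) * indicator {0..} t = ennreal (indicator {0..} t * exp (- c * t))" for t
    by (auto simp: indicator_def)
  ultimately show ?thesis by (intro integrableI_nonneg) auto
qed

lemma measurable_matrix_mult [measurable (raw)]:
  fixes f :: "'x \<Rightarrow> real^'n::finite^'m::finite" and g :: "'x \<Rightarrow> real^'k::finite^'n"
  assumes "f \<in> borel_measurable M" "g \<in> borel_measurable M"
  shows "(\<lambda>x. f x ** g x) \<in> borel_measurable M"
  by (rule borel_measurable_continuous_Pair[OF assms])
    (intro bounded_bilinear.continuous_on[OF bounded_bilinear_matrix_mult] continuous_intros)

definition bounded_function :: "('x \<Rightarrow> 'a::real_normed_vector) \<Rightarrow> bool" where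
  "bounded_function F \<longleftrightarrow> (\<exists>B. \<forall>u. norm (F u) \<le> B)"

lemma matrix_mult_norm:
  "\<exists>k>0. \<forall>(A :: real^'n::finite^'m::finite) (B :: real^'k::finite^'n). norm (A ** B) \<le> norm A * norm B * k"
  using bounded_bilinear.pos_bounded[OF bounded_bilinear_matrix_mult] by blast

lemma bounded_linear_mult_left: "bounded_linear (\<lambda>B :: real^'k::finite^'n::finite. (A :: real^'n^'m::finite) ** B)"
  by (rule bounded_bilinear.bounded_linear_right[OF bounded_bilinear_matrix_mult])

lemma bounded_linear_mult_right: "bounded_linear (\<lambda>A :: real^'n::finite^'m::finite. A ** (B :: real^'k::finite^'n))"
  by (rule bounded_bilinear.bounded_linear_left[OF bounded_bilinear_matrix_mult])

lemma bounded_function_mult: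
  fixes F :: "'x \<Rightarrow> real^'n::finite^'m::finite" and G :: "'x \<Rightarrow> real^'k::finite^'n"
  assumes "bounded_function F" "bounded_function G"
  shows "bounded_function (\<lambda>x. F x ** G x)"
proof -
  obtain k where k: "0 < k" "\<forall>(A :: real^'n^'m) (B :: real^'k^'n). norm (A ** B) \<le> norm A * norm B * k"
    using matrix_mult_norm by blast
  obtain a b where ab: "\<And>x. norm (F x) \<le> a" "\<And>x. norm (G x) \<le> b" using assms by (auto simp: bounded_function_def)
  have "norm (F x ** G x) \<le> a * b * k" for x
  proof -
    have "norm (F x ** G x) \<le> norm (F x) * norm (G x) * k" using k(2) by blast
    also have "\<dots> \<le> a * b * k" using ab[of x] k(1) order_trans[OF norm_ge_zero ab(1)[of x]] by (intro mult_right_mono mult_mono) auto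
    finally show ?thesis .
  qed
  then show ?thesis by (auto simp: bounded_function_def)
qed

lemma bounded_function_const: "bounded_function (\<lambda>_. c)"
  by (auto simp: bounded_function_def)

lemma integrable_mult_bounded:
  fixes F :: "'x \<Rightarrow> real^'n::finite^'m::finite" and G :: "'x \<Rightarrow> real^'k::finite^'n"
  assumes F: "F \<in> borel_measurable M" "bounded_function F" and G: "integrable M G"
  shows "integrable M (\<lambda>x. F x ** G x)"
proof -
  obtain k where k: "0 < k" "\<forall>(A :: real^'n^'m) (B :: real^'k^'n). norm (A ** B) \<le> norm A * norm B * k"
    using matrix_mult_norm by blast
  obtain a where a: "\<And>x. norm (F x) \<le> a" using F by (auto simp: bounded_function_def)
  show ?thesis
  proof (rule Bochner_Integration.integrable_bound[OF integrable_mult_right[OF integrable_norm[OF G], of "a * k"]])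
    show "(\<lambda>x. F x ** G x) \<in> borel_measurable M" using F G by measurable
    show "AE x in M. norm (F x ** G x) \<le> norm (a * k * norm (G x))"
    proof (rule AE_I2)
      fix x
      have "norm (F x ** G x) \<le> norm (F x) * norm (G x) * k" using k(2) by blast
      also have "\<dots> \<le> a * norm (G x) * k" using a k(1) by (intro mult_right_mono) auto
      also have "\<dots> \<le> norm (a * k * norm (G x))" by (simp add: ac_simps)
      finally show "norm (F x ** G x) \<le> norm (a * k * norm (G x))" .
    qed
  qed
qed

lemma integrable_bounded_mult:
  fixes F :: "'x \<Rightarrow> real^'n::finite^'m::finite" and G :: "'x \<Rightarrow> real^'k::finite^'n"
  assumes F: "integrable M F" and G: "G \<in> borel_measurable M" "bounded_function G"
  shows "integrable M (\<lambda>x. F x ** G x)"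
proof -
  obtain k where k: "0 < k" "\<forall>(A :: real^'n^'m) (B :: real^'k^'n). norm (A ** B) \<le> norm A * norm B * k"
    using matrix_mult_norm by blast
  obtain a where a: "\<And>x. norm (G x) \<le> a" using G by (auto simp: bounded_function_def)
  show ?thesis
  proof (rule Bochner_Integration.integrable_bound[OF integrable_mult_right[OF integrable_norm[OF F], of "a * k"]])
    show "(\<lambda>x. F x ** G x) \<in> borel_measurable M" using F G by measurable
    show "AE x in M. norm (F x ** G x) \<le> norm (a * k * norm (F x))"
    proof (rule AE_I2)
      fix x
      have "norm (F x ** G x) \<le> norm (F x) * norm (G x) * k" using k(2) by blast
      also have "\<dots> \<le> norm (F x) * a * k" using a k(1) by (intro mult_right_mono mult_left_mono) auto
      also have "\<dots> \<le> norm (a * k * norm (F x))" by (simp add: ac_simps)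
      finally show "norm (F x ** G x) \<le> norm (a * k * norm (F x))" .
    qed
  qed
qed

lemma integrable_pair_mult:
  fixes a c :: "real \<Rightarrow> real"
  assumes a: "integrable lborel a" and c: "integrable lborel c"
  shows "integrable (lborel \<Otimes>\<^sub>M lborel) (\<lambda>x. a (fst x) * c (snd x))"
proof (rule lborel_pair.Fubini_integrable)
  have [measurable]: "a \<in> borel_measurable lborel" "c \<in> borel_measurable lborel" using a c by auto
  show "(\<lambda>x. a (fst x) * c (snd x)) \<in> borel_measurable (lborel \<Otimes>\<^sub>M lborel)" by measurable
  have "(\<lambda>x. LINT y|lborel. norm (a (fst (x, y)) * c (snd (x, y)))) = (\<lambda>x. \<bar>a x\<bar> * (LINT y|lborel. \<bar>c y\<bar>))"
    by (simp add: abs_mult)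
  then show "integrable lborel (\<lambda>x. LINT y|lborel. norm (a (fst (x, y)) * c (snd (x, y))))"
    using a by simp
  show "AE x in lborel. integrable lborel (\<lambda>y. a (fst (x, y)) * c (snd (x, y)))" using c by simp
qed

lemma integrable_sandwich:
  fixes A :: "real \<Rightarrow> real^'b::finite^'a::finite" and B :: "real \<Rightarrow> real \<Rightarrow> real^'c::finite^'b" and C :: "real \<Rightarrow> real^'d::finite^'c"
  assumes A: "integrable lborel A" and C: "integrable lborel C"
    and Bm: "(\<lambda>x. B (fst x) (snd x)) \<in> borel_measurable (lborel \<Otimes>\<^sub>M lborel)" and Bb: "\<And>u w. norm (B u w) \<le> b"
  shows "integrable (lborel \<Otimes>\<^sub>M lborel) (\<lambda>(u, w). A u ** B u w ** C w)"
proof -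
  obtain k1 where k1: "0 < k1" "\<forall>(A :: real^'b^'a) (B :: real^'c^'b). norm (A ** B) \<le> norm A * norm B * k1" using matrix_mult_norm by blast
  obtain k2 where k2: "0 < k2" "\<forall>(A :: real^'c^'a) (B :: real^'d^'c). norm (A ** B) \<le> norm A * norm B * k2" using matrix_mult_norm by blast
  have [measurable]: "A \<in> borel_measurable lborel" "C \<in> borel_measurable lborel" using A C by auto
  note [measurable] = Bm
  have b0: "0 \<le> b" using Bb[of 0 0] norm_ge_zero order_trans by blast
  have "integrable (lborel \<Otimes>\<^sub>M lborel) (\<lambda>x. A (fst x) ** B (fst x) (snd x) ** C (snd x))"
  proof (rule Bochner_Integration.integrable_bound[OF integrable_mult_right[OF integrable_pair_mult[OF integrable_norm[OF A] integrable_norm[OF C]], of "b * k1 * k2"]])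
    show "(\<lambda>x. A (fst x) ** B (fst x) (snd x) ** C (snd x)) \<in> borel_measurable (lborel \<Otimes>\<^sub>M lborel)" by measurable
    show "AE x in lborel \<Otimes>\<^sub>M lborel. norm (A (fst x) ** B (fst x) (snd x) ** C (snd x)) \<le> norm (b * k1 * k2 * (norm (A (fst x)) * norm (C (snd x))))"
    proof (rule AE_I2)
      fix x :: "real \<times> real"
      have "norm (A (fst x) ** B (fst x) (snd x) ** C (snd x)) \<le> norm (A (fst x) ** B (fst x) (snd x)) * norm (C (snd x)) * k2" using k2(2) by blast
      also have "\<dots> \<le> (norm (A (fst x)) * norm (B (fst x) (snd x)) * k1) * norm (C (snd x)) * k2"
        using k1(2) k2(1) by (intro mult_right_mono) auto
      also have "\<dots> \<le> (norm (A (fst x)) * b * k1) * norm (C (snd x)) * k2"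
        using k1(1) k2(1) Bb by (intro mult_right_mono mult_left_mono) auto
      also have "\<dots> \<le> norm (b * k1 * k2 * (norm (A (fst x)) * norm (C (snd x))))" using b0 k1(1) k2(1) by (simp add: abs_mult ac_simps)
      finally show "norm (A (fst x) ** B (fst x) (snd x) ** C (snd x)) \<le> norm (b * k1 * k2 * (norm (A (fst x)) * norm (C (snd x))))" .
    qed
  qed
  then show ?thesis by (simp add: case_prod_beta')
qed

lemma integrable_shift_left: "integrable lborel C \<Longrightarrow> integrable lborel (\<lambda>w. C (h - w))" for C :: "real \<Rightarrow> 'a::euclidean_space" and h
  using lborel_integrable_real_affine[of C "-1" h] by simp

lemma integral_shift_left: "(LINT w|lborel. C (h - w)) = (LINT w|lborel. C w)" for C :: "real \<Rightarrow> 'a::euclidean_space" and h :: real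
  using lborel_integral_real_affine[of "-1" C h] by simp

lemma integral_shift_right: "(LINT w|lborel. C (w - h)) = (LINT w|lborel. C w)" for C :: "real \<Rightarrow> 'a::euclidean_space" and h :: real
  using lborel_integral_real_affine[of 1 C "-h"] by simp

text \<open>Functions of this kind vanish at negative arguments, so that their convolution over the whole line is a
  convolution over \<open>{0..h}\<close>.\<close>

definition tame :: "(real \<Rightarrow> 'a::euclidean_space) \<Rightarrow> bool" where
  "tame F \<longleftrightarrow> F \<in> borel_measurable borel \<and> bounded_function F \<and> (\<forall>u<0. F u = 0)"

lemma convolution_tame:
  fixes F :: "real \<Rightarrow> real^'n::finite^'m::finite" and G :: "real \<Rightarrow> real^'k::finite^'n"
  assumes F: "tame F" and G: "tame G" "integrable lborel G"
  shows "tame (\<lambda>h. LINT u|lborel. F u ** G (h - u))"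
proof -
  have [measurable]: "F \<in> borel_measurable borel" "G \<in> borel_measurable borel" using F G by (auto simp: tame_def)
  obtain k where k: "0 < k" "\<forall>(A :: real^'n^'m) (B :: real^'k^'n). norm (A ** B) \<le> norm A * norm B * k" using matrix_mult_norm by blast
  obtain b where b: "\<And>u. norm (F u) \<le> b" using F by (auto simp: tame_def bounded_function_def)
  have "(\<lambda>(h, u). F u ** G (h - u)) \<in> borel_measurable (borel \<Otimes>\<^sub>M lborel)" by measurable
  from lborel.borel_measurable_lebesgue_integral[OF this]
  have 1: "(\<lambda>h. LINT u|lborel. F u ** G (h - u)) \<in> borel_measurable borel" .
  have 2: "norm (LINT u|lborel. F u ** G (h - u)) \<le> b * k * (LINT u|lborel. norm (G u))" for h
  proof -
    have i: "integrable lborel (\<lambda>u. F u ** G (h - u))"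
      using F by (intro integrable_mult_bounded integrable_shift_left G) (auto simp: tame_def)
    have "norm (LINT u|lborel. F u ** G (h - u)) \<le> (LINT u|lborel. norm (F u ** G (h - u)))" by (rule integral_norm_bound)
    also have "\<dots> \<le> (LINT u|lborel. b * k * norm (G (h - u)))"
    proof (rule integral_mono)
      show "integrable lborel (\<lambda>u. b * k * norm (G (h - u)))" by (intro integrable_mult_right integrable_norm integrable_shift_left G)
      fix u
      have "norm (F u ** G (h - u)) \<le> norm (F u) * norm (G (h - u)) * k" using k(2) by blast
      also have "\<dots> \<le> b * norm (G (h - u)) * k" using b k(1) by (intro mult_right_mono) auto
      finally show "norm (F u ** G (h - u)) \<le> b * k * norm (G (h - u))" by (simp add: ac_simps)
    qed (use i in simp)
    also have "\<dots> = b * k * (LINT u|lborel. norm (G u))" using integral_shift_left[of "\<lambda>u. norm (G u)" h] by simp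
    finally show ?thesis .
  qed
  have 3: "(LINT u|lborel. F u ** G (h - u)) = 0" if "h < 0" for h
  proof -
    have "F u ** G (h - u) = 0" for u
      using F G that by (cases "u < 0") (auto simp: tame_def bounded_bilinear.zero_left[OF bounded_bilinear_matrix_mult] bounded_bilinear.zero_right[OF bounded_bilinear_matrix_mult])
    then show ?thesis by simp
  qed
  from 1 2 3 show ?thesis by (auto simp: tame_def bounded_function_def)
qed

lemma convolution_assoc:
  fixes A :: "real \<Rightarrow> real^'b::finite^'a::finite" and B :: "real \<Rightarrow> real^'c::finite^'b" and C :: "real \<Rightarrow> real^'d::finite^'c"
  assumes A: "integrable lborel A" and B: "tame B" and C: "integrable lborel C"
  shows "(LINT u|lborel. A u ** (LINT v|lborel. B v ** C (h - u - v))) = (LINT w|lborel. (LINT u|lborel. A u ** B (w - u)) ** C (h - w))"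
proof -
  have [measurable]: "B \<in> borel_measurable borel" and Bb: "bounded_function B" using B by (auto simp: tame_def)
  obtain b where b: "\<And>u. norm (B u) \<le> b" using Bb by (auto simp: bounded_function_def)
  have Bs: "bounded_function (\<lambda>w. B (f w))" for f :: "real \<Rightarrow> real" using b by (auto simp: bounded_function_def)
  let ?f = "\<lambda>u w. A u ** B (w - u) ** C (h - w)"
  have int: "integrable (lborel \<Otimes>\<^sub>M lborel) (\<lambda>(u, w). ?f u w)"
    by (rule integrable_sandwich[OF A integrable_shift_left[OF C], where b=b and B="\<lambda>u w. B (w - u)"]) (use b in measurable)
  have "(LINT u|lborel. A u ** (LINT v|lborel. B v ** C (h - u - v))) = (LINT u|lborel. LINT w|lborel. ?f u w)"
  proof (rule Bochner_Integration.integral_cong[OF refl])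
    fix u
    have "(LINT v|lborel. B v ** C (h - u - v)) = (LINT w|lborel. B (w - u) ** C (h - u - (w - u)))"
      by (rule integral_shift_right[symmetric])
    then have "A u ** (LINT v|lborel. B v ** C (h - u - v)) = A u ** (LINT w|lborel. B (w - u) ** C (h - w))" by simp
    also have "\<dots> = (LINT w|lborel. A u ** (B (w - u) ** C (h - w)))"
      by (rule integral_bounded_linear[OF bounded_linear_mult_left, symmetric])
        (intro integrable_mult_bounded integrable_shift_left C Bs, measurable)
    finally show "A u ** (LINT v|lborel. B v ** C (h - u - v)) = (LINT w|lborel. ?f u w)" by (simp add: matrix_mul_assoc)
  qed
  also have "\<dots> = (LINT w|lborel. LINT u|lborel. ?f u w)"
    using lborel_pair.Fubini_integral[OF int] by simp
  also have "\<dots> = (LINT w|lborel. (LINT u|lborel. A u ** B (w - u)) ** C (h - w))"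
  proof (rule Bochner_Integration.integral_cong[OF refl])
    fix w
    show "(LINT u|lborel. ?f u w) = (LINT u|lborel. A u ** B (w - u)) ** C (h - w)"
      by (rule integral_bounded_linear[OF bounded_linear_mult_right]) (intro integrable_bounded_mult A Bs, measurable)
  qed
  finally show ?thesis .
qed

section \<open>The matrices of descents and excursions\<close>

locale decaying =
  fixes Cp :: "real^'p::finite^'p" and Cm :: "real^'m::finite^'m" and Dpm :: "real^'m^'p" and Dmp :: "real^'p^'m"
  assumes decay_p: "((\<lambda>t. mat_exp (t *\<^sub>R Cp)) \<longlongrightarrow> 0) at_top" and decay_m: "((\<lambda>t. mat_exp (t *\<^sub>R Cm)) \<longlongrightarrow> 0) at_top"
begin

definition Ep :: "real \<Rightarrow> real^'p^'p" where "Ep s = indicator {0..} s *\<^sub>R mat_exp (s *\<^sub>R Cp)"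
definition Em :: "real \<Rightarrow> real^'m^'m" where "Em s = indicator {0..} s *\<^sub>R mat_exp (s *\<^sub>R Cm)"

lemma decay_tame:
  fixes A :: "real^'n::finite^'n"
  assumes "((\<lambda>t. mat_exp (t *\<^sub>R A)) \<longlongrightarrow> 0) at_top"
  shows "tame (\<lambda>s. indicator {0..} s *\<^sub>R mat_exp (s *\<^sub>R A))" "integrable lborel (\<lambda>s. indicator {0..} s *\<^sub>R mat_exp (s *\<^sub>R A))"
proof -
  obtain K c where K: "0 \<le> K" "0 < c" "\<And>t. 0 \<le> t \<Longrightarrow> norm (mat_exp (t *\<^sub>R A)) \<le> K * exp (- c * t)" using mat_exp_decay[OF assms] by blast
  have m: "(\<lambda>s. indicator {0..} s *\<^sub>R mat_exp (s *\<^sub>R A)) \<in> borel_measurable borel"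
    by (intro borel_measurable_continuous_on_indicator continuous_on_mat_exp) auto
  have le: "norm (indicator {0..} s *\<^sub>R mat_exp (s *\<^sub>R A)) \<le> K * (indicator {0..} s * exp (- c * s))" for s
    using K(3)[of s] by (auto simp: indicator_def)
  have "norm (indicator {0..} s *\<^sub>R mat_exp (s *\<^sub>R A)) \<le> K" for s
  proof -
    have "K * (indicator {0..} s * exp (- c * s)) \<le> K * 1" using K by (intro mult_left_mono) (auto simp: indicator_def)
    then show ?thesis using le[of s] by linarith
  qed
  then show "tame (\<lambda>s. indicator {0..} s *\<^sub>R mat_exp (s *\<^sub>R A))" using m unfolding tame_def bounded_function_def by auto
  show "integrable lborel (\<lambda>s. indicator {0..} s *\<^sub>R mat_exp (s *\<^sub>R A))"
  proof (rule Bochner_Integration.integrable_bound[OF integrable_mult_right[OF integrable_exp_decay[OF K(2)], of K]])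
    show "AE s in lborel. norm (indicator {0..} s *\<^sub>R mat_exp (s *\<^sub>R A)) \<le> norm (K * (indicator {0..} s * exp (- c * s)))"
      using le by (intro AE_I2) (smt (verit) real_norm_def)
  qed (use m in simp)
qed

lemma Ep_tame: "tame Ep" and Ep_int: "integrable lborel Ep"
  using decay_tame[OF decay_p] by (simp_all add: Ep_def[abs_def])

lemma Em_tame: "tame Em" and Em_int: "integrable lborel Em"
  using decay_tame[OF decay_m] by (simp_all add: Em_def[abs_def])

lemma Ep_meas [measurable]: "Ep \<in> borel_measurable borel" and Em_meas [measurable]: "Em \<in> borel_measurable borel"
  using Ep_tame Em_tame by (auto simp: tame_def)

lemma Ep_add: "0 \<le> s \<Longrightarrow> 0 \<le> t \<Longrightarrow> Ep (s + t) = Ep s ** Ep t"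
  by (simp add: Ep_def mat_exp_add)

primrec Psi :: "nat \<Rightarrow> real^'m^'p" where
  "Psi 0 = 0"
| "Psi (Suc n) = (LINT y|lborel. Ep y ** (Dpm + Psi n ** Dmp ** Psi n) ** Em y)"

text \<open>The matrix of the descents by \<open>h\<close> whose counter starts at \<open>K\<close> and ends with at most the first argument.
  The recursion splits at the last valley, at depth \<open>u\<close>: neither the counter before it nor the height of
  the excursion there exceeds \<open>n\<close>, and no further valley follows.\<close>

primrec descent_matrix :: "nat \<Rightarrow> nat \<Rightarrow> real \<Rightarrow> real^'m^'m" where
  "descent_matrix 0 K h = 0"
| "descent_matrix (Suc n) K h = (if K \<le> Suc n then Em h else 0) + (LINT u|lborel. descent_matrix n K u ** ((Dmp ** Psi n) ** Em (h - u)))"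

text \<open>The contribution of the excursions of height exactly \<open>k\<close>.\<close>

definition Psi_increment :: "nat \<Rightarrow> real^'m^'p" where "Psi_increment k = Psi k - Psi (k - 1)"

lemmas mm_bilinear = bounded_bilinear_matrix_mult
lemmas mm_zero [simp] = bounded_bilinear.zero_left[OF mm_bilinear] bounded_bilinear.zero_right[OF mm_bilinear]

lemma tame_const_mult:
  fixes F :: "real \<Rightarrow> real^'n::finite^'k::finite"
  assumes "tame F" shows "tame (\<lambda>u. (A :: real^'k^'l::finite) ** F u)"
  using assms bounded_function_mult[OF bounded_function_const, of F A] by (auto simp: tame_def)

lemma tame_mult_const:
  fixes F :: "real \<Rightarrow> real^'k::finite^'l::finite"
  assumes "tame F" shows "tame (\<lambda>u. F u ** (A :: real^'n::finite^'k))"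
  using assms bounded_function_mult[OF _ bounded_function_const, of F A] by (auto simp: tame_def)

lemma tame_add: "tame F \<Longrightarrow> tame G \<Longrightarrow> tame (\<lambda>u. F u + G u)"
proof -
  assume "tame F" "tame G"
  moreover from this obtain a b where "\<And>u. norm (F u) \<le> a" "\<And>u. norm (G u) \<le> b" by (auto simp: tame_def bounded_function_def)
  then have "norm (F u + G u) \<le> a + b" for u by (meson add_mono norm_triangle_le)
  ultimately show ?thesis by (auto simp: tame_def bounded_function_def)
qed

lemma Q_tame: "tame (\<lambda>u. (Dmp ** Psi n) ** Em u)" and Q_int: "integrable lborel (\<lambda>u. (Dmp ** Psi n) ** Em u)"
  by (auto intro!: tame_const_mult Em_tame integrable_bounded_linear[OF bounded_linear_mult_left] Em_int)

lemma descent_matrix_tame: "tame (descent_matrix n K)"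
proof (induction n)
  case 0
  have "descent_matrix 0 K = (\<lambda>_. 0)" by (simp add: fun_eq_iff)
  then show ?case by (simp add: tame_def bounded_function_const)
next
  case (Suc n)
  have "tame (\<lambda>h. (if K \<le> Suc n then Em h else 0))"
    using Em_tame by (cases "K \<le> Suc n") (simp_all add: tame_def bounded_function_const)
  moreover have "descent_matrix (Suc n) K = (\<lambda>h. (if K \<le> Suc n then Em h else 0) + (LINT u|lborel. descent_matrix n K u ** ((Dmp ** Psi n) ** Em (h - u))))"
    by (simp add: fun_eq_iff)
  ultimately show ?case using tame_add[OF _ convolution_tame[OF Suc Q_tame Q_int]] by simp
qed

lemma descent_matrix_meas [measurable]: "descent_matrix n K \<in> borel_measurable borel" and descent_matrix_bounded: "bounded_function (descent_matrix n K)"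
  and descent_matrix_neg: "u < 0 \<Longrightarrow> descent_matrix n K u = 0"
  using descent_matrix_tame[of n K] by (auto simp: tame_def)

lemma descent_matrix_eq_0: "n < K \<Longrightarrow> descent_matrix n K h = 0"
  by (induction n arbitrary: h) auto

lemma sum_Psi_increment: "(\<Sum>k\<in>{1..n}. Psi_increment k) = Psi n"
  by (induction n) (auto simp: Psi_increment_def)

lemma descent_matrix_conv_integrable: "integrable lborel (\<lambda>u. (Em u ** Dmp ** Psi_increment k) ** descent_matrix n K (h - u))"
proof (rule integrable_bounded_mult)
  show "integrable lborel (\<lambda>u. Em u ** Dmp ** Psi_increment k)"
    by (intro integrable_bounded_linear[OF bounded_linear_mult_right] Em_int)
  show "bounded_function (\<lambda>u. descent_matrix n K (h - u))" using descent_matrix_bounded[of n K] by (auto simp: bounded_function_def)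
qed measurable

text \<open>The same matrices satisfy the recursion that splits at the first valley, which is the one that can be
  followed along a path. Inserting the first-valley form into the defining recursion convolves from
  both ends; by associativity of convolution the first valley can be pulled out again.\<close>

lemma descent_matrix_first_valley:
  assumes "1 \<le> K"
  shows "descent_matrix n K h = (if K \<le> n then Em h else 0) + (\<Sum>k\<in>{1..<n}. LINT u|lborel. (Em u ** Dmp ** Psi_increment k) ** descent_matrix n (Suc (max K k)) (h - u))"
proof (induction n arbitrary: h)
  case 0
  then show ?case using assms by simp
next
  case (Suc n)
  let ?Q = "\<lambda>u. (Dmp ** Psi n) ** Em u"
  let ?A = "\<lambda>k u. Em u ** Dmp ** Psi_increment k"
  let ?K = "\<lambda>k. Suc (max K k)"
  have Ai: "integrable lborel (?A k)" for k by (intro integrable_bounded_linear[OF bounded_linear_mult_right] Em_int)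
  have At: "tame (?A k)" for k by (intro tame_mult_const Em_tame)
  have EQ: "integrable lborel (\<lambda>u. Em u ** ?Q (h - u))" for h
    using Q_tame[of n] by (intro integrable_bounded_mult Em_int) (auto simp: tame_def bounded_function_def)
  have EQ': "integrable lborel (\<lambda>u. if K \<le> n then Em u ** ?Q (h - u) else 0)" for h
    using EQ[of h] by (cases "K \<le> n") simp_all
  define CV where "CV = (\<lambda>k w. LINT u|lborel. ?A k u ** descent_matrix n (?K k) (w - u))"
  have CVt: "tame (CV k)" for k
  proof -
      obtain kk where kk: "0 < kk" "\<forall>(A :: real^'m^'m) (B :: real^'m^'m). norm (A ** B) \<le> norm A * norm B * kk" using matrix_mult_norm by blast
      obtain b where b: "\<And>u. norm (descent_matrix n (?K k) u) \<le> b" using descent_matrix_bounded[of n "?K k"] by (auto simp: bounded_function_def)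
      have [measurable]: "?A k \<in> borel_measurable borel" using At by (auto simp: tame_def)
      have "(\<lambda>(w, u). ?A k u ** descent_matrix n (?K k) (w - u)) \<in> borel_measurable (borel \<Otimes>\<^sub>M lborel)" by measurable
      from lborel.borel_measurable_lebesgue_integral[OF this] have "CV k \<in> borel_measurable borel" by (simp add: CV_def)
      moreover have "norm (CV k w) \<le> (LINT u|lborel. norm (?A k u)) * b * kk" for w
      proof -
        have "norm (CV k w) \<le> (LINT u|lborel. norm (?A k u ** descent_matrix n (?K k) (w - u)))" unfolding CV_def by (rule integral_norm_bound)
        also have "\<dots> \<le> (LINT u|lborel. norm (?A k u) * (b * kk))"
        proof (rule integral_mono)
          show "integrable lborel (\<lambda>u. norm (?A k u ** descent_matrix n (?K k) (w - u)))" by (intro integrable_norm descent_matrix_conv_integrable)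
          show "integrable lborel (\<lambda>u. norm (?A k u) * (b * kk))" by (intro integrable_mult_left integrable_norm Ai)
          fix u
          have "norm (?A k u ** descent_matrix n (?K k) (w - u)) \<le> norm (?A k u) * norm (descent_matrix n (?K k) (w - u)) * kk" using kk(2) by blast
          also have "\<dots> \<le> norm (?A k u) * b * kk" using b kk(1) by (intro mult_right_mono mult_left_mono) auto
          finally show "norm (?A k u ** descent_matrix n (?K k) (w - u)) \<le> norm (?A k u) * (b * kk)" by (simp add: mult.assoc)
        qed
        finally show ?thesis by (simp add: mult.assoc)
      qed
      moreover have "CV k w = 0" if "w < 0" for w
      proof -
        have "?A k u ** descent_matrix n (?K k) (w - u) = 0" for u
          using that At descent_matrix_neg[of "w - u"] by (cases "u < 0") (auto simp: tame_def)
        then show ?thesis by (simp add: CV_def)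
      qed
      ultimately show "tame (CV k)" by (auto simp: tame_def bounded_function_def)
  qed
  have CVQ: "integrable lborel (\<lambda>w. CV k w ** ?Q (h - w))" for k h
    using CVt[of k] by (intro integrable_mult_bounded integrable_shift_left Q_int) (auto simp: tame_def)
  have Wn: "descent_matrix n K w = (if K \<le> n then Em w else 0) + (\<Sum>k\<in>{1..<n}. CV k w)" for w
    unfolding CV_def by (rule Suc.IH)
  have last: "(LINT u|lborel. descent_matrix n K u ** ?Q (h - u)) = (if K \<le> n then (LINT u|lborel. Em u ** ?Q (h - u)) else 0) + (\<Sum>k\<in>{1..<n}. LINT w|lborel. CV k w ** ?Q (h - w))"
  proof -
    have "(LINT u|lborel. descent_matrix n K u ** ?Q (h - u)) = (LINT u|lborel. (if K \<le> n then Em u ** ?Q (h - u) else 0) + (\<Sum>k\<in>{1..<n}. CV k u ** ?Q (h - u)))"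
      unfolding Wn by (intro Bochner_Integration.integral_cong refl)
        (simp add: bounded_bilinear.add_left[OF mm_bilinear] bounded_bilinear.sum_left[OF mm_bilinear])
    also have "\<dots> = (LINT u|lborel. (if K \<le> n then Em u ** ?Q (h - u) else 0)) + (LINT u|lborel. (\<Sum>k\<in>{1..<n}. CV k u ** ?Q (h - u)))"
      by (intro Bochner_Integration.integral_add Bochner_Integration.integrable_sum CVQ EQ')
    also have "(LINT u|lborel. (\<Sum>k\<in>{1..<n}. CV k u ** ?Q (h - u))) = (\<Sum>k\<in>{1..<n}. LINT w|lborel. CV k w ** ?Q (h - w))"
      by (intro Bochner_Integration.integral_sum CVQ)
    finally show ?thesis by simp
  qed
  have each: "(LINT u|lborel. ?A k u ** descent_matrix (Suc n) (?K k) (h - u)) =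
      (if max K k \<le> n then (LINT u|lborel. ?A k u ** Em (h - u)) else 0) + (LINT w|lborel. CV k w ** ?Q (h - w))" for k
  proof -
    have i1: "integrable lborel (\<lambda>u. if max K k \<le> n then ?A k u ** Em (h - u) else 0)"
    proof -
      have "integrable lborel (\<lambda>u. ?A k u ** Em (h - u))"
        using Em_tame by (intro integrable_bounded_mult Ai) (auto simp: tame_def bounded_function_def)
      then show ?thesis by (cases "max K k \<le> n") (simp_all del: max.bounded_iff)
    qed
    have "tame (\<lambda>x. LINT v|lborel. descent_matrix n (?K k) v ** ?Q (x - v))" by (rule convolution_tame[OF descent_matrix_tame Q_tame Q_int])
    then have i2: "integrable lborel (\<lambda>u. ?A k u ** (LINT v|lborel. descent_matrix n (?K k) v ** ?Q (h - u - v)))"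
      by (intro integrable_bounded_mult Ai) (auto simp: tame_def bounded_function_def)
    have "(LINT u|lborel. ?A k u ** descent_matrix (Suc n) (?K k) (h - u)) =
       (LINT u|lborel. (if max K k \<le> n then ?A k u ** Em (h - u) else 0) + ?A k u ** (LINT v|lborel. descent_matrix n (?K k) v ** ?Q (h - u - v)))"
      by (intro Bochner_Integration.integral_cong refl) (simp add: bounded_bilinear.add_right[OF mm_bilinear])
    also have "\<dots> = (LINT u|lborel. (if max K k \<le> n then ?A k u ** Em (h - u) else 0)) + (LINT u|lborel. ?A k u ** (LINT v|lborel. descent_matrix n (?K k) v ** ?Q (h - u - v)))"
      by (rule Bochner_Integration.integral_add[OF i1 i2])
    also have "(LINT u|lborel. ?A k u ** (LINT v|lborel. descent_matrix n (?K k) v ** ?Q (h - u - v))) = (LINT w|lborel. CV k w ** ?Q (h - w))"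
      unfolding CV_def by (rule convolution_assoc[OF Ai descent_matrix_tame Q_int])
    finally show ?thesis by (cases "max K k \<le> n") (simp_all del: max.bounded_iff)
  qed
  have valleys: "(\<Sum>k\<in>{1..<Suc n}. if max K k \<le> n then (LINT u|lborel. ?A k u ** Em (h - u)) else 0) = (if K \<le> n then (LINT u|lborel. Em u ** ?Q (h - u)) else 0)"
  proof (cases "K \<le> n")
    case True
    have i: "integrable lborel (\<lambda>u. ?A k u ** Em (h - u))" for k
      using Em_tame by (intro integrable_bounded_mult Ai) (auto simp: tame_def bounded_function_def)
    have "(\<Sum>k\<in>{1..<Suc n}. if max K k \<le> n then (LINT u|lborel. ?A k u ** Em (h - u)) else 0) = (\<Sum>k\<in>{1..n}. (LINT u|lborel. ?A k u ** Em (h - u)))"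
      using True by (intro sum.cong) auto
    also have "\<dots> = (LINT u|lborel. (\<Sum>k\<in>{1..n}. ?A k u ** Em (h - u)))"
      by (rule Bochner_Integration.integral_sum[symmetric]) (rule i)
    also have "\<dots> = (LINT u|lborel. Em u ** ?Q (h - u))"
    proof (intro Bochner_Integration.integral_cong refl)
      fix u
      have "(\<Sum>k\<in>{1..n}. ?A k u ** Em (h - u)) = Em u ** Dmp ** (\<Sum>k\<in>{1..n}. Psi_increment k) ** Em (h - u)"
        by (simp add: bounded_bilinear.sum_left[OF mm_bilinear] bounded_bilinear.sum_right[OF mm_bilinear])
      then show "(\<Sum>k\<in>{1..n}. ?A k u ** Em (h - u)) = Em u ** ?Q (h - u)" unfolding sum_Psi_increment by (simp add: matrix_mul_assoc)
    qed
    finally show ?thesis using True by simp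
  next
    case False then show ?thesis by (auto intro!: sum.neutral)
  qed
  have CVn: "(LINT w|lborel. CV n w ** ?Q (h - w)) = 0"
  proof -
    have "CV n w = 0" for w unfolding CV_def by (simp add: descent_matrix_eq_0)
    then show ?thesis by simp
  qed
  have "(\<Sum>k\<in>{1..<Suc n}. LINT w|lborel. CV k w ** ?Q (h - w)) = (\<Sum>k\<in>{1..<n}. LINT w|lborel. CV k w ** ?Q (h - w))"
    using CVn by (cases n) auto
  then have "(\<Sum>k\<in>{1..<Suc n}. LINT u|lborel. ?A k u ** descent_matrix (Suc n) (?K k) (h - u)) = (LINT u|lborel. descent_matrix n K u ** ?Q (h - u))"
    unfolding each last sum.distrib valleys by simp
  then show ?case by simp
qed

lemma E_M_E_integrable: "integrable lborel (\<lambda>y. Ep y ** M ** Em y)"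
  using Ep_tame by (intro integrable_mult_bounded Em_int bounded_function_mult bounded_function_const) (auto simp: tame_def)

lemma Ep_descent_matrix_integrable: "integrable lborel (\<lambda>s. Ep s ** Dpm ** descent_matrix n K s)"
  using descent_matrix_bounded[of n K] by (intro integrable_bounded_mult integrable_bounded_linear[OF bounded_linear_mult_right] Ep_int) auto

text \<open>Splitting the initial rise at the level \<open>p\<close> of the last valley with the semigroup property leaves, above
  \<open>p\<close>, an excursion of height at most \<open>n\<close>. In this way the recursion of the descents becomes the
  recursion of \<open>Psi\<close>.\<close>

lemma Psi_descent_matrix: "Psi n = (LINT s|lborel. Ep s ** Dpm ** descent_matrix n 1 s)"
proof (induction n)
  case 0 then show ?case by simp
next
  case (Suc n)
  let ?Q = "\<lambda>u. (Dmp ** Psi n) ** Em u"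
  have [measurable]: "?Q \<in> borel_measurable borel" by measurable
  obtain b where b: "\<And>u. norm (descent_matrix n 1 u) \<le> b" using descent_matrix_bounded[of n 1] by (auto simp: bounded_function_def)
  have AD: "integrable lborel (\<lambda>s. Ep s ** Dpm)" by (intro integrable_bounded_linear[OF bounded_linear_mult_right] Ep_int)
  let ?f = "\<lambda>s p. Ep s ** Dpm ** descent_matrix n 1 (s - p) ** ?Q p"
  have int: "integrable (lborel \<Otimes>\<^sub>M lborel) (\<lambda>(s, p). ?f s p)"
    by (rule integrable_sandwich[OF AD Q_int, where b=b and B="\<lambda>s p. descent_matrix n 1 (s - p)"]) (use b in measurable)
  have conv: "tame (\<lambda>s. LINT u|lborel. descent_matrix n 1 u ** ?Q (s - u))" by (rule convolution_tame[OF descent_matrix_tame Q_tame Q_int])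
  have i2: "integrable lborel (\<lambda>s. Ep s ** Dpm ** (LINT u|lborel. descent_matrix n 1 u ** ?Q (s - u)))"
    using conv by (intro integrable_bounded_mult AD) (auto simp: tame_def)
  have "(LINT s|lborel. Ep s ** Dpm ** (LINT u|lborel. descent_matrix n 1 u ** ?Q (s - u))) = (LINT s|lborel. LINT p|lborel. ?f s p)"
  proof (rule Bochner_Integration.integral_cong[OF refl])
    fix s
    have "(LINT u|lborel. descent_matrix n 1 u ** ?Q (s - u)) = (LINT p|lborel. descent_matrix n 1 (s - p) ** ?Q (s - (s - p)))"
      by (rule integral_shift_left[symmetric])
    then have "Ep s ** Dpm ** (LINT u|lborel. descent_matrix n 1 u ** ?Q (s - u)) = Ep s ** Dpm ** (LINT p|lborel. descent_matrix n 1 (s - p) ** ?Q p)" by simp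
    also have "\<dots> = (LINT p|lborel. Ep s ** Dpm ** (descent_matrix n 1 (s - p) ** ?Q p))"
      by (rule integral_bounded_linear[OF bounded_linear_mult_left, symmetric])
        (intro integrable_mult_bounded Q_int, use b in \<open>auto simp: bounded_function_def\<close>)
    finally show "Ep s ** Dpm ** (LINT u|lborel. descent_matrix n 1 u ** ?Q (s - u)) = (LINT p|lborel. ?f s p)" by (simp add: matrix_mul_assoc)
  qed
  also have "\<dots> = (LINT p|lborel. LINT s|lborel. ?f s p)" using lborel_pair.Fubini_integral[OF int] by simp
  also have "\<dots> = (LINT p|lborel. Ep p ** (Psi n ** Dmp ** Psi n) ** Em p)"
  proof (rule Bochner_Integration.integral_cong[OF refl])
    fix p
    show "(LINT s|lborel. ?f s p) = Ep p ** (Psi n ** Dmp ** Psi n) ** Em p"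
    proof (cases "0 \<le> p")
      case False then show ?thesis by (simp add: Em_def)
    next
      case True
      have "(LINT s|lborel. ?f s p) = (LINT u|lborel. Ep (u + p) ** Dpm ** descent_matrix n 1 (u + p - p) ** ?Q p)"
        using integral_shift_right[of "\<lambda>u. Ep (u + p) ** Dpm ** descent_matrix n 1 (u + p - p) ** ?Q p" p] by simp
      also have "\<dots> = (LINT u|lborel. Ep p ** ((Ep u ** Dpm ** descent_matrix n 1 u) ** ?Q p))"
      proof (rule Bochner_Integration.integral_cong[OF refl])
        fix u show "Ep (u + p) ** Dpm ** descent_matrix n 1 (u + p - p) ** ?Q p = Ep p ** ((Ep u ** Dpm ** descent_matrix n 1 u) ** ?Q p)"
          using Ep_add[OF True, of u] by (cases "0 \<le> u") (simp_all add: descent_matrix_neg matrix_mul_assoc add.commute)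
      qed
      also have "\<dots> = Ep p ** (LINT u|lborel. (Ep u ** Dpm ** descent_matrix n 1 u) ** ?Q p)"
        by (rule integral_bounded_linear[OF bounded_linear_mult_left]) (intro integrable_bounded_linear[OF bounded_linear_mult_right] Ep_descent_matrix_integrable)
      also have "(LINT u|lborel. (Ep u ** Dpm ** descent_matrix n 1 u) ** ?Q p) = (LINT u|lborel. Ep u ** Dpm ** descent_matrix n 1 u) ** ?Q p"
        by (rule integral_bounded_linear[OF bounded_linear_mult_right Ep_descent_matrix_integrable])
      finally show ?thesis by (simp add: Suc.IH[symmetric] matrix_mul_assoc del: One_nat_def)
    qed
  qed
  finally have 1: "(LINT s|lborel. Ep s ** Dpm ** (LINT u|lborel. descent_matrix n 1 u ** ?Q (s - u))) = (LINT p|lborel. Ep p ** (Psi n ** Dmp ** Psi n) ** Em p)" .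
  have "(LINT s|lborel. Ep s ** Dpm ** descent_matrix (Suc n) 1 s) = (LINT s|lborel. Ep s ** Dpm ** Em s + Ep s ** Dpm ** (LINT u|lborel. descent_matrix n 1 u ** ?Q (s - u)))"
    by (intro Bochner_Integration.integral_cong refl) (simp add: bounded_bilinear.add_right[OF mm_bilinear])
  also have "\<dots> = (LINT s|lborel. Ep s ** Dpm ** Em s) + (LINT p|lborel. Ep p ** (Psi n ** Dmp ** Psi n) ** Em p)"
    using Bochner_Integration.integral_add[OF E_M_E_integrable i2] 1 by simp
  also have "\<dots> = (LINT s|lborel. Ep s ** Dpm ** Em s + Ep s ** (Psi n ** Dmp ** Psi n) ** Em s)"
    by (rule Bochner_Integration.integral_add[OF E_M_E_integrable E_M_E_integrable, symmetric])
  also have "\<dots> = Psi (Suc n)"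
    by (simp add: bounded_bilinear.add_right[OF mm_bilinear] bounded_bilinear.add_left[OF mm_bilinear])
  finally show ?case by simp
qed

end

section \<open>Expectations over descents and excursions\<close>

lemma mat_exp_vanishes:
  fixes A :: "real^'n::finite^'n"
  assumes span: "span Z = UNIV" and Z: "\<And>x y. x \<in> Z \<Longrightarrow> ((\<lambda>t. (x v* mat_exp (t *\<^sub>R A)) \<bullet> y) \<longlongrightarrow> 0) at_top"
  shows "((\<lambda>t. mat_exp (t *\<^sub>R A)) \<longlongrightarrow> 0) at_top"
proof (intro vec_tendstoI)
  have all: "((\<lambda>t. (x v* mat_exp (t *\<^sub>R A)) \<bullet> y) \<longlongrightarrow> 0) at_top" for x y
  proof -
    have "x \<in> span Z" using span by simp
    then show ?thesis
    proof (induction rule: span_induct_alt)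
      case base then show ?case by (simp add: bounded_bilinear.zero_left[OF vm_bilinear])
    next
      case (step c z x)
      have "((\<lambda>t. c * ((z v* mat_exp (t *\<^sub>R A)) \<bullet> y) + (x v* mat_exp (t *\<^sub>R A)) \<bullet> y) \<longlongrightarrow> c * 0 + 0) at_top"
        by (intro tendsto_add tendsto_mult tendsto_const Z step)
      then show ?case
        by (simp add: bounded_bilinear.add_left[OF vm_bilinear] bounded_bilinear.scaleR_left[OF vm_bilinear] inner_add_left)
    qed
  qed
  fix i j
  have "mat_exp (t *\<^sub>R A) $ i $ j = (axis i 1 v* mat_exp (t *\<^sub>R A)) \<bullet> axis j 1" for t
  proof -
    have "(axis i 1 v* mat_exp (t *\<^sub>R A)) $ j = (\<Sum>k\<in>UNIV. if k = i then mat_exp (t *\<^sub>R A) $ k $ j else 0)"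
      unfolding vector_matrix_mult_def axis_def vec_lambda_beta by (rule sum.cong[OF refl]) simp
    then show ?thesis by (simp add: inner_axis)
  qed
  then show "((\<lambda>t. mat_exp (t *\<^sub>R A) $ i $ j) \<longlongrightarrow> 0 $ i $ j) at_top" using all[of "axis i 1" "axis j 1"] by simp
qed

lemma row_matrix_inner: "(x v* A) \<bullet> y = x \<bullet> (A *v y)" for A :: "real^'n::finite^'m::finite"
  by (simp add: dot_lmul_matrix)

lemma bounded_linear_entry: "bounded_linear (\<lambda>A :: real^'n::finite^'m::finite. x \<bullet> (A *v y))"
  by (intro bounded_linear_compose[OF bounded_linear_inner_right] bounded_bilinear.bounded_linear_left[OF bounded_bilinear_matrix_vector_mult])

locale rap_fluid = rap_process X P
  for X :: "('p::finite, 'm::finite, 'i::finite, 'j::finite) rap_data" and P :: "('p, 'm) state \<Rightarrow> ('p, 'm) path measure" +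
  assumes leaves: "a \<in> side X b \<Longrightarrow> ((\<lambda>t. measure (P a) {\<omega>\<in>Omega X. \<forall>s\<in>{0..t}. \<omega> s \<in> side X b}) \<longlongrightarrow> 0) at_top"
begin

lemma side_zero: "a \<in> side X True \<Longrightarrow> snd a = 0" "a \<in> side X False \<Longrightarrow> fst a = 0"
  by (auto simp: side_def Zplus_def Zminus_def)

lemma stay_set: assumes "0 \<le> t"
  shows "{\<omega>\<in>Omega X. \<forall>s\<in>{0..t}. \<omega> s \<in> side X b} = {\<omega>\<in>Omega X. \<omega> 0 \<in> side X b \<and> t < sw \<omega>}"
proof (intro Collect_cong conj_cong refl iffI)
  fix \<omega> :: "('p, 'm) path" assume \<omega>: "\<omega> \<in> Omega X"
  {
    assume s: "\<forall>s\<in>{0..t}. \<omega> s \<in> side X b"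
    then have 0: "\<omega> 0 \<in> side X b" using assms by simp
    have "\<not> sw \<omega> \<le> t"
    proof
      assume "sw \<omega> \<le> t"
      then have "\<omega> (sw \<omega>) \<in> side X b" using s switch_time(1)[OF \<omega> 0] by simp
      then show False using switch_time(2)[OF \<omega> 0] side_excl by blast
    qed
    then show "\<omega> 0 \<in> side X b \<and> t < sw \<omega>" using 0 by simp
  }
  assume "\<omega> 0 \<in> side X b \<and> t < sw \<omega>"
  then show "\<forall>s\<in>{0..t}. \<omega> s \<in> side X b" using switch_time(3)[OF \<omega>, of b] by auto
qed

lemma integral_P_const: "a \<in> states X \<Longrightarrow> (LINT \<omega>|P a. c :: real) = c"
  using prob_space.prob_space[OF prob_space_P] by simp

lemma integral_P_inner: assumes "a \<in> states X" shows "(LINT \<omega>|P a. \<omega> 0 \<bullet> e) = a \<bullet> e"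
proof -
  have "(LINT \<omega>|P a. \<omega> 0 \<bullet> e) = (LINT \<omega>|P a. a \<bullet> e)"
    by (rule integral_P_start[OF assms]) (use measurable_eval[of 0] in measurable)
  then show ?thesis using integral_P_const[OF assms] by simp
qed

text \<open>By \<open>switch_integral\<close> the left-hand side is the expectation of \<open>\<omega> t \<bullet> e\<close> on the event that the path has not
  left its side until \<open>t\<close>. States are bounded, and the probability of the event vanishes in the limit.\<close>

lemma side_flow_vanishes: assumes a: "a \<in> side X b" shows "((\<lambda>t. side_flow X t a \<bullet> e) \<longlongrightarrow> 0) at_top"
proof -
  obtain S where S: "\<And>a. a \<in> states X \<Longrightarrow> norm a \<le> S" using bounded_states by (auto simp: bounded_iff)
  note st = side_states[OF a]
  have S0: "0 \<le> S" using S[OF st] norm_ge_zero order_trans by blast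
  let ?stay = "\<lambda>t. {\<omega>\<in>Omega X. \<forall>s\<in>{0..t}. \<omega> s \<in> side X b}"
  have le: "norm (side_flow X t a \<bullet> e) \<le> (S * norm e) * measure (P a) (?stay t)" if t: "0 \<le> t" for t
  proof -
    have He: "\<bar>\<omega> t \<bullet> e\<bar> \<le> S * norm e" if "\<omega> \<in> Omega X" "0 \<le> t" for \<omega> :: "('p, 'm) path" and t
      using Cauchy_Schwarz_ineq2[of "\<omega> t" e] mult_right_mono[OF S[OF path_states[OF that]] norm_ge_zero[of e]] by linarith
    note [measurable] = measurable_switch_time measurable_eval[OF order_refl] measurable_eval[OF t]
    have [measurable]: "Measurable.pred PA (\<lambda>\<omega>. \<omega> 0 \<in> side X b)" by (rule measurable_in_side) auto
    have m: "?stay t \<in> sets PA" unfolding stay_set[OF t] unfolding space_PA[symmetric] by measurable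
    have "(LINT \<omega>|P a. (if sw \<omega> \<le> t then 0 else shift t \<omega> 0 \<bullet> e)) = reward e (\<lambda>_. 0) t t a"
      by (rule switch_integral[where B=0 and B'="S * norm e" and G="\<lambda>_ _. 0" and H="\<lambda>\<omega>. \<omega> 0 \<bullet> e", OF _ _ a t])
        (use He S0 integral_P_inner side_states in auto)
    then have "norm (side_flow X t a \<bullet> e) = \<bar>LINT \<omega>|P a. (if sw \<omega> \<le> t then 0 else \<omega> t \<bullet> e)\<bar>"
      by (simp add: reward_def cong: if_cong)
    also have "\<dots> \<le> (LINT \<omega>|P a. \<bar>if sw \<omega> \<le> t then 0 else \<omega> t \<bullet> e\<bar>)"
      by (rule integral_abs_bound)
    also have "\<dots> \<le> (LINT \<omega>|P a. (S * norm e) * indicator (?stay t) \<omega>)"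
    proof (rule integral_mono_AE)
      show "integrable (P a) (\<lambda>\<omega>. \<bar>if sw \<omega> \<le> t then 0 else \<omega> t \<bullet> e\<bar>)"
        by (rule integrable_P[OF st, where B="S * norm e"]) (use He[OF _ t] S0 in auto)
      show "integrable (P a) (\<lambda>\<omega>. (S * norm e) * indicator (?stay t) \<omega>)"
      proof (rule integrable_P[OF st, where B="S * norm e"])
        show "(\<lambda>\<omega>. (S * norm e) * indicator (?stay t) \<omega>) \<in> borel_measurable PA"
          by (intro borel_measurable_times borel_measurable_const borel_measurable_indicator m)
      qed (use S0 in \<open>auto simp: indicator_def\<close>)
      show "AE \<omega> in P a. \<bar>if sw \<omega> \<le> t then 0 else \<omega> t \<bullet> e\<bar> \<le> (S * norm e) * indicator (?stay t) \<omega>"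
        using AE_start[OF st] AE_space
      proof eventually_elim
        case (elim \<omega>)
        then have \<omega>: "\<omega> \<in> Omega X" "\<omega> 0 \<in> side X b" using a by (auto simp: space_P[OF st])
        show ?case
        proof (cases "sw \<omega> \<le> t")
          case False
          then have "\<omega> \<in> ?stay t" unfolding stay_set[OF t] using \<omega> by simp
          then show ?thesis using He[OF \<omega>(1) t] False by simp
        qed (use S0 in simp)
      qed
    qed
    also have "\<dots> = (S * norm e) * measure (P a) (?stay t)"
    proof -
      have "?stay t \<inter> space (P a) = ?stay t" by (auto simp: space_P[OF st])
      then show ?thesis by simp
    qed
    finally show ?thesis .
  qed
  show ?thesis
  proof (rule Lim_null_comparison)
    show "\<forall>\<^sub>F t in at_top. norm (side_flow X t a \<bullet> e) \<le> (S * norm e) * measure (P a) (?stay t)"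
      using eventually_ge_at_top[of 0] by eventually_elim (rule le)
    show "((\<lambda>t. (S * norm e) * measure (P a) (?stay t)) \<longlongrightarrow> 0) at_top"
      by (rule tendsto_mult_right_zero[OF leaves[OF a]])
  qed
qed

sublocale decaying "Cp X" "Cm X" "Dpm X" "Dmp X"
proof
  show "((\<lambda>t. mat_exp (t *\<^sub>R Cp X)) \<longlongrightarrow> 0) at_top"
  proof (rule mat_exp_vanishes[OF span_Zp])
    fix x y assume "x \<in> (\<Union>i. Zp X i)"
    then have "(x, 0) \<in> side X True" by (auto simp: side_def Zplus_def)
    from side_flow_vanishes[OF this, of "(y, 0)"]
    show "((\<lambda>t. (x v* mat_exp (t *\<^sub>R Cp X)) \<bullet> y) \<longlongrightarrow> 0) at_top" by (simp add: side_flow_def)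
  qed
  show "((\<lambda>t. mat_exp (t *\<^sub>R Cm X)) \<longlongrightarrow> 0) at_top"
  proof (rule mat_exp_vanishes[OF span_Zm])
    fix x y assume "x \<in> (\<Union>j. Zm X j)"
    then have "(0, x) \<in> side X False" by (auto simp: side_def Zminus_def)
    from side_flow_vanishes[OF this, of "(0, y)"]
    show "((\<lambda>t. (x v* mat_exp (t *\<^sub>R Cm X)) \<bullet> y) \<longlongrightarrow> 0) at_top" by (simp add: side_flow_def)
  qed
qed

text \<open>A switch exactly at depth \<open>h\<close> counts as a completed descent in \<open>after_descent_rec\<close> but as a switch in
  \<open>switch_integral\<close>; it has probability 0.\<close>

lemma switch_no_atom: assumes a: "a \<in> side X b" and h: "0 < h" shows "AE \<omega> in P a. sw \<omega> \<noteq> h"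
proof -
  note st = side_states[OF a]
  note [measurable] = measurable_switch_time
  let ?e = "(vec 1, vec 1) :: ('p, 'm) state"
  let ?M = "\<lambda>s. indicator {h} s *\<^sub>R ?e"
  let ?f = "\<lambda>\<omega>. if sw \<omega> \<le> h then indicator {h} (sw \<omega>) else 0 :: real"
  have "(LINT \<omega>|P a. ?f \<omega>) = reward 0 ?M h h a"
  proof (rule switch_integral[where B="norm ?e" and B'=1 and G="\<lambda>s _. indicator {h} s" and H="\<lambda>_. 0", OF _ _ a])
    show "(\<lambda>(s, \<omega>). indicator {h} s :: real) \<in> borel_measurable (borel \<Otimes>\<^sub>M PA)" by measurable
    fix s a assume a: "a \<in> side X (\<not> b)"
    have "a \<bullet> ?M s = indicator {h} s * (a \<bullet> ?e)" by (rule inner_scaleR_right)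
    also have "a \<bullet> ?e = mass a" by (simp only: mass_inner inner_prod_def fst_conv snd_conv)
    finally show "(LINT \<omega>|P a. indicator {h} s) = a \<bullet> ?M s"
      using integral_P_const[OF side_states[OF a]] mass_states[OF side_states[OF a]] by simp
  qed (use h in \<open>auto simp: indicator_def\<close>)
  also have "\<dots> = 0"
  proof -
    have "AE w in lborel. indicator {0..h} w * (cross X (side_flow X w a) \<bullet> ?M (h - h + w)) = 0"
      using AE_lborel_singleton[of h] by eventually_elim (simp add: zero_prod_def[symmetric])
    from integral_eq_zero_AE[OF this] show ?thesis by (simp only: reward_def inner_zero_right add_0)
  qed
  finally have "(LINT \<omega>|P a. ?f \<omega>) = 0" .
  moreover have "integrable (P a) ?f" by (rule integrable_P[OF st, where B=1]) auto
  ultimately have "AE \<omega> in P a. ?f \<omega> = 0" by (subst (asm) integral_nonneg_eq_0_iff_AE) auto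
  then show ?thesis by eventually_elim auto
qed

text \<open>The contribution of the descents whose counter ends with exactly \<open>n\<close>.\<close>

definition descent_increment :: "nat \<Rightarrow> nat \<Rightarrow> real \<Rightarrow> real^'m^'m" where
  "descent_increment n K h = descent_matrix n K h - descent_matrix (n - 1) K h"

lemma descent_increment_meas [measurable]: "descent_increment n K \<in> borel_measurable borel"
  unfolding descent_increment_def by measurable

lemma descent_increment_bounded: "\<exists>b. \<forall>u. norm (descent_increment n K u) \<le> b"
proof -
  obtain b1 b2 where b: "\<And>u. norm (descent_matrix n K u) \<le> b1" "\<And>u. norm (descent_matrix (n - 1) K u) \<le> b2"
    using descent_matrix_bounded[of n K] descent_matrix_bounded[of "n - 1" K] by (auto simp: bounded_function_def)
  have "norm (descent_increment n K u) \<le> b1 + b2" for u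
    unfolding descent_increment_def by (rule order_trans[OF norm_triangle_ineq4 add_mono[OF b]])
  then show ?thesis by blast
qed

lemma descent_increment_neg: "u < 0 \<Longrightarrow> descent_increment n K u = 0"
  by (simp add: descent_increment_def descent_matrix_neg)

lemma descent_increment_zero: "n < K \<Longrightarrow> descent_increment n K h = 0"
  by (simp add: descent_increment_def descent_matrix_eq_0)

lemma descent_increment_conv_int: "integrable lborel (\<lambda>u. (Em u ** Dmp X ** Psi_increment k) ** descent_increment n K (h - u))"
  using Bochner_Integration.integrable_diff[OF descent_matrix_conv_integrable descent_matrix_conv_integrable, of k n K h k "n - 1" K h]
  by (simp add: descent_increment_def bounded_bilinear.diff_right[OF mm_bilinear])

lemma descent_increment_first_valley: assumes "1 \<le> K" "1 \<le> n"
  shows "descent_increment n K h = (if n = K then Em h else 0) + (\<Sum>k\<in>{1..<n}. LINT u|lborel. (Em u ** Dmp X ** Psi_increment k) ** descent_increment n (Suc (max K k)) (h - u))"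
proof -
  obtain m where n: "n = Suc m" using assms(2) by (cases n) auto
  let ?I = "\<lambda>n k. LINT u|lborel. (Em u ** Dmp X ** Psi_increment k) ** descent_matrix n (Suc (max K k)) (h - u)"
  have "?I m m = 0" by (simp add: descent_matrix_eq_0)
  then have "(\<Sum>k\<in>{1..<m}. ?I m k) = (\<Sum>k\<in>{1..<n}. ?I m k)" by (cases m) (auto simp: n)
  then have "descent_increment n K h = (if K \<le> n then Em h else 0) - (if K \<le> m then Em h else 0) + (\<Sum>k\<in>{1..<n}. ?I n k - ?I m k)"
    using descent_matrix_first_valley[OF assms(1), of n h] descent_matrix_first_valley[OF assms(1), of m h] by (simp add: descent_increment_def n sum_subtractf del: descent_matrix.simps)
  moreover have "?I n k - ?I m k = (LINT u|lborel. (Em u ** Dmp X ** Psi_increment k) ** descent_increment n (Suc (max K k)) (h - u))" for k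
    using Bochner_Integration.integral_diff[OF descent_matrix_conv_integrable descent_matrix_conv_integrable, of k n "Suc (max K k)" h k m "Suc (max K k)" h]
    by (simp add: descent_increment_def n bounded_bilinear.diff_right[OF mm_bilinear] del: descent_matrix.simps)
  moreover have "(if K \<le> n then Em h else 0) - (if K \<le> m then Em h else 0) = (if n = K then Em h else 0)" by (auto simp: n)
  ultimately show ?thesis by simp
qed

lemma Ep_descent_increment_integrable: "integrable lborel (\<lambda>s. Ep s ** Dpm X ** descent_increment n K s)"
  using Bochner_Integration.integrable_diff[OF Ep_descent_matrix_integrable Ep_descent_matrix_integrable, of n K "n - 1" K]
  by (simp add: descent_increment_def bounded_bilinear.diff_right[OF mm_bilinear])

lemma Psi_increment_eq: "Psi_increment n = (LINT s|lborel. Ep s ** Dpm X ** descent_increment n 1 s)"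
  using Bochner_Integration.integral_diff[OF Ep_descent_matrix_integrable Ep_descent_matrix_integrable, of n 1 "n - 1" 1]
  by (simp add: descent_increment_def Psi_increment_def Psi_descent_matrix bounded_bilinear.diff_right[OF mm_bilinear] del: One_nat_def)

text \<open>An excursion rises until its first switch, at some level \<open>h\<close>, and then descends by \<open>h\<close>. The law of the
  first switch is applied up to the time \<open>N\<close>, which is then sent to infinity.\<close>

lemma excursion_integral:
  assumes G: "G \<in> borel_measurable PA" "\<And>\<omega>. \<omega> \<in> Omega X \<Longrightarrow> \<bar>G \<omega>\<bar> \<le> B"
    and D: "\<And>h a. 0 < h \<Longrightarrow> a \<in> side X False \<Longrightarrow> (LINT \<omega>|P a. after_descent 1 k G h \<omega>) = a \<bullet> (0, descent_increment k 1 h *v \<nu>)"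
    and a: "a \<in> side X True"
  shows "(LINT \<omega>|P a. after_excursion k G \<omega>) = a \<bullet> (Psi_increment k *v \<nu>, 0)"
proof -
  note st = side_states[OF a]
  obtain b where b: "\<And>u. norm (descent_increment k 1 u) \<le> b" using descent_increment_bounded[of k 1] by blast
  obtain c where c: "0 \<le> c" "\<And>(A :: real^'m^'m) v. norm (A *v v) \<le> norm A * norm v * c"
    using bounded_bilinear.nonneg_bounded[OF bounded_bilinear_matrix_vector_mult] by blast
  define M :: "real \<Rightarrow> ('p, 'm) state" where "M = (\<lambda>s. (0, (if 0 < s then descent_increment k 1 s else 0) *v \<nu>))"
  have wm: "(\<lambda>s. (if 0 < s then descent_increment k 1 s else 0) *v \<nu>) \<in> borel_measurable borel"
    by (rule measurable_compose[OF _ borel_measurable_continuous_onI[OF linear_continuous_on[OF bounded_bilinear.bounded_linear_left[OF bounded_bilinear_matrix_vector_mult]]]]) measurable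
  then have Mm: "M \<in> borel_measurable borel" unfolding M_def by measurable
  have MB: "norm (M s) \<le> b * norm \<nu> * c" for s
  proof -
    have "norm (M s) = norm ((if 0 < s then descent_increment k 1 s else 0) *v \<nu>)" by (simp add: M_def)
    also have "\<dots> \<le> norm (if 0 < s then descent_increment k 1 s else 0) * norm \<nu> * c" by (rule c)
    also have "\<dots> \<le> b * norm \<nu> * c" using b[of s] c(1) order_trans[OF norm_ge_zero b] by (intro mult_right_mono) auto
    finally show ?thesis .
  qed
  \<comment> \<open>\<open>D\<close> is about positive depths only, and a switch does not happen at time 0\<close>
  define G' where "G' = (\<lambda>s \<omega>. if 0 < s then after_descent 1 k G s \<omega> else 0)"
  have Gm0: "(\<lambda>(x, \<omega>). G \<omega>) \<in> borel_measurable (N \<Otimes>\<^sub>M PA)" for N :: "'z measure"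
    using measurable_compose[OF measurable_snd G(1)] by (simp add: case_prod_beta')
  have [measurable]: "(\<lambda>x. after_descent 1 k G (fst x) (snd x)) \<in> borel_measurable (borel \<Otimes>\<^sub>M PA)"
    by (rule measurable_after_descent[OF measurable_fst measurable_snd Gm0])
  have Gm: "(\<lambda>(s, \<omega>). G' s \<omega>) \<in> borel_measurable (borel \<Otimes>\<^sub>M PA)" unfolding G'_def case_prod_beta' by measurable
  have GB: "\<bar>G' s \<omega>\<bar> \<le> \<bar>B\<bar>" if "\<omega> \<in> Omega X" for s \<omega>
  proof -
    have "\<bar>after_descent 1 k G s \<omega>\<bar> \<le> B" by (rule after_descent_bounded[OF that]) (rule G(2))
    then show ?thesis by (auto simp: G'_def)
  qed
  have aeB: "\<bar>after_excursion k G \<omega>\<bar> \<le> \<bar>B\<bar>" if "\<omega> \<in> Omega X" for \<omega>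
  proof -
    have "\<bar>after_excursion k G \<omega>\<bar> \<le> B" by (rule after_excursion_bounded[OF that]) (rule G(2))
    then show ?thesis by linarith
  qed
  have aem: "after_excursion k G \<in> borel_measurable PA"
    by (rule measurable_after_excursion[OF measurable_ident Gm0, unfolded id_def])
  let ?f = "\<lambda>N \<omega>. if sw \<omega> \<le> real N then G' (sw \<omega>) (shift (sw \<omega>) \<omega>) else 0"
  have f_eq: "?f N \<omega> = (if sw \<omega> \<le> real N then after_excursion k G \<omega> else 0)" if "\<omega> \<in> Omega X" for N \<omega>
    using switch_time_pos[OF that] by (simp add: G'_def after_excursion_def)
  note [measurable] = measurable_switch_time aem
  let ?g = "\<lambda>w. fst a \<bullet> ((Ep w ** Dpm X ** descent_increment k 1 w) *v \<nu>)"
  have gi: "integrable lborel ?g" by (rule integrable_bounded_linear[OF bounded_linear_entry Ep_descent_increment_integrable])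
  have eq: "(LINT \<omega>|P a. (if sw \<omega> \<le> real N then after_excursion k G \<omega> else 0)) = (LINT w|lborel. indicator {0..real N} w * ?g w)" for N
  proof -
    have "(LINT \<omega>|P a. (if sw \<omega> \<le> real N then after_excursion k G \<omega> else 0)) = (LINT \<omega>|P a. ?f N \<omega>)"
      by (rule Bochner_Integration.integral_cong[OF refl]) (simp add: f_eq space_P[OF st])
    also have "\<dots> = reward 0 M (real N) (real N) a"
    proof (rule switch_integral[OF Mm MB a _ Gm GB, where H="\<lambda>_. 0"])
      fix s a assume a: "a \<in> side X (\<not> True)"
      then have a': "a \<in> side X False" by simp
      show "(LINT \<omega>|P a. G' s \<omega>) = a \<bullet> M s"
        using D[OF _ a', of s] by (cases "0 < s") (simp_all add: G'_def M_def zero_prod_def[symmetric])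
    qed auto
    also have "\<dots> = (LINT w|lborel. indicator {0..real N} w * (cross X (side_flow X w a) \<bullet> M w))"
      by (simp add: reward_def)
    also have "\<dots> = (LINT w|lborel. indicator {0..real N} w * ?g w)"
    proof (rule integral_cong_AE)
      have "(\<lambda>w. cross X (side_flow X w a)) \<in> borel_measurable borel"
        by (intro borel_measurable_continuous_onI bounded_linear.continuous_on[OF bounded_linear_cross] continuous_on_side_flow)
      then show "(\<lambda>w. indicator {0..real N} w * (cross X (side_flow X w a) \<bullet> M w)) \<in> borel_measurable lborel"
        using Mm by measurable
      show "(\<lambda>w. indicator {0..real N} w * ?g w) \<in> borel_measurable lborel" using gi by measurable
      show "AE w in lborel. indicator {0..real N} w * (cross X (side_flow X w a) \<bullet> M w) = indicator {0..real N} w * ?g w"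
        using AE_lborel_singleton[of 0]
      proof eventually_elim
        case (elim w)
        show ?case
        proof (cases "w \<in> {0..real N}")
          case True
          then have "0 < w" using elim by simp
          then show ?thesis using True side_zero(1)[OF a]
            by (simp add: M_def cross_def side_flow_def row_matrix_inner Ep_def matrix_vector_mul_assoc matrix_mul_assoc inner_prod_def)
        qed simp
      qed
    qed
    finally show ?thesis .
  qed
  have lim1: "(\<lambda>N. LINT \<omega>|P a. (if sw \<omega> \<le> real N then after_excursion k G \<omega> else 0)) \<longlonglongrightarrow> (LINT \<omega>|P a. after_excursion k G \<omega>)"
  proof (rule integral_dominated_convergence[where w="\<lambda>_. \<bar>B\<bar>"])
    show "integrable (P a) (\<lambda>_. \<bar>B\<bar>)" by (rule integrable_P[OF st, where B="\<bar>B\<bar>"]) auto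
    show "AE \<omega> in P a. (\<lambda>N. if sw \<omega> \<le> real N then after_excursion k G \<omega> else 0) \<longlonglongrightarrow> after_excursion k G \<omega>"
    proof (rule AE_I2)
      fix \<omega>
      have "eventually (\<lambda>N. sw \<omega> \<le> real N) sequentially"
        using filterlim_real_sequentially by (simp add: filterlim_at_top)
      then have "eventually (\<lambda>N. (if sw \<omega> \<le> real N then after_excursion k G \<omega> else 0) = after_excursion k G \<omega>) sequentially"
        by eventually_elim simp
      then show "(\<lambda>N. if sw \<omega> \<le> real N then after_excursion k G \<omega> else 0) \<longlonglongrightarrow> after_excursion k G \<omega>"
        by (rule tendsto_eventually)
    qed
    show "AE \<omega> in P a. norm (if sw \<omega> \<le> real N then after_excursion k G \<omega> else 0) \<le> \<bar>B\<bar>" for N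
      by (rule AE_I2) (use aeB in \<open>auto simp: space_P[OF st]\<close>)
  qed (unfold measurable_P[OF st], measurable)
  have lim2: "(\<lambda>N. LINT w|lborel. indicator {0..real N} w * ?g w) \<longlonglongrightarrow> (LINT w|lborel. ?g w)"
  proof (rule integral_dominated_convergence[where w="\<lambda>w. norm (?g w)"])
    show "integrable lborel (\<lambda>w. norm (?g w))" by (intro integrable_norm gi)
    show "AE w in lborel. (\<lambda>N. indicator {0..real N} w * ?g w) \<longlonglongrightarrow> ?g w"
    proof (rule AE_I2)
      fix w
      have "eventually (\<lambda>N. w \<le> real N) sequentially"
        using filterlim_real_sequentially by (simp add: filterlim_at_top)
      then have "eventually (\<lambda>N. indicator {0..real N} w * ?g w = ?g w) sequentially"
        by eventually_elim (auto simp: indicator_def Ep_def)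
      then show "(\<lambda>N. indicator {0..real N} w * ?g w) \<longlonglongrightarrow> ?g w" by (rule tendsto_eventually)
    qed
    show "AE w in lborel. norm (indicator {0..real N} w * ?g w) \<le> norm (?g w)" for N
      by (rule AE_I2) (auto simp: indicator_def)
  qed (use gi in measurable)
  have "(LINT \<omega>|P a. after_excursion k G \<omega>) = (LINT w|lborel. ?g w)"
    using LIMSEQ_unique[OF lim1] lim2 by (simp only: eq)
  also have "\<dots> = fst a \<bullet> (Psi_increment k *v \<nu>)"
    unfolding Psi_increment_eq by (rule integral_bounded_linear[OF bounded_linear_entry Ep_descent_increment_integrable])
  finally show ?thesis by (simp add: inner_prod_def)
qed

text \<open>Following the path up to its first valley, the excursion there and the remaining descent start from
  states with expectations that are linear by induction, so that \<open>switch_integral\<close> applies. This yields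
  the recursion \<open>descent_increment_first_valley\<close>.\<close>

lemma descent_integral:
  assumes "H \<in> borel_measurable PA" "\<And>\<omega>. \<omega> \<in> Omega X \<Longrightarrow> \<bar>H \<omega>\<bar> \<le> B"
    and "\<And>a. a \<in> side X False \<Longrightarrow> (LINT \<omega>|P a. H \<omega>) = a \<bullet> (0, \<mu>)"
    and "1 \<le> K" "0 < h" "a \<in> side X False"
  shows "(LINT \<omega>|P a. after_descent K n H h \<omega>) = a \<bullet> (0, descent_increment n K h *v \<mu>)"
  using assms
  \<comment> \<open>the excursion at the first valley has a height below \<open>n\<close>, and the descent after it a larger \<open>K\<close>;
     the measure decreases in both cases\<close>
proof (induction "n * (n + 1) + (Suc n - K)" arbitrary: n K H \<mu> B h a rule: less_induct)
  case less
  note H = less.prems(1,2) and HL = less.prems(3) and K = less.prems(4) and h = less.prems(5) and a = less.prems(6)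
  note st = side_states[OF a]
  show ?case
  proof (cases "n < K")
    case True
    have "(LINT \<omega>|P a. after_descent K n H h \<omega>) = (LINT \<omega>|P a. 0)"
    proof (rule Bochner_Integration.integral_cong[OF refl])
      fix \<omega> assume "\<omega> \<in> space (P a)"
      then have "\<omega> \<in> Omega X" by (simp add: space_P[OF st])
      then show "after_descent K n H h \<omega> = 0"
        unfolding after_descent_def by (rule visit_none) (use True descent_mono in force)
    qed
    then show ?thesis using descent_increment_zero[OF True] by (simp add: zero_prod_def[symmetric])
  next
    case False
    let ?K = "\<lambda>k. Suc (max K k)"
    let ?D = "\<lambda>k s. after_descent (?K k) n H (h - s)"
    have Hm: "(\<lambda>(x, \<omega>). H \<omega>) \<in> borel_measurable (N \<Otimes>\<^sub>M PA)" for N :: "'z measure"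
      using measurable_compose[OF measurable_snd H(1)] by (simp add: case_prod_beta')
    have Dm: "(\<lambda>(x, \<omega>). ?D k (fst x) \<omega>) \<in> borel_measurable ((borel \<Otimes>\<^sub>M PA) \<Otimes>\<^sub>M PA)" for k
    proof -
      have "(\<lambda>y. after_descent (?K k) n H (h - fst (fst y)) (snd y)) \<in> borel_measurable ((borel \<Otimes>\<^sub>M PA) \<Otimes>\<^sub>M PA)"
        by (rule measurable_after_descent[OF _ measurable_snd Hm]) measurable
      then show ?thesis by (simp add: case_prod_beta')
    qed
    have Dm1: "?D k s \<in> borel_measurable PA" for k s
      by (rule measurable_after_descent[OF measurable_const measurable_ident Hm, unfolded id_def]) simp
    have DB: "\<bar>?D k s \<omega>\<bar> \<le> B" if "\<omega> \<in> Omega X" for k s \<omega> by (rule after_descent_bounded[OF that]) (rule H(2))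
    have exc: "(LINT \<omega>|P a'. after_excursion k (?D k s) \<omega>) = a' \<bullet> (Psi_increment k *v (descent_increment n (?K k) (h - s) *v \<mu>), 0)"
      if k: "k \<in> {1..<n}" and s: "s < h" and a': "a' \<in> side X True" for k s a'
    proof (rule excursion_integral[OF Dm1 DB _ a'])
      fix h' a'' assume h': "0 < (h' :: real)" and a'': "a'' \<in> side X False"
      show "(LINT \<omega>|P a''. after_descent 1 k (?D k s) h' \<omega>) = a'' \<bullet> (0, descent_increment k 1 h' *v (descent_increment n (?K k) (h - s) *v \<mu>))"
      proof (rule less.hyps[OF _ Dm1 DB _ order_refl h' a''])
        have "k * (k + 1) + (Suc k - 1) < (k + 1) * (k + 1 + 1)" by simp
        also have "\<dots> \<le> n * (n + 1)" using k by (intro mult_mono) auto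
        finally show "k * (k + 1) + (Suc k - 1) < n * (n + 1) + (Suc n - K)" by simp
        fix b assume b: "b \<in> side X False"
        show "(LINT \<omega>|P b. ?D k s \<omega>) = b \<bullet> (0, descent_increment n (?K k) (h - s) *v \<mu>)"
        proof (rule less.hyps[OF _ H HL _ _ b])
          show "n * (n + 1) + (Suc n - ?K k) < n * (n + 1) + (Suc n - K)" using False by auto
        qed (use s in auto)
      qed
    qed
    define G where "G = (\<lambda>s \<omega>. if s < h then \<Sum>k\<in>{1..<n}. after_excursion k (?D k s) \<omega> else 0)"
    define M :: "real \<Rightarrow> ('p, 'm) state" where
      "M = (\<lambda>s. if s < h then (\<Sum>k\<in>{1..<n}. Psi_increment k *v (descent_increment n (?K k) (h - s) *v \<mu>), 0) else 0)"
    let ?mv = "\<lambda>k s. Psi_increment k *v (descent_increment n (?K k) (h - s) *v \<mu>)"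
    have mv_bl: "bounded_linear (\<lambda>A. Psi_increment k *v (A *v \<mu>))" for k
      by (intro bounded_linear_compose[OF bounded_bilinear.bounded_linear_right[OF bounded_bilinear_matrix_vector_mult]]
          bounded_bilinear.bounded_linear_left[OF bounded_bilinear_matrix_vector_mult])
    have mvm [measurable]: "?mv k \<in> borel_measurable borel" for k
      by (rule measurable_compose[OF _ borel_measurable_continuous_onI[OF linear_continuous_on[OF mv_bl]]]) measurable
    have Mm: "M \<in> borel_measurable borel" unfolding M_def by measurable
    obtain Q where Q: "\<And>s. norm (M s) \<le> Q"
    proof -
      have "\<exists>q\<ge>0. \<forall>s. norm (?mv k s) \<le> q" for k
      proof -
        obtain b where b: "\<And>u. norm (descent_increment n (?K k) u) \<le> b" using descent_increment_bounded[of n "?K k"] by blast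
        obtain c where c: "0 \<le> c" "\<And>A. norm (Psi_increment k *v (A *v \<mu>)) \<le> norm A * c"
          using bounded_linear.nonneg_bounded[OF mv_bl] by blast
        have "norm (?mv k s) \<le> b * c" for s using order_trans[OF c(2) mult_right_mono[OF b c(1)]] .
        then show ?thesis using order_trans[OF norm_ge_zero b] c(1) by (intro exI[of _ "b * c"]) auto
      qed
      then obtain q where q: "\<And>k. 0 \<le> q k" "\<And>k s. norm (?mv k s) \<le> q k" by metis
      have "norm (M s) \<le> (\<Sum>k\<in>{1..<n}. q k)" for s
      proof (cases "s < h")
        case True
        then have "norm (M s) = norm (\<Sum>k\<in>{1..<n}. ?mv k s)" by (simp add: M_def)
        also have "\<dots> \<le> (\<Sum>k\<in>{1..<n}. q k)" using q(2) by (intro sum_norm_le) auto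
        finally show ?thesis .
      qed (simp add: M_def sum_nonneg q(1))
      then show ?thesis by (rule that)
    qed
    have em: "(\<lambda>x. after_excursion k (?D k (fst x)) (snd x)) \<in> borel_measurable (borel \<Otimes>\<^sub>M PA)" for k
      by (rule measurable_after_excursion[OF measurable_snd Dm])
    then have Gm: "(\<lambda>(s, \<omega>). G s \<omega>) \<in> borel_measurable (borel \<Otimes>\<^sub>M PA)" unfolding G_def case_prod_beta' by measurable
    have eB: "\<bar>after_excursion k (?D k s) \<omega>\<bar> \<le> B" if "\<omega> \<in> Omega X" for k s \<omega> by (rule after_excursion_bounded[OF that]) (rule DB)
    have GB: "\<bar>G s \<omega>\<bar> \<le> real n * \<bar>B\<bar> + \<bar>B\<bar>" if "\<omega> \<in> Omega X" for s \<omega>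
    proof -
      have "\<bar>\<Sum>k\<in>{1..<n}. after_excursion k (?D k s) \<omega>\<bar> \<le> (\<Sum>k\<in>{1..<n}. \<bar>B\<bar>)"
        using eB[OF that] by (intro order_trans[OF sum_abs] sum_mono) (simp add: order_trans[OF _ abs_ge_self])
      also have "\<dots> \<le> real n * \<bar>B\<bar> + \<bar>B\<bar>" by (simp add: mult_right_mono add_increasing2)
      finally show ?thesis by (cases "s < h") (simp_all add: G_def)
    qed
    \<comment> \<open>without a valley the counter does not change\<close>
    define H' where "H' = (\<lambda>\<omega>. if n = K then H \<omega> else 0)"
    define \<mu>' :: "('p, 'm) state" where "\<mu>' = (if n = K then (0, \<mu>) else 0)"
    have H'm: "H' \<in> borel_measurable PA" unfolding H'_def using H(1) by (cases "n = K") simp_all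
    have H'B: "\<bar>H' \<omega>\<bar> \<le> real n * \<bar>B\<bar> + \<bar>B\<bar>" if "\<omega> \<in> Omega X" for \<omega>
      using H(2)[OF that] by (auto simp: H'_def intro: order_trans[of _ "\<bar>B\<bar>"])
    have aem: "after_excursion k (?D k s) \<in> borel_measurable PA" for k s
      using measurable_compose[OF measurable_Pair1'[of s borel PA] em[of k]] by simp
    have "(LINT \<omega>|P a. (if sw \<omega> \<le> h then G (sw \<omega>) (shift (sw \<omega>) \<omega>) else H' (shift h \<omega>))) = reward \<mu>' M h h a"
    proof (rule switch_integral[OF Mm Q a _ Gm GB H'm H'B])
      show "0 \<le> h" using h by simp
      show "(LINT \<omega>|P a'. H' \<omega>) = a' \<bullet> \<mu>'" if "a' \<in> side X False" for a'
        using HL[OF that] by (cases "n = K") (simp_all add: H'_def \<mu>'_def)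
      fix s a' assume "0 \<le> s" "s \<le> h" and a': "a' \<in> side X (\<not> False)"
      show "(LINT \<omega>|P a'. G s \<omega>) = a' \<bullet> M s"
      proof (cases "s < h")
        case True
        have "(LINT \<omega>|P a'. G s \<omega>) = (LINT \<omega>|P a'. (\<Sum>k\<in>{1..<n}. after_excursion k (?D k s) \<omega>))" using True by (simp add: G_def)
        also have "\<dots> = (\<Sum>k\<in>{1..<n}. LINT \<omega>|P a'. after_excursion k (?D k s) \<omega>)"
          by (intro Bochner_Integration.integral_sum integrable_P[OF side_states[OF a'] aem eB])
        also have "\<dots> = (\<Sum>k\<in>{1..<n}. a' \<bullet> (?mv k s, 0))"
          using a' True by (intro sum.cong refl exc) auto
        also have "\<dots> = a' \<bullet> M s" using True by (simp add: M_def inner_prod_def inner_sum_right)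
        finally show ?thesis .
      qed (simp add: G_def M_def)
    qed
    moreover have "(LINT \<omega>|P a. after_descent K n H h \<omega>) = (LINT \<omega>|P a. (if sw \<omega> \<le> h then G (sw \<omega>) (shift (sw \<omega>) \<omega>) else H' (shift h \<omega>)))"
    proof (rule integral_cong_AE)
      note [measurable] = measurable_switch_time
      have s1: "(\<lambda>\<omega>. shift (sw \<omega>) \<omega>) \<in> measurable PA PA"
        by (rule measurable_shift) (auto simp: measurable_switch_time less_imp_le[OF switch_time_pos])
      have "(\<lambda>\<omega>. (sw \<omega>, shift (sw \<omega>) \<omega>)) \<in> measurable PA (borel \<Otimes>\<^sub>M PA)" using s1 by measurable
      from measurable_compose[OF this Gm] have [measurable]: "(\<lambda>\<omega>. G (sw \<omega>) (shift (sw \<omega>) \<omega>)) \<in> borel_measurable PA" by simp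
      have "shift h \<in> measurable PA PA" using measurable_shift[of "\<lambda>_. h" PA "\<lambda>\<omega>. \<omega>"] h by simp
      from measurable_compose[OF this H'm] have [measurable]: "(\<lambda>\<omega>. H' (shift h \<omega>)) \<in> borel_measurable PA" .
      show "(\<lambda>\<omega>. if sw \<omega> \<le> h then G (sw \<omega>) (shift (sw \<omega>) \<omega>) else H' (shift h \<omega>)) \<in> borel_measurable (P a)"
        unfolding measurable_P[OF st] by measurable
      show "after_descent K n H h \<in> borel_measurable (P a)"
        unfolding measurable_P[OF st]
        by (rule measurable_after_descent[OF measurable_const measurable_ident Hm, unfolded id_def]) simp
      show "AE \<omega> in P a. after_descent K n H h \<omega> = (if sw \<omega> \<le> h then G (sw \<omega>) (shift (sw \<omega>) \<omega>) else H' (shift h \<omega>))"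
        using AE_start[OF st] switch_no_atom[OF a h] AE_space
      proof eventually_elim
        case (elim \<omega>)
        then have \<omega>: "\<omega> \<in> Omega X" "\<omega> 0 \<in> side X False" using a by (auto simp: space_P[OF st])
        show ?case
        proof (cases "sw \<omega> < h")
          case True
          then show ?thesis unfolding after_descent_rec[OF \<omega> h] by (simp add: G_def)
        next
          case False
          then have "h \<le> sw \<omega>" "\<not> sw \<omega> \<le> h" using elim by auto
          then show ?thesis unfolding after_descent_rec[OF \<omega> h] by (simp add: H'_def)
        qed
      qed
    qed
    moreover have "reward \<mu>' M h h a = a \<bullet> (0, descent_increment n K h *v \<mu>)"
    proof -
      let ?F = "\<lambda>k w. (Em w ** Dmp X ** Psi_increment k) ** descent_increment n (?K k) (h - w)"
      let ?y = "snd a"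
      have fa: "fst a = 0" by (rule side_zero(2)[OF a])
      have F_int: "integrable lborel (\<lambda>w. ?y \<bullet> (?F k w *v \<mu>))" for k
        by (rule integrable_bounded_linear[OF bounded_linear_entry descent_increment_conv_int])
      have "(LINT w|lborel. indicator {0..h} w * (cross X (side_flow X w a) \<bullet> M w)) = (LINT w|lborel. (\<Sum>k\<in>{1..<n}. ?y \<bullet> (?F k w *v \<mu>)))"
      proof (rule integral_cong_AE)
        have "(\<lambda>w. cross X (side_flow X w a)) \<in> borel_measurable borel"
          by (intro borel_measurable_continuous_onI bounded_linear.continuous_on[OF bounded_linear_cross] continuous_on_side_flow)
        then show "(\<lambda>w. indicator {0..h} w * (cross X (side_flow X w a) \<bullet> M w)) \<in> borel_measurable lborel"
          using Mm by measurable
        show "(\<lambda>w. \<Sum>k\<in>{1..<n}. ?y \<bullet> (?F k w *v \<mu>)) \<in> borel_measurable lborel"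
          using F_int by (intro borel_measurable_sum) auto
        show "AE w in lborel. indicator {0..h} w * (cross X (side_flow X w a) \<bullet> M w) = (\<Sum>k\<in>{1..<n}. ?y \<bullet> (?F k w *v \<mu>))"
          using AE_lborel_singleton[of h]
        proof eventually_elim
          case (elim w)
          consider "w < 0" | "0 \<le> w" "w < h" | "h < w" using elim by linarith
          then show ?case
          proof cases
            case 1 then show ?thesis by (simp add: Em_def)
          next
            case 2
            have e: "((?y v* mat_exp (w *\<^sub>R Cm X)) v* Dmp X) \<bullet> ?mv k w = ?y \<bullet> (?F k w *v \<mu>)" for k
              using 2 by (simp add: row_matrix_inner Em_def matrix_vector_mul_assoc matrix_mul_assoc)
            have "cross X (side_flow X w a) \<bullet> M w = ((?y v* mat_exp (w *\<^sub>R Cm X)) v* Dmp X) \<bullet> (\<Sum>k\<in>{1..<n}. ?mv k w)"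
              using 2 by (simp add: M_def cross_def side_flow_def fa inner_prod_def)
            also have "\<dots> = (\<Sum>k\<in>{1..<n}. ?y \<bullet> (?F k w *v \<mu>))" by (simp only: inner_sum_right e)
            finally show ?thesis using 2 by simp
          next
            case 3 then show ?thesis by (simp add: descent_increment_neg)
          qed
        qed
      qed
      also have "\<dots> = (\<Sum>k\<in>{1..<n}. LINT w|lborel. ?y \<bullet> (?F k w *v \<mu>))" by (rule Bochner_Integration.integral_sum) (rule F_int)
      also have "\<dots> = (\<Sum>k\<in>{1..<n}. ?y \<bullet> ((LINT w|lborel. ?F k w) *v \<mu>))"
        by (intro sum.cong refl integral_bounded_linear[OF bounded_linear_entry descent_increment_conv_int])
      also have "\<dots> = ?y \<bullet> ((\<Sum>k\<in>{1..<n}. LINT w|lborel. ?F k w) *v \<mu>)"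
        using linear_sum[OF bounded_linear.linear[OF bounded_linear_entry[of ?y \<mu>]]] by metis
      finally have 1: "(LINT w|lborel. indicator {0..h} w * (cross X (side_flow X w a) \<bullet> M w)) = ?y \<bullet> ((\<Sum>k\<in>{1..<n}. LINT w|lborel. ?F k w) *v \<mu>)" .
      have 2: "side_flow X h a \<bullet> \<mu>' = ?y \<bullet> ((if n = K then Em h else 0) *v \<mu>)"
        using h by (simp add: \<mu>'_def side_flow_def Em_def row_matrix_inner inner_prod_def fa)
      have "descent_increment n K h *v \<mu> = (if n = K then Em h else 0) *v \<mu> + (\<Sum>k\<in>{1..<n}. LINT w|lborel. ?F k w) *v \<mu>"
        unfolding descent_increment_first_valley[OF K order_trans[OF K leI[OF False]], of h] by (rule bounded_bilinear.add_left[OF bounded_bilinear_matrix_vector_mult])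
      then show ?thesis unfolding reward_def using 1 2 by (simp add: inner_prod_def fa inner_add_right)
    qed
    ultimately show ?thesis by simp
  qed
qed

lemma after_excursion_minus: assumes "\<omega> \<in> Omega X" "\<omega> 0 \<in> side X False" shows "after_excursion k H \<omega> = 0"
  unfolding after_excursion_def after_descent_def
proof (rule visit_none)
  note S = switch_shift[OF assms]
  show "shift (sw \<omega>) \<omega> \<in> Omega X" by (rule S)
  show "\<not> descent (shift (sw \<omega>) \<omega>) (sw \<omega>) 1 k t" for t
    using descent_start S(3) side_excl by blast
qed

text \<open>An excursion has exactly one height, so at most one term of the sum over \<open>k\<close> is nonzero.\<close>

lemma return_vector_eq: assumes \<omega>: "\<omega> \<in> Omega X" and n: "1 \<le> n"
  shows "indicator (Omega_n X n) \<omega> *\<^sub>R snd (\<omega> (tau_minus X \<omega>)) =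
    (\<Sum>j\<in>UNIV. (\<Sum>k\<in>{1..n}. after_excursion k (\<lambda>\<omega>. snd (\<omega> 0) $ j) \<omega>) *\<^sub>R axis j 1)"
proof -
  have coord: "(\<Sum>k\<in>{1..n}. after_excursion k (\<lambda>\<omega>. snd (\<omega> 0) $ j) \<omega>) = indicator (Omega_n X n) \<omega> * snd (\<omega> (tau_minus X \<omega>)) $ j" for j
  proof (cases "\<omega> \<in> Omega_n X n")
    case True
    then obtain k t where k: "k \<le> n" "excursion \<omega> k t" using Omega_n_iff[OF \<omega> n] by blast
    have p: "\<omega> 0 \<in> side X True" and k1: "1 \<le> k" using k(2) descent_mono by (auto simp: excursion_def)
    have "after_excursion k' (\<lambda>\<omega>. snd (\<omega> 0) $ j) \<omega> = (if k' = k then snd (\<omega> t) $ j else 0)" for k'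
    proof (cases "k' = k")
      case True
      then show ?thesis using after_excursion_eq(1)[OF \<omega> p k(2), of "\<lambda>\<omega>. snd (\<omega> 0) $ j"] by simp
    next
      case False
      then have "\<not> excursion \<omega> k' t'" for t' using excursion_unique[OF k(2)] by blast
      then show ?thesis using after_excursion_eq(2)[OF \<omega> p] False by simp
    qed
    then show ?thesis using True k(1) k1 excursion_tau_minus(1)[OF k(2) \<omega>] by simp
  next
    case False
    have "after_excursion k (\<lambda>\<omega>. snd (\<omega> 0) $ j) \<omega> = 0" if "k \<in> {1..n}" for k
    proof (cases "\<omega> 0 \<in> side X True")
      case True
      have "\<not> excursion \<omega> k t" for t using False Omega_n_iff[OF \<omega> n] that by auto
      then show ?thesis by (rule after_excursion_eq(2)[OF \<omega> True])
    next
      case minus: False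
      then show ?thesis using side_compl[OF \<omega>, of 0 True] by (intro after_excursion_minus[OF \<omega>]) simp
    qed
    then show ?thesis using False by simp
  qed
  show ?thesis unfolding coord by (simp add: vec_eq_iff axis_def if_distrib cong: if_cong)
qed

lemma psi_matrix_Psi: assumes n: "1 \<le> n" shows "psi_matrix X P n (Psi n)"
  unfolding psi_matrix_def
proof (intro allI ballI)
  fix i \<alpha> assume \<alpha>: "\<alpha> \<in> Zp X i"
  then have a: "(\<alpha>, 0) \<in> side X True" by (auto simp: side_def Zplus_def)
  note st = side_states[OF a]
  obtain S where S: "\<And>a. a \<in> states X \<Longrightarrow> norm a \<le> S" using bounded_states by (auto simp: bounded_iff)
  define H where "H = (\<lambda>j (\<omega> :: ('p, 'm) path). snd (\<omega> 0) $ j)"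
  have Hm: "H j \<in> borel_measurable PA" for j
    unfolding H_def by (rule measurable_compose[OF measurable_eval[OF order_refl] borel_measurable_continuous_onI]) (intro continuous_intros)
  have HB: "\<bar>H j \<omega>\<bar> \<le> S" if "\<omega> \<in> Omega X" for j \<omega>
  proof -
    have "\<bar>H j \<omega>\<bar> \<le> norm (snd (\<omega> 0))" unfolding H_def by (rule component_le_norm_cart)
    also have "\<dots> \<le> norm (\<omega> 0)" using norm_snd_le[where x="fst (\<omega> 0)" and y="snd (\<omega> 0)"] by simp
    also have "\<dots> \<le> S" by (rule S[OF path_states[OF that order_refl]])
    finally show ?thesis .
  qed
  have ex: "has_bochner_integral (P (\<alpha>, 0)) (after_excursion k (H j)) (\<alpha> \<bullet> (Psi_increment k *v axis j 1))" for k j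
  proof -
    have "(LINT \<omega>|P (\<alpha>, 0). after_excursion k (H j) \<omega>) = (\<alpha>, 0 :: real^'m) \<bullet> (Psi_increment k *v axis j 1, 0)"
    proof (rule excursion_integral[where B=S])
      show "H j \<in> borel_measurable PA" by (rule Hm)
      show "\<bar>H j \<omega>\<bar> \<le> S" if "\<omega> \<in> Omega X" for \<omega> by (rule HB[OF that])
      show "(\<alpha>, 0) \<in> side X True" by (rule a)
      show "(LINT \<omega>|P b. after_descent 1 k (H j) h \<omega>) = b \<bullet> (0, descent_increment k 1 h *v axis j 1)"
        if h: "0 < h" and b: "b \<in> side X False" for h b
      proof (rule descent_integral[where B=S])
        show "H j \<in> borel_measurable PA" by (rule Hm)
        show "\<bar>H j \<omega>\<bar> \<le> S" if "\<omega> \<in> Omega X" for \<omega> by (rule HB[OF that])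
        show "(LINT \<omega>|P c. H j \<omega>) = c \<bullet> (0, axis j 1)" if "c \<in> side X False" for c
          using integral_P_inner[OF side_states[OF that], of "(0, axis j 1)"] by (simp add: H_def inner_prod_def inner_axis)
      qed (use h b in auto)
    qed
    moreover have "integrable (P (\<alpha>, 0)) (after_excursion k (H j))"
    proof (rule integrable_P[OF st])
      show "after_excursion k (H j) \<in> borel_measurable PA"
        by (rule measurable_after_excursion[OF measurable_ident, unfolded id_def]) (use measurable_compose[OF measurable_snd Hm] in \<open>simp add: case_prod_beta'\<close>)
      show "\<bar>after_excursion k (H j) \<omega>\<bar> \<le> S" if "\<omega> \<in> Omega X" for \<omega> by (rule after_excursion_bounded[OF that]) (rule HB)
    qed
    ultimately show ?thesis by (simp add: has_bochner_integral_iff)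
  qed
  have "has_bochner_integral (P (\<alpha>, 0)) (\<lambda>\<omega>. \<Sum>j\<in>UNIV. (\<Sum>k\<in>{1..n}. after_excursion k (H j) \<omega>) *\<^sub>R axis j 1)
     (\<Sum>j\<in>UNIV. (\<Sum>k\<in>{1..n}. \<alpha> \<bullet> (Psi_increment k *v axis j 1)) *\<^sub>R axis j (1 :: real))"
    by (intro has_bochner_integral_sum has_bochner_integral_scaleR_left ex)
  moreover have "(\<Sum>j\<in>UNIV. (\<Sum>k\<in>{1..n}. \<alpha> \<bullet> (Psi_increment k *v axis j 1)) *\<^sub>R axis j (1 :: real)) = \<alpha> v* Psi n"
  proof -
    have "(\<Sum>k\<in>{1..n}. \<alpha> \<bullet> (Psi_increment k *v axis j 1)) = (\<alpha> v* Psi n) $ j" for j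
    proof -
      have "(\<Sum>k\<in>{1..n}. \<alpha> \<bullet> (Psi_increment k *v axis j 1)) = \<alpha> \<bullet> ((\<Sum>k\<in>{1..n}. Psi_increment k) *v axis j 1)"
        using linear_sum[OF bounded_linear.linear[OF bounded_linear_entry[of \<alpha> "axis j 1"]]] by metis
      also have "\<dots> = (\<alpha> v* Psi n) \<bullet> axis j 1" unfolding sum_Psi_increment row_matrix_inner ..
      finally show ?thesis by (simp add: inner_axis)
    qed
    then show ?thesis by (simp add: vec_eq_iff axis_def if_distrib cong: if_cong)
  qed
  ultimately have *: "has_bochner_integral (P (\<alpha>, 0)) (\<lambda>\<omega>. \<Sum>j\<in>UNIV. (\<Sum>k\<in>{1..n}. after_excursion k (H j) \<omega>) *\<^sub>R axis j 1) (\<alpha> v* Psi n)"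
    by simp
  show "has_bochner_integral (P (\<alpha>, 0)) (\<lambda>\<omega>. indicator (Omega_n X n) \<omega> *\<^sub>R snd (\<omega> (tau_minus X \<omega>))) (\<alpha> v* Psi n)"
    by (rule has_bochner_integral_cong[THEN iffD2, OF refl _ refl *]) (simp add: return_vector_eq[OF _ n] space_P[OF st] H_def)
qed

text \<open>The defining equation determines the linear map on the orbit sets, and these span the whole space.\<close>

lemma psi_matrix_unique: assumes "psi_matrix X P n M" "psi_matrix X P n M'" shows "M = M'"
proof -
  have Z: "\<alpha> v* M = \<alpha> v* M'" if "\<alpha> \<in> (\<Union>i. Zp X i)" for \<alpha>
    using assms that has_bochner_integral_eq unfolding psi_matrix_def by blast
  have "x v* M = x v* M'" for x
  proof -
    have "x \<in> span (\<Union>i. Zp X i)" using span_Zp by simp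
    then show ?thesis
      by (rule linear_eq_on[OF bounded_linear.linear[OF bounded_linear_vm] bounded_linear.linear[OF bounded_linear_vm]]) (rule Z)
  qed
  then have "x \<bullet> (M *v y) = x \<bullet> (M' *v y)" for x y by (simp add: row_matrix_inner[symmetric])
  then have "M *v y = M' *v y" for y by (metis vector_eq_ldot)
  then show ?thesis by (simp add: matrix_eq)
qed

lemma Psi_integral:
  "has_bochner_integral lborel
     (\<lambda>y. indicator {0..} y *\<^sub>R (mat_exp (y *\<^sub>R Cp X) ** (Dpm X + Psi n ** Dmp X ** Psi n) ** mat_exp (y *\<^sub>R Cm X))) (Psi (Suc n))"
proof -
  have "(\<lambda>y. indicator {0..} y *\<^sub>R (mat_exp (y *\<^sub>R Cp X) ** (Dpm X + Psi n ** Dmp X ** Psi n) ** mat_exp (y *\<^sub>R Cm X)))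
      = (\<lambda>y. Ep y ** (Dpm X + Psi n ** Dmp X ** Psi n) ** Em y)"
    by (auto simp: fun_eq_iff indicator_def Ep_def Em_def)
  then show ?thesis using E_M_E_integrable by (simp add: has_bochner_integral_iff)
qed

end

theorem theorem4p1:
  fixes X :: "('p::finite, 'm::finite, 'i::finite, 'j::finite) rap_data"
    and P :: "('p, 'm) state \<Rightarrow> ('p, 'm) path measure"
  assumes "rap_fluid_process X P"
  shows "(\<exists>!\<Psi> :: nat \<Rightarrow> real^'m^'p. \<Psi> 0 = 0 \<and> (\<forall>n\<ge>1. psi_matrix X P n (\<Psi> n))) \<and>
         (\<forall>\<Psi> :: nat \<Rightarrow> real^'m^'p. \<Psi> 0 = 0 \<and> (\<forall>n\<ge>1. psi_matrix X P n (\<Psi> n)) \<longrightarrow>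
            (\<forall>n\<ge>1. has_bochner_integral lborel
               (\<lambda>y. indicator {0..} y *\<^sub>R
                  (mat_exp (y *\<^sub>R Cp X) ** (Dpm X + \<Psi> (n - 1) ** Dmp X ** \<Psi> (n - 1)) **
                   mat_exp (y *\<^sub>R Cm X)))
               (\<Psi> n)))"
proof -
  interpret rap_fluid X P
  proof
    show "rap_data_valid X" "orbit_process X P" using assms by (auto simp: rap_fluid_process_def)
    show "((\<lambda>t. measure (P a) {\<omega>\<in>Omega X. \<forall>s\<in>{0..t}. \<omega> s \<in> side X b}) \<longlongrightarrow> 0) at_top" if "a \<in> side X b" for a b
      using assms that by (cases b) (simp_all add: rap_fluid_process_def side_def)
  qed
  have P: "Psi 0 = 0 \<and> (\<forall>n\<ge>1. psi_matrix X P n (Psi n))" using psi_matrix_Psi by simp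
  have U: "\<Psi> = Psi" if "\<Psi> 0 = 0 \<and> (\<forall>n\<ge>1. psi_matrix X P n (\<Psi> n))" for \<Psi>
  proof
    fix n show "\<Psi> n = Psi n"
    proof (cases "n = 0")
      case True then show ?thesis using that by simp
    next
      case False
      then have "1 \<le> n" by simp
      then show ?thesis using that psi_matrix_unique[OF _ psi_matrix_Psi] by blast
    qed
  qed
  have I: "has_bochner_integral lborel (\<lambda>y. indicator {0..} y *\<^sub>R (mat_exp (y *\<^sub>R Cp X) ** (Dpm X + Psi (n - 1) ** Dmp X ** Psi (n - 1)) ** mat_exp (y *\<^sub>R Cm X))) (Psi n)"
    if "1 \<le> n" for n using Psi_integral[of "n - 1"] that by simp
  show ?thesis
  proof (intro conjI allI impI)
    show "\<exists>!\<Psi>. \<Psi> 0 = 0 \<and> (\<forall>n\<ge>1. psi_matrix X P n (\<Psi> n))" by (rule ex1I[of _ Psi]) (use P U in auto)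
  qed (use U I in auto)
qed

end
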